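(* Fix $\gamma\in(0,\gamma_0)$ and $\mathtt d\in(0,\tfrac12)$. For any $n\in\mathbb N$, $r>\tfrac12$, $s>\tfrac32$ and any $(\mu_1,\mu_2)\in\mathbb Z^2$ there exist $\varepsilon_0=\varepsilon_0(n,r,s,\mathtt d,\gamma,\mu_1,\mu_2)>0$ and $C=C(n,r,s,\mathtt d,\mu_1,\mu_2)>0$ such that for any $\varepsilon$ belonging to $$\mathcal E:=\{\varepsilon\in(0,\varepsilon_0):\ \omega_\varepsilon\in\Omega_\gamma\},\qquad\omega_\varepsilon^2:=1+\varepsilon,$$ there exist $n$ different, non zero, $T_\varepsilon$-periodic solutions $\phi^{(1)}_\varepsilon,\dots,\phi^{(n)}_\varepsilon$ of $$(-\partial_{tt}+\Delta_{\mathbb S^3}-1)\phi=|\phi|^2\phi$$ which are Hopf plane waves with momentum $(\mu_1,\mu_2)$, have frequency $\omega_\varepsilon=\frac{2\pi}{T_\varepsilon}$ and are even in time. They are of the following form: (i) There exist $n$ different $2\pi$-periodic, non zero Hopf plane wave solutions, with momentum $(\mu_1,\mu_2)$, $v^{(1)}_\varepsilon,\dots,v^{(n)}_\varepsilon$ of the linear equation $-\partial_{tt}v+\Delta_{\mathbb S^3}v-v=0$, with size $$C^{-1}\varepsilon^{\frac12}\le\|v^{(k)}_\varepsilon\|_{H^r([0,2\pi],H^s(\mathbb S^3,d\sigma))}\le C\varepsilon^{\frac12-\mathtt d},$$ such that, as $\varepsilon\to0$, $$\|\phi^{(k)}_\varepsilon-v^{(k)}_\varepsilon(\omega_\varepsilon\cdot,\cdot)\|_{H^r([0,T_\varepsilon],H^s(\mathbb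 S^3,d\sigma))}=o\big(\|v^{(k)}_\varepsilon(\omega_\varepsilon\cdot,\cdot)\|_{H^r([0,T_\varepsilon],H^s(\mathbb S^3,d\sigma))}\big).$$ (ii) Each $\phi^{(k)}_\varepsilon$ has minimal period $T_{k,\varepsilon}:=\frac{T_\varepsilon}{m_k}$, where $\{m_k\}_{k=1}^n$ is an increasing sequence of positive integers, and each $v^{(k)}_\varepsilon$ has minimal period $T_k:=\frac{2\pi}{m_k}$.
   Context: $\mathbb N=\{0,1,2,\dots\}$, $\mathbb N_*=\{1,2,\dots\}$, $\mathbb T=\mathbb R/2\pi\mathbb Z$; "increasing" means strictly increasing. $\Delta_{\mathbb S^3}$ is the Laplace-Beltrami operator of the round unit sphere $\mathbb S^3$, $d\sigma$ its standard measure, and $H^s(\mathbb S^3,d\sigma)=\{\phi\in L^2(\mathbb S^3,d\sigma):(-\Delta_{\mathbb S^3}+1)^{s/2}\phi\in L^2(\mathbb S^3,d\sigma)\}$ with norm $\|(-\Delta_{\mathbb S^3}+1)^{s/2}\phi\|_{L^2}$. $H^r(I,H^s)$ denotes the Sobolev space of order $r$ on the time interval $I$ (of periodic functions of time) with values in $H^s$. For $\gamma>0$, $$\Omega_\gamma:=\Big\{\omega\in[\tfrac12,2]:\ |\omega\ell-j|\ge\frac{\gamma}{\ell}\ \ \forall\,\ell\in\mathbb N_*,\ j\in\mathbb N,\ \ell\ne j\Big\}.$$ $\gamma_0>0$ is a fixed small constant such that for every $\gamma\in(0,\gamma_0)$ the set $\Omega_\gamma$ is uncountable, has zero measure and accumulates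 at $\omega=1$. Use Hopf coordinates $(0,\tfrac\pi2)\times\mathbb T\times\mathbb T\ni(\eta,\xi_1,\xi_2)\mapsto(\sin\eta\cos\xi_1,\sin\eta\sin\xi_1,\cos\eta\cos\xi_2,\cos\eta\sin\xi_2)$ on $\mathbb S^3$. A function $\phi:\mathbb S^3\to\mathbb C$ is a Hopf plane wave with momentum $(\mu_1,\mu_2)$ if $\phi(\eta,\xi_1,\xi_2)=u(\eta)e^{\mathrm i\mu_1\xi_1}e^{\mathrm i\mu_2\xi_2}$ with $u:(0,\tfrac\pi2)\to\mathbb R$; $\phi:\mathbb R\times\mathbb S^3\to\mathbb C$ is a Hopf plane wave with momentum $(\mu_1,\mu_2)$ if $\phi(t,\cdot)$ is one for every $t$. *)

theory Defs
  imports "HOL-Analysis.Analysis" "HOL-Library.Landau_Symbols"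
begin

section \<open>The round unit sphere\<close>

typedef S3 = "sphere (0 :: real ^ 4) 1"
proof
  show "axis 1 1 \<in> sphere (0 :: real ^ 4) 1" by simp
qed

text \<open>The chordal distance: it induces the subspace topology of the unit sphere.\<close>

instantiation S3 :: metric_space
begin

definition dist_S3 :: "S3 \<Rightarrow> S3 \<Rightarrow> real"
  where "dist_S3 x y = dist (Rep_S3 x) (Rep_S3 y)"

definition uniformity_S3 :: "(S3 \<times> S3) filter"
  where "uniformity_S3 = (INF e\<in>{0<..}. principal {(x, y). dist x y < e})"

definition open_S3 :: "S3 set \<Rightarrow> bool"
  where "open_S3 U = (\<forall>x\<in>U. eventually (\<lambda>(x', y). x' = x \<longrightarrow> y \<in> U) uniformity)"

instance
proof
  fix x y z :: S3
  show "(dist x y = 0) = (x = y)"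
    by (simp add: dist_S3_def Rep_S3_inject)
  show "dist x y \<le> dist x z + dist y z"
    unfolding dist_S3_def by (rule dist_triangle2)
qed (simp_all add: uniformity_S3_def open_S3_def)

end

definition radial_proj :: "real ^ 4 \<Rightarrow> S3"
  where "radial_proj y = Abs_S3 (y /\<^sub>R norm y)"

text \<open>
  The standard measure as the cone measure: the measure of \<open>A\<close> is \<open>4\<close> times the Lebesgue measure
  of the part over \<open>A\<close> of the punctured unit ball (\<open>d\<lambda> = \<rho>\<^sup>3 d\<rho> d\<sigma>\<close> in polar
  coordinates). The total mass is \<open>2 \<pi>\<^sup>2\<close>.
\<close>

definition S3_measure :: "S3 measure"
  where "S3_measure =
    scale_measure 4 (distr (restrict_space lborel (ball 0 1 - {0})) borel radial_proj)"

section \<open>Smooth functions and the Laplace-Beltrami operator\<close>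

text \<open>Meant for open sets \<open>U\<close>.\<close>

primrec Ck_on :: "nat \<Rightarrow> 'a::euclidean_space set \<Rightarrow> ('a \<Rightarrow> 'b::real_normed_vector) \<Rightarrow> bool"
  where
    "Ck_on 0 U f = continuous_on U f"
  | "Ck_on (Suc k) U f =
      ((\<forall>x\<in>U. f differentiable (at x)) \<and>
       (\<forall>b\<in>Basis. Ck_on k U (\<lambda>x. frechet_derivative f (at x) b)))"

definition smooth_on :: "'a::euclidean_space set \<Rightarrow> ('a \<Rightarrow> 'b::real_normed_vector) \<Rightarrow> bool"
  where "smooth_on U f \<longleftrightarrow> (\<forall>k. Ck_on k U f)"

definition euclidean_laplacian :: "('a::euclidean_space \<Rightarrow> 'b::real_normed_vector) \<Rightarrow> 'a \<Rightarrow> 'b"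
  where "euclidean_laplacian f x =
    (\<Sum>b\<in>Basis. frechet_derivative (\<lambda>y. frechet_derivative f (at y) b) (at x) b)"

text \<open>
  A function on the sphere is smooth iff its extension that is constant along rays is smooth away
  from the origin, and the Laplace-Beltrami operator of the round metric is the restriction to the
  sphere of the Euclidean Laplacian of this extension.
\<close>

definition smooth_S3 :: "(S3 \<Rightarrow> complex) \<Rightarrow> bool"
  where "smooth_S3 f \<longleftrightarrow> smooth_on (- {0}) (\<lambda>y. f (radial_proj y))"

definition laplace_beltrami :: "(S3 \<Rightarrow> complex) \<Rightarrow> S3 \<Rightarrow> complex"
  where "laplace_beltrami f x = euclidean_laplacian (\<lambda>y. f (radial_proj y)) (Rep_S3 x)"

section \<open>Sobolev spaces\<close>

definition L2_S3 :: "(S3 \<Rightarrow> complex) set"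
  where "L2_S3 = {f \<in> borel_measurable S3_measure. integrable S3_measure (\<lambda>x. (norm (f x))\<^sup>2)}"

definition L2_inner :: "(S3 \<Rightarrow> complex) \<Rightarrow> (S3 \<Rightarrow> complex) \<Rightarrow> complex"
  where "L2_inner f g = (LINT x|S3_measure. f x * cnj (g x))"

definition L2_norm :: "(S3 \<Rightarrow> complex) \<Rightarrow> real"
  where "L2_norm f = sqrt (LINT x|S3_measure. (norm (f x))\<^sup>2)"

definition eigenfunction :: "real \<Rightarrow> (S3 \<Rightarrow> complex) \<Rightarrow> bool"
  where "eigenfunction lam e \<longleftrightarrow>
    smooth_S3 e \<and> (\<forall>x. - laplace_beltrami e x = complex_of_real lam * e x)"

text \<open>
  \<open>is_bessel s f g\<close> says that \<open>g\<close> is \<open>(- \<Delta> + 1)\<^bsup>s/2\<^esup> f\<close> and lies in \<open>L\<^sup>2\<close>, in the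
  sense of the functional calculus: on the eigenspace of \<open>- \<Delta>\<close> for the eigenvalue \<open>lam\<close> the
  operator acts as multiplication by \<open>(lam + 1)\<^bsup>s/2\<^esup>\<close>. As the eigenfunctions span a dense
  subspace of \<open>L\<^sup>2\<close>, \<open>g\<close> is unique up to null sets.
\<close>

definition is_bessel :: "real \<Rightarrow> (S3 \<Rightarrow> complex) \<Rightarrow> (S3 \<Rightarrow> complex) \<Rightarrow> bool"
  where "is_bessel s f g \<longleftrightarrow> g \<in> L2_S3 \<and>
    (\<forall>lam e. eigenfunction lam e \<longrightarrow>
       L2_inner g e = complex_of_real ((lam + 1) powr (s / 2)) * L2_inner f e)"

definition Hs :: "real \<Rightarrow> (S3 \<Rightarrow> complex) set"
  where "Hs s = {f \<in> L2_S3. \<exists>g. is_bessel s f g}"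

definition Hs_norm :: "real \<Rightarrow> (S3 \<Rightarrow> complex) \<Rightarrow> real"
  where "Hs_norm s f = L2_norm (SOME g. is_bessel s f g)"

definition periodic :: "real \<Rightarrow> (real \<Rightarrow> S3 \<Rightarrow> complex) \<Rightarrow> bool"
  where "periodic T u \<longleftrightarrow> (\<forall>t x. u (t + T) x = u t x)"

definition minimal_period :: "real \<Rightarrow> (real \<Rightarrow> S3 \<Rightarrow> complex) \<Rightarrow> bool"
  where "minimal_period T u \<longleftrightarrow>
    0 < T \<and> periodic T u \<and> (\<forall>T'. 0 < T' \<and> T' < T \<longrightarrow> \<not> periodic T' u)"

definition time_fourier :: "real \<Rightarrow> (real \<Rightarrow> S3 \<Rightarrow> complex) \<Rightarrow> int \<Rightarrow> S3 \<Rightarrow> complex"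
  where "time_fourier T u l x =
    (LINT t:{0..T}|lborel. u t x * cis (- (2 * pi * of_int l * t / T))) / complex_of_real T"

text \<open>
  \<open>HrHs T r s\<close> is the space of \<open>T\<close>-periodic functions of time in \<open>H\<^sup>r([0,T], H\<^sup>s)\<close>, with the
  norm of \<open>(1 - \<partial>\<^sub>t\<^sub>t)\<^bsup>r/2\<^esup> u\<close> in \<open>L\<^sup>2([0,T], H\<^sup>s)\<close> expressed by Parseval.
\<close>

definition HrHs :: "real \<Rightarrow> real \<Rightarrow> real \<Rightarrow> (real \<Rightarrow> S3 \<Rightarrow> complex) set"
  where "HrHs T r s = {u. periodic T u \<and>
    (\<lambda>(t, x). u t x) \<in> borel_measurable (lborel \<Otimes>\<^sub>M S3_measure) \<and>
    set_integrable (lborel \<Otimes>\<^sub>M S3_measure) ({0..T} \<times> UNIV) (\<lambda>(t, x). (norm (u t x))\<^sup>2) \<and>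
    (\<forall>l. time_fourier T u l \<in> Hs s) \<and>
    (\<lambda>l. (1 + (2 * pi * of_int l / T)\<^sup>2) powr r * (Hs_norm s (time_fourier T u l))\<^sup>2)
      summable_on UNIV}"

definition HrHs_norm :: "real \<Rightarrow> real \<Rightarrow> real \<Rightarrow> (real \<Rightarrow> S3 \<Rightarrow> complex) \<Rightarrow> real"
  where "HrHs_norm T r s u = sqrt (T * (\<Sum>\<^sub>\<infinity>l::int.
    (1 + (2 * pi * of_int l / T)\<^sup>2) powr r * (Hs_norm s (time_fourier T u l))\<^sup>2))"

section \<open>Solutions\<close>

definition test_function :: "(real \<Rightarrow> S3 \<Rightarrow> complex) \<Rightarrow> bool"
  where "test_function \<psi> \<longleftrightarrow>
    smooth_on (UNIV \<times> (- {0})) (\<lambda>(t, y). \<psi> t (radial_proj y)) \<and>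
    (\<exists>R. \<forall>t x. R < \<bar>t\<bar> \<longrightarrow> \<psi> t x = 0)"

definition KG_operator :: "(real \<Rightarrow> S3 \<Rightarrow> complex) \<Rightarrow> real \<Rightarrow> S3 \<Rightarrow> complex"
  where "KG_operator \<psi> t x =
    - vector_derivative (\<lambda>t1. vector_derivative (\<lambda>t2. \<psi> t2 x) (at t1)) (at t)
    + laplace_beltrami (\<psi> t) x - \<psi> t x"

text \<open>
  \<open>(- \<partial>\<^sub>t\<^sub>t + \<Delta> - 1) \<phi> = F(\<phi>)\<close> in the sense of distributions on \<open>\<real> \<times> S\<^sup>3\<close>. For
  \<open>r > 1/2\<close> and \<open>s > 3/2\<close> every element of \<open>H\<^sup>r(H\<^sup>s)\<close> has exactly one continuous
  representative; asking for continuity selects it, so that pointwise equations between such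
  functions (non zero, different, even, minimal period, ...) are equations in \<open>H\<^sup>r(H\<^sup>s)\<close>.
\<close>

definition solves :: "(complex \<Rightarrow> complex) \<Rightarrow> (real \<Rightarrow> S3 \<Rightarrow> complex) \<Rightarrow> bool"
  where "solves F \<phi> \<longleftrightarrow>
    continuous_on UNIV (\<lambda>(t, x). \<phi> t x) \<and>
    (\<forall>\<psi>. test_function \<psi> \<longrightarrow>
      (LINT (t, x)|(lborel \<Otimes>\<^sub>M S3_measure). \<phi> t x * KG_operator \<psi> t x) =
      (LINT (t, x)|(lborel \<Otimes>\<^sub>M S3_measure). F (\<phi> t x) * \<psi> t x))"

abbreviation solves_cubic_KG :: "(real \<Rightarrow> S3 \<Rightarrow> complex) \<Rightarrow> bool"
  where "solves_cubic_KG \<equiv> solves (\<lambda>z. complex_of_real ((norm z)\<^sup>2) * z)"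

abbreviation solves_linear_KG :: "(real \<Rightarrow> S3 \<Rightarrow> complex) \<Rightarrow> bool"
  where "solves_linear_KG \<equiv> solves (\<lambda>z. 0)"

section \<open>Hopf plane waves\<close>

definition hopf :: "real \<Rightarrow> real \<Rightarrow> real \<Rightarrow> S3"
  where "hopf \<eta> \<xi>1 \<xi>2 =
    Abs_S3 (vector [sin \<eta> * cos \<xi>1, sin \<eta> * sin \<xi>1, cos \<eta> * cos \<xi>2, cos \<eta> * sin \<xi>2])"

definition hopf_plane_wave :: "int \<Rightarrow> int \<Rightarrow> (S3 \<Rightarrow> complex) \<Rightarrow> bool"
  where "hopf_plane_wave \<mu>1 \<mu>2 f \<longleftrightarrow>
    (\<exists>u :: real \<Rightarrow> real. \<forall>\<eta>\<in>{0<..<pi/2}. \<forall>\<xi>1 \<xi>2.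
      f (hopf \<eta> \<xi>1 \<xi>2) =
        complex_of_real (u \<eta>) * exp (\<i> * of_int \<mu>1 * of_real \<xi>1) * exp (\<i> * of_int \<mu>2 * of_real \<xi>2))"

section \<open>Frequencies\<close>

definition Omega :: "real \<Rightarrow> real set"
  where "Omega \<gamma> = {\<omega>\<in>{1/2..2}. \<forall>(l::nat) (j::nat). 1 \<le> l \<and> l \<noteq> j \<longrightarrow>
    \<bar>\<omega> * real l - real j\<bar> \<ge> \<gamma> / real l}"

definition freq :: "real \<Rightarrow> real"
  where "freq \<epsilon> = sqrt (1 + \<epsilon>)"

definition period :: "real \<Rightarrow> real"
  where "period \<epsilon> = 2 * pi / freq \<epsilon>"

definition admissible :: "real \<Rightarrow> real \<Rightarrow> real set"
  where "admissible \<gamma> \<epsilon>0 = {\<epsilon>\<in>{0<..<\<epsilon>0}. freq \<epsilon> \<in> Omega \<gamma>}"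

end

theory Submission
  imports Defs "HOL-Computational_Algebra.Polynomial"
begin

text \<open>
  Separating variables in Hopf coordinates, the functions with momentum \<open>(\<mu>1, \<mu>2)\<close> are spanned by
  eigenfunctions \<open>e\<^sub>a\<close> of \<open>- \<Delta> + 1\<close> with eigenvalue \<open>(\<bar>\<mu>1\<bar> + \<bar>\<mu>2\<bar> + 1 + 2 a)\<^sup>2\<close>, given by Jacobi polynomials.
  The linear equation is thus completely resonant, and for every \<open>a0\<close> a branch is sought near the single mode
  \<open>\<epsilon>\<^bsup>1/2\<^esup> A cos (m \<tau>) e\<^bsub>a0\<^esub>\<close>, where \<open>m\<close> is the frequency of \<open>e\<^bsub>a0\<^esub>\<close> and the amplitude \<open>A\<close> solves the
  resonant equation exactly. In the space of absolutely summable expansions into modes \<open>cos ((2 k + 1) m \<tau>) e\<^sub>a\<close>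
  the cubic nonlinearity is bounded; on the non-resonant modes the condition defining \<open>\<Omega>\<^sub>\<gamma>\<close> bounds the
  inverse of the wave operator by \<open>2 / \<gamma>\<close>, without loss of derivatives. On the resonant modes the
  linearization at the single mode is diagonal, by the degrees of the Jacobi polynomials, and it is invertible
  for infinitely many \<open>a0\<close>. A contraction then yields a solution at distance \<open>O(\<epsilon>)\<close> from the single mode, relative to
  its size, with minimal period \<open>T\<^sub>\<epsilon> / m\<close>; different \<open>a0\<close> have different \<open>m\<close>.
\<close>

section \<open>Absolutely summable families\<close>

text \<open>Weighted l1 is chosen because a bounded multilinear map on it is the same thing as a
  uniformly bounded family of values on unit vectors: boundedness of the cubic term becomes one
  estimate on products of three modes, diagonal inverses are controlled by their largest entry, and
  identities are checked on single modes. The integrals of four Jacobi polynomials are never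
  evaluated. Their size comes from a polynomial inequality with explicit growth, and invertibility
  of the linearization from an extremal choice of \<open>a0\<close> instead of a formula. Odd
  harmonics suffice because sums of three odd integers are odd; beyond the central mode the resonant
  frequencies are then at least tripled, which is what the extremal argument needs. The definitions
  attach the Sobolev norm to an arbitrarily chosen Bessel potential; that the choice is harmless
  requires completeness of the eigenfunctions of the sphere, whence the density argument for
  polynomials. The amplitude is fixed before the small divisors enter, so \<open>C\<close> is
  independent of \<gamma>, while the range of \<epsilon> depends on it.\<close>

typedef 'i l1 = "{f :: 'i \<Rightarrow> real. (\<lambda>i. \<bar>f i\<bar>) summable_on UNIV}" morphisms coef Abs_l1
  by (rule exI[of _ "\<lambda>_. 0"]) simp

setup_lifting type_definition_l1

lemma coef_summable: "(\<lambda>i. \<bar>coef x i\<bar>) summable_on UNIV"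
  using coef[of x] by simp

lemma l1_eqI: "(\<And>i. coef x i = coef y i) \<Longrightarrow> x = y"
  by (simp add: coef_inject[symmetric] fun_eq_iff)

instantiation l1 :: (type) real_normed_vector
begin

lift_definition zero_l1 :: "'a l1" is "\<lambda>_. 0" by simp

lift_definition plus_l1 :: "'a l1 \<Rightarrow> 'a l1 \<Rightarrow> 'a l1" is "\<lambda>f g i. f i + g i"
proof -
  fix f g :: "'a \<Rightarrow> real"
  assume "(\<lambda>i. \<bar>f i\<bar>) summable_on UNIV" "(\<lambda>i. \<bar>g i\<bar>) summable_on UNIV"
  then have "(\<lambda>i. \<bar>f i\<bar> + \<bar>g i\<bar>) summable_on UNIV" by (rule summable_on_add)
  then show "(\<lambda>i. \<bar>f i + g i\<bar>) summable_on UNIV"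
    by (rule summable_on_comparison_test) (auto intro: abs_triangle_ineq)
qed

lift_definition uminus_l1 :: "'a l1 \<Rightarrow> 'a l1" is "\<lambda>f i. - f i" by simp

lift_definition scaleR_l1 :: "real \<Rightarrow> 'a l1 \<Rightarrow> 'a l1" is "\<lambda>c f i. c * f i"
  by (simp add: abs_mult summable_on_cmult_right)

definition minus_l1 :: "'a l1 \<Rightarrow> 'a l1 \<Rightarrow> 'a l1" where "minus_l1 x y = x + - y"

definition norm_l1 :: "'a l1 \<Rightarrow> real" where "norm_l1 x = (\<Sum>\<^sub>\<infinity>i. \<bar>coef x i\<bar>)"

definition dist_l1 :: "'a l1 \<Rightarrow> 'a l1 \<Rightarrow> real" where "dist_l1 x y = norm (x - y)"

definition sgn_l1 :: "'a l1 \<Rightarrow> 'a l1" where "sgn_l1 x = scaleR (inverse (norm x)) x"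

definition uniformity_l1 :: "('a l1 \<times> 'a l1) filter"
  where "uniformity_l1 = (INF e\<in>{0<..}. principal {(x, y). dist x y < e})"

definition open_l1 :: "'a l1 set \<Rightarrow> bool"
  where "open_l1 U = (\<forall>x\<in>U. eventually (\<lambda>(x', y). x' = x \<longrightarrow> y \<in> U) uniformity)"

instance
proof
  fix x y z :: "'a l1" and a b :: real
  show "x - y = x + - y" by (rule minus_l1_def)
  show "dist x y = norm (x - y)" by (rule dist_l1_def)
  show "sgn x = scaleR (inverse (norm x)) x" by (rule sgn_l1_def)
  show "x + y + z = x + (y + z)" "x + y = y + x" "0 + x = x" "- x + x = 0"
    by (transfer; simp add: fun_eq_iff)+
  show "a *\<^sub>R (x + y) = a *\<^sub>R x + a *\<^sub>R y" "(a + b) *\<^sub>R x = a *\<^sub>R x + b *\<^sub>R x"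
    "a *\<^sub>R b *\<^sub>R x = (a * b) *\<^sub>R x" "1 *\<^sub>R x = x"
    by (transfer; simp add: fun_eq_iff algebra_simps)+
  show "norm (a *\<^sub>R x) = \<bar>a\<bar> * norm x"
    by (simp add: norm_l1_def scaleR_l1.rep_eq abs_mult infsum_cmult_right')
  show "norm (x + y) \<le> norm x + norm y"
    unfolding norm_l1_def infsum_add[OF coef_summable coef_summable, symmetric]
    by (rule infsum_mono[OF coef_summable summable_on_add[OF coef_summable coef_summable]])
       (simp add: plus_l1.rep_eq)
  show "(norm x = 0) = (x = 0)"
  proof
    assume "norm x = 0"
    then have "\<bar>coef x i\<bar> = 0" for i
      unfolding norm_l1_def by (intro nonneg_infsum_le_0D[OF _ coef_summable]) auto
    then show "x = 0" by (intro l1_eqI) (simp add: zero_l1.rep_eq)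
  qed (simp add: norm_l1_def zero_l1.rep_eq)
qed (simp_all add: uniformity_l1_def open_l1_def)

end

lemma coef_0 [simp]: "coef 0 i = 0"
  and coef_add [simp]: "coef (x + y) i = coef x i + coef y i"
  and coef_scaleR [simp]: "coef (c *\<^sub>R x) i = c * coef x i"
  and coef_minus [simp]: "coef (- x) i = - coef x i"
  by (transfer, simp)+

lemma coef_diff [simp]: "coef (x - y) i = coef x i - coef y i"
  unfolding minus_l1_def coef_add coef_minus by simp

lemma sum_abs_coef_le: "finite F \<Longrightarrow> (\<Sum>i\<in>F. \<bar>coef x i\<bar>) \<le> norm x"
  unfolding norm_l1_def by (rule finite_sum_le_infsum[OF coef_summable]) auto

lemma abs_coef_le: "\<bar>coef x i\<bar> \<le> norm x"
  using sum_abs_coef_le[of "{i}" x] by simp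

lemma bounded_linear_coef: "bounded_linear (\<lambda>x. coef x i)"
  by (rule bounded_linear_intro[where K = 1]) (auto intro: abs_coef_le)

lemma norm_l1_leI:
  assumes "\<And>F. finite F \<Longrightarrow> (\<Sum>i\<in>F. \<bar>coef x i\<bar>) \<le> B"
  shows "norm x \<le> B"
  unfolding norm_l1_def by (rule infsum_le_finite_sums[OF coef_summable]) (use assms in auto)

instance l1 :: (type) banach
proof
  fix X :: "nat \<Rightarrow> 'a l1"
  assume X: "Cauchy X"
  define c where "c i = lim (\<lambda>n. coef (X n) i)" for i
  have "Cauchy (\<lambda>n. coef (X n) i)" for i
    by (rule bounded_linear.Cauchy[OF bounded_linear_coef X])
  then have c: "(\<lambda>n. coef (X n) i) \<longlonglongrightarrow> c i" for i
    unfolding c_def by (simp add: Cauchy_convergent convergent_LIMSEQ_iff[symmetric])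
  \<comment> \<open>Finite partial sums commute with limits, so the Cauchy estimate passes to the
    coefficientwise limit \<open>c\<close>. The bound with \<open>e = 1\<close> places
    \<open>c\<close> in the space, the bound with \<open>e / 2\<close> gives convergence in
    norm.\<close>
  have tail: "(\<Sum>i\<in>F. \<bar>coef (X n) i - c i\<bar>) \<le> e"
    if "finite F" "\<And>m. m \<ge> n \<Longrightarrow> norm (X n - X m) \<le> e" for F n e
  proof (rule LIMSEQ_le_const2)
    show "(\<lambda>m. \<Sum>i\<in>F. \<bar>coef (X n) i - coef (X m) i\<bar>) \<longlonglongrightarrow> (\<Sum>i\<in>F. \<bar>coef (X n) i - c i\<bar>)"
      by (intro tendsto_intros c)
    have "(\<Sum>i\<in>F. \<bar>coef (X n) i - coef (X m) i\<bar>) \<le> e" if "m \<ge> n" for m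
      using sum_abs_coef_le[OF \<open>finite F\<close>, of "X n - X m"] \<open>\<And>m. m \<ge> n \<Longrightarrow> _\<close>[OF that] by simp
    then show "\<exists>N. \<forall>m\<ge>N. (\<Sum>i\<in>F. \<bar>coef (X n) i - coef (X m) i\<bar>) \<le> e" by blast
  qed
  have ex: "\<exists>N. \<forall>n\<ge>N. \<forall>m\<ge>n. norm (X n - X m) \<le> e" if "e > 0" for e
    using metric_CauchyD[OF X that] unfolding dist_norm by (meson le_trans less_imp_le)
  obtain N where N: "\<And>m. m \<ge> N \<Longrightarrow> norm (X N - X m) \<le> 1" using ex[of 1] by auto
  have "(\<lambda>i. \<bar>coef (X N) i - c i\<bar>) summable_on UNIV"
    by (rule nonneg_bdd_above_summable_on) (auto intro!: bdd_aboveI2 tail N)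
  then have "(\<lambda>i. \<bar>coef (X N) i\<bar> + \<bar>coef (X N) i - c i\<bar>) summable_on UNIV"
    by (intro summable_on_add coef_summable)
  then have "(\<lambda>i. \<bar>c i\<bar>) summable_on UNIV"
    by (rule summable_on_comparison_test) auto
  then have lim: "coef (Abs_l1 c) = c" by (simp add: Abs_l1_inverse)
  have "X \<longlonglongrightarrow> Abs_l1 c"
  proof (rule metric_LIMSEQ_I)
    fix e :: real assume "e > 0"
    then obtain N where N: "\<And>n m. n \<ge> N \<Longrightarrow> m \<ge> n \<Longrightarrow> norm (X n - X m) \<le> e / 2"
      using ex[of "e / 2"] by auto
    have "norm (X n - Abs_l1 c) \<le> e / 2" if "n \<ge> N" for n
      by (rule norm_l1_leI) (use tail[OF _ N[OF that]] in \<open>simp add: lim\<close>)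
    then show "\<exists>no. \<forall>n\<ge>no. dist (X n) (Abs_l1 c) < e"
      using \<open>e > 0\<close> by (intro exI[of _ N]) (fastforce simp: dist_norm)
  qed
  then show "convergent X" by (auto simp: convergent_def)
qed

lift_definition unit :: "'i \<Rightarrow> 'i l1" is "\<lambda>i j. if j = i then 1 else 0"
proof -
  fix i :: 'i
  have "(\<lambda>j. \<bar>if j = i then 1 else 0 :: real\<bar>) summable_on UNIV \<longleftrightarrow>
        (\<lambda>j. \<bar>if j = i then 1 else 0 :: real\<bar>) summable_on {i}"
    by (rule summable_on_cong_neutral) auto
  then show "(\<lambda>j. \<bar>if j = i then 1 else 0 :: real\<bar>) summable_on UNIV" by simp
qed

lemma coef_unit: "coef (unit i) j = (if j = i then 1 else 0)"
  by (transfer) simp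

lemma norm_unit_le: "norm (unit i) \<le> 1"
proof (rule norm_l1_leI)
  fix F :: "'a set" assume "finite F"
  have "(\<Sum>j\<in>F. \<bar>coef (unit i) j\<bar>) = (\<Sum>j\<in>F. if j = i then 1 else 0)"
    by (rule sum.cong) (auto simp: coef_unit)
  also have "\<dots> \<le> 1" using \<open>finite F\<close> by (simp add: sum.delta)
  finally show "(\<Sum>j\<in>F. \<bar>coef (unit i) j\<bar>) \<le> 1" .
qed

text \<open>The universal property of l1: each bounded family \<open>b\<close> extends to exactly
  one bounded operator sending \<open>unit i\<close> to \<open>b i\<close>. All operators below
  arise in this way, so a uniform bound on \<open>b\<close> is the only thing to be proved about
  them.\<close>

definition lin :: "('i \<Rightarrow> 'e::banach) \<Rightarrow> 'i l1 \<Rightarrow> 'e"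
  where "lin b x = (\<Sum>\<^sub>\<infinity>i. coef x i *\<^sub>R b i)"

lemma
  fixes b :: "'i \<Rightarrow> 'e::banach"
  assumes b: "\<And>i. norm (b i) \<le> B"
  shows lin_abs_summable: "(\<lambda>i. norm (coef x i *\<^sub>R b i)) summable_on UNIV"
    and lin_has_sum: "((\<lambda>i. coef x i *\<^sub>R b i) has_sum lin b x) UNIV"
    and norm_lin_le: "norm (lin b x) \<le> B * norm x"
    and bounded_linear_lin: "bounded_linear (lin b)"
    and lin_unit: "lin b (unit j) = b j"
proof -
  have sB: "(\<lambda>i. B * \<bar>coef x i\<bar>) summable_on UNIV" for x :: "'i l1"
    by (rule summable_on_cmult_right[OF coef_summable])
  have abs: "(\<lambda>i. norm (coef x i *\<^sub>R b i)) summable_on UNIV" for x :: "'i l1"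
    by (rule summable_on_comparison_test[OF sB])
       (use b in \<open>auto simp: mult.commute[of B] intro: mult_left_mono\<close>)
  have hs: "((\<lambda>i. coef x i *\<^sub>R b i) has_sum lin b x) UNIV" for x :: "'i l1"
    unfolding lin_def by (rule has_sum_infsum) (rule abs_summable_summable[OF abs])
  have nle: "norm (lin b x) \<le> B * norm x" for x
  proof -
    have "norm (lin b x) \<le> (\<Sum>\<^sub>\<infinity>i. norm (coef x i *\<^sub>R b i))"
      unfolding lin_def by (rule norm_infsum_bound) (rule abs)
    also have "\<dots> \<le> (\<Sum>\<^sub>\<infinity>i. B * \<bar>coef x i\<bar>)"
      by (rule infsum_mono[OF abs sB]) (use b in \<open>auto simp: mult.commute[of B] intro: mult_left_mono\<close>)
    also have "\<dots> = B * norm x" by (simp add: norm_l1_def infsum_cmult_right')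
    finally show ?thesis .
  qed
  show "(\<lambda>i. norm (coef x i *\<^sub>R b i)) summable_on UNIV"
    "((\<lambda>i. coef x i *\<^sub>R b i) has_sum lin b x) UNIV" "norm (lin b x) \<le> B * norm x"
    by (rule abs hs nle)+
  show "bounded_linear (lin b)"
  proof (rule bounded_linear_intro[where K = B])
    show "lin b (x + y) = lin b x + lin b y" for x y
      by (rule has_sum_unique[OF hs]) (use has_sum_add[OF hs hs] in \<open>simp add: algebra_simps\<close>)
    show "lin b (c *\<^sub>R x) = c *\<^sub>R lin b x" for c x
      by (rule has_sum_unique[OF hs])
         (use has_sum_bounded_linear[OF bounded_linear_scaleR_right hs, of c] in simp)
    show "norm (lin b x) \<le> norm x * B" for x using nle[of x] by (simp add: mult.commute)
  qed
  have "lin b (unit j) = (\<Sum>\<^sub>\<infinity>i\<in>{j}. coef (unit j) i *\<^sub>R b i)"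
    unfolding lin_def by (rule infsum_cong_neutral) (auto simp: coef_unit)
  then show "lin b (unit j) = b j" by (simp add: coef_unit)
qed

lemma lin_unit_eq: "lin unit x = x"
proof (rule l1_eqI)
  fix j
  have "((\<lambda>i. coef (coef x i *\<^sub>R unit i) j) has_sum coef (lin unit x) j) UNIV"
    by (rule has_sum_bounded_linear[OF bounded_linear_coef lin_has_sum[OF norm_unit_le]])
  moreover have "((\<lambda>i. coef (coef x i *\<^sub>R unit i) j) has_sum coef x j) UNIV \<longleftrightarrow>
      ((\<lambda>i. coef (coef x i *\<^sub>R unit i) j) has_sum coef x j) {j}"
    by (rule has_sum_cong_neutral) (auto simp: coef_unit)
  moreover have "((\<lambda>i. coef (coef x i *\<^sub>R unit i) j) has_sum coef x j) {j}"
    by (rule has_sum_finiteI) (auto simp: coef_unit)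
  ultimately show "coef (lin unit x) j = coef x j" using has_sum_unique by blast
qed

lemma bounded_linear_has_sum_unit:
  assumes "bounded_linear f"
  shows "((\<lambda>i. coef x i *\<^sub>R f (unit i)) has_sum f x) UNIV"
proof -
  interpret bounded_linear f by fact
  have "((\<lambda>i. f (coef x i *\<^sub>R unit i)) has_sum f (lin unit x)) UNIV"
    by (rule has_sum_bounded_linear[OF assms lin_has_sum[OF norm_unit_le]])
  then show ?thesis by (simp add: lin_unit_eq scaleR)
qed

text \<open>The unit vectors span a dense subspace. This rule replaces every interchange of an
  infinite sum with an integral, a product or a derivative: only a single mode has to be computed,
  and boundedness of both sides does the rest.\<close>

lemma bounded_linear_l1_eqI:
  assumes "bounded_linear f" "bounded_linear g" "\<And>i. f (unit i) = g (unit i)"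
  shows "f x = g x"
  using bounded_linear_has_sum_unit[OF assms(1), of x] bounded_linear_has_sum_unit[OF assms(2), of x]
  by (simp add: assms(3) has_sum_unique)

definition diag :: "('i \<Rightarrow> real) \<Rightarrow> 'i l1 \<Rightarrow> 'i l1"
  where "diag c = lin (\<lambda>i. c i *\<^sub>R unit i)"

lemma
  assumes c: "\<And>i. \<bar>c i\<bar> \<le> B"
  shows bounded_linear_diag: "bounded_linear (diag c)"
    and norm_diag_le: "norm (diag c x) \<le> B * norm x"
    and coef_diag: "coef (diag c x) i = c i * coef x i"
proof -
  have B: "norm (c i *\<^sub>R unit i :: 'a l1) \<le> B" for i
    using mult_mono[OF c[of i] norm_unit_le[of i]] order_trans[OF abs_ge_zero c] by fastforce
  show bl: "bounded_linear (diag c)"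
    unfolding diag_def by (rule bounded_linear_lin[of _ B]) (use B in auto)
  show "norm (diag c x) \<le> B * norm x"
    unfolding diag_def by (rule norm_lin_le) (rule B)
  have "diag c (unit j) = c j *\<^sub>R unit j" for j
    unfolding diag_def by (rule lin_unit[where B = B]) (rule B)
  then have *: "coef (diag c (unit j)) i = c i * coef (unit j) i" for j
    by (simp add: coef_unit)
  show "coef (diag c x) i = c i * coef x i"
    by (rule bounded_linear_l1_eqI[OF bounded_linear_compose[OF bounded_linear_coef bl]
          bounded_linear_compose[OF bounded_linear_mult_right bounded_linear_coef] *])
qed

text \<open>Curried, because the fixed point argument needs each partial application to be a bounded
  operator with its own norm; each of the three layers passes on the same bound
  \<open>B\<close>.\<close>

definition tri :: "('i \<Rightarrow> 'i \<Rightarrow> 'i \<Rightarrow> 'e::banach) \<Rightarrow> 'i l1 \<Rightarrow>\<^sub>L 'i l1 \<Rightarrow>\<^sub>L 'i l1 \<Rightarrow>\<^sub>L 'e"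
  where "tri b = Blinfun (lin (\<lambda>i. Blinfun (lin (\<lambda>j. Blinfun (lin (b i j))))))"

lemma Blinfun_lin:
  fixes b :: "'i \<Rightarrow> 'e::banach"
  assumes b: "\<And>i. norm (b i) \<le> B"
  shows "blinfun_apply (Blinfun (lin b)) = lin b" "norm (Blinfun (lin b)) \<le> B"
proof -
  show eq: "blinfun_apply (Blinfun (lin b)) = lin b"
    by (rule bounded_linear_Blinfun_apply[OF bounded_linear_lin[OF b]])
  have "0 \<le> B" using norm_ge_zero b order_trans by blast
  then show "norm (Blinfun (lin b)) \<le> B"
    by (rule norm_blinfun_bound) (unfold eq, rule norm_lin_le[OF b])
qed

lemma
  fixes b :: "'i \<Rightarrow> 'i \<Rightarrow> 'i \<Rightarrow> 'e::banach"
  assumes b: "\<And>i j k. norm (b i j k) \<le> B"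
  shows norm_tri: "norm (tri b) \<le> B"
    and tri_unit: "tri b (unit i) (unit j) (unit k) = b i j k"
proof -
  have 1: "norm (Blinfun (lin (b i j))) \<le> B" for i j by (rule Blinfun_lin(2)[OF b])
  have 2: "norm (Blinfun (lin (\<lambda>j. Blinfun (lin (b i j))))) \<le> B" for i by (rule Blinfun_lin(2)[OF 1])
  show "norm (tri b) \<le> B" unfolding tri_def by (rule Blinfun_lin(2)[OF 2])
  show "tri b (unit i) (unit j) (unit k) = b i j k"
    unfolding tri_def Blinfun_lin(1)[OF 2] lin_unit[OF 2] Blinfun_lin(1)[OF 1] lin_unit[OF 1]
      Blinfun_lin(1)[OF b] lin_unit[OF b] ..
qed

section \<open>A cubic fixed point problem\<close>

text \<open>
  The operator \<open>K\<close> inverts the wave operator on the non-resonant modes and is only known to be bounded, uniformly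
  in \<open>\<epsilon>\<close>; \<open>G\<close> inverts the linearization on the resonant ones. Inserting the non-resonant part into
  \<open>DN\<close> makes every term on the right hand side small or quadratic in \<open>h\<close>.
\<close>

lemma cubic_fixed_point:
  fixes N :: "'e::banach \<Rightarrow>\<^sub>L 'e \<Rightarrow>\<^sub>L 'e \<Rightarrow>\<^sub>L 'e" and G :: "'e \<Rightarrow>\<^sub>L 'e" and v :: 'e and \<kappa> :: real
  assumes "0 \<le> \<kappa>"
  defines "DN \<equiv> \<lambda>h. N h v v + N v h v + N v v h"
    and "R \<equiv> \<lambda>h. N (v + h) (v + h) (v + h) - N v v v - (N h v v + N v h v + N v v h)"
  shows "\<exists>\<epsilon>1>0. \<exists>C>0. \<forall>\<epsilon> K. 0 < \<epsilon> \<and> \<epsilon> < \<epsilon>1 \<and> norm (K :: 'e \<Rightarrow>\<^sub>L 'e) \<le> \<kappa> \<longrightarrow>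
    (\<exists>h. norm h \<le> C * \<epsilon> \<and>
       h = G (DN (\<epsilon> *\<^sub>R K (N (v + h) (v + h) (v + h))) + R h) + \<epsilon> *\<^sub>R K (N (v + h) (v + h) (v + h)))"
proof -
  define b where "b = norm N"
  define V where "V = norm v + 1"
  define g where "g = norm G"
  \<comment> \<open>\<open>V\<close> bounds \<open>v + h\<close> once \<open>norm h \<le> 1\<close>.
    The factor \<open>3 * g * b * V\<^sup>2 + 1\<close> bounds the map from \<open>w\<close> to
    \<open>G (DN w) + w\<close>, \<open>C\<close> is at least twice the size of the map at 0 divided
    by \<epsilon>, and \<open>L * \<epsilon>\<close> is its Lipschitz constant on the ball of radius
    \<open>C * \<epsilon>\<close>.\<close>
  define a where "a = (3 * g * b * V\<^sup>2 + 1) * \<kappa>"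
  define C where "C = 2 * a * b * V ^ 3 + 1"
  define L where "L = 3 * a * b * V\<^sup>2 + 9 * g * b * V * C"
  define \<epsilon>1 where "\<epsilon>1 = min (1 / C) (1 / (2 * L + 1))"
  have pos: "b \<ge> 0" "V \<ge> 1" "g \<ge> 0" "a \<ge> 0" "C \<ge> 1" "L \<ge> 0"
    using \<open>0 \<le> \<kappa>\<close> by (auto simp: b_def V_def g_def a_def C_def L_def)
  have nN: "norm (N x y z) \<le> b * X * Y * Z" if "norm x \<le> X" "norm y \<le> Y" "norm z \<le> Z" for x y z X Y Z
  proof -
    have "norm (N x y z) \<le> norm (N x y) * norm z" by (rule norm_blinfun)
    also have "\<dots> \<le> (norm (N x) * norm y) * norm z" by (intro mult_right_mono norm_blinfun) auto
    also have "\<dots> \<le> (b * norm x * norm y) * norm z"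
      unfolding b_def by (intro mult_right_mono norm_blinfun) auto
    also have "\<dots> \<le> b * X * Y * Z"
      using that pos by (intro mult_mono mult_nonneg_nonneg) (auto intro: order_trans[OF norm_ge_zero])
    finally show ?thesis .
  qed
  have nV: "norm v \<le> V" by (simp add: V_def)
  have DNle: "norm (DN h) \<le> 3 * b * V\<^sup>2 * norm h" for h
  proof -
    have "norm (DN h) \<le> norm (N h v v) + norm (N v h v) + norm (N v v h)"
      unfolding DN_def by (intro order_trans[OF norm_triangle_ineq] add_mono) auto
    also have "\<dots> \<le> b * norm h * V * V + b * V * norm h * V + b * V * V * norm h"
      by (intro add_mono nN nV order_refl)
    finally show ?thesis by (simp add: power2_eq_square algebra_simps)
  qed
  have DNlin: "DN (x - y) = DN x - DN y" for x y
    unfolding DN_def by (simp add: blinfun.diff_left blinfun.diff_right)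
  have diff: "norm (N x x x - N y y y) \<le> 3 * b * V\<^sup>2 * norm (x - y)" if "norm x \<le> V" "norm y \<le> V" for x y
  proof -
    have "N x x x - N y y y = N (x - y) x x + N y (x - y) x + N y y (x - y)"
      by (simp add: blinfun.diff_left blinfun.diff_right)
    also have "norm \<dots> \<le> norm (N (x - y) x x) + norm (N y (x - y) x) + norm (N y y (x - y))"
      by (intro order_trans[OF norm_triangle_ineq] add_mono) auto
    also have "\<dots> \<le> b * norm (x - y) * V * V + b * V * norm (x - y) * V + b * V * V * norm (x - y)"
      by (intro add_mono nN that order_refl)
    finally show ?thesis by (simp add: power2_eq_square algebra_simps)
  qed
  have Rdiff: "norm (R x - R y) \<le> 9 * b * V * \<rho> * norm (x - y)"
    if "norm x \<le> \<rho>" "norm y \<le> \<rho>" "\<rho> \<le> 1" for x y \<rho>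
  proof -
    define d where "d = x - y"
    have x: "x = y + d" by (simp add: d_def)
    have nx: "norm (v + x) \<le> V" "norm (v + y) \<le> V" "norm x \<le> V" "norm y \<le> V"
      using that norm_triangle_ineq[of v x] norm_triangle_ineq[of v y] norm_ge_zero[of v]
      unfolding V_def by linarith+
    \<comment> \<open>\<open>R\<close> consists of the terms with at least two entries
      \<open>h\<close>. Telescoping leaves six terms, each of which contains, besides
      \<open>d\<close>, one factor \<open>x\<close> or \<open>y\<close> of size at most \<rho>; this
      makes the Lipschitz constant of \<open>R\<close> small.\<close>
    have "R x - R y = (N d x (v + x) + N d v x) + (N y d (v + x) + N v d x) + (N y (v + y) d + N v y d)"
      unfolding x R_def by (simp add: blinfun.add_left blinfun.add_right algebra_simps)
    also have "norm \<dots> \<le> (b * norm d * \<rho> * V + b * norm d * V * \<rho>) + (b * \<rho> * norm d * V + b * V * norm d * \<rho>)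
        + (b * \<rho> * V * norm d + b * V * \<rho> * norm d)"
      by (intro order_trans[OF norm_triangle_ineq] add_mono nN nx nV that order_refl)
    also have "\<dots> = 6 * (b * V * \<rho> * norm d)" by (simp add: algebra_simps)
    also have "\<dots> \<le> 9 * (b * V * \<rho> * norm d)"
      using pos order_trans[OF norm_ge_zero that(1)] by (intro mult_right_mono mult_nonneg_nonneg) auto
    finally show ?thesis by (simp add: d_def mult.assoc)
  qed
  have "\<epsilon>1 > 0" "C > 0" using pos by (auto simp: \<epsilon>1_def)
  have "\<exists>h. norm h \<le> C * \<epsilon> \<and>
       h = G (DN (\<epsilon> *\<^sub>R K (N (v + h) (v + h) (v + h))) + R h) + \<epsilon> *\<^sub>R K (N (v + h) (v + h) (v + h))"
    if eps: "0 < \<epsilon>" "\<epsilon> < \<epsilon>1" and K: "norm K \<le> \<kappa>" for \<epsilon> and K :: "'e \<Rightarrow>\<^sub>L 'e"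
  proof -
    define F where "F h = \<epsilon> *\<^sub>R K (N (v + h) (v + h) (v + h))" for h
    define T where "T h = G (DN (F h) + R h) + F h" for h
    have \<rho>: "C * \<epsilon> \<le> 1" and L\<epsilon>: "L * \<epsilon> \<le> 1 / 2"
    proof -
      have "\<epsilon> < 1 / C" "\<epsilon> < 1 / (2 * L + 1)" using eps by (auto simp: \<epsilon>1_def)
      then show "C * \<epsilon> \<le> 1" using pos by (simp add: field_simps)
      have "\<epsilon> * (2 * L + 1) < 1" using \<open>\<epsilon> < 1 / (2 * L + 1)\<close> pos by (simp add: field_simps)
      then show "L * \<epsilon> \<le> 1 / 2" using eps by (simp add: algebra_simps)
    qed
    have Tdiff: "norm (T x - T y) \<le> 1 / 2 * norm (x - y)"
      if "norm x \<le> C * \<epsilon>" "norm y \<le> C * \<epsilon>" for x y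
    proof -
      have nx: "norm (v + x) \<le> V" "norm (v + y) \<le> V"
        using that \<rho> norm_triangle_ineq[of v x] norm_triangle_ineq[of v y] unfolding V_def by linarith+
      have Fd: "norm (F x - F y) \<le> \<epsilon> * (\<kappa> * (3 * b * V\<^sup>2 * norm (x - y)))"
      proof -
        have "F x - F y = \<epsilon> *\<^sub>R K (N (v + x) (v + x) (v + x) - N (v + y) (v + y) (v + y))"
          by (simp add: F_def blinfun.diff_right scaleR_diff_right)
        also have "norm \<dots> \<le> \<epsilon> * (norm K * norm (N (v + x) (v + x) (v + x) - N (v + y) (v + y) (v + y)))"
          using eps norm_blinfun by (simp add: mult_left_mono)
        also have "\<dots> \<le> \<epsilon> * (\<kappa> * (3 * b * V\<^sup>2 * norm (x - y)))"
          using eps K \<open>0 \<le> \<kappa>\<close> diff[OF nx] by (intro mult_left_mono mult_mono) auto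
        finally show ?thesis .
      qed
      have "T x - T y = G (DN (F x - F y) + (R x - R y)) + (F x - F y)"
        unfolding T_def DNlin by (simp add: blinfun.diff_right blinfun.add_right)
      also have "norm \<dots> \<le> norm (G (DN (F x - F y) + (R x - R y))) + norm (F x - F y)"
        by (rule norm_triangle_ineq)
      also have "norm (G (DN (F x - F y) + (R x - R y))) \<le> g * norm (DN (F x - F y) + (R x - R y))"
        unfolding g_def by (rule norm_blinfun)
      also have "\<dots> \<le> g * (3 * b * V\<^sup>2 * norm (F x - F y) + 9 * b * V * (C * \<epsilon>) * norm (x - y))"
        using pos(3) by (intro mult_left_mono order_trans[OF norm_triangle_ineq] add_mono DNle Rdiff that \<rho>)
      also have "g * (3 * b * V\<^sup>2 * norm (F x - F y) + 9 * b * V * (C * \<epsilon>) * norm (x - y)) + norm (F x - F y)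
          = (3 * g * b * V\<^sup>2 + 1) * norm (F x - F y) + 9 * g * b * V * C * \<epsilon> * norm (x - y)"
        by (simp add: algebra_simps)
      also have "\<dots> \<le> (3 * g * b * V\<^sup>2 + 1) * (\<epsilon> * (\<kappa> * (3 * b * V\<^sup>2 * norm (x - y))))
          + 9 * g * b * V * C * \<epsilon> * norm (x - y)"
        using pos by (intro add_right_mono mult_left_mono Fd) auto
      also have "\<dots> = (L * \<epsilon>) * norm (x - y)"
        unfolding L_def a_def by algebra
      also have "\<dots> \<le> 1 / 2 * norm (x - y)" by (rule mult_right_mono[OF L\<epsilon>]) simp
      finally show ?thesis by simp
    qed
    have R0: "R 0 = 0" by (simp add: R_def)
    have T0: "norm (T 0) \<le> C * \<epsilon> / 2"
    proof -
      have F0: "norm (F 0) \<le> \<epsilon> * (\<kappa> * (b * V * V * V))"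
      proof -
        have "norm (F 0) \<le> \<epsilon> * (norm K * norm (N v v v))"
          using eps norm_blinfun by (simp add: F_def mult_left_mono)
        also have "\<dots> \<le> \<epsilon> * (\<kappa> * (b * V * V * V))"
          using eps K \<open>0 \<le> \<kappa>\<close> by (intro mult_left_mono mult_mono nN nV) auto
        finally show ?thesis .
      qed
      have "norm (T 0) \<le> norm (G (DN (F 0))) + norm (F 0)"
        unfolding T_def R0 by (simp add: norm_triangle_ineq)
      also have "norm (G (DN (F 0))) \<le> g * norm (DN (F 0))" unfolding g_def by (rule norm_blinfun)
      also have "\<dots> \<le> g * (3 * b * V\<^sup>2 * norm (F 0))" using pos(3) by (intro mult_left_mono DNle)
      also have "g * (3 * b * V\<^sup>2 * norm (F 0)) + norm (F 0) = (3 * g * b * V\<^sup>2 + 1) * norm (F 0)"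
        by (simp add: algebra_simps)
      also have "\<dots> \<le> (3 * g * b * V\<^sup>2 + 1) * (\<epsilon> * (\<kappa> * (b * V * V * V)))"
        using pos by (intro mult_left_mono F0) auto
      also have "\<dots> = a * b * V ^ 3 * \<epsilon>" by (simp add: a_def power3_eq_cube algebra_simps)
      also have "\<dots> \<le> C * \<epsilon> / 2" using eps by (simp add: C_def algebra_simps)
      finally show ?thesis by simp
    qed
    have "\<exists>!x\<in>cball 0 (C * \<epsilon>). T x = x"
    proof (rule Banach_fix[where c = "1 / 2"])
      show "complete (cball 0 (C * \<epsilon>) :: 'e set)" by (simp add: complete_eq_closed)
      show "cball 0 (C * \<epsilon>) \<noteq> ({} :: 'e set)" using pos eps by (simp add: not_less)
      show "T ` cball 0 (C * \<epsilon>) \<subseteq> cball 0 (C * \<epsilon>)"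
      proof
        fix y assume "y \<in> T ` cball 0 (C * \<epsilon>)"
        then obtain x where x: "norm x \<le> C * \<epsilon>" "y = T x" by auto
        have "norm (T x) \<le> norm (T x - T 0) + norm (T 0)" using norm_triangle_sub by (metis add.commute)
        also have "\<dots> \<le> 1 / 2 * norm x + C * \<epsilon> / 2"
          using Tdiff[OF x(1), of 0] T0 pos eps by simp
        finally show "y \<in> cball 0 (C * \<epsilon>)" using x by simp
      qed
      show "dist (T x) (T y) \<le> 1 / 2 * dist x y" if "x \<in> cball 0 (C * \<epsilon>)" "y \<in> cball 0 (C * \<epsilon>)" for x y
        using Tdiff[of x y] that by (simp add: dist_norm)
    qed auto
    then obtain h where "norm h \<le> C * \<epsilon>" "T h = h" by auto
    then show ?thesis unfolding T_def F_def by (intro exI[of _ h]) simp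
  qed
  with \<open>\<epsilon>1 > 0\<close> \<open>C > 0\<close> show ?thesis by blast
qed

section \<open>An inequality between sup norm and mean of polynomials\<close>

text \<open>Under t = (1 - cos \<theta>) / 2 the polynomials of degree at most N become cosine sums
  of order N, for which orthogonality gives exact L2 norms.\<close>

definition cos_poly :: "nat \<Rightarrow> (real \<Rightarrow> real) \<Rightarrow> bool"
  where "cos_poly N g \<longleftrightarrow> (\<exists>c. \<forall>\<theta>. g \<theta> = (\<Sum>j\<le>N. c j * cos (real j * \<theta>)))"

lemma cos_poly_cos: "j \<le> N \<Longrightarrow> cos_poly N (\<lambda>\<theta>. cos (real j * \<theta>))"
  unfolding cos_poly_def
  by (intro exI[of _ "\<lambda>i. if i = j then 1 else 0"]) (simp add: if_distrib[of "\<lambda>x. x * _"] sum.delta cong: if_cong)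

lemma cos_poly_cmult: "cos_poly N g \<Longrightarrow> cos_poly N (\<lambda>\<theta>. a * g \<theta>)"
proof -
  assume "cos_poly N g"
  then obtain c where c: "\<And>\<theta>. g \<theta> = (\<Sum>j\<le>N. c j * cos (real j * \<theta>))" unfolding cos_poly_def by auto
  show ?thesis unfolding cos_poly_def
    by (rule exI[of _ "\<lambda>j. a * c j"]) (simp add: c sum_distrib_left mult.assoc)
qed

lemma cos_poly_add: "cos_poly N g \<Longrightarrow> cos_poly N h \<Longrightarrow> cos_poly N (\<lambda>\<theta>. g \<theta> + h \<theta>)"
proof -
  assume "cos_poly N g" "cos_poly N h"
  then obtain c d where c: "\<And>\<theta>. g \<theta> = (\<Sum>j\<le>N. c j * cos (real j * \<theta>))"
    "\<And>\<theta>. h \<theta> = (\<Sum>j\<le>N. d j * cos (real j * \<theta>))" unfolding cos_poly_def by auto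
  show ?thesis unfolding cos_poly_def
    by (rule exI[of _ "\<lambda>j. c j + d j"]) (simp add: c sum.distrib algebra_simps)
qed

lemma cos_poly_sum: "(\<And>i. i \<in> A \<Longrightarrow> cos_poly N (f i)) \<Longrightarrow> cos_poly N (\<lambda>\<theta>. \<Sum>i\<in>A. f i \<theta>)"
proof (induction A rule: infinite_finite_induct)
  case (insert x F)
  then show ?case by (simp add: cos_poly_add)
qed (use cos_poly_cmult[OF cos_poly_cos[of 0 N], of 0] in auto)

lemma cos_poly_mult_cos:
  assumes "cos_poly N g"
  shows "cos_poly (Suc N) (\<lambda>\<theta>. cos \<theta> * g \<theta>)"
proof -
  obtain c where c: "\<And>\<theta>. g \<theta> = (\<Sum>j\<le>N. c j * cos (real j * \<theta>))"
    using assms unfolding cos_poly_def by auto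
  have "cos \<theta> * cos (real j * \<theta>) = 1/2 * cos (real (j + 1) * \<theta>) +
      1/2 * (if j = 0 then cos (real 1 * \<theta>) else cos (real (j - 1) * \<theta>))" for \<theta> j
  proof (cases j)
    case (Suc i)
    have "cos (real (j + 1) * \<theta>) + cos (real i * \<theta>) = 2 * cos (real j * \<theta>) * cos \<theta>"
    proof -
      have "real (j + 1) * \<theta> = real j * \<theta> + \<theta>" "real i * \<theta> = real j * \<theta> - \<theta>"
        by (simp_all add: Suc algebra_simps)
      then show ?thesis by (simp only: cos_add cos_diff)
    qed
    then show ?thesis by (simp add: Suc mult.commute[of "cos \<theta>"])
  qed simp
  note prod = this
  have eq: "(\<lambda>\<theta>. cos \<theta> * g \<theta>) = (\<lambda>\<theta>. \<Sum>j\<le>N. c j * (1/2 * cos (real (j + 1) * \<theta>) +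
      1/2 * (if j = 0 then cos (real 1 * \<theta>) else cos (real (j - 1) * \<theta>))))"
    unfolding fun_eq_iff c sum_distrib_left prod[symmetric] by (simp add: mult.left_commute)
  have if_pull: "(\<lambda>\<theta>. if j = 0 then cos (real 1 * \<theta>) else cos (real (j - 1) * \<theta>)) =
      (\<lambda>\<theta>. cos (real (if j = 0 then 1 else j - 1) * \<theta>))" for j :: nat by auto
  show ?thesis unfolding eq
    by (intro cos_poly_sum cos_poly_cmult cos_poly_add, unfold if_pull; intro cos_poly_cos) auto
qed

lemma cos_poly_Suc: "cos_poly N g \<Longrightarrow> cos_poly (Suc N) g"
proof -
  assume "cos_poly N g"
  then obtain c where c: "\<And>\<theta>. g \<theta> = (\<Sum>j\<le>N. c j * cos (real j * \<theta>))" unfolding cos_poly_def by auto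
  have "cos_poly (Suc N) (\<lambda>\<theta>. \<Sum>j\<le>N. c j * cos (real j * \<theta>))"
    by (intro cos_poly_sum cos_poly_cmult cos_poly_cos) auto
  then show ?thesis by (simp add: c[symmetric])
qed

text \<open>Induction along the Horner scheme: multiplication by t is 1/2 minus half a
  multiplication by the cosine, which raises the order of a cosine sum by one.\<close>

lemma cos_poly_poly:
  "degree q \<le> N \<Longrightarrow> cos_poly N (\<lambda>\<theta>. poly q ((1 - cos \<theta>) / 2))"
proof (induction q arbitrary: N)
  case 0
  show ?case using cos_poly_cmult[OF cos_poly_cos[of 0 N], of 0] by simp
next
  case (pCons a q)
  show ?case
  proof (cases "q = 0")
    case True
    then show ?thesis using cos_poly_cmult[OF cos_poly_cos[of 0 N], of a] by simp
  next
    case False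
    then obtain N' where N: "N = Suc N'" "degree q \<le> N'" using pCons.prems by (cases N) auto
    have *: "cos_poly N' (\<lambda>\<theta>. poly q ((1 - cos \<theta>) / 2))" by (rule pCons.IH[OF N(2)])
    have "cos_poly N (\<lambda>\<theta>. a * cos (real 0 * \<theta>) + (1/2 * poly q ((1 - cos \<theta>) / 2) +
        (-1/2) * (cos \<theta> * poly q ((1 - cos \<theta>) / 2))))"
      unfolding N
      by (intro cos_poly_add cos_poly_cmult cos_poly_cos cos_poly_mult_cos * cos_poly_Suc[OF *]) auto
    then show ?thesis by (simp add: field_simps)
  qed
qed

lemma integral_cos_mult_cos:
  "((\<lambda>\<theta>. cos (real i * \<theta>) * cos (real j * \<theta>)) has_integral
    (if i = j then if i = 0 then pi else pi / 2 else 0)) {0..pi}"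
proof -
  have I: "((\<lambda>\<theta>. cos (of_int n * \<theta>)) has_integral (if n = 0 then pi else 0)) {0..pi}" for n :: int
  proof (cases "n = 0")
    case True
    have "((\<lambda>\<theta>::real. 1) has_integral (1 * (pi - 0))) {0..pi}"
      using has_integral_const_real[of "1::real" 0 pi] by simp
    then show ?thesis by (simp add: True)
  next
    case False
    have "((\<lambda>\<theta>. cos (of_int n * \<theta>)) has_integral
        sin (of_int n * pi) / of_int n - sin (of_int n * 0) / of_int n) {0..pi}"
      by (rule fundamental_theorem_of_calculus)
         (use False in \<open>auto intro!: derivative_eq_intros simp: has_real_derivative_iff_has_vector_derivative[symmetric]\<close>)
    then show ?thesis using False by (simp add: mult.commute)
  qed
  have "((\<lambda>\<theta>. (cos (of_int (int i - int j) * \<theta>) + cos (of_int (int i + int j) * \<theta>)) * (1/2)) has_integral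
      ((if int i - int j = 0 then pi else 0) + (if int i + int j = 0 then pi else 0)) * (1/2)) {0..pi}"
    by (intro has_integral_mult_left has_integral_add I)
  moreover have "(\<lambda>\<theta>::real. (cos (of_int (int i - int j) * \<theta>) + cos (of_int (int i + int j) * \<theta>)) * (1/2))
      = (\<lambda>\<theta>. cos (real i * \<theta>) * cos (real j * \<theta>))"
    by (simp add: cos_add cos_diff algebra_simps fun_eq_iff)
  moreover have "((if int i - int j = 0 then pi else 0) + (if int i + int j = 0 then pi else 0)) * (1/2)
      = (if i = j then if i = 0 then pi else pi / 2 else 0)" by auto
  ultimately show ?thesis by (simp only:)
qed

text \<open>Parseval bounds the squared coefficients by the integral (the constant mode has norm pi
  instead of pi / 2, so pi / 2 serves for all), and Cauchy-Schwarz over the N + 1 coefficients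
  bounds the sup norm.\<close>

lemma cos_poly_sup_le:
  assumes "cos_poly N g"
  shows "(g \<theta>)\<^sup>2 \<le> real (N + 1) * (2 / pi) * integral {0..pi} (\<lambda>\<theta>. (g \<theta>)\<^sup>2)"
proof -
  obtain c where c: "\<And>\<theta>. g \<theta> = (\<Sum>j\<le>N. c j * cos (real j * \<theta>))"
    using assms unfolding cos_poly_def by auto
  have "((\<lambda>\<theta>. \<Sum>i\<le>N. \<Sum>j\<le>N. (c i * c j) * (cos (real i * \<theta>) * cos (real j * \<theta>))) has_integral
      (\<Sum>i\<le>N. \<Sum>j\<le>N. (c i * c j) * (if i = j then if i = 0 then pi else pi / 2 else 0))) {0..pi}"
    by (intro has_integral_sum has_integral_mult_right integral_cos_mult_cos) auto
  moreover have "(\<Sum>i\<le>N. \<Sum>j\<le>N. (c i * c j) * (cos (real i * \<theta>) * cos (real j * \<theta>))) = (g \<theta>)\<^sup>2" for \<theta>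
    unfolding c power2_eq_square sum_product by (intro sum.cong refl) (simp add: algebra_simps)
  ultimately have Q: "integral {0..pi} (\<lambda>\<theta>. (g \<theta>)\<^sup>2) =
      (\<Sum>i\<le>N. \<Sum>j\<le>N. (c i * c j) * (if i = j then if i = 0 then pi else pi / 2 else 0))"
    by (simp add: integral_unique)
  also have "\<dots> = (\<Sum>i\<le>N. c i * c i * (if i = 0 then pi else pi / 2))"
    by (intro sum.cong refl) (simp add: if_distrib[of "\<lambda>x. _ * x"] sum.delta cong: if_cong)
  also have "\<dots> \<ge> (\<Sum>i\<le>N. (c i)\<^sup>2 * (pi / 2))"
    by (intro sum_mono) (auto simp: power2_eq_square intro!: mult_left_mono)
  finally have cQ: "(\<Sum>i\<le>N. (c i)\<^sup>2) * (pi / 2) \<le> integral {0..pi} (\<lambda>\<theta>. (g \<theta>)\<^sup>2)"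
    by (simp only: sum_distrib_right)
  have "\<bar>g \<theta>\<bar> \<le> (\<Sum>j\<le>N. \<bar>c j\<bar>)"
    unfolding c by (rule order_trans[OF sum_abs]) (auto simp: abs_mult intro!: sum_mono mult_left_le)
  then have "(g \<theta>)\<^sup>2 \<le> (\<Sum>j\<le>N. \<bar>c j\<bar>)\<^sup>2"
    by (metis abs_ge_zero power2_abs power_mono)
  also have "\<dots> \<le> (\<Sum>j\<le>N. \<bar>c j\<bar>\<^sup>2) * real (N + 1)"
    using sum_squared_le_sum_of_squares[of "\<lambda>j. \<bar>c j\<bar>" "{..N}"] by (simp add: mult.commute)
  also have "\<dots> = real (N + 1) * (2 / pi) * ((\<Sum>j\<le>N. (c j)\<^sup>2) * (pi / 2))"
    by simp
  also have "\<dots> \<le> real (N + 1) * (2 / pi) * integral {0..pi} (\<lambda>\<theta>. (g \<theta>)\<^sup>2)"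
    by (rule mult_left_mono[OF cQ]) simp
  finally show ?thesis .
qed

lemma continuous_on_poly_real: "continuous_on S (poly (q :: real poly))"
  by (intro continuous_intros)

lemma integral_pderiv: "((\<lambda>t. poly (pderiv h) t) has_integral (poly h 1 - poly h 0)) {0..1::real}"
  by (rule fundamental_theorem_of_calculus)
     (auto intro!: DERIV_subset[OF poly_DERIV] simp: has_real_derivative_iff_has_vector_derivative[symmetric])

lemma ex_antiderivative_poly: "\<exists>h :: real poly. pderiv h = q"
proof -
  define h where "h = (\<Sum>i\<le>degree q. monom (coeff q i / real (Suc i)) (Suc i))"
  have "pderiv h = (\<Sum>i\<le>degree q. monom (coeff q i) i)"
    unfolding h_def higher_pderiv_sum[of 1, simplified] by (intro sum.cong refl) (simp add: pderiv_monom)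
  then show ?thesis by (metis poly_as_sum_of_monoms)
qed

text \<open>
  After the substitution \<open>t = (1 - cos \<theta>) / 2\<close>, cosine sums of degree \<open>N\<close> cannot concentrate on the two end
  intervals of length proportional to \<open>1 / (N + 1)\<close>, and outside of them the density \<open>sin \<theta> / 2\<close> is bounded below.
\<close>

lemma poly_sq_le:
  fixes q :: "real poly"
  assumes "degree q \<le> N" "0 \<le> t" "t \<le> 1"
  shows "(poly q t)\<^sup>2 \<le> 11 * real (N + 1) ^ 2 * integral {0..1} (\<lambda>t. (poly q t)\<^sup>2)"
proof -
  define g where "g \<theta> = poly q ((1 - cos \<theta>) / 2)" for \<theta>
  have cg: "cos_poly N g" unfolding g_def by (rule cos_poly_poly[OF assms(1)])
  have cont: "continuous_on S (\<lambda>\<theta>. (g \<theta>)\<^sup>2)" for S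
    unfolding g_def by (intro continuous_intros) auto
  define Q where "Q = integral {0..pi} (\<lambda>\<theta>. (g \<theta>)\<^sup>2)"
  define P where "P = integral {0..pi} (\<lambda>\<theta>. (g \<theta>)\<^sup>2 * sin \<theta>)"
  have int: "(\<lambda>\<theta>. (g \<theta>)\<^sup>2) integrable_on {a..b}" "(\<lambda>\<theta>. (g \<theta>)\<^sup>2 * sin \<theta>) integrable_on {a..b}" for a b
    by (rule integrable_continuous_real, intro continuous_intros cont)+
  have P: "P = 2 * integral {0..1} (\<lambda>t. (poly q t)\<^sup>2)"
  proof -
    obtain h where h: "pderiv h = q * q" using ex_antiderivative_poly by blast
    have "((\<lambda>\<theta>. (g \<theta>)\<^sup>2 * sin \<theta>) has_integral
        2 * poly h ((1 - cos pi) / 2) - 2 * poly h ((1 - cos 0) / 2)) {0..pi}"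
    proof (rule fundamental_theorem_of_calculus)
      fix \<theta> :: real
      have "((\<lambda>\<theta>. (1 - cos \<theta>) / 2) has_real_derivative sin \<theta> / 2) (at \<theta> within {0..pi})"
        by (auto intro!: derivative_eq_intros)
      from DERIV_cmult[OF DERIV_chain2[OF poly_DERIV[of h] this], of 2]
      show "((\<lambda>\<theta>. 2 * poly h ((1 - cos \<theta>) / 2)) has_vector_derivative (g \<theta>)\<^sup>2 * sin \<theta>) (at \<theta> within {0..pi})"
        by (simp add: has_real_derivative_iff_has_vector_derivative[symmetric] h g_def power2_eq_square)
    qed simp
    then have "P = 2 * (poly h 1 - poly h 0)" by (simp add: P_def integral_unique)
    moreover have "integral {0..1} (\<lambda>t. (poly q t)\<^sup>2) = poly h 1 - poly h 0"
      using integral_pderiv[of h] by (simp add: h power2_eq_square integral_unique)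
    ultimately show ?thesis by simp
  qed
  \<comment> \<open>Chosen so that \<open>S * \<delta> = Q / 4\<close>: both end intervals together
    carry at most half of \<open>Q\<close>, and this half can be absorbed.\<close>
  define \<delta> where "\<delta> = pi / (8 * real (N + 1))"
  have \<delta>: "0 < \<delta>" "\<delta> \<le> pi / 8" by (auto simp: \<delta>_def field_simps)
  then have \<delta>2: "\<delta> \<le> pi - \<delta>" using pi_gt_zero by linarith
  define S where "S = real (N + 1) * (2 / pi) * Q"
  have S: "(g \<theta>)\<^sup>2 \<le> S" for \<theta> unfolding S_def Q_def by (rule cos_poly_sup_le[OF cg])
  have sin_ge: "sin \<theta> \<ge> 2 * \<delta> / pi" if "\<delta> \<le> \<theta>" "\<theta> \<le> pi - \<delta>" for \<theta>
  proof -
    have A: "sin x \<ge> 2 * \<delta> / pi" if x: "\<delta> \<le> x" "x \<le> pi / 2" for x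
    proof -
      have "sin x \<ge> sin \<delta>" using x \<delta> by (intro sin_monotone_2pi_le) auto
      \<comment> \<open>By the mean value theorem, since the cosine is at least sqrt 3 / 2 > 3 / 4 >
        2 / pi on [0, pi / 6].\<close>
      moreover have "sin \<delta> \<ge> 2 * \<delta> / pi"
      proof -
        have d: "0 < \<delta>" "\<delta> < pi / 6" using \<delta> pi_gt_zero by linarith+
        have "sqrt 3 \<ge> 3 / 2" by (rule real_le_rsqrt) (simp add: power2_eq_square)
        then have c: "cos x \<ge> 3 / 4" if "0 \<le> x" "x \<le> \<delta>" for x
          using that d pi_gt_zero cos_monotone_0_pi_le[of x "pi / 6"] by (simp add: cos_30)
        obtain z where z: "0 < z" "z < \<delta>" "sin \<delta> - sin 0 = (\<delta> - 0) * cos z"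
          using MVT2[of 0 \<delta> sin cos] d by (auto intro!: derivative_eq_intros)
        have "2 / pi \<le> 3 / 4" using pi_gt3 by (simp add: field_simps)
        then have "2 / pi \<le> cos z" using c[of z] z by simp
        then have "\<delta> * (2 / pi) \<le> \<delta> * cos z" using d by (intro mult_left_mono) auto
        then show ?thesis using z by (simp add: mult.commute)
      qed
      ultimately show ?thesis by linarith
    qed
    show ?thesis
    proof (cases "\<theta> \<le> pi / 2")
      case True
      then show ?thesis using A that by simp
    next
      case False
      then show ?thesis using A[of "pi - \<theta>"] that by simp
    qed
  qed
  have ends: "integral {a..b} (\<lambda>\<theta>. (g \<theta>)\<^sup>2) \<le> S * \<delta>" if "b - a = \<delta>" for a b
  proof -
    have "integral {a..b} (\<lambda>\<theta>. (g \<theta>)\<^sup>2) \<le> integral {a..b} (\<lambda>\<theta>. S)"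
      by (rule integral_le[OF int(1)]) (auto simp: S)
    also have "\<dots> = S * \<delta>" using that \<delta> by simp
    finally show ?thesis .
  qed
  have mid: "2 * \<delta> / pi * integral {\<delta>..pi - \<delta>} (\<lambda>\<theta>. (g \<theta>)\<^sup>2) \<le> P"
  proof -
    have "2 * \<delta> / pi * integral {\<delta>..pi - \<delta>} (\<lambda>\<theta>. (g \<theta>)\<^sup>2) =
        integral {\<delta>..pi - \<delta>} (\<lambda>\<theta>. 2 * \<delta> / pi * (g \<theta>)\<^sup>2)" by simp
    also have "\<dots> \<le> integral {\<delta>..pi - \<delta>} (\<lambda>\<theta>. (g \<theta>)\<^sup>2 * sin \<theta>)"
      by (rule integral_le)
         (auto intro!: int integrable_continuous_real continuous_intros cont sin_ge mult_left_mono
               simp: mult.commute[of "2 * \<delta> / pi"] simp del: times_divide_eq_left times_divide_eq_right)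
    also have "\<dots> \<le> P" unfolding P_def
      by (rule integral_subset_le) (use \<delta> in \<open>auto intro!: int mult_nonneg_nonneg sin_ge_zero\<close>)
    finally show ?thesis .
  qed
  have "Q = integral {0..\<delta>} (\<lambda>\<theta>. (g \<theta>)\<^sup>2) + integral {\<delta>..pi - \<delta>} (\<lambda>\<theta>. (g \<theta>)\<^sup>2)
      + integral {pi - \<delta>..pi} (\<lambda>\<theta>. (g \<theta>)\<^sup>2)"
    unfolding Q_def using \<delta> \<delta>2
    by (subst Henstock_Kurzweil_Integration.integral_combine; (simp add: int)?)+
  also have "\<dots> \<le> S * \<delta> + pi / (2 * \<delta>) * P + S * \<delta>"
  proof (intro add_mono ends)
    show "integral {\<delta>..pi - \<delta>} (\<lambda>\<theta>. (g \<theta>)\<^sup>2) \<le> pi / (2 * \<delta>) * P"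
      using mid \<delta> by (simp add: field_simps)
  qed auto
  also have "\<dots> = Q / 2 + 4 * real (N + 1) * P"
  proof -
    obtain n where n: "real (N + 1) = n" "n > 0" by simp
    have "S * \<delta> = Q / 4" "pi / (2 * \<delta>) = 4 * real (N + 1)"
      unfolding S_def \<delta>_def n(1) using n(2) by (simp_all add: field_simps)
    then show ?thesis by simp
  qed
  finally have "Q \<le> 8 * real (N + 1) * P" by (simp add: algebra_simps)
  then have "S \<le> real (N + 1) * (2 / pi) * (8 * real (N + 1) * P)"
    unfolding S_def by (intro mult_left_mono) auto
  also have "\<dots> = (32 / pi) * (real (N + 1) ^ 2 * integral {0..1} (\<lambda>t. (poly q t)\<^sup>2))"
    unfolding P power2_eq_square by (simp only: times_divide_eq_left times_divide_eq_right mult.assoc mult.left_commute) simp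
  \<comment> \<open>The constant 11 is 32 / pi rounded up by means of pi > 3.\<close>
  also have "\<dots> \<le> 11 * (real (N + 1) ^ 2 * integral {0..1} (\<lambda>t. (poly q t)\<^sup>2))"
    using pi_gt3
    by (intro mult_right_mono mult_nonneg_nonneg Henstock_Kurzweil_Integration.integral_nonneg)
       (auto simp: field_simps intro!: integrable_continuous_real continuous_intros)
  finally have "S \<le> 11 * real (N + 1) ^ 2 * integral {0..1} (\<lambda>t. (poly q t)\<^sup>2)" by (simp add: mult.assoc)
  moreover have "(poly q t)\<^sup>2 = (g (arccos (1 - 2 * t)))\<^sup>2"
    using assms unfolding g_def by simp
  ultimately show ?thesis using S[of "arccos (1 - 2 * t)"] by simp
qed

text \<open>For nonnegative \<open>q\<close> with maximum \<open>A\<close> the integral of the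
  square is at most \<open>A\<close> times the integral of \<open>q\<close>; inserted into the
  quadratic inequality, one factor \<open>A\<close> cancels and an L1 bound with the same constant
  results.\<close>

lemma nonneg_poly_le:
  fixes q :: "real poly"
  assumes "degree q \<le> N" "\<And>t. 0 \<le> t \<Longrightarrow> t \<le> 1 \<Longrightarrow> 0 \<le> poly q t" "0 \<le> t" "t \<le> 1"
  shows "poly q t \<le> 11 * real (N + 1) ^ 2 * integral {0..1} (poly q)"
proof -
  obtain t0 where t0: "t0 \<in> {0..1}" "\<And>y. y \<in> {0..1} \<Longrightarrow> poly q y \<le> poly q t0"
    using continuous_attains_sup[of "{0..1::real}" "poly q"] continuous_on_poly_real by auto
  define A where "A = poly q t0"
  define B where "B = 11 * real (N + 1) ^ 2"
  have A0: "A \<ge> 0" using assms(2) t0(1) by (simp add: A_def)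
  have "A\<^sup>2 \<le> B * integral {0..1} (\<lambda>t. (poly q t)\<^sup>2)"
    unfolding A_def B_def using t0(1) by (intro poly_sq_le[OF assms(1)]) auto
  also have "\<dots> \<le> B * integral {0..1} (\<lambda>t. A * poly q t)"
    by (intro mult_left_mono integral_le)
       (auto simp: B_def power2_eq_square A_def intro!: integrable_continuous_real continuous_intros mult_right_mono t0(2) assms(2))
  finally have "A * A \<le> A * (B * integral {0..1} (poly q))" by (simp add: power2_eq_square mult.left_commute)
  moreover have "0 \<le> B * integral {0..1} (poly q)"
    unfolding B_def using assms(2)
    by (intro mult_nonneg_nonneg Henstock_Kurzweil_Integration.integral_nonneg)
       (auto intro!: integrable_continuous_real continuous_intros)
  ultimately have "A \<le> B * integral {0..1} (poly q)"
    using A0 by (cases "A = 0") (auto simp: mult_le_cancel_left)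
  then show ?thesis using t0(2)[of t] assms(3,4) unfolding A_def B_def by simp
qed

section \<open>Jacobi polynomials on the unit interval\<close>

locale jacobi =
  fixes \<alpha> \<beta> :: nat
begin

definition W :: "real poly" where "W = [:0, 1:] ^ \<alpha> * [:1, -1:] ^ \<beta>"

text \<open>The Jacobi operator on [0, 1] in expanded form: W L f is the derivative of t (1 - t) W
  f'.\<close>

definition L :: "real poly \<Rightarrow> real poly"
  where "L f = [:0, 1, -1:] * pderiv (pderiv f) + [:real \<alpha> + 1, - (real \<alpha> + real \<beta> + 2):] * pderiv f"

definition int01 :: "real poly \<Rightarrow> real" where "int01 f = integral {0..1} (poly f)"

lemma int_poly: "(poly f) integrable_on {0..1::real}"
  by (rule integrable_continuous_real) (rule continuous_on_poly_real)

lemma int01_0 [simp]: "int01 0 = 0"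
proof -
  have "poly 0 = (\<lambda>_. 0 :: real)" by (simp add: fun_eq_iff)
  then show ?thesis by (simp add: int01_def)
qed

lemma int01_add: "int01 (f + g) = int01 f + int01 g"
  unfolding int01_def poly_add by (rule Henstock_Kurzweil_Integration.integral_add[OF int_poly int_poly])

lemma int01_smult: "int01 (smult c f) = c * int01 f"
  unfolding int01_def poly_smult by simp

lemma int01_diff: "int01 (f - g) = int01 f - int01 g"
  using int01_add[of f "smult (-1) g"] int01_smult[of "-1" g] by simp

lemma int01_sum: "int01 (\<Sum>i\<in>A. f i) = (\<Sum>i\<in>A. int01 (f i))"
proof (induction A rule: infinite_finite_induct)
  case (insert x F)
  then show ?case by (simp add: int01_add)
qed auto

lemma int01_pderiv: "int01 (pderiv f) = poly f 1 - poly f 0"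
  unfolding int01_def by (rule integral_unique[OF integral_pderiv])

lemma int01_mono: "(\<And>t. 0 \<le> t \<Longrightarrow> t \<le> 1 \<Longrightarrow> poly f t \<le> poly g t) \<Longrightarrow> int01 f \<le> int01 g"
  unfolding int01_def by (rule integral_le[OF int_poly int_poly]) auto

lemma int01_nonneg: "(\<And>t. 0 \<le> t \<Longrightarrow> t \<le> 1 \<Longrightarrow> 0 \<le> poly f t) \<Longrightarrow> 0 \<le> int01 f"
  using int01_mono[of 0 f] by simp

lemma int01_pos:
  assumes "\<And>t. 0 \<le> t \<Longrightarrow> t \<le> 1 \<Longrightarrow> 0 \<le> poly f t" "f \<noteq> 0"
  shows "0 < int01 f"
proof (rule ccontr)
  assume "\<not> 0 < int01 f"
  then have "integral {0..1} (poly f) = 0" using int01_nonneg[OF assms(1)] by (simp add: int01_def)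
  then have "poly f t = 0" if "t \<in> {0..1}" for t
    using integral_eq_0_iff[of 0 1 "poly f"] assms(1) that continuous_on_poly_real[of _ f] by auto
  then have "{0..1} \<subseteq> {t. poly f t = 0}" by auto
  then have "finite {0..1::real}" using poly_roots_finite[OF assms(2)] finite_subset by blast
  then show False using infinite_Icc[of "0::real" 1] by simp
qed

lemma poly_W: "poly W t = t ^ \<alpha> * (1 - t) ^ \<beta>"
  by (simp add: W_def poly_power)

lemma W_nonneg: "0 \<le> t \<Longrightarrow> t \<le> 1 \<Longrightarrow> 0 \<le> poly W t"
  by (simp add: poly_W)

lemma W_nz: "W \<noteq> 0" by (simp add: W_def)

lemma degree_W: "degree W = \<alpha> + \<beta>"
  unfolding W_def by (subst degree_mult_eq) (auto simp: degree_power_eq)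

text \<open>Lagrange's identity: the difference of the integrands is the derivative of V (f' g - f
  g'), and V = t (1 - t) W vanishes at both ends because its exponents are at least one.\<close>

lemma W_L_self_adjoint: "int01 (W * L f * g) = int01 (W * f * L g)"
proof -
  define V where "V = [:0, 1, -1:] * W"
  have V: "V = [:0, 1:] ^ Suc \<alpha> * [:1, -1:] ^ Suc \<beta>"
    unfolding V_def W_def by (simp add: algebra_simps)
  have dV: "pderiv V = W * [:real \<alpha> + 1, - (real \<alpha> + real \<beta> + 2):]"
    unfolding V pderiv_mult pderiv_power_Suc W_def
    by (rule poly_eq_poly_eq_iff[THEN iffD1]) (simp add: fun_eq_iff pderiv_pCons poly_power algebra_simps)
  have "pderiv (V * (pderiv f * g - f * pderiv g)) = W * L f * g - W * f * L g"
    unfolding pderiv_mult pderiv_diff dV unfolding L_def V_def by (simp add: algebra_simps smult_diff_right)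
  then have "int01 (W * L f * g - W * f * L g) = 0"
    using int01_pderiv[of "V * (pderiv f * g - f * pderiv g)"] by (simp add: V)
  then show ?thesis by (simp add: int01_diff)
qed

lemma coeff_L: "coeff (L f) i = real (i + 1) * real (i + 1 + \<alpha>) * coeff f (i + 1)
    - real i * real (i + \<alpha> + \<beta> + 1) * coeff f i"
proof (cases i)
  case 0
  then show ?thesis by (simp add: L_def coeff_pderiv)
next
  case (Suc j)
  then show ?thesis
    by (cases j) (simp_all add: L_def coeff_pderiv algebra_simps)
qed

text \<open>The coefficients of the hypergeometric function 2F1(-n, n + \<alpha> + \<beta> + 1;
  \<alpha> + 1; t), a multiple of the Jacobi polynomial in the variable 1 - 2 t. The factor i - n
  ends the series at degree n.\<close>

primrec jc :: "nat \<Rightarrow> nat \<Rightarrow> real" where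
  "jc n 0 = 1"
| "jc n (Suc i) = jc n i * ((real i - real n) * real (i + n + \<alpha> + \<beta> + 1)) / (real (i + 1) * real (i + 1 + \<alpha>))"

definition J :: "nat \<Rightarrow> real poly" where "J n = (\<Sum>i\<le>n. monom (jc n i) i)"

lemma jc_eq_0: "i > n \<Longrightarrow> jc n i = 0"
  by (induction i) (auto simp: less_Suc_eq)

lemma jc_nz: "i \<le> n \<Longrightarrow> jc n i \<noteq> 0"
  by (induction i) auto

lemma coeff_J: "coeff (J n) i = jc n i"
proof -
  have "coeff (J n) i = (\<Sum>j\<le>n. if j = i then jc n j else 0)"
    unfolding J_def coeff_sum by (rule sum.cong) auto
  also have "\<dots> = jc n i" by (auto simp: sum.delta jc_eq_0)
  finally show ?thesis .
qed

lemma degree_J: "degree (J n) = n"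
proof (rule antisym)
  show "degree (J n) \<le> n" by (rule degree_le) (simp add: coeff_J jc_eq_0)
  show "n \<le> degree (J n)" by (rule le_degree) (simp add: coeff_J jc_nz)
qed

lemma J_nz: "J n \<noteq> 0"
  using jc_nz[of 0 n] coeff_J[of n 0] by auto

text \<open>The recursion for \<open>jc\<close> matches the two terms of \<open>coeff_L\<close>, by
  i (i + c) - n (n + c) = (i - n) (i + n + c) with c = \<alpha> + \<beta> + 1.\<close>

lemma L_J: "L (J n) = smult (- (real n * real (n + \<alpha> + \<beta> + 1))) (J n)"
proof (rule poly_eqI)
  fix i
  have "real (i + 1) * real (i + 1 + \<alpha>) * jc n (Suc i) = jc n i * ((real i - real n) * real (i + n + \<alpha> + \<beta> + 1))"
    by (simp del: of_nat_add of_nat_Suc)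
  then show "coeff (L (J n)) i = coeff (smult (- (real n * real (n + \<alpha> + \<beta> + 1))) (J n)) i"
    unfolding coeff_L coeff_smult coeff_J by (simp add: algebra_simps)
qed

definition ip :: "real poly \<Rightarrow> real poly \<Rightarrow> real" where "ip f g = int01 (W * f * g)"

lemma ip_JJ_pos: "0 < ip (J n) (J n)"
  unfolding ip_def by (rule int01_pos) (auto simp: W_nz J_nz W_nonneg mult.assoc)

definition P :: "nat \<Rightarrow> real poly" where "P n = smult (1 / sqrt (ip (J n) (J n))) (J n)"

lemma degree_P: "degree (P n) = n" and P_nz: "P n \<noteq> 0"
  using ip_JJ_pos[of n] by (simp_all add: P_def degree_J J_nz)

lemma L_P: "L (P n) = smult (- (real n * real (n + \<alpha> + \<beta> + 1))) (P n)"
proof -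
  have "L (smult c f) = smult c (L f)" for c f
    by (simp add: L_def pderiv_smult smult_add_right)
  then show ?thesis by (simp add: P_def L_J mult.commute)
qed

lemma ip_smult_left: "ip (smult c f) g = c * ip f g"
  and ip_smult_right: "ip f (smult c g) = c * ip f g"
  by (simp_all add: ip_def int01_smult[symmetric])

lemma ip_P: "ip (P a) (P b) = (if a = b then 1 else 0)"
proof (cases "a = b")
  case True
  then show ?thesis
    using ip_JJ_pos[of b] by (simp add: P_def ip_smult_left ip_smult_right)
next
  case False
  have "ip (L (P a)) (P b) = ip (P a) (L (P b))"
    unfolding ip_def by (rule W_L_self_adjoint)
  then have "(real a * real (a + \<alpha> + \<beta> + 1) - real b * real (b + \<alpha> + \<beta> + 1)) * ip (P a) (P b) = 0"
    by (simp add: L_P ip_smult_left ip_smult_right algebra_simps)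
  moreover have "real a * real (a + \<alpha> + \<beta> + 1) \<noteq> real b * real (b + \<alpha> + \<beta> + 1)"
  proof -
    have "a * (a + \<alpha> + \<beta> + 1) < b * (b + \<alpha> + \<beta> + 1)" if "a < b" for a b
      using that by (intro mult_less_le_imp_less) auto
    then have "a * (a + \<alpha> + \<beta> + 1) \<noteq> b * (b + \<alpha> + \<beta> + 1)"
      using False by (metis linorder_neqE_nat less_irrefl)
    then show ?thesis by (metis of_nat_eq_iff of_nat_mult)
  qed
  ultimately show ?thesis using False by simp
qed

lemma ip_sum_left: "ip (\<Sum>i\<in>A. f i) g = (\<Sum>i\<in>A. ip (f i) g)"
  unfolding ip_def by (simp add: sum_distrib_left sum_distrib_right int01_sum)

lemma P_expansion:
  assumes "degree f \<le> n"
  shows "f = (\<Sum>d\<le>n. smult (ip f (P d)) (P d))"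
proof -
  have "\<exists>c. f = (\<Sum>d\<le>n. smult (c d) (P d))"
    using assms
  proof (induction n arbitrary: f)
    case 0
    then obtain a where f: "f = [:a:]" by (metis degree_eq_zeroE le_zero_eq)
    obtain b where b: "P 0 = [:b:]" by (metis degree_eq_zeroE degree_P)
    with P_nz[of 0] have "b \<noteq> 0" by auto
    then show ?case using f b by (intro exI[of _ "\<lambda>_. a / b"]) simp
  next
    case (Suc n)
    define c where "c = coeff f (Suc n) / coeff (P (Suc n)) (Suc n)"
    have nz: "coeff (P (Suc n)) (Suc n) \<noteq> 0"
      using P_nz[of "Suc n"] degree_P[of "Suc n"] by (metis leading_coeff_0_iff)
    have "degree (f - smult c (P (Suc n))) \<le> n"
    proof (rule degree_le, safe)
      fix i assume "n < i"
      show "coeff (f - smult c (P (Suc n))) i = 0"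
      proof (cases "i = Suc n")
        case True
        then show ?thesis using nz by (simp add: c_def)
      next
        case False
        then have "i > Suc n" using \<open>n < i\<close> by simp
        then show ?thesis using Suc.prems degree_P[of "Suc n"] by (simp add: coeff_eq_0)
      qed
    qed
    from Suc.IH[OF this] obtain c' where "f - smult c (P (Suc n)) = (\<Sum>d\<le>n. smult (c' d) (P d))" by blast
    then have "f = (\<Sum>d\<le>n. smult (c' d) (P d)) + smult c (P (Suc n))" by (simp add: algebra_simps)
    also have "\<dots> = (\<Sum>d\<le>Suc n. smult (if d = Suc n then c else c' d) (P d))" by simp
    finally show ?case by (intro exI[of _ "\<lambda>d. if d = Suc n then c else c' d"])
  qed
  then obtain c where c: "f = (\<Sum>d\<le>n. smult (c d) (P d))" by blast
  have "ip f (P d) = c d" if "d \<le> n" for d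
    using that unfolding c ip_sum_left ip_smult_left ip_P
    by (simp add: if_distrib[of "\<lambda>x. _ * x"] sum.delta' cong: if_cong)
  then show ?thesis by (subst c, intro sum.cong) auto
qed

lemma ip_eq_0: "degree f < d \<Longrightarrow> ip f (P d) = 0"
  by (subst P_expansion[of f "degree f"]) (auto simp: ip_sum_left ip_smult_left ip_P intro!: sum.neutral)

definition fr :: "nat \<Rightarrow> nat" where "fr a = \<alpha> + \<beta> + 1 + 2 * a"

lemma fr_ge: "a + 1 \<le> fr a" and fr_pos: "0 < fr a" by (simp_all add: fr_def)

text \<open>The weighted square is itself a nonnegative polynomial, of degree \<alpha> + \<beta> + 2
  a and with integral 1, so \<open>nonneg_poly_le\<close> applies directly; its degree plus one is
  exactly \<open>fr a\<close>.\<close>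

lemma WPP_le:
  assumes "0 \<le> t" "t \<le> 1"
  shows "poly W t * (poly (P a) t)\<^sup>2 \<le> 11 * (real (fr a))\<^sup>2"
proof -
  have "poly (W * P a * P a) t \<le> 11 * real (\<alpha> + \<beta> + 2 * a + 1) ^ 2 * integral {0..1} (poly (W * P a * P a))"
  proof (rule nonneg_poly_le[OF _ _ assms])
    have "degree (W * P a * P a) \<le> degree W + degree (P a) + degree (P a)"
      by (intro order_trans[OF degree_mult_le] add_mono degree_mult_le) auto
    then show "degree (W * P a * P a) \<le> \<alpha> + \<beta> + 2 * a" by (simp add: degree_W degree_P)
  qed (simp add: W_nonneg mult.assoc)
  also have "integral {0..1} (poly (W * P a * P a)) = 1"
    using ip_P[of a a] by (simp add: ip_def int01_def)
  finally show ?thesis by (simp add: fr_def power2_eq_square algebra_simps)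
qed

text \<open>The coupling coefficients of the cubic term. One factor \<open>W\<close> is the weight
  of the inner product, the other one is the squared modulus of the factor common to all modes of
  the given momentum.\<close>

definition q4 :: "nat \<Rightarrow> nat \<Rightarrow> nat \<Rightarrow> nat \<Rightarrow> real"
  where "q4 a b c d = int01 (W * W * P a * P b * P c * P d)"

lemma q4_perm: "q4 a b c d = q4 b a c d" "q4 a b c d = q4 a c b d" "q4 a b c d = q4 a b d c"
  unfolding q4_def by (simp_all only: mult.commute mult.left_commute)

lemma q4_eq_0: "a + b + c + \<alpha> + \<beta> < d \<Longrightarrow> q4 a b c d = 0"
proof -
  assume "a + b + c + \<alpha> + \<beta> < d"
  moreover have "degree (W * P a * P b * P c) \<le> degree W + degree (P a) + degree (P b) + degree (P c)"
    by (intro order_trans[OF degree_mult_le] add_mono degree_mult_le) auto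
  ultimately have "ip (W * P a * P b * P c) (P d) = 0"
    by (intro ip_eq_0) (simp add: degree_W degree_P)
  then show "q4 a b c d = 0" by (simp add: ip_def q4_def mult.assoc)
qed

lemma product_expansion:
  "W * P a * P b * P c = (\<Sum>d\<le>a + b + c + \<alpha> + \<beta>. smult (q4 a b c d) (P d))"
proof -
  have "degree (W * P a * P b * P c) \<le> degree W + degree (P a) + degree (P b) + degree (P c)"
    by (intro order_trans[OF degree_mult_le] add_mono degree_mult_le) auto
  then have "degree (W * P a * P b * P c) \<le> a + b + c + \<alpha> + \<beta>"
    by (simp add: degree_W degree_P)
  moreover have "ip (W * P a * P b * P c) (P d) = q4 a b c d" for d
    by (simp add: ip_def q4_def mult.assoc)
  ultimately show ?thesis using P_expansion[of "W * P a * P b * P c"] by simp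
qed

lemma abs_int01_le:
  assumes "\<And>t. 0 \<le> t \<Longrightarrow> t \<le> 1 \<Longrightarrow> \<bar>poly f t\<bar> \<le> poly g t"
  shows "\<bar>int01 f\<bar> \<le> int01 g"
proof -
  have "int01 f \<le> int01 g" by (rule int01_mono) (use assms in fastforce)
  moreover have "int01 (smult (-1) f) \<le> int01 g" by (rule int01_mono) (use assms in fastforce)
  ultimately show ?thesis by (simp only: int01_smult)
qed

text \<open>Two of the four factors are estimated pointwise by \<open>WPP_le\<close>, each with a
  square root of \<open>W\<close>; what remains is the weighted integral of P_a P_d, at most 1 by
  the arithmetic-geometric mean and normalization. By symmetry of \<open>q4\<close> the two costly
  factors can be those of the smallest indices.\<close>

lemma abs_q4_le: "\<bar>q4 a b c d\<bar> \<le> 11 * real (fr b) * real (fr c)"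
proof -
  let ?w = "\<lambda>t. poly W t" and ?p = "\<lambda>a t. poly (P a) t"
  define B where "B = 11 * real (fr b) * real (fr c)"
  have "\<bar>q4 a b c d\<bar> \<le> int01 (smult (B / 2) (W * P a * P a + W * P d * P d))"
    unfolding q4_def
  proof (rule abs_int01_le)
    fix t :: real assume t: "0 \<le> t" "t \<le> 1"
    have w: "?w t \<ge> 0" by (rule W_nonneg[OF t])
    have "(?w t * ?p b t * ?p c t)\<^sup>2 = (?w t * (?p b t)\<^sup>2) * (?w t * (?p c t)\<^sup>2)"
      by (simp add: power2_eq_square algebra_simps)
    also have "\<dots> \<le> (11 * (real (fr b))\<^sup>2) * (11 * (real (fr c))\<^sup>2)"
      by (intro mult_mono WPP_le t mult_nonneg_nonneg w) auto
    also have "\<dots> = B\<^sup>2" by (simp add: B_def power2_eq_square)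
    finally have 1: "\<bar>?w t * ?p b t * ?p c t\<bar> \<le> B"
      using abs_le_square_iff[of "?w t * ?p b t * ?p c t" B] by (simp add: B_def)
    have "\<bar>?p a t * ?p d t\<bar> \<le> ((?p a t)\<^sup>2 + (?p d t)\<^sup>2) / 2"
      using sum_squares_bound[of "\<bar>?p a t\<bar>" "\<bar>?p d t\<bar>"] by (simp add: abs_mult)
    then have 2: "\<bar>?w t * (?p a t * ?p d t)\<bar> \<le> ?w t * (((?p a t)\<^sup>2 + (?p d t)\<^sup>2) / 2)"
      using w by (simp only: abs_mult abs_of_nonneg mult_left_mono)
    have "\<bar>poly (W * W * P a * P b * P c * P d) t\<bar> = \<bar>?w t * ?p b t * ?p c t\<bar> * \<bar>?w t * (?p a t * ?p d t)\<bar>"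
      by (simp add: abs_mult algebra_simps)
    also have "\<dots> \<le> B * (?w t * (((?p a t)\<^sup>2 + (?p d t)\<^sup>2) / 2))"
      by (rule mult_mono[OF 1 2]) (auto simp: B_def)
    finally show "\<bar>poly (W * W * P a * P b * P c * P d) t\<bar> \<le> poly (smult (B / 2) (W * P a * P a + W * P d * P d)) t"
      by (simp add: power2_eq_square algebra_simps)
  qed
  also have "\<dots> = B" using ip_P[of a a] ip_P[of d d] by (simp add: int01_smult int01_add ip_def)
  finally show ?thesis by (simp add: B_def)
qed

lemma q4_diag_pos: "0 < q4 a a a a"
proof -
  have "0 < int01 (W * W * P a * P a * P a * P a)"
  proof (rule int01_pos)
    have "poly (W * W * P a * P a * P a * P a) t = (poly (W * P a * P a) t)\<^sup>2" for t
      by (simp add: power2_eq_square algebra_simps)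
    then show "0 \<le> poly (W * W * P a * P a * P a * P a) t" for t by simp
  qed (auto simp: W_nz P_nz)
  then show ?thesis by (simp add: q4_def)
qed

lemma q4_Cauchy_Schwarz: "(q4 a a b b)\<^sup>2 \<le> q4 a a a a * q4 b b b b"
proof -
  \<comment> \<open>The minimizer of the nonnegative quadratic polynomial x \<mapsto> \<integral> (W
    P_b^2 - x W P_a^2)^2.\<close>
  define x where "x = q4 a a b b / q4 a a a a"
  have "0 \<le> int01 ((W * P b * P b - smult x (W * P a * P a)) * (W * P b * P b - smult x (W * P a * P a)))"
    by (rule int01_nonneg) simp
  also have "(W * P b * P b - smult x (W * P a * P a)) * (W * P b * P b - smult x (W * P a * P a))
     = W * W * P b * P b * P b * P b - smult (2 * x) (W * W * P a * P a * P b * P b)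
       + smult (x * x) (W * W * P a * P a * P a * P a)"
    by (rule poly_eq_poly_eq_iff[THEN iffD1]) (simp add: fun_eq_iff algebra_simps)
  also have "int01 \<dots> = q4 b b b b - 2 * x * q4 a a b b + x * x * q4 a a a a"
    by (simp add: int01_add int01_diff int01_smult q4_def)
  also have "\<dots> = q4 b b b b - (q4 a a b b)\<^sup>2 / q4 a a a a"
    using q4_diag_pos[of a] by (simp add: x_def power2_eq_square field_simps)
  finally show ?thesis using q4_diag_pos[of a] by (simp add: field_simps)
qed

text \<open>
  On the resonant mode with frequency \<open>K * fr a\<close> the linearization acts as multiplication by \<open>(K m)\<^sup>2\<close> minus a multiple
  of \<open>q4 a a b b\<close>; the condition keeps it away from zero.
\<close>

definition nondegenerate :: "nat \<Rightarrow> bool"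
  where "nondegenerate a \<longleftrightarrow>
    (\<forall>b K. 3 \<le> K \<and> K * fr a = fr b \<longrightarrow> 2 * q4 a a b b \<le> 3 / 4 * (real K)\<^sup>2 * q4 a a a a)"

text \<open>
  The quotient of \<open>\<integral> W\<^sup>2 P\<^sub>a\<^sup>4\<close> and the square of the frequency is bounded. If \<open>a\<close> almost
  maximizes it among all larger indices, then \<open>\<integral> W\<^sup>2 P\<^sub>b\<^sup>4\<close> is at most \<open>10/9 K\<^sup>2\<close> times as large at
  the \<open>K\<close>-fold frequency, and the Cauchy-Schwarz inequality applies.
\<close>

lemma ex_nondegenerate: "\<exists>a\<ge>N. nondegenerate a"
proof -
  define f where "f a = q4 a a a a / (real (fr a))\<^sup>2" for a
  have fpos: "f a > 0" for a using q4_diag_pos[of a] fr_pos[of a] by (simp add: f_def)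
  have fle: "f a \<le> 11" for a
    using abs_q4_le[of a a a a] fr_pos[of a] by (simp add: f_def field_simps power2_eq_square)
  define S where "S = (SUP a\<in>{N..}. f a)"
  have bdd: "bdd_above (f ` {N..})" using fle by (auto intro!: bdd_aboveI2)
  have fS: "f a \<le> S" if "a \<ge> N" for a
    unfolding S_def by (rule cSUP_upper[OF _ bdd]) (use that in auto)
  have "S > 0" using fpos[of N] fS[of N] by simp
  then have "\<exists>a\<in>{N..}. 9 / 10 * S < f a"
    using less_cSUP_iff[OF _ bdd, of "9 / 10 * S"] unfolding S_def[symmetric] by auto
  then obtain a where a: "a \<ge> N" "9 / 10 * S < f a" by auto
  have "2 * q4 a a b b \<le> 3 / 4 * (real K)\<^sup>2 * q4 a a a a" if K: "3 \<le> K" "K * fr a = fr b" for b K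
  proof -
    have "fr a \<le> fr b" using K by (metis One_nat_def le_trans mult_le_mono1 nat_mult_1 numeral_le_one_iff
      one_le_numeral)
    then have "b \<ge> a" by (simp add: fr_def)
    then have "f b \<le> 10 / 9 * f a" using fS[of b] a by simp
    then have Fb: "q4 b b b b \<le> 10 / 9 * (real K)\<^sup>2 * q4 a a a a"
      using fr_pos[of a] K(2)[symmetric] \<open>3 \<le> K\<close> by (simp add: f_def field_simps power2_eq_square)
    have "(q4 a a b b)\<^sup>2 \<le> q4 a a a a * q4 b b b b" by (rule q4_Cauchy_Schwarz)
    also have "\<dots> \<le> q4 a a a a * (10 / 9 * (real K)\<^sup>2 * q4 a a a a)"
      using q4_diag_pos[of a] by (intro mult_left_mono Fb) auto
    \<comment> \<open>The square of 3/8 is 9/64, and 10/9 K^2 \<le> 9/64 K^4 means K^2 \<ge> 640/81,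
      which lies between 7 and 8: tripled frequencies pass, doubled ones would not.\<close>
    also have "\<dots> \<le> (3 / 8 * (real K)\<^sup>2 * q4 a a a a)\<^sup>2"
    proof -
      have "9 \<le> (real K)\<^sup>2" using power_mono[of 3 "real K" 2] K(1) by simp
      then have "(real K)\<^sup>2 * (10 / 9) \<le> (real K)\<^sup>2 * (9 / 64 * (real K)\<^sup>2)"
        by (intro mult_left_mono) auto
      then have "10 / 9 * (real K)\<^sup>2 \<le> 9 / 64 * (real K)\<^sup>2 * (real K)\<^sup>2"
        by (simp only: mult.commute mult.left_commute)
      then have "10 / 9 * (real K)\<^sup>2 * (q4 a a a a)\<^sup>2 \<le> 9 / 64 * (real K)\<^sup>2 * (real K)\<^sup>2 * (q4 a a a a)\<^sup>2"
        by (rule mult_right_mono) simp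
      then show ?thesis by (simp add: power2_eq_square algebra_simps)
    qed
    finally have "q4 a a b b \<le> 3 / 8 * (real K)\<^sup>2 * q4 a a a a"
      by (rule power2_le_imp_le) (use q4_diag_pos[of a] in auto)
    then show ?thesis by simp
  qed
  then show ?thesis using a(1) unfolding nondegenerate_def by blast
qed

end

section \<open>Calculus of smooth functions\<close>

lemma Ck_on_cong:
  assumes "open U" "\<And>x. x \<in> U \<Longrightarrow> f x = g x" "Ck_on k U f"
  shows "Ck_on k U g"
  using assms(2,3)
proof (induction k arbitrary: f g)
  case 0
  then show ?case by (simp cong: continuous_on_cong)
next
  case (Suc k)
  have d: "f differentiable (at x)" if "x \<in> U" for x using Suc.prems that by simp
  have "g differentiable (at x)" if "x \<in> U" for x
    using d[OF that] has_derivative_transform_within_open[OF _ assms(1) that] Suc.prems(1)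
    unfolding differentiable_def by blast
  moreover have "frechet_derivative f (at x) b = frechet_derivative g (at x) b" if "x \<in> U" for x b
    using frechet_derivative_transform_within_open[OF d[OF that] assms(1) that] Suc.prems(1) by simp
  ultimately show ?case
    using Suc.IH[of "\<lambda>x. frechet_derivative f (at x) _" "\<lambda>x. frechet_derivative g (at x) _"] Suc.prems(2)
    by simp
qed

text \<open>Lets an explicit derivative formula take the place of the chosen
  \<open>frechet_derivative\<close>; on an open set the two agree pointwise.\<close>

lemma Ck_on_SucI:
  assumes "open U" "\<And>x. x \<in> U \<Longrightarrow> (f has_derivative f' x) (at x)"
    "\<And>b. b \<in> Basis \<Longrightarrow> Ck_on k U (\<lambda>x. f' x b)"
  shows "Ck_on (Suc k) U f"
proof -
  have "frechet_derivative f (at x) = f' x" if "x \<in> U" for x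
    using frechet_derivative_at[OF assms(2)[OF that]] by simp
  then have "Ck_on k U (\<lambda>x. frechet_derivative f (at x) b)" if "b \<in> Basis" for b
    by (intro Ck_on_cong[OF assms(1) _ assms(3)[OF that]]) simp
  then show ?thesis using assms(2) by (auto simp: differentiable_def)
qed

lemma Ck_on_has_derivative:
  "Ck_on (Suc k) U f \<Longrightarrow> x \<in> U \<Longrightarrow> (f has_derivative frechet_derivative f (at x)) (at x)"
  using frechet_derivative_works by auto

lemma Ck_on_Suc_imp: "Ck_on (Suc k) U f \<Longrightarrow> Ck_on k U f"
proof (induction k arbitrary: f)
  case 0
  then show ?case
    by (auto intro!: differentiable_imp_continuous_on differentiable_at_imp_differentiable_on)
qed auto

lemma Ck_on_continuous: "Ck_on k U f \<Longrightarrow> continuous_on U f"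
  by (induction k) (auto dest: Ck_on_Suc_imp simp del: Ck_on.simps(2))

lemma Ck_on_const: "open U \<Longrightarrow> Ck_on k U (\<lambda>x. c)"
proof (induction k arbitrary: c)
  case (Suc k)
  show ?case by (rule Ck_on_SucI[OF Suc.prems has_derivative_const]) (rule Suc.IH[OF Suc.prems])
qed simp

lemma Ck_on_linear:
  assumes "open U" "bounded_linear f"
  shows "Ck_on k U f"
proof (cases k)
  case 0
  then show ?thesis using linear_continuous_on[OF assms(2)] by simp
next
  case (Suc j)
  show ?thesis unfolding Suc
    by (rule Ck_on_SucI[OF assms(1) bounded_linear_imp_has_derivative[OF assms(2)] Ck_on_const[OF assms(1)]])
qed

lemma Ck_on_add:
  assumes "open U"
  shows "Ck_on k U f \<Longrightarrow> Ck_on k U g \<Longrightarrow> Ck_on k U (\<lambda>x. f x + g x)"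
proof (induction k arbitrary: f g)
  case 0
  then show ?case by (simp add: continuous_on_add)
next
  case (Suc k)
  show ?case
    by (rule Ck_on_SucI[OF assms has_derivative_add[OF Ck_on_has_derivative[OF Suc.prems(1)] Ck_on_has_derivative[OF Suc.prems(2)]]])
       (use Suc.prems in \<open>auto intro!: Suc.IH\<close>)
qed

lemma (in bounded_bilinear) Ck_on_prod:
  assumes "open U"
  shows "Ck_on k U f \<Longrightarrow> Ck_on k U g \<Longrightarrow> Ck_on k U (\<lambda>x. prod (f x) (g x))"
proof (induction k arbitrary: f g)
  case 0
  then show ?case by (simp add: continuous_on)
next
  case (Suc k)
  show ?case
    by (rule Ck_on_SucI[OF assms FDERIV[OF Ck_on_has_derivative[OF Suc.prems(1)] Ck_on_has_derivative[OF Suc.prems(2)]]])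
       (use Suc.prems Ck_on_Suc_imp[OF Suc.prems(1)] Ck_on_Suc_imp[OF Suc.prems(2)]
         in \<open>auto intro!: Suc.IH Ck_on_add[OF assms]\<close>)
qed

lemma Ck_on_linear_comp:
  assumes "open U" "bounded_linear h"
  shows "Ck_on k U f \<Longrightarrow> Ck_on k U (\<lambda>x. h (f x))"
proof (induction k arbitrary: f)
  case 0
  then show ?case by (simp add: bounded_linear.continuous_on[OF assms(2)])
next
  case (Suc k)
  show ?case
    by (rule Ck_on_SucI[OF assms(1) bounded_linear.has_derivative[OF assms(2) Ck_on_has_derivative[OF Suc.prems]]])
       (use Suc.prems in \<open>auto intro!: Suc.IH\<close>)
qed

text \<open>The induction closes because the derivative - (y \<bullet> h) / |y|^3 is a product of a
  linear function and powers of the same function 1 / |y|.\<close>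

lemma Ck_on_inverse_norm:
  "Ck_on k (- {0}) (\<lambda>y :: 'a::euclidean_space. inverse (norm y))"
proof (induction k)
  case 0
  show ?case by (auto intro!: continuous_intros)
next
  case (Suc k)
  have op: "open (- {0 :: 'a})" by auto
  have lin: "Ck_on k (- {0}) (\<lambda>x :: 'a. x \<bullet> b)" for b
    by (rule Ck_on_linear[OF op bounded_linear_inner_left])
  show ?case
  proof (rule Ck_on_SucI[OF op])
    fix x :: 'a assume "x \<in> - {0}"
    then show "((\<lambda>y. inverse (norm y)) has_derivative
        (\<lambda>h. (x \<bullet> (- h)) * (inverse (norm x) * (inverse (norm x) * inverse (norm x))))) (at x)"
      by (intro has_derivative_eq_rhs[OF Deriv.has_derivative_inverse[OF _ has_derivative_norm]])
         (auto simp: inner_commute sgn_div_norm divide_simps)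
  next
    show "Ck_on k (- {0}) (\<lambda>x. (x \<bullet> (- b)) * (inverse (norm x) * (inverse (norm x) * inverse (norm x))))" for b :: 'a
      by (intro bounded_bilinear.Ck_on_prod[OF bounded_bilinear_mult op] lin Suc)
  qed
qed

lemma Ck_on_slice:
  assumes "open U"
  shows "Ck_on k (UNIV \<times> U) \<Psi> \<Longrightarrow> Ck_on k U (\<lambda>y. \<Psi> (t :: real, y))"
proof (induction k arbitrary: \<Psi>)
  case 0
  then show ?case
    by (auto intro!: continuous_on_compose2[of "UNIV \<times> U" \<Psi>] continuous_intros)
next
  case (Suc k)
  have b: "(0, b) \<in> Basis" if "b \<in> Basis" for b :: 'a using that by (simp add: Basis_prod_def)
  show ?case
  proof (rule Ck_on_SucI[OF assms])
    fix x assume "x \<in> U"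
    have "((\<lambda>y. (t, y)) has_derivative (\<lambda>h. (0, h))) (at x)"
      by (auto intro!: derivative_eq_intros)
    then show "((\<lambda>y. \<Psi> (t, y)) has_derivative (\<lambda>h. frechet_derivative \<Psi> (at (t, x)) (0, h))) (at x)"
      by (rule has_derivative_compose[where g = \<Psi> and f = "\<lambda>y. (t, y)"])
         (use Ck_on_has_derivative[OF Suc.prems, of "(t, x)"] \<open>x \<in> U\<close> in auto)
  next
    fix b :: 'a assume "b \<in> Basis"
    then have "Ck_on k (UNIV \<times> U) (\<lambda>x. frechet_derivative \<Psi> (at x) (0, b))" using Suc.prems b by auto
    then show "Ck_on k U (\<lambda>x. frechet_derivative \<Psi> (at (t, x)) (0, b))" by (rule Suc.IH)
  qed
qed

section \<open>Topology and smooth functions of the sphere\<close>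

lemma norm_Rep_S3 [simp]: "norm (Rep_S3 x) = 1"
  using Rep_S3[of x] by simp

lemma Rep_S3_nz [simp]: "Rep_S3 x \<noteq> 0"
  using norm_Rep_S3[of x] by force

lemma Rep_radial_proj: "y \<noteq> 0 \<Longrightarrow> Rep_S3 (radial_proj y) = y /\<^sub>R norm y"
  unfolding radial_proj_def by (rule Abs_S3_inverse) simp

lemma radial_proj_Rep [simp]: "radial_proj (Rep_S3 x) = x"
  by (simp add: radial_proj_def Rep_S3_inverse)

lemma radial_proj_scale: "0 < c \<Longrightarrow> radial_proj (c *\<^sub>R y) = radial_proj y"
  by (simp add: radial_proj_def field_simps)

lemma continuous_on_Rep_S3: "continuous_on S Rep_S3"
  unfolding continuous_on_iff by (auto simp: dist_S3_def)

lemma continuous_on_radial_proj: "continuous_on (- {0}) radial_proj"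
proof -
  have "continuous_on (- {0}) (\<lambda>y :: real ^ 4. y /\<^sub>R norm y)"
    by (auto intro!: continuous_intros)
  then show ?thesis
    unfolding continuous_on_iff by (simp add: dist_S3_def Rep_radial_proj)
qed

lemma compact_S3: "compact (UNIV :: S3 set)"
proof -
  have "compact (radial_proj ` sphere 0 1)"
    by (intro compact_continuous_image continuous_on_subset[OF continuous_on_radial_proj]) auto
  moreover have "radial_proj ` sphere 0 1 = UNIV"
    using radial_proj_Rep Rep_S3 by (metis UNIV_eq_I image_eqI)
  ultimately show ?thesis by simp
qed

text \<open>Second countability identifies the product sigma-algebra on time and sphere with the
  Borel sets of the product, so that joint continuity gives joint measurability.\<close>

instance S3 :: second_countable_topology
proof
  obtain B :: "(real ^ 4) set set" where B: "countable B" "topological_basis B"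
    using ex_countable_basis by blast
  define C where "C = (\<lambda>U. Rep_S3 -` U) ` B"
  have "topological_basis C"
  proof (rule topological_basisI)
    fix U assume "U \<in> C"
    then show "open U"
      using continuous_on_open_vimage[of UNIV Rep_S3] continuous_on_Rep_S3 topological_basis_open[OF B(2)]
      by (auto simp: C_def)
  next
    fix U :: "S3 set" and x assume U: "open U" "x \<in> U"
    then obtain e where e: "e > 0" "\<And>y. dist y x < e \<Longrightarrow> y \<in> U" by (auto simp: open_dist)
    obtain V where V: "V \<in> B" "Rep_S3 x \<in> V" "V \<subseteq> ball (Rep_S3 x) e"
      using topological_basisE[OF B(2), of "ball (Rep_S3 x) e" "Rep_S3 x"] e(1) by auto
    then show "\<exists>V\<in>C. x \<in> V \<and> V \<subseteq> U"
      using e(2) by (intro bexI[of _ "Rep_S3 -` V"]) (auto simp: C_def dist_S3_def dist_commute subset_eq)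
  qed
  then show "\<exists>B :: S3 set set. countable B \<and> open = generate_topology B"
    using B(1) topological_basis_imp_subbasis by (auto simp: C_def)
qed

lemma open_Compl_0: "open (- {0 :: real ^ 4})" by auto

lemma smooth_S3_const: "smooth_S3 (\<lambda>x. c)"
  by (simp add: smooth_S3_def smooth_on_def Ck_on_const[OF open_Compl_0])

lemma smooth_S3_add: "smooth_S3 f \<Longrightarrow> smooth_S3 g \<Longrightarrow> smooth_S3 (\<lambda>x. f x + g x)"
  by (simp add: smooth_S3_def smooth_on_def Ck_on_add[OF open_Compl_0])

lemma smooth_S3_mult: "smooth_S3 f \<Longrightarrow> smooth_S3 g \<Longrightarrow> smooth_S3 (\<lambda>x. f x * g x)"
  by (simp add: smooth_S3_def smooth_on_def bounded_bilinear.Ck_on_prod[OF bounded_bilinear_mult open_Compl_0])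

lemma smooth_S3_cnj: "smooth_S3 f \<Longrightarrow> smooth_S3 (\<lambda>x. cnj (f x))"
  by (simp add: smooth_S3_def smooth_on_def Ck_on_linear_comp[OF open_Compl_0 bounded_linear_cnj])

lemma smooth_S3_power: "smooth_S3 f \<Longrightarrow> smooth_S3 (\<lambda>x. f x ^ n)"
  by (induction n) (auto intro: smooth_S3_const smooth_S3_mult)

text \<open>The extension constant along rays of a linear form is h(y) / |y|, a product of functions
  already known to be smooth away from the origin.\<close>

lemma smooth_S3_linear:
  assumes "linear h"
  shows "smooth_S3 (\<lambda>x. h (Rep_S3 x))"
  unfolding smooth_S3_def smooth_on_def
proof
  fix k
  have h: "bounded_linear h" using assms by (rule linear_conv_bounded_linear[THEN iffD1])
  have "Ck_on k (- {0}) (\<lambda>y. inverse (norm y) *\<^sub>R h y)"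
    by (intro bounded_bilinear.Ck_on_prod[OF bounded_bilinear_scaleR open_Compl_0] Ck_on_inverse_norm
        Ck_on_linear[OF open_Compl_0 h])
  then show "Ck_on k (- {0}) (\<lambda>y. h (Rep_S3 (radial_proj y)))"
    by (rule Ck_on_cong[OF open_Compl_0, rotated]) (simp add: Rep_radial_proj linear_scale[OF assms])
qed

lemma smooth_S3_continuous: "smooth_S3 f \<Longrightarrow> continuous_on UNIV f"
proof -
  assume "smooth_S3 f"
  then have "continuous_on (- {0}) (\<lambda>y. f (radial_proj y))"
    unfolding smooth_S3_def smooth_on_def using Ck_on_continuous by blast
  then have "continuous_on UNIV (\<lambda>x. f (radial_proj (Rep_S3 x)))"
    by (rule continuous_on_compose2[OF _ continuous_on_Rep_S3]) auto
  then show ?thesis by simp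
qed

definition z1 :: "S3 \<Rightarrow> complex" where "z1 x = Complex (Rep_S3 x $ 1) (Rep_S3 x $ 2)"
definition z2 :: "S3 \<Rightarrow> complex" where "z2 x = Complex (Rep_S3 x $ 3) (Rep_S3 x $ 4)"

lemma smooth_S3_z: "smooth_S3 z1" "smooth_S3 z2"
proof -
  have "linear (\<lambda>y :: real ^ 4. Complex (y $ i) (y $ j))" for i j
    by (rule linearI) (simp_all add: complex_eq_iff)
  from smooth_S3_linear[OF this] show "smooth_S3 z1" "smooth_S3 z2"
    unfolding z1_def[abs_def] z2_def[abs_def] by auto
qed

lemma norm_z_sum: "(cmod (z1 x))\<^sup>2 + (cmod (z2 x))\<^sup>2 = 1"
proof -
  have "(norm (Rep_S3 x))\<^sup>2 = 1" by simp
  then show ?thesis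
    unfolding z1_def z2_def cmod_def
    by (simp add: norm_eq_sqrt_inner inner_vec_def sum_4 power2_eq_square)
qed

section \<open>The cone measure of the sphere and rotation invariance of Lebesgue measure\<close>

lemma sets_S3_measure [simp, measurable_cong]: "sets S3_measure = sets borel"
  by (simp add: S3_measure_def)

lemma space_S3_measure [simp]: "space S3_measure = UNIV"
  by (simp add: S3_measure_def space_scale_measure)

lemma measurable_radial_proj:
  "radial_proj \<in> measurable (restrict_space lborel (ball 0 1 - {0})) borel"
proof (rule measurableI)
  fix X :: "S3 set" assume "X \<in> sets borel"
  have "radial_proj \<in> borel_measurable (restrict_space borel (- {0}))"
    by (rule borel_measurable_continuous_on_restrict[OF continuous_on_radial_proj])
  from measurable_sets[OF this \<open>X \<in> sets borel\<close>]
  have "radial_proj -` X \<inter> - {0} \<in> sets borel" by (auto simp: sets_restrict_space space_restrict_space)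
  then have "(radial_proj -` X \<inter> - {0}) \<inter> (ball 0 1 - {0}) \<in> sets borel" by auto
  moreover have "(radial_proj -` X \<inter> - {0}) \<inter> (ball 0 1 - {0}) = radial_proj -` X \<inter> (ball 0 1 - {0})" by auto
  ultimately show "radial_proj -` X \<inter> space (restrict_space lborel (ball 0 1 - {0}))
      \<in> sets (restrict_space lborel (ball 0 1 - {0}))"
    by (auto simp: space_restrict_space sets_restrict_space_iff)
qed simp

lemma emeasure_S3:
  assumes "A \<in> sets borel"
  shows "emeasure S3_measure A = 4 * emeasure lborel (radial_proj -` A \<inter> (ball 0 1 - {0}))"
proof -
  have "emeasure S3_measure A =
      4 * emeasure (restrict_space lborel (ball 0 1 - {0})) (radial_proj -` A \<inter> (ball 0 1 - {0}))"
    unfolding S3_measure_def using assms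
    by (simp add: emeasure_distr[OF measurable_radial_proj] space_restrict_space)
  then show ?thesis by (simp add: emeasure_restrict_space)
qed

lemma finite_S3_measure: "finite_measure S3_measure"
proof
  have "emeasure lborel (ball 0 1 - {0 :: real ^ 4}) \<le> emeasure lborel (ball (0 :: real ^ 4) 1)"
    by (rule emeasure_mono) auto
  also have "\<dots> < \<infinity>" by (rule emeasure_bounded_finite) auto
  finally show "emeasure S3_measure (space S3_measure) \<noteq> \<infinity>"
    by (simp add: emeasure_S3 ennreal_mult_eq_top_iff)
qed

interpretation S3: finite_measure S3_measure by (rule finite_S3_measure)

text \<open>Lebesgue measure is determined by its values on boxes, whose preimages are images under
  the inverse rotation. This invariance is the source of the integration by parts on the
  sphere.\<close>

lemma lborel_orthogonal:
  fixes T :: "real ^ 4 \<Rightarrow> real ^ 4"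
  assumes T: "orthogonal_transformation T"
  shows "distr lborel borel T = lborel"
proof (rule lborel_eqI[symmetric])
  fix l u :: "real ^ 4"
  assume lu: "\<And>b. b \<in> Basis \<Longrightarrow> l \<bullet> b \<le> u \<bullet> b"
  have bij: "bij T" by (rule orthogonal_transformation_bij[OF T])
  have lT: "bounded_linear T"
    by (rule linear_conv_bounded_linear[THEN iffD1, OF orthogonal_transformation_linear[OF T]])
  have mT: "T \<in> borel_measurable borel"
    by (intro borel_measurable_continuous_onI linear_continuous_on lT)
  have "T -` box l u = inv T ` box l u" using bij by (simp add: bij_vimage_eq_inv_image)
  moreover have "measure lebesgue (inv T ` box l u) = measure lebesgue (box l u)"
    by (rule measure_orthogonal_image[OF orthogonal_transformation_inv[OF T]]) simp
  ultimately have m: "measure lborel (T -` box l u) = measure lborel (box l u)"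
    by (metis (no_types, lifting) measure_completion mT measurable_sets_borel open_box borel_open sets_lborel)
  have "T -` box l u \<in> sets borel" using measurable_sets_borel[OF mT borel_open[OF open_box]] .
  moreover have "emeasure lborel (T -` box l u) < \<infinity>"
  proof (rule emeasure_bounded_finite)
    have "bounded (inv T ` box l u)"
      by (rule bounded_linear_image[OF _ linear_conv_bounded_linear[THEN iffD1,
              OF orthogonal_transformation_linear[OF orthogonal_transformation_inv[OF T]]]]) simp
    then show "bounded (T -` box l u)" using bij by (simp add: bij_vimage_eq_inv_image)
  qed
  moreover have "emeasure lborel (box l u) < \<infinity>" by (rule emeasure_bounded_finite) simp
  ultimately have "emeasure lborel (T -` box l u) = emeasure lborel (box l u)"
    using m emeasure_eq_ennreal_measure[of lborel "T -` box l u"] emeasure_eq_ennreal_measure[of lborel "box l u"]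
    by (simp add: less_top)
  then show "emeasure (distr lborel borel T) (box l u) = ennreal (\<Prod>b\<in>Basis. (u - l) \<bullet> b)"
    using lu mT by (simp add: emeasure_distr emeasure_lborel_box)
qed simp

section \<open>Three orthonormal flows on the sphere\<close>

text \<open>An orthogonal map with square -1 is antisymmetric, hence cos \<theta> + sin \<theta> A =
  exp(\<theta> A) is a one-parameter group of rotations whose orbits on the sphere are great
  circles. Such flows replace charts in the treatment of the Laplacian.\<close>

definition cstruct :: "(real ^ 4 \<Rightarrow> real ^ 4) \<Rightarrow> bool"
  where "cstruct A \<longleftrightarrow> orthogonal_transformation A \<and> (\<forall>y. A (A y) = - y)"

definition rot :: "(real ^ 4 \<Rightarrow> real ^ 4) \<Rightarrow> real \<Rightarrow> real ^ 4 \<Rightarrow> real ^ 4"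
  where "rot A \<theta> y = cos \<theta> *\<^sub>R y + sin \<theta> *\<^sub>R A y"

definition rotS :: "(real ^ 4 \<Rightarrow> real ^ 4) \<Rightarrow> real \<Rightarrow> S3 \<Rightarrow> S3"
  where "rotS A \<theta> x = Abs_S3 (rot A \<theta> (Rep_S3 x))"

lemma cstructD:
  assumes "cstruct A"
  shows "linear A" "A (A y) = - y" "A v \<bullet> A w = v \<bullet> w" "A v \<bullet> w = - (v \<bullet> A w)"
proof -
  show 1: "linear A" "A (A y) = - y" "A v \<bullet> A w = v \<bullet> w" for y v w
    using assms unfolding cstruct_def orthogonal_transformation_def by auto
  show "A v \<bullet> w = - (v \<bullet> A w)"
    using 1(3)[of "A v" w] by (simp add: 1(2))
qed

lemma orthogonal_rot:
  assumes A: "cstruct A"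
  shows "orthogonal_transformation (rot A \<theta>)"
  unfolding orthogonal_transformation_def
proof (intro conjI allI)
  show "linear (rot A \<theta>)"
    by (rule linearI) (simp_all add: rot_def linear_add[OF cstructD(1)[OF A]] linear_scale[OF cstructD(1)[OF A]] algebra_simps)
  fix v w
  have "rot A \<theta> v \<bullet> rot A \<theta> w = cos \<theta> * (cos \<theta> * (v \<bullet> w)) + sin \<theta> * (sin \<theta> * (v \<bullet> w))"
    unfolding rot_def
    by (simp add: inner_add_left inner_add_right cstructD(3)[OF A, of v w] cstructD(4)[OF A, of v w]
        algebra_simps)
  also have "\<dots> = ((cos \<theta>)\<^sup>2 + (sin \<theta>)\<^sup>2) * (v \<bullet> w)"
    by (simp only: power2_eq_square distrib_right mult.assoc)
  finally show "rot A \<theta> v \<bullet> rot A \<theta> w = v \<bullet> w" by simp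
qed

lemma Rep_rotS: "cstruct A \<Longrightarrow> Rep_S3 (rotS A \<theta> x) = rot A \<theta> (Rep_S3 x)"
  unfolding rotS_def
  by (rule Abs_S3_inverse) (simp add: orthogonal_transformation_norm[OF orthogonal_rot])

lemma rotS_0 [simp]: "rotS A 0 x = x"
  by (simp add: rotS_def rot_def Rep_S3_inverse)

lemma radial_proj_rot:
  assumes A: "cstruct A" and y: "y \<noteq> 0"
  shows "radial_proj (rot A \<theta> y) = rotS A \<theta> (radial_proj y)"
proof -
  have "linear (rot A \<theta>)" "norm (rot A \<theta> y) = norm y"
    using orthogonal_rot[OF A, of \<theta>]
    by (auto simp: orthogonal_transformation_norm orthogonal_transformation_linear)
  then show ?thesis
    by (simp add: radial_proj_def[of "rot A \<theta> y"] rotS_def Rep_radial_proj[OF y] linear_scale)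
qed

lemma continuous_on_rotS: "cstruct A \<Longrightarrow> continuous_on UNIV (rotS A \<theta>)"
proof -
  assume A: "cstruct A"
  have "bounded_linear (rot A \<theta>)"
    by (rule linear_conv_bounded_linear[THEN iffD1, OF orthogonal_transformation_linear[OF orthogonal_rot[OF A]]])
  then have "continuous_on UNIV (\<lambda>x. rot A \<theta> (Rep_S3 x))"
    by (rule bounded_linear.continuous_on[OF _ continuous_on_Rep_S3])
  then show ?thesis unfolding continuous_on_iff by (simp add: dist_S3_def Rep_rotS[OF A])
qed

lemma distr_rotS:
  assumes A: "cstruct A"
  shows "distr S3_measure borel (rotS A \<theta>) = S3_measure"
proof (rule measure_eqI)
  fix X assume "X \<in> sets (distr S3_measure borel (rotS A \<theta>))"
  then have X: "X \<in> sets borel" by simp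
  have m: "rotS A \<theta> \<in> borel_measurable borel"
    by (intro borel_measurable_continuous_onI continuous_on_rotS A)
  have mR: "rot A \<theta> \<in> borel_measurable borel"
    by (rule borel_measurable_continuous_onI[OF linear_continuous_on[OF linear_conv_bounded_linear[THEN iffD1,
            OF orthogonal_transformation_linear[OF orthogonal_rot[OF A]]]]])
  have meas: "radial_proj -` X \<inter> (ball 0 1 - {0}) \<in> sets borel"
    using measurable_sets[OF measurable_radial_proj X] by (auto simp: space_restrict_space sets_restrict_space)
  have inj: "rot A \<theta> y = 0 \<longleftrightarrow> y = 0" for y
    using orthogonal_transformation_norm[OF orthogonal_rot[OF A], of \<theta> y] by (metis norm_eq_zero)
  have "radial_proj -` (rotS A \<theta> -` X) \<inter> (ball 0 1 - {0}) = rot A \<theta> -` (radial_proj -` X \<inter> (ball 0 1 - {0}))"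
    by (auto simp: radial_proj_rot[OF A] inj orthogonal_transformation_norm[OF orthogonal_rot[OF A]])
  then have "emeasure (distr S3_measure borel (rotS A \<theta>)) X =
      4 * emeasure (distr lborel borel (rot A \<theta>)) (radial_proj -` X \<inter> (ball 0 1 - {0}))"
    using X meas m mR measurable_sets_borel[OF m X]
    by (subst emeasure_distr) (auto simp: emeasure_S3 emeasure_distr)
  then show "emeasure (distr S3_measure borel (rotS A \<theta>)) X = emeasure S3_measure X"
    by (simp add: lborel_orthogonal[OF orthogonal_rot[OF A]] emeasure_S3[OF X])
qed simp

lemma integral_rotS:
  fixes f :: "S3 \<Rightarrow> complex"
  assumes "cstruct A" "f \<in> borel_measurable borel"
  shows "(LINT x|S3_measure. f (rotS A \<theta> x)) = (LINT x|S3_measure. f x)"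
proof -
  have m: "rotS A \<theta> \<in> borel_measurable borel"
    by (intro borel_measurable_continuous_onI continuous_on_rotS assms)
  have "(LINT x|distr S3_measure borel (rotS A \<theta>). f x) = (LINT x|S3_measure. f (rotS A \<theta> x))"
    by (rule integral_distr) (use m assms in auto)
  then show ?thesis by (simp add: distr_rotS[OF assms(1)])
qed

lemma continuous_S3_bounded:
  fixes f :: "S3 \<Rightarrow> 'b::real_normed_vector"
  assumes "continuous_on UNIV f"
  obtains B where "0 < B" "\<And>x. norm (f x) \<le> B"
proof -
  have "bounded (range f)" using compact_continuous_image[OF assms compact_S3] compact_imp_bounded by blast
  then show ?thesis using that unfolding bounded_pos by auto
qed

lemma integrable_continuous_S3:
  fixes f :: "S3 \<Rightarrow> 'b::{banach, second_countable_topology}"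
  assumes "continuous_on UNIV f"
  shows "integrable S3_measure f"
proof -
  obtain B where B: "\<And>x. norm (f x) \<le> B" using continuous_S3_bounded[OF assms] by blast
  show ?thesis
    by (rule S3.integrable_const_bound[where B = B])
       (use B borel_measurable_continuous_onI[OF assms] in auto)
qed

text \<open>The divergence theorem in the form used here. The flow preserves the measure, so the
  difference quotients of \<open>F\<close> along it have integral 0; they converge to
  \<open>G\<close> and are dominated by the supremum of |G|.\<close>

lemma integral_flow_derivative:
  fixes F G :: "S3 \<Rightarrow> complex"
  assumes A: "cstruct A" and F: "continuous_on UNIV F" and G: "continuous_on UNIV G"
    and der: "\<And>x \<theta>. ((\<lambda>\<theta>. F (rotS A \<theta> x)) has_vector_derivative G (rotS A \<theta> x)) (at \<theta>)"
  shows "(LINT x|S3_measure. G x) = 0"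
proof -
  obtain B where B: "0 < B" "\<And>x. norm (G x) \<le> B" using continuous_S3_bounded[OF G] by blast
  have lip: "norm (F (rotS A h x) - F x) \<le> B * \<bar>h\<bar>" for h x
  proof -
    have "norm (F (rotS A h x) - F (rotS A 0 x)) \<le> B * norm (h - 0)"
    proof (rule differentiable_bound)
      fix \<theta> :: real
      show "((\<lambda>\<theta>. F (rotS A \<theta> x)) has_derivative (\<lambda>h. h *\<^sub>R G (rotS A \<theta> x))) (at \<theta> within UNIV)"
        using der[of x \<theta>] by (simp add: has_vector_derivative_def)
      show "onorm (\<lambda>h. h *\<^sub>R G (rotS A \<theta> x)) \<le> B"
        by (rule onorm_le) (simp add: mult.commute[of B] mult_left_mono B(2))
    qed auto
    then show ?thesis by simp
  qed
  define h where "h n = inverse (real (Suc n))" for n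
  have h: "h n > 0" "h \<longlonglongrightarrow> 0" for n
    unfolding h_def by (simp, rule LIMSEQ_inverse_real_of_nat)
  have hn: "h n \<noteq> 0" for n using h(1)[of n] by simp
  have mF: "F \<in> borel_measurable borel" "G \<in> borel_measurable borel"
    by (intro borel_measurable_continuous_onI F G)+
  have mR: "rotS A \<theta> \<in> borel_measurable borel" for \<theta>
    by (intro borel_measurable_continuous_onI continuous_on_rotS A)
  have cFR: "continuous_on UNIV (\<lambda>x. F (rotS A \<theta> x))" for \<theta>
    by (rule continuous_on_compose2[OF F continuous_on_rotS[OF A]]) auto
  have lim: "(\<lambda>n. LINT x|S3_measure. (F (rotS A (h n) x) - F x) /\<^sub>R h n) \<longlonglongrightarrow> (LINT x|S3_measure. G x)"
  proof (rule integral_dominated_convergence[where w = "\<lambda>_. B"])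
    show "integrable S3_measure (\<lambda>_. B)" by simp
    show "AE x in S3_measure. (\<lambda>n. (F (rotS A (h n) x) - F x) /\<^sub>R h n) \<longlonglongrightarrow> G x"
    proof (rule AE_I2)
      fix x
      have "((\<lambda>t. (F (rotS A t x) - F x) /\<^sub>R t) \<longlongrightarrow> G x) (at 0)"
      proof -
        have "((\<lambda>t. norm (F (rotS A t x) - F x - t *\<^sub>R G x) / norm t) \<longlongrightarrow> 0) (at 0)"
          using der[of x 0] by (simp add: has_vector_derivative_def has_derivative_at)
        moreover have "\<forall>\<^sub>F t in at 0. norm (F (rotS A t x) - F x - t *\<^sub>R G x) / norm t =
            norm ((F (rotS A t x) - F x) /\<^sub>R t - G x)"
          unfolding eventually_at_filter
        proof (intro always_eventually allI impI)
          fix t :: real assume "t \<noteq> 0"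
          then have "(F (rotS A t x) - F x) /\<^sub>R t - G x = (F (rotS A t x) - F x - t *\<^sub>R G x) /\<^sub>R t"
            by (simp add: scaleR_diff_right)
          then show "norm (F (rotS A t x) - F x - t *\<^sub>R G x) / norm t = norm ((F (rotS A t x) - F x) /\<^sub>R t - G x)"
            by (simp add: divide_inverse mult.commute)
        qed
        ultimately have "((\<lambda>t. norm ((F (rotS A t x) - F x) /\<^sub>R t - G x)) \<longlongrightarrow> 0) (at 0)"
          by (rule Lim_transform_eventually)
        then show ?thesis by (simp only: tendsto_norm_zero_iff Lim_null[symmetric])
      qed
      moreover have "filterlim h (at 0) sequentially"
        using h(2) hn by (simp add: filterlim_at)
      ultimately show "(\<lambda>n. (F (rotS A (h n) x) - F x) /\<^sub>R h n) \<longlonglongrightarrow> G x"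
        by (rule filterlim_compose)
    qed
    show "AE x in S3_measure. norm ((F (rotS A (h n) x) - F x) /\<^sub>R h n) \<le> B" for n
    proof (rule AE_I2)
      fix x
      have "norm ((F (rotS A (h n) x) - F x) /\<^sub>R h n) = norm (F (rotS A (h n) x) - F x) / h n"
        unfolding norm_scaleR using h(1)[of n] by (simp add: divide_inverse)
      also have "\<dots> \<le> B" using lip[of "h n" x] h(1)[of n] by (simp add: pos_divide_le_eq)
      finally show "norm ((F (rotS A (h n) x) - F x) /\<^sub>R h n) \<le> B" .
    qed
  qed (use mF mR in \<open>auto intro!: borel_measurable_scaleR borel_measurable_diff measurable_compose[OF mR]\<close>)
  have "(LINT x|S3_measure. (F (rotS A (h n) x) - F x) /\<^sub>R h n) = 0" for n
    using integral_rotS[OF A mF(1)]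
    by (simp add: Bochner_Integration.integral_diff integrable_continuous_S3 F cFR)
  with lim show ?thesis by (simp only: LIMSEQ_const_iff)
qed

lemma linear_Basis_expansion:
  fixes v :: "'a::euclidean_space"
  assumes "linear g"
  shows "g v = (\<Sum>b\<in>Basis. (v \<bullet> b) *\<^sub>R g b)"
proof -
  have "g v = g (\<Sum>b\<in>Basis. (v \<bullet> b) *\<^sub>R b)" by (simp add: euclidean_representation)
  then show ?thesis by (simp add: linear_sum[OF assms] linear_scale[OF assms])
qed

section \<open>Derivatives of the radially constant extension along the flows\<close>

definition D1 :: "(S3 \<Rightarrow> complex) \<Rightarrow> real ^ 4 \<Rightarrow> real ^ 4 \<Rightarrow> complex"
  where "D1 f b y = frechet_derivative (\<lambda>y. f (radial_proj y)) (at y) b"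

definition D2 :: "(S3 \<Rightarrow> complex) \<Rightarrow> real ^ 4 \<Rightarrow> real ^ 4 \<Rightarrow> real ^ 4 \<Rightarrow> complex"
  where "D2 f b b' y = frechet_derivative (D1 f b) (at y) b'"

definition hess :: "(S3 \<Rightarrow> complex) \<Rightarrow> real ^ 4 \<Rightarrow> real ^ 4 \<Rightarrow> complex"
  where "hess f y v = (\<Sum>b\<in>Basis. \<Sum>b'\<in>Basis. ((v \<bullet> b) * (v \<bullet> b')) *\<^sub>R D2 f b b' y)"

definition X1 :: "(real ^ 4 \<Rightarrow> real ^ 4) \<Rightarrow> (S3 \<Rightarrow> complex) \<Rightarrow> S3 \<Rightarrow> complex"
  where "X1 A f x = (\<Sum>b\<in>Basis. (A (Rep_S3 x) \<bullet> b) *\<^sub>R D1 f b (Rep_S3 x))"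

definition X2 :: "(real ^ 4 \<Rightarrow> real ^ 4) \<Rightarrow> (S3 \<Rightarrow> complex) \<Rightarrow> S3 \<Rightarrow> complex"
  where "X2 A f x = hess f (Rep_S3 x) (A (Rep_S3 x))"

context
  fixes f :: "S3 \<Rightarrow> complex"
  assumes f: "smooth_S3 f"
begin

lemma has_derivative_ext:
  assumes "y \<noteq> 0"
  shows "((\<lambda>y. f (radial_proj y)) has_derivative (\<lambda>h. \<Sum>b\<in>Basis. (h \<bullet> b) *\<^sub>R D1 f b y)) (at y)"
proof -
  have "Ck_on (Suc 0) (- {0}) (\<lambda>y. f (radial_proj y))"
    using f unfolding smooth_S3_def smooth_on_def by blast
  then have d: "((\<lambda>y. f (radial_proj y)) has_derivative
      frechet_derivative (\<lambda>y. f (radial_proj y)) (at y)) (at y)"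
    by (rule Ck_on_has_derivative) (use assms in auto)
  have "frechet_derivative (\<lambda>y. f (radial_proj y)) (at y) h = (\<Sum>b\<in>Basis. (h \<bullet> b) *\<^sub>R D1 f b y)" for h
    unfolding D1_def by (rule linear_Basis_expansion[OF has_derivative_linear[OF d]])
  then have "frechet_derivative (\<lambda>y. f (radial_proj y)) (at y) = (\<lambda>h. \<Sum>b\<in>Basis. (h \<bullet> b) *\<^sub>R D1 f b y)"
    by auto
  with d show ?thesis by simp
qed

lemma has_derivative_D1:
  assumes "y \<noteq> 0" "b \<in> Basis"
  shows "(D1 f b has_derivative (\<lambda>h. \<Sum>b'\<in>Basis. (h \<bullet> b') *\<^sub>R D2 f b b' y)) (at y)"
proof -
  have "Ck_on (Suc (Suc 0)) (- {0}) (\<lambda>y. f (radial_proj y))"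
    using f unfolding smooth_S3_def smooth_on_def by blast
  then have "Ck_on (Suc 0) (- {0}) (D1 f b)" using assms(2) by (simp add: D1_def[abs_def])
  then have d: "(D1 f b has_derivative frechet_derivative (D1 f b) (at y)) (at y)"
    by (rule Ck_on_has_derivative) (use assms in auto)
  have "frechet_derivative (D1 f b) (at y) h = (\<Sum>b'\<in>Basis. (h \<bullet> b') *\<^sub>R D2 f b b' y)" for h
    unfolding D2_def by (rule linear_Basis_expansion[OF has_derivative_linear[OF d]])
  then have "frechet_derivative (D1 f b) (at y) = (\<lambda>h. \<Sum>b'\<in>Basis. (h \<bullet> b') *\<^sub>R D2 f b b' y)" by auto
  with d show ?thesis by simp
qed

lemma continuous_on_D1: "b \<in> Basis \<Longrightarrow> continuous_on (- {0}) (D1 f b)"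
  and continuous_on_D2: "b \<in> Basis \<Longrightarrow> b' \<in> Basis \<Longrightarrow> continuous_on (- {0}) (D2 f b b')"
proof -
  have "Ck_on (Suc (Suc 0)) (- {0}) (\<lambda>y. f (radial_proj y))"
    using f unfolding smooth_S3_def smooth_on_def by blast
  then have *: "Ck_on (Suc 0) (- {0}) (D1 f b)" if "b \<in> Basis" for b using that by (simp add: D1_def[abs_def])
  show "continuous_on (- {0}) (D1 f b)" if "b \<in> Basis" by (rule Ck_on_continuous[OF *[OF that]])
  show "continuous_on (- {0}) (D2 f b b')" if "b \<in> Basis" "b' \<in> Basis"
    using *[OF that(1)] that by (simp add: D2_def[abs_def])
qed

lemma radial_D1:
  assumes "y \<noteq> 0"
  shows "(\<Sum>b\<in>Basis. (y \<bullet> b) *\<^sub>R D1 f b y) = 0"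
proof -
  have 1: "((\<lambda>t. t *\<^sub>R y) has_derivative (\<lambda>h. h *\<^sub>R y)) (at 1)"
    by (auto intro!: derivative_eq_intros)
  have 2: "((\<lambda>y. f (radial_proj y)) has_derivative (\<lambda>h. \<Sum>b\<in>Basis. (h \<bullet> b) *\<^sub>R D1 f b y)) (at (1 *\<^sub>R y))"
    using has_derivative_ext[OF assms] by simp
  note has_derivative_compose[OF 1 2]
  moreover have "((\<lambda>t. f (radial_proj (t *\<^sub>R y))) has_derivative (\<lambda>h. 0)) (at 1)"
    by (rule has_derivative_transform_within_open[of "\<lambda>t. f (radial_proj y)" _ _ _ "{0<..}"])
       (auto simp: radial_proj_scale)
  ultimately have "(\<lambda>h. \<Sum>b\<in>Basis. ((h *\<^sub>R y) \<bullet> b) *\<^sub>R D1 f b y) = (\<lambda>h. 0)"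
    by (rule has_derivative_unique)
  from fun_cong[OF this, of 1] show ?thesis by simp
qed

text \<open>Euler's relation \<open>radial_D1\<close>, divided by t at the points t y of a ray, is
  differentiated in t at t = 1.\<close>

lemma radial_hess:
  assumes "y \<noteq> 0"
  shows "hess f y y = 0"
proof -
  have "((\<lambda>t. t *\<^sub>R y) has_derivative (\<lambda>h. h *\<^sub>R y)) (at 1)"
    by (auto intro!: derivative_eq_intros)
  note 1 = this
  have 2: "(D1 f b has_derivative (\<lambda>h. \<Sum>b'\<in>Basis. (h \<bullet> b') *\<^sub>R D2 f b b' y)) (at (1 *\<^sub>R y))"
    if "b \<in> Basis" for b
    using has_derivative_D1[OF assms that] by simp
  have "((\<lambda>t. \<Sum>b\<in>Basis. (y \<bullet> b) *\<^sub>R D1 f b (t *\<^sub>R y)) has_derivative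
     (\<lambda>h. \<Sum>b\<in>Basis. (y \<bullet> b) *\<^sub>R (\<Sum>b'\<in>Basis. ((h *\<^sub>R y) \<bullet> b') *\<^sub>R D2 f b b' y))) (at 1)"
    by (rule has_derivative_sum, rule has_derivative_scaleR_right, rule has_derivative_compose[OF 1 2])
  moreover have "((\<lambda>t. \<Sum>b\<in>Basis. (y \<bullet> b) *\<^sub>R D1 f b (t *\<^sub>R y)) has_derivative (\<lambda>h. 0)) (at 1)"
  proof (rule has_derivative_transform_within_open[of "\<lambda>t. 0" _ _ _ "{0<..}"])
    fix t :: real assume "t \<in> {0<..}"
    then have "(\<Sum>b\<in>Basis. ((t *\<^sub>R y) \<bullet> b) *\<^sub>R D1 f b (t *\<^sub>R y)) = 0" "t > 0"
      using radial_D1[of "t *\<^sub>R y"] assms by auto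
    then have "t *\<^sub>R (\<Sum>b\<in>Basis. (y \<bullet> b) *\<^sub>R D1 f b (t *\<^sub>R y)) = 0"
      by (simp add: scaleR_sum_right)
    then show "0 = (\<Sum>b\<in>Basis. (y \<bullet> b) *\<^sub>R D1 f b (t *\<^sub>R y))" using \<open>t > 0\<close> by simp
  qed auto
  ultimately have "(\<lambda>h. \<Sum>b\<in>Basis. (y \<bullet> b) *\<^sub>R (\<Sum>b'\<in>Basis. ((h *\<^sub>R y) \<bullet> b') *\<^sub>R D2 f b b' y)) = (\<lambda>h. 0)"
    by (rule has_derivative_unique)
  from fun_cong[OF this, of 1] show ?thesis by (simp add: hess_def scaleR_sum_right)
qed

lemma has_vector_derivative_rot:
  "cstruct A \<Longrightarrow> ((\<lambda>\<theta>. rot A \<theta> y) has_vector_derivative A (rot A \<theta> y)) (at \<theta>)"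
  unfolding rot_def
  by (auto intro!: derivative_eq_intros simp: linear_add[OF cstructD(1)] linear_scale[OF cstructD(1)] cstructD(2))

lemma rot_nz: "cstruct A \<Longrightarrow> rot A \<theta> (Rep_S3 x) \<noteq> 0"
  by (metis Rep_S3_nz Rep_rotS)

lemma flow_derivative:
  assumes A: "cstruct A"
  shows "((\<lambda>\<theta>. f (rotS A \<theta> x)) has_vector_derivative X1 A f (rotS A \<theta> x)) (at \<theta>)"
proof -
  let ?y = "rot A \<theta> (Rep_S3 x)"
  have "((\<lambda>\<theta>. f (radial_proj (rot A \<theta> (Rep_S3 x)))) has_derivative
      (\<lambda>h. \<Sum>b\<in>Basis. ((h *\<^sub>R A ?y) \<bullet> b) *\<^sub>R D1 f b ?y)) (at \<theta>)"
    using has_vector_derivative_rot[OF A, of "Rep_S3 x" \<theta>] has_derivative_ext[OF rot_nz[OF A, of \<theta> x]]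
    unfolding has_vector_derivative_def by (rule has_derivative_compose)
  then show ?thesis
    by (simp add: has_vector_derivative_def X1_def Rep_rotS[OF A] radial_proj_rot[OF A] scaleR_sum_right)
qed

text \<open>The curve has acceleration A A y = - y. Its contribution is a radial first derivative of
  the extension and vanishes, so the second derivative along the flow is purely the Hessian.\<close>

lemma flow_derivative2:
  assumes A: "cstruct A"
  shows "((\<lambda>\<theta>. X1 A f (rotS A \<theta> x)) has_vector_derivative X2 A f (rotS A \<theta> x)) (at \<theta>)"
proof -
  let ?c = "\<lambda>\<theta>. rot A \<theta> (Rep_S3 x)"
  let ?y = "?c \<theta>"
  have lA: "bounded_linear A" by (rule linear_conv_bounded_linear[THEN iffD1, OF cstructD(1)[OF A]])
  have c: "(?c has_derivative (\<lambda>h. h *\<^sub>R A ?y)) (at \<theta>)"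
    using has_vector_derivative_rot[OF A, of "Rep_S3 x" \<theta>] by (simp add: has_vector_derivative_def)
  have Ac: "((\<lambda>\<theta>. A (?c \<theta>) \<bullet> b) has_derivative (\<lambda>h. A (h *\<^sub>R A ?y) \<bullet> b)) (at \<theta>)" for b
    by (intro has_derivative_inner_left bounded_linear.has_derivative[OF lA] c)
  have "((\<lambda>\<theta>. \<Sum>b\<in>Basis. (A (?c \<theta>) \<bullet> b) *\<^sub>R D1 f b (?c \<theta>)) has_derivative
      (\<lambda>h. \<Sum>b\<in>Basis. (A ?y \<bullet> b) *\<^sub>R (\<Sum>b'\<in>Basis. ((h *\<^sub>R A ?y) \<bullet> b') *\<^sub>R D2 f b b' ?y)
        + (A (h *\<^sub>R A ?y) \<bullet> b) *\<^sub>R D1 f b ?y)) (at \<theta>)"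
    by (intro has_derivative_sum has_derivative_scaleR Ac
        has_derivative_compose[OF c has_derivative_D1[OF rot_nz[OF A]]])
  moreover have "(\<Sum>b\<in>Basis. (A ?y \<bullet> b) *\<^sub>R (\<Sum>b'\<in>Basis. ((h *\<^sub>R A ?y) \<bullet> b') *\<^sub>R D2 f b b' ?y)
        + (A (h *\<^sub>R A ?y) \<bullet> b) *\<^sub>R D1 f b ?y) = h *\<^sub>R hess f ?y (A ?y)" for h
  proof -
    have "(\<Sum>b\<in>Basis. (A (h *\<^sub>R A ?y) \<bullet> b) *\<^sub>R D1 f b ?y) = - h *\<^sub>R (\<Sum>b\<in>Basis. (?y \<bullet> b) *\<^sub>R D1 f b ?y)"
      by (simp add: linear_scale[OF cstructD(1)[OF A]] cstructD(2)[OF A] scaleR_sum_right sum_negf)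
    then show ?thesis
      by (simp add: sum.distrib radial_D1[OF rot_nz[OF A]] hess_def scaleR_sum_right mult.left_commute mult.commute)
  qed
  ultimately show ?thesis
    by (simp add: has_vector_derivative_def X1_def X2_def Rep_rotS[OF A])
qed

lemma continuous_on_X1:
  assumes "cstruct A"
  shows "continuous_on UNIV (X1 A f)"
proof -
  have lA: "bounded_linear A" by (rule linear_conv_bounded_linear[THEN iffD1, OF cstructD(1)[OF assms]])
  have 1: "continuous_on UNIV (\<lambda>x. A (Rep_S3 x))"
    by (rule bounded_linear.continuous_on[OF lA continuous_on_Rep_S3])
  have 2: "continuous_on UNIV (\<lambda>x. D1 f b (Rep_S3 x))" if "b \<in> Basis" for b
    by (rule continuous_on_compose2[OF continuous_on_D1[OF that] continuous_on_Rep_S3]) auto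
  show ?thesis
    unfolding X1_def[abs_def]
    by (intro continuous_on_sum continuous_on_scaleR continuous_on_inner continuous_on_const 1 2)
qed

lemma continuous_on_X2:
  assumes "cstruct A"
  shows "continuous_on UNIV (X2 A f)"
proof -
  have lA: "bounded_linear A" by (rule linear_conv_bounded_linear[THEN iffD1, OF cstructD(1)[OF assms]])
  have 1: "continuous_on UNIV (\<lambda>x. A (Rep_S3 x))"
    by (rule bounded_linear.continuous_on[OF lA continuous_on_Rep_S3])
  have 2: "continuous_on UNIV (\<lambda>x. D2 f b b' (Rep_S3 x))" if "b \<in> Basis" "b' \<in> Basis" for b b'
    by (rule continuous_on_compose2[OF continuous_on_D2[OF that] continuous_on_Rep_S3]) auto
  show ?thesis
    unfolding X2_def[abs_def] hess_def
    by (intro continuous_on_sum continuous_on_scaleR continuous_on_mult continuous_on_inner continuous_on_const 1 2)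
qed

end

lemma vector_4 [simp]:
  "(vector [a, b, c, d] :: 'a::zero ^ 4) $ 1 = a" "(vector [a, b, c, d] :: 'a ^ 4) $ 2 = b"
  "(vector [a, b, c, d] :: 'a ^ 4) $ 3 = c" "(vector [a, b, c, d] :: 'a ^ 4) $ 4 = d"
  unfolding vector_def by simp_all

text \<open>Right multiplication of the quaternion y1 + y2 i + y3 j + y4 k by i, j and k. For a unit
  vector y the vectors y, fI y, fJ y, fK y form an orthonormal basis.\<close>

definition fI :: "real ^ 4 \<Rightarrow> real ^ 4" where "fI y = vector [- (y $ 2), y $ 1, y $ 4, - (y $ 3)]"
definition fJ :: "real ^ 4 \<Rightarrow> real ^ 4" where "fJ y = vector [- (y $ 3), - (y $ 4), y $ 1, y $ 2]"
definition fK :: "real ^ 4 \<Rightarrow> real ^ 4" where "fK y = vector [- (y $ 4), y $ 3, - (y $ 2), y $ 1]"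

lemma cstruct_frame: "cstruct fI" "cstruct fJ" "cstruct fK"
  unfolding cstruct_def orthogonal_transformation_def
  by (auto intro!: linearI simp: fI_def fJ_def fK_def vec_eq_iff forall_4 inner_vec_def sum_4 algebra_simps)

lemma sum_Basis_4: "(\<Sum>b\<in>(Basis :: (real ^ 4) set). g b) = (\<Sum>i\<in>UNIV. g (axis i 1))"
proof -
  have 1: "(Basis :: (real ^ 4) set) = range (\<lambda>i. axis i 1)" by (auto simp: Basis_vec_def)
  have 2: "inj (\<lambda>i :: 4. axis i (1 :: real))" by (auto simp: inj_on_def axis_eq_axis)
  show ?thesis unfolding 1 by (simp add: sum.reindex[OF 2])
qed

text \<open>The Euclidean Laplacian is the trace of the Hessian, evaluated in the orthonormal basis
  y, fI y, fJ y, fK y; the direction y contributes nothing by \<open>radial_hess\<close>.\<close>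

lemma laplace_beltrami_frame:
  assumes "smooth_S3 f"
  shows "laplace_beltrami f x = X2 fI f x + X2 fJ f x + X2 fK f x"
proof -
  let ?y = "Rep_S3 x"
  let ?D = "\<lambda>i j :: 4. D2 f (axis i 1) (axis j 1) ?y"
  have hess: "hess f ?y v = (\<Sum>i\<in>UNIV. \<Sum>j\<in>UNIV. (v $ i * v $ j) *\<^sub>R ?D i j)" for v
    unfolding hess_def sum_Basis_4 by (simp add: inner_axis)
  have "(norm ?y)\<^sup>2 = 1" by simp
  then have n: "(?y $ 1)\<^sup>2 + (?y $ 2)\<^sup>2 + (?y $ 3)\<^sup>2 + (?y $ 4)\<^sup>2 = 1"
    by (simp add: norm_eq_sqrt_inner inner_vec_def sum_4 power2_eq_square)
  have coef: "?y $ i * ?y $ j + fI ?y $ i * fI ?y $ j + fJ ?y $ i * fJ ?y $ j + fK ?y $ i * fK ?y $ j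
      = (if i = j then 1 else 0)" for i j
  proof -
    have "\<forall>i j. ?y $ i * ?y $ j + fI ?y $ i * fI ?y $ j + fJ ?y $ i * fJ ?y $ j + fK ?y $ i * fK ?y $ j
      = (if i = j then 1 else 0)"
      unfolding forall_4 fI_def fJ_def fK_def using n by (simp add: power2_eq_square algebra_simps)
    then show ?thesis by blast
  qed
  have "X2 fI f x + X2 fJ f x + X2 fK f x = hess f ?y ?y + hess f ?y (fI ?y) + hess f ?y (fJ ?y) + hess f ?y (fK ?y)"
    using radial_hess[OF assms, of ?y] by (simp add: X2_def)
  also have "\<dots> = (\<Sum>i\<in>UNIV. \<Sum>j\<in>UNIV. (?y $ i * ?y $ j + fI ?y $ i * fI ?y $ j + fJ ?y $ i * fJ ?y $ j
      + fK ?y $ i * fK ?y $ j) *\<^sub>R ?D i j)"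
    unfolding hess by (simp add: sum.distrib scaleR_add_left)
  also have "\<dots> = (\<Sum>i\<in>UNIV. ?D i i)"
    unfolding coef by (simp add: if_distrib[of "\<lambda>c. c *\<^sub>R _"] sum.delta cong: if_cong)
  also have "\<dots> = laplace_beltrami f x"
    unfolding laplace_beltrami_def euclidean_laplacian_def sum_Basis_4 by (simp add: D2_def D1_def[abs_def])
  finally show ?thesis by simp
qed

lemma X1_eqI:
  assumes "smooth_S3 f" "cstruct A" "((\<lambda>\<theta>. f (rotS A \<theta> x)) has_vector_derivative d) (at \<theta>)"
  shows "X1 A f (rotS A \<theta> x) = d"
  using vector_derivative_unique_at[OF flow_derivative[OF assms(1,2)] assms(3)] .

text \<open>Reduces the computation of the Laplacian to ordinary second derivatives of f along great
  circles, without reference to the extension to the ambient space.\<close>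

lemma X2_eqI:
  assumes "smooth_S3 f" "cstruct A" "\<And>\<theta>. ((\<lambda>\<theta>. f (rotS A \<theta> x)) has_vector_derivative g \<theta>) (at \<theta>)"
    "(g has_vector_derivative d) (at 0)"
  shows "X2 A f x = d"
proof -
  have "(\<lambda>\<theta>. X1 A f (rotS A \<theta> x)) = g" using X1_eqI[OF assms(1-3)] by auto
  then show ?thesis
    using vector_derivative_unique_at[OF flow_derivative2[OF assms(1,2), of x 0]] assms(4) by simp
qed

lemma laplace_beltrami_add:
  assumes f: "smooth_S3 f" and g: "smooth_S3 g"
  shows "laplace_beltrami (\<lambda>x. f x + g x) x = laplace_beltrami f x + laplace_beltrami g x"
proof -
  have "X2 A (\<lambda>x. f x + g x) x = X2 A f x + X2 A g x" if A: "cstruct A" for A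
    by (rule X2_eqI[OF smooth_S3_add[OF f g] A
          has_vector_derivative_add[OF flow_derivative[OF f A] flow_derivative[OF g A]]])
       (use has_vector_derivative_add[OF flow_derivative2[OF f A, of x 0] flow_derivative2[OF g A, of x 0]] in simp)
  then show ?thesis
    by (simp add: laplace_beltrami_frame f g smooth_S3_add cstruct_frame)
qed

lemma laplace_beltrami_cmult:
  assumes f: "smooth_S3 f"
  shows "laplace_beltrami (\<lambda>x. c * f x) x = c * laplace_beltrami f x"
proof -
  have s: "smooth_S3 (\<lambda>x. c * f x)" by (intro smooth_S3_mult smooth_S3_const f)
  have "X2 A (\<lambda>x. c * f x) x = c * X2 A f x" if A: "cstruct A" for A
    by (rule X2_eqI[OF s A has_vector_derivative_mult_right[OF flow_derivative[OF f A]]])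
       (use has_vector_derivative_mult_right[OF flow_derivative2[OF f A, of x 0]] in simp)
  then show ?thesis
    by (simp add: laplace_beltrami_frame f s cstruct_frame distrib_left)
qed

lemma laplace_beltrami_sum:
  assumes "\<And>i. i \<in> A \<Longrightarrow> smooth_S3 (f i)"
  shows "smooth_S3 (\<lambda>x. \<Sum>i\<in>A. f i x)"
    "laplace_beltrami (\<lambda>x. \<Sum>i\<in>A. f i x) x = (\<Sum>i\<in>A. laplace_beltrami (f i) x)"
proof -
  have "smooth_S3 (\<lambda>x. \<Sum>i\<in>A. f i x) \<and>
    laplace_beltrami (\<lambda>x. \<Sum>i\<in>A. f i x) x = (\<Sum>i\<in>A. laplace_beltrami (f i) x)"
    using assms
  proof (induction A rule: infinite_finite_induct)
    case (insert i F)
    then show ?case by (simp add: smooth_S3_add laplace_beltrami_add)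
  qed (use laplace_beltrami_cmult[OF smooth_S3_const, of 0 0] in \<open>simp_all add: smooth_S3_const\<close>)
  then show "smooth_S3 (\<lambda>x. \<Sum>i\<in>A. f i x)"
    "laplace_beltrami (\<lambda>x. \<Sum>i\<in>A. f i x) x = (\<Sum>i\<in>A. laplace_beltrami (f i) x)" by auto
qed

text \<open>For each of the three flows f X X g - (X X f) g is the flow derivative of f X g - (X f)
  g, so its integral vanishes.\<close>

lemma Green:
  assumes f: "smooth_S3 f" and g: "smooth_S3 g"
  shows "(LINT x|S3_measure. f x * laplace_beltrami g x) = (LINT x|S3_measure. laplace_beltrami f x * g x)"
proof -
  note cf = smooth_S3_continuous[OF f] and cg = smooth_S3_continuous[OF g]
  have flow: "(LINT x|S3_measure. f x * X2 A g x - X2 A f x * g x) = 0" if A: "cstruct A" for A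
  proof (rule integral_flow_derivative[OF A])
    show "continuous_on UNIV (\<lambda>x. f x * X1 A g x - X1 A f x * g x)"
      "continuous_on UNIV (\<lambda>x. f x * X2 A g x - X2 A f x * g x)"
      by (intro continuous_on_diff continuous_on_mult cf cg continuous_on_X1 continuous_on_X2 f g A)+
    fix x \<theta>
    show "((\<lambda>\<theta>. f (rotS A \<theta> x) * X1 A g (rotS A \<theta> x) - X1 A f (rotS A \<theta> x) * g (rotS A \<theta> x))
        has_vector_derivative f (rotS A \<theta> x) * X2 A g (rotS A \<theta> x) - X2 A f (rotS A \<theta> x) * g (rotS A \<theta> x)) (at \<theta>)"
      by (rule has_vector_derivative_eq_rhs[OF has_vector_derivative_diff[OF
            has_vector_derivative_mult[OF flow_derivative[OF f A] flow_derivative2[OF g A]]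
            has_vector_derivative_mult[OF flow_derivative2[OF f A] flow_derivative[OF g A]]]])
         (simp add: algebra_simps)
  qed
  have i: "integrable S3_measure (\<lambda>x. f x * X2 A g x)" "integrable S3_measure (\<lambda>x. X2 A f x * g x)"
    if "cstruct A" for A
    by (intro integrable_continuous_S3 continuous_on_mult cf cg continuous_on_X2 f g that)+
  have eq: "(LINT x|S3_measure. f x * X2 A g x) = (LINT x|S3_measure. X2 A f x * g x)" if "cstruct A" for A
    using flow[OF that] by (simp add: Bochner_Integration.integral_diff i that)
  show ?thesis
    unfolding laplace_beltrami_frame[OF f] laplace_beltrami_frame[OF g] distrib_left distrib_right
    by (simp add: Bochner_Integration.integral_add Bochner_Integration.integrable_add i cstruct_frame eq)
qed

section \<open>Spherical harmonics in Hopf coordinates\<close>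

lemma z_rotS:
  "z1 (rotS fI \<theta> x) = cos (of_real \<theta>) * z1 x + sin (of_real \<theta>) * (\<i> * z1 x)"
  "z2 (rotS fI \<theta> x) = cos (of_real \<theta>) * z2 x + sin (of_real \<theta>) * (- \<i> * z2 x)"
  "z1 (rotS fJ \<theta> x) = cos (of_real \<theta>) * z1 x + sin (of_real \<theta>) * (- z2 x)"
  "z2 (rotS fJ \<theta> x) = cos (of_real \<theta>) * z2 x + sin (of_real \<theta>) * z1 x"
  "z1 (rotS fK \<theta> x) = cos (of_real \<theta>) * z1 x + sin (of_real \<theta>) * (\<i> * z2 x)"
  "z2 (rotS fK \<theta> x) = cos (of_real \<theta>) * z2 x + sin (of_real \<theta>) * (\<i> * z1 x)"
  by (simp_all add: z1_def z2_def Rep_rotS cstruct_frame rot_def fI_def fJ_def fK_def complex_eq_iff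
      cos_of_real sin_of_real)

text \<open>Leibniz' rule for three powers of curves c = cos \<theta> u + sin \<theta> u'. Each
  curve satisfies c'' = - c, which produces the subtracted terms; truncated exponents such as k - 2
  always stand beside a vanishing factor. Differentiating in complex \<theta> makes the field
  derivative rules available.\<close>

lemma monomial_second_derivative:
  fixes z z' y y' w w' :: complex
  defines "c \<equiv> \<lambda>u u' \<theta>. cos \<theta> * u + sin \<theta> * u'"
  obtains g where
    "\<And>\<theta>. ((\<lambda>\<theta>. c z z' (of_real \<theta>) ^ k * c y y' (of_real \<theta>) ^ l * c w w' (of_real \<theta>) ^ m)
        has_vector_derivative g \<theta>) (at \<theta>)"
    "(g has_vector_derivative
        (of_nat (k * (k - 1)) * z ^ (k - 2) * z'\<^sup>2 - of_nat k * z ^ (k - 1) * z) * y ^ l * w ^ m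
      + z ^ k * (of_nat (l * (l - 1)) * y ^ (l - 2) * y'\<^sup>2 - of_nat l * y ^ (l - 1) * y) * w ^ m
      + z ^ k * y ^ l * (of_nat (m * (m - 1)) * w ^ (m - 2) * w'\<^sup>2 - of_nat m * w ^ (m - 1) * w)
      + 2 * (of_nat k * z ^ (k - 1) * z') * (of_nat l * y ^ (l - 1) * y') * w ^ m
      + 2 * (of_nat k * z ^ (k - 1) * z') * y ^ l * (of_nat m * w ^ (m - 1) * w')
      + 2 * z ^ k * (of_nat l * y ^ (l - 1) * y') * (of_nat m * w ^ (m - 1) * w')) (at 0)"
proof -
  define p where "p u u' n \<theta> = c u u' \<theta> ^ n" for u u' n \<theta>
  define p1 where "p1 u u' n \<theta> = of_nat n * c u u' \<theta> ^ (n - 1) * c u' (- u) \<theta>" for u u' n \<theta>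
  define p2 where "p2 u u' n \<theta> = of_nat (n * (n - 1)) * c u u' \<theta> ^ (n - 2) * (c u' (- u) \<theta>)\<^sup>2
      - of_nat n * c u u' \<theta> ^ (n - 1) * c u u' \<theta>" for u u' n \<theta>
  have dc: "(c u u' has_field_derivative c u' (- u) \<theta>) (at \<theta>)" for u u' \<theta>
    unfolding c_def by (auto intro!: derivative_eq_intros simp: algebra_simps)
  have d1: "(p u u' n has_field_derivative p1 u u' n \<theta>) (at \<theta>)" for u u' n \<theta>
    unfolding p_def[abs_def] p1_def
    by (rule DERIV_cong[OF DERIV_power[OF dc]]) (simp add: algebra_simps)
  have cneg: "c (- u) (- u') \<theta> = - c u u' \<theta>" for u u' \<theta> by (simp add: c_def)
  have d2: "(p1 u u' n has_field_derivative p2 u u' n \<theta>) (at \<theta>)" for u u' n \<theta>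
    unfolding p1_def[abs_def] p2_def
    by (rule DERIV_cong[OF DERIV_mult[OF DERIV_cmult[OF DERIV_power[OF dc]] dc]])
       (cases n; simp add: cneg power2_eq_square algebra_simps numeral_2_eq_2)
  define g where "g \<theta> = p1 z z' k \<theta> * p y y' l \<theta> * p w w' m \<theta> + p z z' k \<theta> * p1 y y' l \<theta> * p w w' m \<theta>
      + p z z' k \<theta> * p y y' l \<theta> * p1 w w' m \<theta>" for \<theta>
  define h where "h \<theta> = p2 z z' k \<theta> * p y y' l \<theta> * p w w' m \<theta> + p z z' k \<theta> * p2 y y' l \<theta> * p w w' m \<theta>
      + p z z' k \<theta> * p y y' l \<theta> * p2 w w' m \<theta> + 2 * p1 z z' k \<theta> * p1 y y' l \<theta> * p w w' m \<theta>
      + 2 * p1 z z' k \<theta> * p y y' l \<theta> * p1 w w' m \<theta> + 2 * p z z' k \<theta> * p1 y y' l \<theta> * p1 w w' m \<theta>" for \<theta>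
  have f1: "((\<lambda>\<theta>. p z z' k \<theta> * p y y' l \<theta> * p w w' m \<theta>) has_field_derivative g \<theta>) (at \<theta>)" for \<theta>
    unfolding g_def
    by (rule DERIV_cong[OF DERIV_mult[OF DERIV_mult[OF d1 d1] d1]]) (simp add: algebra_simps)
  have f2: "(g has_field_derivative h \<theta>) (at \<theta>)" for \<theta>
    unfolding g_def[abs_def] h_def
    by (rule DERIV_cong[OF DERIV_add[OF DERIV_add[OF
          DERIV_mult[OF DERIV_mult[OF d2 d1] d1] DERIV_mult[OF DERIV_mult[OF d1 d2] d1]]
          DERIV_mult[OF DERIV_mult[OF d1 d1] d2]]]) (simp add: algebra_simps)
  have c0: "c u u' 0 = u" for u u' by (simp add: c_def)
  show thesis
  proof (rule that[of "\<lambda>\<theta>. g (of_real \<theta>)"])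
    show "((\<lambda>\<theta>. c z z' (of_real \<theta>) ^ k * c y y' (of_real \<theta>) ^ l * c w w' (of_real \<theta>) ^ m)
        has_vector_derivative g (of_real \<theta>)) (at \<theta>)" for \<theta>
      using has_vector_derivative_real_field[OF f1[of "of_real \<theta>"]] by (simp add: p_def)
    have "((\<lambda>\<theta>. g (of_real \<theta>)) has_vector_derivative h 0) (at 0)"
      using has_vector_derivative_real_field[of g "h 0" 0 UNIV] f2[of 0] by simp
    then show "((\<lambda>\<theta>. g (of_real \<theta>)) has_vector_derivative
        (of_nat (k * (k - 1)) * z ^ (k - 2) * z'\<^sup>2 - of_nat k * z ^ (k - 1) * z) * y ^ l * w ^ m
      + z ^ k * (of_nat (l * (l - 1)) * y ^ (l - 2) * y'\<^sup>2 - of_nat l * y ^ (l - 1) * y) * w ^ m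
      + z ^ k * y ^ l * (of_nat (m * (m - 1)) * w ^ (m - 2) * w'\<^sup>2 - of_nat m * w ^ (m - 1) * w)
      + 2 * (of_nat k * z ^ (k - 1) * z') * (of_nat l * y ^ (l - 1) * y') * w ^ m
      + 2 * (of_nat k * z ^ (k - 1) * z') * y ^ l * (of_nat m * w ^ (m - 1) * w')
      + 2 * z ^ k * (of_nat l * y ^ (l - 1) * y') * (of_nat m * w ^ (m - 1) * w')) (at 0)"
      unfolding h_def p_def p1_def p2_def c0 by (simp only:)
  qed
qed

lemma power_diff_mult:
  fixes z :: complex
  shows "of_nat k * z ^ (k - 1) * z = of_nat k * z ^ k" "of_nat (k * (k - 1)) * z ^ (k - 2) * z\<^sup>2 = of_nat (k * (k - 1)) * z ^ k"
    "of_nat k * z ^ (k - 1) = 0 \<or> k > 0"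
  by (cases k; simp) (cases k; cases "k - 1"; simp add: power2_eq_square)+

text \<open>With the exponent |\<mu>| this gives the phase exp(i \<mu> \<xi>) for both signs of the
  momentum, while the powers remain natural numbers.\<close>

definition hv :: "int \<Rightarrow> complex \<Rightarrow> complex" where "hv \<mu> u = (if 0 \<le> \<mu> then u else cnj u)"

lemma hv_simps:
  "hv \<mu> (a + b) = hv \<mu> a + hv \<mu> b" "hv \<mu> (a * b) = hv \<mu> a * hv \<mu> b"
  "hv \<mu> (cos (of_real \<theta>)) = cos (of_real \<theta>)" "hv \<mu> (sin (of_real \<theta>)) = sin (of_real \<theta>)"
  by (auto simp: hv_def cos_of_real sin_of_real)

text \<open>For a homogeneous polynomial of degree n in four variables the spherical Laplacian is
  the Euclidean one minus n (n + 2); the Euclidean Laplacian 4 d_u d_(cnj u) + 4 d_w d_(cnj w)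
  leaves the term with k l, as cnj w does not occur.\<close>

lemma laplace_monomial:
  fixes \<mu>1 \<mu>2 :: int
  defines "u \<equiv> \<lambda>x. hv \<mu>1 (z1 x)" and "w \<equiv> \<lambda>x. hv \<mu>2 (z2 x)"
  shows "smooth_S3 (\<lambda>x. u x ^ k * cnj (u x) ^ l * w x ^ m)"
    "laplace_beltrami (\<lambda>x. u x ^ k * cnj (u x) ^ l * w x ^ m) x =
     - of_nat ((k + l + m) * (k + l + m + 2)) * (u x ^ k * cnj (u x) ^ l * w x ^ m)
     + 4 * of_nat (k * l) * (u x ^ (k - 1) * cnj (u x) ^ (l - 1) * w x ^ m)"
proof -
  let ?f = "\<lambda>x. u x ^ k * cnj (u x) ^ l * w x ^ m"
  have "smooth_S3 u" "smooth_S3 w"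
    unfolding u_def w_def hv_def
    by (cases "0 \<le> \<mu>1"; cases "0 \<le> \<mu>2"; simp add: smooth_S3_z smooth_S3_cnj)+
  then show sm: "smooth_S3 ?f"
    by (intro smooth_S3_mult smooth_S3_power smooth_S3_cnj)
  define z y v where "z = u x" and "y = cnj (u x)" and "v = w x"
  define \<Phi> where "\<Phi> z' y' v' = (of_nat (k * (k - 1)) * z ^ (k - 2) * z'\<^sup>2 - of_nat k * z ^ (k - 1) * z) * y ^ l * v ^ m
      + z ^ k * (of_nat (l * (l - 1)) * y ^ (l - 2) * y'\<^sup>2 - of_nat l * y ^ (l - 1) * y) * v ^ m
      + z ^ k * y ^ l * (of_nat (m * (m - 1)) * v ^ (m - 2) * v'\<^sup>2 - of_nat m * v ^ (m - 1) * v)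
      + 2 * (of_nat k * z ^ (k - 1) * z') * (of_nat l * y ^ (l - 1) * y') * v ^ m
      + 2 * (of_nat k * z ^ (k - 1) * z') * y ^ l * (of_nat m * v ^ (m - 1) * v')
      + 2 * z ^ k * (of_nat l * y ^ (l - 1) * y') * (of_nat m * v ^ (m - 1) * v')" for z' y' v'
  have flow: "X2 A ?f x = \<Phi> (hv \<mu>1 a) (cnj (hv \<mu>1 a)) (hv \<mu>2 b)"
    if A: "cstruct A" and a: "\<And>\<theta>. z1 (rotS A \<theta> x) = cos (of_real \<theta>) * z1 x + sin (of_real \<theta>) * a"
      and b: "\<And>\<theta>. z2 (rotS A \<theta> x) = cos (of_real \<theta>) * z2 x + sin (of_real \<theta>) * b" for A a b
  proof -
    have e: "u (rotS A \<theta> x) = cos (of_real \<theta>) * z + sin (of_real \<theta>) * hv \<mu>1 a"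
      "w (rotS A \<theta> x) = cos (of_real \<theta>) * v + sin (of_real \<theta>) * hv \<mu>2 b" for \<theta>
      unfolding u_def w_def z_def v_def a b by (simp_all add: hv_simps)
    have e2: "cnj (u (rotS A \<theta> x)) = cos (of_real \<theta>) * y + sin (of_real \<theta>) * cnj (hv \<mu>1 a)" for \<theta>
      unfolding e by (simp add: cos_of_real sin_of_real y_def z_def)
    show ?thesis
    proof (rule monomial_second_derivative[of z "hv \<mu>1 a" k y "cnj (hv \<mu>1 a)" l v "hv \<mu>2 b" m])
      fix g :: "real \<Rightarrow> complex"
      assume g: "\<And>\<theta>. ((\<lambda>\<theta>. (cos (of_real \<theta>) * z + sin (of_real \<theta>) * hv \<mu>1 a) ^ k *
          (cos (of_real \<theta>) * y + sin (of_real \<theta>) * cnj (hv \<mu>1 a)) ^ l *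
          (cos (of_real \<theta>) * v + sin (of_real \<theta>) * hv \<mu>2 b) ^ m) has_vector_derivative g \<theta>) (at \<theta>)"
      assume g0: "(g has_vector_derivative (of_nat (k * (k - 1)) * z ^ (k - 2) * (hv \<mu>1 a)\<^sup>2 - of_nat k * z ^ (k - 1) * z) * y ^ l * v ^ m
      + z ^ k * (of_nat (l * (l - 1)) * y ^ (l - 2) * (cnj (hv \<mu>1 a))\<^sup>2 - of_nat l * y ^ (l - 1) * y) * v ^ m
      + z ^ k * y ^ l * (of_nat (m * (m - 1)) * v ^ (m - 2) * (hv \<mu>2 b)\<^sup>2 - of_nat m * v ^ (m - 1) * v)
      + 2 * (of_nat k * z ^ (k - 1) * hv \<mu>1 a) * (of_nat l * y ^ (l - 1) * cnj (hv \<mu>1 a)) * v ^ m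
      + 2 * (of_nat k * z ^ (k - 1) * hv \<mu>1 a) * y ^ l * (of_nat m * v ^ (m - 1) * hv \<mu>2 b)
      + 2 * z ^ k * (of_nat l * y ^ (l - 1) * cnj (hv \<mu>1 a)) * (of_nat m * v ^ (m - 1) * hv \<mu>2 b)) (at 0)"
      show ?thesis
        unfolding \<Phi>_def by (rule X2_eqI[OF sm A _ g0]) (unfold e2, unfold e, rule g)
    qed
  qed
  define a1 a2 a3 b1 b2 b3 where ab: "a1 = hv \<mu>1 (\<i> * z1 x)" "a2 = hv \<mu>1 (- z2 x)" "a3 = hv \<mu>1 (\<i> * z2 x)"
    "b1 = hv \<mu>2 (- \<i> * z2 x)" "b2 = hv \<mu>2 (z1 x)" "b3 = hv \<mu>2 (\<i> * z1 x)"
  have L: "laplace_beltrami ?f x = \<Phi> a1 (cnj a1) b1 + \<Phi> a2 (cnj a2) b2 + \<Phi> a3 (cnj a3) b3"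
    unfolding laplace_beltrami_frame[OF sm] ab
    by (simp only: flow[OF cstruct_frame(1) z_rotS(1,2)] flow[OF cstruct_frame(2) z_rotS(3,4)]
        flow[OF cstruct_frame(3) z_rotS(5,6)])
  have nz: "z1 x * cnj (z1 x) + z2 x * cnj (z2 x) = 1"
    using norm_z_sum[of x] by (simp add: complex_norm_square[symmetric] of_real_add[symmetric] del: of_real_add of_real_power)
  \<comment> \<open>Traces over the three tangential directions: the full trace over four directions
    is 0 for the complex bilinear pairs and 2 for u with its conjugate, and the radial direction is
    subtracted.\<close>
  have sq: "a1\<^sup>2 + a2\<^sup>2 + a3\<^sup>2 = - z\<^sup>2" "(cnj a1)\<^sup>2 + (cnj a2)\<^sup>2 + (cnj a3)\<^sup>2 = - y\<^sup>2" "b1\<^sup>2 + b2\<^sup>2 + b3\<^sup>2 = - v\<^sup>2"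
    "a1 * b1 + a2 * b2 + a3 * b3 = - z * v" "cnj a1 * b1 + cnj a2 * b2 + cnj a3 * b3 = - y * v"
    "a1 * cnj a1 + a2 * cnj a2 + a3 * cnj a3 = 2 - z * y"
    using nz unfolding ab z_def y_def v_def u_def w_def hv_def
    by (auto simp: power_mult_distrib algebra_simps)
  define U U1 U2 where "U = z ^ k" and "U1 = of_nat k * z ^ (k - 1)" and "U2 = of_nat (k * (k - 1)) * z ^ (k - 2)"
  define Y Y1 Y2 where "Y = y ^ l" and "Y1 = of_nat l * y ^ (l - 1)" and "Y2 = of_nat (l * (l - 1)) * y ^ (l - 2)"
  define V V1 V2 where "V = v ^ m" and "V1 = of_nat m * v ^ (m - 1)" and "V2 = of_nat (m * (m - 1)) * v ^ (m - 2)"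
  have ofn: "of_nat (n * (n - 1)) = (of_nat n * (of_nat n - 1) :: complex)" for n
    by (cases n) (auto simp: algebra_simps)
  have pm: "of_nat (n * (n - 1)) * q ^ (n - 2) * q\<^sup>2 = of_nat n * (of_nat n - 1) * q ^ n" for n and q :: complex
    using power_diff_mult(2)[of n q] by (simp only: ofn)
  have pw: "U1 * z = of_nat k * U" "U2 * z\<^sup>2 = of_nat k * (of_nat k - 1) * U" "Y1 * y = of_nat l * Y"
    "Y2 * y\<^sup>2 = of_nat l * (of_nat l - 1) * Y" "V1 * v = of_nat m * V" "V2 * v\<^sup>2 = of_nat m * (of_nat m - 1) * V"
    unfolding U_def U1_def U2_def Y_def Y1_def Y2_def V_def V1_def V2_def
    by (simp_all only: power_diff_mult(1) pm)
  have \<Phi>: "\<Phi> a b c = U2 * Y * V * a\<^sup>2 + U * Y2 * V * b\<^sup>2 + U * Y * V2 * c\<^sup>2 + 2 * U1 * Y1 * V * (a * b)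
      + 2 * U1 * Y * V1 * (a * c) + 2 * U * Y1 * V1 * (b * c) - (U1 * z) * Y * V - U * (Y1 * y) * V - U * Y * (V1 * v)" for a b c
    unfolding \<Phi>_def U_def U1_def U2_def Y_def Y1_def Y2_def V_def V1_def V2_def
    by (simp only: power2_eq_square) (simp add: algebra_simps)
  have "laplace_beltrami ?f x = U2 * Y * V * (a1\<^sup>2 + a2\<^sup>2 + a3\<^sup>2) + U * Y2 * V * ((cnj a1)\<^sup>2 + (cnj a2)\<^sup>2 + (cnj a3)\<^sup>2)
      + U * Y * V2 * (b1\<^sup>2 + b2\<^sup>2 + b3\<^sup>2) + 2 * U1 * Y1 * V * (a1 * cnj a1 + a2 * cnj a2 + a3 * cnj a3)
      + 2 * U1 * Y * V1 * (a1 * b1 + a2 * b2 + a3 * b3) + 2 * U * Y1 * V1 * (cnj a1 * b1 + cnj a2 * b2 + cnj a3 * b3)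
      - 3 * ((U1 * z) * Y * V + U * (Y1 * y) * V + U * Y * (V1 * v))"
    unfolding L \<Phi> by (simp add: algebra_simps)
  also have "\<dots> = - (U2 * z\<^sup>2) * Y * V - U * (Y2 * y\<^sup>2) * V - U * Y * (V2 * v\<^sup>2) + 4 * U1 * Y1 * V - 2 * (U1 * z) * (Y1 * y) * V
      - 2 * (U1 * z) * Y * (V1 * v) - 2 * U * (Y1 * y) * (V1 * v) - 3 * ((U1 * z) * Y * V + U * (Y1 * y) * V + U * Y * (V1 * v))"
    unfolding sq by (simp add: algebra_simps)
  also have "\<dots> = - of_nat ((k + l + m) * (k + l + m + 2)) * (U * Y * V) + 4 * U1 * Y1 * V"
    unfolding pw by (simp add: algebra_simps)
  finally show "laplace_beltrami ?f x = - of_nat ((k + l + m) * (k + l + m + 2)) * (u x ^ k * cnj (u x) ^ l * w x ^ m)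
     + 4 * of_nat (k * l) * (u x ^ (k - 1) * cnj (u x) ^ (l - 1) * w x ^ m)"
    by (simp add: U_def U1_def Y_def Y1_def V_def z_def y_def v_def algebra_simps)
qed

locale hopf =
  fixes \<mu>1 \<mu>2 :: int
begin

definition k1 :: nat where "k1 = nat \<bar>\<mu>1\<bar>"
definition k2 :: nat where "k2 = nat \<bar>\<mu>2\<bar>"

sublocale jacobi k1 k2 .

definition Z :: "S3 \<Rightarrow> complex" where "Z x = hv \<mu>1 (z1 x) ^ k1 * hv \<mu>2 (z2 x) ^ k2"

text \<open>In the variable t = |z1|^2, which is the squared sine of the Hopf angle, the squared
  modulus of \<open>Z\<close> becomes the Jacobi weight t^k1 (1 - t)^k2. Thus the radial profile is
  described by a polynomial on [0, 1].\<close>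

definition emode :: "real poly \<Rightarrow> S3 \<Rightarrow> complex"
  where "emode q x = Z x * of_real (poly q ((cmod (z1 x))\<^sup>2))"

definition e :: "nat \<Rightarrow> S3 \<Rightarrow> complex" where "e a = emode (P a)"

lemma emode_add: "emode (p + q) x = emode p x + emode q x"
  and emode_smult: "emode (smult c p) x = of_real c * emode p x"
  and emode_sum: "emode (\<Sum>i\<in>A. f i) x = (\<Sum>i\<in>A. emode (f i) x)"
  by (simp_all add: emode_def algebra_simps poly_sum sum_distrib_left)

lemma emode_monom:
  "emode (monom c i) x = of_real c * (hv \<mu>1 (z1 x) ^ (k1 + i) * cnj (hv \<mu>1 (z1 x)) ^ i * hv \<mu>2 (z2 x) ^ k2)"
proof -
  have "hv \<mu>1 (z1 x) * cnj (hv \<mu>1 (z1 x)) = of_real ((cmod (z1 x))\<^sup>2)"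
    by (simp add: hv_def complex_norm_square mult.commute del: of_real_power)
  then have "of_real (((cmod (z1 x))\<^sup>2) ^ i) = hv \<mu>1 (z1 x) ^ i * cnj (hv \<mu>1 (z1 x)) ^ i"
    by (simp add: power_mult_distrib[symmetric])
  then show ?thesis by (simp add: emode_def Z_def poly_monom power_add algebra_simps)
qed

definition EL :: "real poly \<Rightarrow> real poly"
  where "EL q = smult 4 (L q) - smult (real ((k1 + k2) * (k1 + k2 + 2))) q"

text \<open>By linearity only monomials matter. Since t = u cnj u, a power of t becomes a monomial
  in u, cnj u and w, and lowering both exponents in \<open>laplace_monomial\<close> lowers the power
  of t by one, as in the Jacobi operator.\<close>

lemma emode_laplace: "smooth_S3 (emode q)" "laplace_beltrami (emode q) x = emode (EL q) x"
proof -
  have mon: "smooth_S3 (emode (monom c i))" "laplace_beltrami (emode (monom c i)) x = emode (EL (monom c i)) x"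
    for c i
  proof -
    note m = laplace_monomial[of \<mu>1 "k1 + i" i \<mu>2 k2]
    have eq: "emode (monom c i) = (\<lambda>x. of_real c * (hv \<mu>1 (z1 x) ^ (k1 + i) * cnj (hv \<mu>1 (z1 x)) ^ i * hv \<mu>2 (z2 x) ^ k2))"
      for c i by (rule ext) (rule emode_monom)
    show "smooth_S3 (emode (monom c i))" unfolding eq by (intro smooth_S3_mult[OF smooth_S3_const] m(1))
    have L: "L (monom c i) = monom (- c * (real i * real (i + k1 + k2 + 1))) i + monom (c * (real i * real (i + k1))) (i - 1)"
      by (rule poly_eqI) (cases i; auto simp: coeff_L)
    have E: "EL (monom c i) = monom (- c * real ((k1 + i + i + k2) * (k1 + i + i + k2 + 2))) i
        + monom (4 * c * (real (k1 + i) * real i)) (i - 1)"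
      unfolding EL_def L by (rule poly_eqI) (auto simp: algebra_simps)
    show "laplace_beltrami (emode (monom c i)) x = emode (EL (monom c i)) x"
      unfolding E emode_add emode_monom unfolding eq laplace_beltrami_cmult[OF m(1)] m(2)
      by (cases i) (simp_all add: algebra_simps)
  qed
  have q: "q = (\<Sum>i\<le>degree q. monom (coeff q i) i)" by (simp add: poly_as_sum_of_monoms)
  have eq: "emode q = (\<lambda>x. \<Sum>i\<le>degree q. emode (monom (coeff q i) i) x)"
    by (subst q) (simp add: emode_sum fun_eq_iff)
  show "smooth_S3 (emode q)" unfolding eq by (rule laplace_beltrami_sum(1)) (rule mon)
  have ELsum: "EL (\<Sum>i\<in>A. f i) = (\<Sum>i\<in>A. EL (f i))" for A :: "nat set" and f
  proof (induction A rule: infinite_finite_induct)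
    case (insert i F)
    have "EL (p + q) = EL p + EL q" for p q
      by (simp add: EL_def L_def pderiv_add smult_add_right smult_diff_right algebra_simps)
    then show ?case using insert by simp
  qed (simp_all add: EL_def L_def)
  have "laplace_beltrami (emode q) x = (\<Sum>i\<le>degree q. emode (EL (monom (coeff q i) i)) x)"
    unfolding eq by (subst laplace_beltrami_sum(2)) (auto simp: mon)
  also have "\<dots> = emode (EL q) x"
    by (subst (3) q) (simp add: ELsum emode_sum)
  finally show "laplace_beltrami (emode q) x = emode (EL q) x" .
qed

text \<open>The square is completed: 4 a (a + n + 1) + n (n + 2) = (n + 1 + 2 a)^2 - 1 with n = k1 +
  k2. Adding 1 makes the eigenvalue a perfect square, which is the origin of the complete
  resonance.\<close>

lemma eigenfunction_e: "eigenfunction ((real (fr a))\<^sup>2 - 1) (e a)"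
proof -
  have "EL (P a) = smult (- ((real (fr a))\<^sup>2 - 1)) (P a)"
    unfolding EL_def L_P smult_smult smult_diff_left[symmetric]
    by (simp add: fr_def power2_eq_square algebra_simps)
  then show ?thesis
    unfolding eigenfunction_def e_def by (simp add: emode_laplace emode_smult algebra_simps)
qed

lemma Z_norm: "(cmod (Z x))\<^sup>2 = poly W ((cmod (z1 x))\<^sup>2)"
proof -
  have "(cmod (z2 x))\<^sup>2 = 1 - (cmod (z1 x))\<^sup>2" using norm_z_sum[of x] by simp
  moreover have "cmod (hv \<mu> u) = cmod u" for \<mu> u by (simp add: hv_def)
  moreover have "(cmod (Z x))\<^sup>2 = ((cmod (hv \<mu>1 (z1 x)))\<^sup>2) ^ k1 * ((cmod (hv \<mu>2 (z2 x)))\<^sup>2) ^ k2"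
    by (simp add: Z_def norm_mult norm_power power_mult_distrib power_mult[symmetric] mult.commute)
  ultimately show ?thesis by (simp only: poly_W)
qed

lemma norm_z1_le: "(cmod (z1 x))\<^sup>2 \<le> 1" using norm_z_sum[of x] by (metis le_add_same_cancel1 zero_le_power2)

lemma norm_e_le: "cmod (e a x) \<le> 4 * real (fr a)"
proof (rule power2_le_imp_le)
  have "(cmod (e a x))\<^sup>2 = poly W ((cmod (z1 x))\<^sup>2) * (poly (P a) ((cmod (z1 x))\<^sup>2))\<^sup>2"
    by (simp add: e_def emode_def norm_mult power_mult_distrib Z_norm)
  also have "\<dots> \<le> 11 * (real (fr a))\<^sup>2" by (rule WPP_le) (auto simp: norm_z1_le)
  also have "\<dots> \<le> (4 * real (fr a))\<^sup>2" by (simp add: power_mult_distrib)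
  finally show "(cmod (e a x))\<^sup>2 \<le> (4 * real (fr a))\<^sup>2" .
qed simp

text \<open>The nonlinearity preserves the momentum: \<open>Z\<close> and its conjugate multiply to
  the weight \<open>W\<close>, one factor \<open>Z\<close> survives, and the remaining polynomial W
  P_a P_b P_c is expanded in the orthonormal basis.\<close>

lemma e_product:
  "e a x * cnj (e b x) * e c x = (\<Sum>d\<le>a + b + c + k1 + k2. of_real (q4 a b c d) * e d x)"
proof -
  let ?t = "(cmod (z1 x))\<^sup>2"
  have "Z x * cnj (Z x) = of_real (poly W ?t)"
    unfolding Z_norm[symmetric] by (rule complex_norm_square[symmetric])
  then have "e a x * cnj (e b x) * e c x = emode (W * P a * P b * P c) x"
    by (simp add: e_def emode_def algebra_simps)
  then show ?thesis by (simp add: product_expansion emode_sum emode_smult e_def)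
qed

lemma z_hopf:
  assumes "\<eta> \<in> {0<..<pi/2}"
  shows "z1 (hopf \<eta> \<xi>1 \<xi>2) = of_real (sin \<eta>) * cis \<xi>1" "z2 (hopf \<eta> \<xi>1 \<xi>2) = of_real (cos \<eta>) * cis \<xi>2"
proof -
  let ?v = "vector [sin \<eta> * cos \<xi>1, sin \<eta> * sin \<xi>1, cos \<eta> * cos \<xi>2, cos \<eta> * sin \<xi>2] :: real ^ 4"
  have "?v \<bullet> ?v = (sin \<eta> * cos \<xi>1)\<^sup>2 + (sin \<eta> * sin \<xi>1)\<^sup>2 + ((cos \<eta> * cos \<xi>2)\<^sup>2 + (cos \<eta> * sin \<xi>2)\<^sup>2)"
    by (simp add: inner_vec_def sum_4 power2_eq_square)
  also have "\<dots> = (sin \<eta>)\<^sup>2 * ((cos \<xi>1)\<^sup>2 + (sin \<xi>1)\<^sup>2) + (cos \<eta>)\<^sup>2 * ((cos \<xi>2)\<^sup>2 + (sin \<xi>2)\<^sup>2)"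
    by (simp only: power_mult_distrib distrib_left)
  also have "\<dots> = 1" by simp
  finally have "norm ?v = 1" by (simp add: norm_eq_sqrt_inner)
  then have "Rep_S3 (hopf \<eta> \<xi>1 \<xi>2) = ?v" unfolding hopf_def by (intro Abs_S3_inverse) simp
  then show "z1 (hopf \<eta> \<xi>1 \<xi>2) = of_real (sin \<eta>) * cis \<xi>1" "z2 (hopf \<eta> \<xi>1 \<xi>2) = of_real (cos \<eta>) * cis \<xi>2"
    by (simp_all add: z1_def z2_def complex_eq_iff)
qed

lemma hv_power: "hv \<mu> (of_real r * cis \<xi>) ^ nat \<bar>\<mu>\<bar> = of_real (r ^ nat \<bar>\<mu>\<bar>) * exp (\<i> * of_int \<mu> * of_real \<xi>)"
proof -
  have "cis \<xi> ^ nat \<mu> = exp (\<i> * of_int \<mu> * of_real \<xi>)" if "\<mu> \<ge> 0"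
    using that by (simp add: cis_conv_exp exp_of_nat_mult[symmetric] algebra_simps)
  moreover have "cnj (cis \<xi>) ^ nat (- \<mu>) = exp (\<i> * of_int \<mu> * of_real \<xi>)" if "\<mu> < 0"
  proof -
    have "cnj (cis \<xi>) = cis (- \<xi>)" by (simp add: cis_cnj)
    then show ?thesis using that by (simp add: cis_conv_exp exp_of_nat_mult[symmetric] algebra_simps)
  qed
  ultimately show ?thesis by (auto simp: hv_def power_mult_distrib)
qed

lemma emode_hopf:
  assumes "\<eta> \<in> {0<..<pi/2}"
  shows "emode q (hopf \<eta> \<xi>1 \<xi>2) = of_real (sin \<eta> ^ k1 * cos \<eta> ^ k2 * poly q ((sin \<eta>)\<^sup>2)) *
     exp (\<i> * of_int \<mu>1 * of_real \<xi>1) * exp (\<i> * of_int \<mu>2 * of_real \<xi>2)"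
  unfolding emode_def Z_def z_hopf[OF assms] k1_def k2_def hv_power by (simp add: norm_mult algebra_simps)

end

section \<open>Completeness of the Hopf modes\<close>

lemma hv_shift:
  "u * hv \<mu> u ^ nat \<bar>\<mu>\<bar> = (if 0 \<le> \<mu> then 1 else of_real ((cmod u)\<^sup>2)) * hv (\<mu> + 1) u ^ nat \<bar>\<mu> + 1\<bar>"
  "cnj u * hv \<mu> u ^ nat \<bar>\<mu>\<bar> = (if \<mu> \<le> 0 then 1 else of_real ((cmod u)\<^sup>2)) * hv (\<mu> - 1) u ^ nat \<bar>\<mu> - 1\<bar>"
proof -
  have c: "u * cnj u = of_real ((cmod u)\<^sup>2)" by (rule complex_norm_square[symmetric])
  show "u * hv \<mu> u ^ nat \<bar>\<mu>\<bar> = (if 0 \<le> \<mu> then 1 else of_real ((cmod u)\<^sup>2)) * hv (\<mu> + 1) u ^ nat \<bar>\<mu> + 1\<bar>"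
  proof (cases "0 \<le> \<mu>")
    case True
    then have "nat \<bar>\<mu> + 1\<bar> = Suc (nat \<bar>\<mu>\<bar>)" by simp
    with True show ?thesis by (simp add: hv_def)
  next
    case False
    then have s: "nat \<bar>\<mu>\<bar> = Suc (nat \<bar>\<mu> + 1\<bar>)" by simp
    have "u * hv \<mu> u ^ nat \<bar>\<mu>\<bar> = (u * cnj u) * cnj u ^ nat \<bar>\<mu> + 1\<bar>"
      unfolding s using False by (simp add: hv_def)
    also have "cnj u ^ nat \<bar>\<mu> + 1\<bar> = hv (\<mu> + 1) u ^ nat \<bar>\<mu> + 1\<bar>"
      using False by (cases "\<mu> + 1 = 0") (auto simp: hv_def)
    finally show ?thesis using False c by simp
  qed
  show "cnj u * hv \<mu> u ^ nat \<bar>\<mu>\<bar> = (if \<mu> \<le> 0 then 1 else of_real ((cmod u)\<^sup>2)) * hv (\<mu> - 1) u ^ nat \<bar>\<mu> - 1\<bar>"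
  proof (cases "\<mu> \<le> 0")
    case True
    then have "nat \<bar>\<mu> - 1\<bar> = Suc (nat \<bar>\<mu>\<bar>)" by simp
    with True show ?thesis by (cases "\<mu> = 0") (auto simp: hv_def)
  next
    case False
    then have s: "nat \<bar>\<mu>\<bar> = Suc (nat \<bar>\<mu> - 1\<bar>)" by simp
    have "cnj u * hv \<mu> u ^ nat \<bar>\<mu>\<bar> = (u * cnj u) * u ^ nat \<bar>\<mu> - 1\<bar>"
      unfolding s using False by (simp add: hv_def)
    also have "u ^ nat \<bar>\<mu> - 1\<bar> = hv (\<mu> - 1) u ^ nat \<bar>\<mu> - 1\<bar>"
      using False by (auto simp: hv_def)
    finally show ?thesis using False c by simp
  qed
qed

text \<open>Multiplication by a coordinate moves the momentum by one. When this lowers its absolute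
  value, a pair u cnj u splits off and becomes the polynomial factor t, respectively 1 - t.\<close>

lemma emode_shift:
  "z1 x * hopf.emode \<mu>1 \<mu>2 q x = hopf.emode (\<mu>1 + 1) \<mu>2 (if 0 \<le> \<mu>1 then q else [:0, 1:] * q) x"
  "cnj (z1 x) * hopf.emode \<mu>1 \<mu>2 q x = hopf.emode (\<mu>1 - 1) \<mu>2 (if \<mu>1 \<le> 0 then q else [:0, 1:] * q) x"
  "z2 x * hopf.emode \<mu>1 \<mu>2 q x = hopf.emode \<mu>1 (\<mu>2 + 1) (if 0 \<le> \<mu>2 then q else [:1, -1:] * q) x"
  "cnj (z2 x) * hopf.emode \<mu>1 \<mu>2 q x = hopf.emode \<mu>1 (\<mu>2 - 1) (if \<mu>2 \<le> 0 then q else [:1, -1:] * q) x"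
proof -
  note defs = hopf.emode_def hopf.Z_def hopf.k1_def hopf.k2_def
  have z2: "(cmod (z2 x))\<^sup>2 = 1 - (cmod (z1 x))\<^sup>2" using norm_z_sum[of x] by simp
  show "z1 x * hopf.emode \<mu>1 \<mu>2 q x = hopf.emode (\<mu>1 + 1) \<mu>2 (if 0 \<le> \<mu>1 then q else [:0, 1:] * q) x"
    unfolding defs using hv_shift(1)[of "z1 x" \<mu>1] by (simp add: mult.assoc[symmetric])
  show "cnj (z1 x) * hopf.emode \<mu>1 \<mu>2 q x = hopf.emode (\<mu>1 - 1) \<mu>2 (if \<mu>1 \<le> 0 then q else [:0, 1:] * q) x"
    unfolding defs using hv_shift(2)[of "z1 x" \<mu>1] by (simp add: mult.assoc[symmetric])
  have c: "z * (A * B * C) = A * (z * B) * C" for z A B C :: complex by (simp add: mult.left_commute)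
  show "z2 x * hopf.emode \<mu>1 \<mu>2 q x = hopf.emode \<mu>1 (\<mu>2 + 1) (if 0 \<le> \<mu>2 then q else [:1, -1:] * q) x"
    unfolding defs c hv_shift by (simp add: z2 algebra_simps)
  show "cnj (z2 x) * hopf.emode \<mu>1 \<mu>2 q x = hopf.emode \<mu>1 (\<mu>2 - 1) (if \<mu>2 \<le> 0 then q else [:1, -1:] * q) x"
    unfolding defs c hv_shift by (simp add: z2 algebra_simps)
qed

text \<open>The complex span of the modes of all momenta at once. A fixed momentum is not stable
  under multiplication by coordinates, but this span is; it contains 1 and hence the restriction of
  every polynomial.\<close>

inductive hspan :: "(S3 \<Rightarrow> complex) \<Rightarrow> bool" where
  mode: "hspan (\<lambda>x. c * hopf.emode \<mu>1 \<mu>2 q x)"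
| add: "hspan f \<Longrightarrow> hspan g \<Longrightarrow> hspan (\<lambda>x. f x + g x)"

lemma hspan_cmult: "hspan f \<Longrightarrow> hspan (\<lambda>x. c * f x)"
proof (induction rule: hspan.induct)
  case (mode c' \<mu>1 \<mu>2 q)
  show ?case using hspan.mode[of "c * c'"] by (simp add: mult.assoc)
qed (simp add: distrib_left hspan.add)

lemma hspan_mult_z:
  assumes "hspan f"
  shows "hspan (\<lambda>x. z1 x * f x)" "hspan (\<lambda>x. cnj (z1 x) * f x)"
    "hspan (\<lambda>x. z2 x * f x)" "hspan (\<lambda>x. cnj (z2 x) * f x)"
  using assms
proof (induction rule: hspan.induct)
  case (mode c \<mu>1 \<mu>2 q)
  {
    case 1 show ?case by (simp only: mult.left_commute[of _ c] emode_shift hspan.mode)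
    case 2 show ?case by (simp only: mult.left_commute[of _ c] emode_shift hspan.mode)
    case 3 show ?case by (simp only: mult.left_commute[of _ c] emode_shift hspan.mode)
    case 4 show ?case by (simp only: mult.left_commute[of _ c] emode_shift hspan.mode)
  }
next
  case (add f g)
  {
    case 1 show ?case using add by (simp add: distrib_left hspan.add)
    case 2 show ?case using add by (simp add: distrib_left hspan.add)
    case 3 show ?case using add by (simp add: distrib_left hspan.add)
    case 4 show ?case using add by (simp add: distrib_left hspan.add)
  }
qed

lemma hspan_mult_coordinate:
  assumes "hspan f"
  shows "hspan (\<lambda>x. of_real (Rep_S3 x $ i) * f x)"
proof -
  note m = hspan_mult_z[OF assms]
  have "hspan (\<lambda>x. 1/2 * (z1 x * f x) + 1/2 * (cnj (z1 x) * f x))"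
    "hspan (\<lambda>x. (-\<i>/2) * (z1 x * f x) + (\<i>/2) * (cnj (z1 x) * f x))"
    "hspan (\<lambda>x. 1/2 * (z2 x * f x) + 1/2 * (cnj (z2 x) * f x))"
    "hspan (\<lambda>x. (-\<i>/2) * (z2 x * f x) + (\<i>/2) * (cnj (z2 x) * f x))"
    by (intro hspan.add hspan_cmult m)+
  moreover have "of_real (Rep_S3 x $ 1) * f x = 1/2 * (z1 x * f x) + 1/2 * (cnj (z1 x) * f x)"
    "of_real (Rep_S3 x $ 2) * f x = (-\<i>/2) * (z1 x * f x) + (\<i>/2) * (cnj (z1 x) * f x)"
    "of_real (Rep_S3 x $ 3) * f x = 1/2 * (z2 x * f x) + 1/2 * (cnj (z2 x) * f x)"
    "of_real (Rep_S3 x $ 4) * f x = (-\<i>/2) * (z2 x * f x) + (\<i>/2) * (cnj (z2 x) * f x)" for x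
    by (simp_all add: z1_def z2_def complex_eq_iff field_simps)
  ultimately have "\<forall>i. hspan (\<lambda>x. of_real (Rep_S3 x $ i) * f x)"
    unfolding forall_4 by (simp only:)
  then show ?thesis by blast
qed

lemma hspan_mult_polynomial:
  "real_polynomial_function p \<Longrightarrow> hspan f \<Longrightarrow> hspan (\<lambda>x. of_real (p (Rep_S3 x)) * f x)"
proof (induction p arbitrary: f rule: real_polynomial_function.induct)
  case (linear p)
  have "p y = (\<Sum>i\<in>UNIV. y $ i * p (axis i 1))" for y
    using linear_Basis_expansion[OF bounded_linear.linear[OF linear(1)], of y]
    unfolding sum_Basis_4 by (simp add: inner_axis)
  note pe = this
  have eq: "(\<lambda>x. of_real (p (Rep_S3 x)) * f x) = (\<lambda>x. of_real (p (axis 1 1)) * (of_real (Rep_S3 x $ 1) * f x)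
      + of_real (p (axis 2 1)) * (of_real (Rep_S3 x $ 2) * f x) + of_real (p (axis 3 1)) * (of_real (Rep_S3 x $ 3) * f x)
      + of_real (p (axis 4 1)) * (of_real (Rep_S3 x $ 4) * f x))"
    by (rule ext, subst pe) (simp add: sum_4 algebra_simps)
  show ?case unfolding eq by (intro hspan.add hspan_cmult hspan_mult_coordinate linear(2))
next
  case (const c)
  then show ?case by (rule hspan_cmult)
next
  case (add p q)
  then show ?case by (simp add: distrib_right hspan.add)
next
  case (mult p q)
  then show ?case by (simp add: mult.assoc)
qed

lemma hspan_polynomial: "real_polynomial_function p \<Longrightarrow> hspan (\<lambda>x. of_real (p (Rep_S3 x)))"
proof -
  assume p: "real_polynomial_function p"
  have "hspan (\<lambda>x. 1 * hopf.emode 0 0 1 x)" by (rule hspan.mode)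
  moreover have "hopf.emode 0 0 1 x = 1" for x
    by (simp add: hopf.emode_def hopf.Z_def hopf.k1_def hopf.k2_def)
  ultimately show ?thesis using hspan_mult_polynomial[OF p, of "\<lambda>x. 1"] by simp
qed

section \<open>Uniqueness in L2: orthogonality to all eigenfunctions forces a function to vanish
  almost everywhere\<close>

lemma L2_integrable:
  assumes "h \<in> L2_S3"
  shows "integrable S3_measure h"
proof (rule Bochner_Integration.integrable_bound[where f = "\<lambda>x. 1 + (norm (h x))\<^sup>2"])
  show "integrable S3_measure (\<lambda>x. 1 + (norm (h x))\<^sup>2)"
    using assms by (intro Bochner_Integration.integrable_add) (auto simp: L2_S3_def)
  show "h \<in> borel_measurable S3_measure" using assms by (simp add: L2_S3_def)
  have "t \<le> 1 + t\<^sup>2" for t :: real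
  proof -
    have "2 * t \<le> 1 + t\<^sup>2" using zero_le_power2[of "t - 1"] by (simp add: power2_eq_square algebra_simps)
    then show ?thesis using zero_le_power2[of t] by linarith
  qed
  then show "AE x in S3_measure. norm (h x) \<le> norm (1 + (norm (h x))\<^sup>2)"
    by (intro AE_I2) (simp add: abs_of_nonneg)
qed

lemma L2_mult_continuous_integrable:
  assumes "h \<in> L2_S3" "continuous_on UNIV f"
  shows "integrable S3_measure (\<lambda>x. h x * f x)"
proof -
  obtain B where B: "0 < B" "\<And>x. norm (f x) \<le> B" using continuous_S3_bounded[OF assms(2)] by blast
  have m: "f \<in> borel_measurable S3_measure" using borel_measurable_continuous_onI[OF assms(2)] by simp
  show ?thesis
  proof (rule Bochner_Integration.integrable_bound[OF integrable_mult_left[OF L2_integrable[OF assms(1)], of "of_real B"]])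
    show "(\<lambda>x. h x * f x) \<in> borel_measurable S3_measure"
      using assms(1) m by (auto simp: L2_S3_def)
    show "AE x in S3_measure. norm (h x * f x) \<le> norm (h x * of_real B)"
      using B by (intro AE_I2) (simp add: norm_mult mult_left_mono)
  qed
qed

lemma continuous_in_L2: "continuous_on UNIV f \<Longrightarrow> f \<in> L2_S3"
proof -
  assume f: "continuous_on UNIV f"
  have "integrable S3_measure (\<lambda>x. (norm (f x))\<^sup>2)"
    by (rule integrable_continuous_S3) (intro continuous_intros f)
  then show ?thesis using borel_measurable_continuous_onI[OF f] by (simp add: L2_S3_def)
qed

lemma L2_diff: "f \<in> L2_S3 \<Longrightarrow> g \<in> L2_S3 \<Longrightarrow> (\<lambda>x. f x - g x) \<in> L2_S3"
proof -
  assume f: "f \<in> L2_S3" and g: "g \<in> L2_S3"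
  have "integrable S3_measure (\<lambda>x. (norm (f x - g x))\<^sup>2)"
  proof (rule Bochner_Integration.integrable_bound[where f = "\<lambda>x. 2 * (norm (f x))\<^sup>2 + 2 * (norm (g x))\<^sup>2"])
    show "integrable S3_measure (\<lambda>x. 2 * (norm (f x))\<^sup>2 + 2 * (norm (g x))\<^sup>2)"
      using f g by (auto simp: L2_S3_def)
    have "(norm (a - b))\<^sup>2 \<le> 2 * (norm a)\<^sup>2 + 2 * (norm b)\<^sup>2" for a b :: complex
    proof -
      have "(norm (a - b))\<^sup>2 \<le> (norm a + norm b)\<^sup>2"
        by (intro power_mono norm_triangle_ineq4) simp
      also have "\<dots> \<le> 2 * (norm a)\<^sup>2 + 2 * (norm b)\<^sup>2"
        using sum_squares_bound[of "norm a" "norm b"] by (simp add: power2_sum)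
      finally show ?thesis .
    qed
    then show "AE x in S3_measure. norm ((norm (f x - g x))\<^sup>2) \<le> norm (2 * (norm (f x))\<^sup>2 + 2 * (norm (g x))\<^sup>2)"
      by (intro AE_I2) (simp add: abs_of_nonneg)
  qed (use f g in \<open>auto simp: L2_S3_def\<close>)
  with f g show ?thesis by (auto simp: L2_S3_def)
qed

context
  fixes h :: "S3 \<Rightarrow> complex"
  assumes h: "h \<in> L2_S3" and orth: "\<And>lam e. eigenfunction lam e \<Longrightarrow> L2_inner h e = 0"
begin

text \<open>Every mode is a finite combination of the eigenfunctions \<open>e d\<close> of its
  momentum by \<open>P_expansion\<close>. Continuity is carried along in the induction to guarantee
  integrability of the summands.\<close>

lemma orth_hspan: "hspan f \<Longrightarrow> continuous_on UNIV f \<and> (LINT x|S3_measure. h x * cnj (f x)) = 0"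
proof (induction rule: hspan.induct)
  case (mode c \<mu>1 \<mu>2 q)
  interpret hopf \<mu>1 \<mu>2 .
  have cont: "continuous_on UNIV (emode p)" for p by (rule smooth_S3_continuous[OF emode_laplace(1)])
  have ce: "continuous_on UNIV (\<lambda>x. cnj (e d x))" for d
    unfolding e_def by (intro continuous_on_cnj cont)
  have i: "integrable S3_measure (\<lambda>x. h x * cnj (e d x))" for d
    by (rule L2_mult_continuous_integrable[OF h ce])
  have z: "(LINT x|S3_measure. h x * cnj (e d x)) = 0" for d
    using orth[OF eigenfunction_e] by (simp add: L2_inner_def)
  have "emode q x = (\<Sum>d\<le>degree q. of_real (ip q (P d)) * e d x)" for x
    by (subst P_expansion[of q "degree q"]) (simp_all add: emode_sum emode_smult e_def)
  then have "(\<lambda>x. h x * cnj (c * emode q x)) =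
      (\<lambda>x. \<Sum>d\<le>degree q. (cnj c * of_real (ip q (P d))) * (h x * cnj (e d x)))"
    by (simp add: sum_distrib_left sum_distrib_right mult.assoc mult.left_commute)
  then have "(LINT x|S3_measure. h x * cnj (c * emode q x)) = 0"
    by (simp only:) (simp add: Bochner_Integration.integral_sum i z)
  then show ?case by (auto intro!: continuous_on_mult cont)
next
  case (add f g)
  then have "integrable S3_measure (\<lambda>x. h x * cnj (f x))" "integrable S3_measure (\<lambda>x. h x * cnj (g x))"
    by (auto intro!: L2_mult_continuous_integrable[OF h] continuous_on_cnj)
  with add show ?case by (simp add: distrib_left continuous_on_add)
qed

text \<open>Stone-Weierstrass on the unit sphere of the ambient space; h is integrable since the
  measure is finite, so uniform approximation controls the integral.\<close>

lemma orth_continuous: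
  fixes f :: "S3 \<Rightarrow> real"
  assumes f: "continuous_on UNIV f"
  shows "(LINT x|S3_measure. h x * of_real (f x)) = 0"
proof -
  define B where "B = (LINT x|S3_measure. norm (h x))"
  have B: "B \<ge> 0" unfolding B_def by simp
  have hi: "integrable S3_measure h" by (rule L2_integrable[OF h])
  have "norm (LINT x|S3_measure. h x * of_real (f x)) \<le> 0 + d" if "d > 0" for d
  proof -
    define d' where "d' = d / (B + 1)"
    have d': "d' > 0" "B * d' \<le> d" using that B by (auto simp: d'_def field_simps)
    have cf: "continuous_on (sphere 0 1) (\<lambda>y. f (radial_proj y))"
      by (rule continuous_on_compose2[OF f continuous_on_subset[OF continuous_on_radial_proj]]) auto
    obtain p where p: "real_polynomial_function p" "\<And>y. y \<in> sphere 0 1 \<Longrightarrow> \<bar>f (radial_proj y) - p y\<bar> < d'"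
      using Stone_Weierstrass_real_polynomial_function[OF compact_sphere cf d'(1)] by blast
    have pf: "\<bar>f x - p (Rep_S3 x)\<bar> \<le> d'" for x using p(2)[of "Rep_S3 x"] by simp
    note o = orth_hspan[OF hspan_polynomial[OF p(1)]]
    then have i: "integrable S3_measure (\<lambda>x. h x * of_real (p (Rep_S3 x)))"
      by (intro L2_mult_continuous_integrable[OF h]) auto
    have i': "integrable S3_measure (\<lambda>x. h x * of_real (f x))"
      by (intro L2_mult_continuous_integrable[OF h] continuous_on_of_real f)
    have "(LINT x|S3_measure. h x * of_real (f x)) = (LINT x|S3_measure. h x * of_real (f x) - h x * of_real (p (Rep_S3 x)))"
      using o by (simp add: Bochner_Integration.integral_diff i i')
    also have "norm \<dots> \<le> (LINT x|S3_measure. norm (h x * of_real (f x) - h x * of_real (p (Rep_S3 x))))"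
      by (rule integral_norm_bound)
    also have "\<dots> \<le> (LINT x|S3_measure. norm (h x) * d')"
    proof (rule integral_mono)
      show "integrable S3_measure (\<lambda>x. norm (h x * of_real (f x) - h x * of_real (p (Rep_S3 x))))"
        by (intro integrable_norm Bochner_Integration.integrable_diff i i')
      show "integrable S3_measure (\<lambda>x. norm (h x) * d')" using hi by simp
      fix x
      have "norm (h x * of_real (f x) - h x * of_real (p (Rep_S3 x))) = norm (h x) * \<bar>f x - p (Rep_S3 x)\<bar>"
        by (metis norm_mult norm_of_real of_real_diff right_diff_distrib)
      then show "norm (h x * of_real (f x) - h x * of_real (p (Rep_S3 x))) \<le> norm (h x) * d'"
        by (simp add: mult_left_mono pf)
    qed
    also have "\<dots> = B * d'" by (simp add: B_def)
    also have "\<dots> \<le> d" by (rule d')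
    finally show ?thesis by simp
  qed
  then have "norm (LINT x|S3_measure. h x * of_real (f x)) \<le> 0" by (rule field_le_epsilon)
  then show ?thesis by simp
qed

lemma orth_closed:
  assumes "closed C"
  shows "(LINT x|S3_measure. h x * indicator C x) = 0"
proof (cases "C = {}")
  case False
  \<comment> \<open>Continuous functions decreasing to the indicator of a closed set, built from the
    distance to the set.\<close>
  define f where "f n x = max 0 (1 - real n * infdist x C)" for n x
  have cf: "continuous_on UNIV (f n)" for n
    unfolding f_def by (intro continuous_intros)
  have lim: "(\<lambda>n. f n x) \<longlonglongrightarrow> indicator C x" for x
  proof (cases "x \<in> C")
    case True
    then show ?thesis by (simp add: f_def)
  next
    case nin: False
    then have "infdist x C > 0"
      using infdist_pos_not_in_closed[OF assms False] by blast
    then obtain N :: nat where N: "1 < real N * infdist x C" using reals_Archimedean3 by blast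
    have "f n x = 0" if "n \<ge> N" for n
    proof -
      have "real N * infdist x C \<le> real n * infdist x C"
        using that \<open>infdist x C > 0\<close> by (intro mult_right_mono) auto
      then show ?thesis using N by (simp add: f_def)
    qed
    then show ?thesis using nin by (intro tendsto_eventually) (auto simp: eventually_sequentially)
  qed
  have hm: "h \<in> borel_measurable S3_measure" using h by (simp add: L2_S3_def)
  have cof: "continuous_on UNIV (\<lambda>x. complex_of_real (f n x))" for n by (intro continuous_on_of_real cf)
  have fm: "(\<lambda>x. complex_of_real (f n x)) \<in> borel_measurable S3_measure" for n
    using borel_measurable_continuous_onI[OF cof] by simp
  have "(\<lambda>n. LINT x|S3_measure. h x * of_real (f n x)) \<longlonglongrightarrow> (LINT x|S3_measure. h x * indicator C x)"
  proof (rule integral_dominated_convergence[where w = "\<lambda>x. norm (h x)"])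
    show "integrable S3_measure (\<lambda>x. norm (h x))" by (intro integrable_norm L2_integrable h)
    show "(\<lambda>x. h x * indicator C x) \<in> borel_measurable S3_measure"
      using hm assms by (intro borel_measurable_times borel_measurable_indicator) auto
    show "(\<lambda>x. h x * of_real (f n x)) \<in> borel_measurable S3_measure" for n
      by (intro borel_measurable_times hm fm)
    show "AE x in S3_measure. (\<lambda>n. h x * of_real (f n x)) \<longlonglongrightarrow> h x * indicator C x"
    proof (intro AE_I2)
      fix x
      have "(\<lambda>n. h x * of_real (f n x)) \<longlonglongrightarrow> h x * of_real (indicator C x)"
        by (intro tendsto_intros lim)
      then show "(\<lambda>n. h x * of_real (f n x)) \<longlonglongrightarrow> h x * indicator C x"
        by (simp add: indicator_def of_bool_def split: if_splits)
    qed
    have "\<bar>f n x\<bar> \<le> 1" for n x by (simp add: f_def infdist_nonneg)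
    then show "AE x in S3_measure. norm (h x * of_real (f n x)) \<le> norm (h x)" for n
      by (intro AE_I2) (simp add: norm_mult mult_left_le)
  qed
  moreover have "(LINT x|S3_measure. h x * of_real (f n x)) = 0" for n by (rule orth_continuous[OF cf])
  ultimately show ?thesis by (simp add: LIMSEQ_const_iff)
qed simp

text \<open>Closed sets form an intersection-stable generator of the Borel sets, and the sets with
  vanishing integral are closed under complements and countable disjoint unions.\<close>

lemma orth_borel:
  assumes "A \<in> sets borel"
  shows "(LINT x|S3_measure. h x * indicator A x) = 0"
proof -
  have hi: "integrable S3_measure h" by (rule L2_integrable[OF h])
  have conv: "(indicator A x :: real) *\<^sub>R h x = h x * indicator A x" for A x by (simp add: indicator_def)
  have i: "integrable S3_measure (\<lambda>x. h x * indicator A x)" if "A \<in> sets borel" for A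
    using integrable_mult_indicator[of A S3_measure h] hi that by (simp add: conv)
  have gen: "sets borel = sigma_sets UNIV (Collect closed :: S3 set set)"
    by (simp add: borel_eq_closed)
  have U: "(LINT x|S3_measure. h x * indicator UNIV x) = 0" by (rule orth_closed) simp
  have IS: "Int_stable (Collect closed :: S3 set set)" "Collect closed \<subseteq> Pow (UNIV :: S3 set)"
    by (auto simp: Int_stable_def)
  have "A \<in> sigma_sets UNIV (Collect closed)" using assms by (simp add: gen)
  with IS show ?thesis
  proof (induction rule: sigma_sets_induct_disjoint)
    case empty
    show ?case by simp
  next
    case (basic A)
    then show ?case by (simp add: orth_closed)
  next
    case (compl A)
    then have A: "A \<in> sets borel" by (simp add: gen)
    have "(LINT x|S3_measure. h x * indicator (UNIV - A) x) =
        (LINT x|S3_measure. h x * indicator UNIV x - h x * indicator A x)"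
      by (intro Bochner_Integration.integral_cong) (auto simp: indicator_def)
    then show ?case using compl U by (simp add: Bochner_Integration.integral_diff i[OF A] hi)
  next
    case (union A)
    then have A: "A n \<in> sets borel" for n unfolding gen by blast
    have "(LINT x:(\<Union>n. A n)|S3_measure. h x) = (\<Sum>n. LINT x:(A n)|S3_measure. h x)"
    proof (rule lebesgue_integral_countable_add)
      show "set_integrable S3_measure (\<Union>n. A n) h"
        using hi A unfolding set_integrable_def by (intro integrable_mult_indicator) auto
    qed (use union A in \<open>auto simp: disjoint_family_on_def\<close>)
    then show ?case using union by (simp add: set_lebesgue_integral_def conv)
  qed
qed

lemma orth_AE_0: "AE x in S3_measure. h x = 0"
proof -
  have hi: "integrable S3_measure h" by (rule L2_integrable[OF h])
  have conv: "(indicator A x :: real) *\<^sub>R h x = h x * indicator A x" for A x by (simp add: indicator_def)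
  have s: "(LINT x:A|S3_measure. h x) = 0" if "A \<in> sets S3_measure" for A
    using orth_borel[of A] that by (simp add: set_lebesgue_integral_def conv)
  have i: "integrable S3_measure (\<lambda>x. indicator A x *\<^sub>R h x)" if "A \<in> sets S3_measure" for A
    by (rule integrable_mult_indicator[OF that hi])
  have "AE x in S3_measure. Re (h x) = 0"
  proof (rule density_unique_real)
    fix A assume A: "A \<in> sets S3_measure"
    show "(LINT x:A|S3_measure. Re (h x)) = (LINT x:A|S3_measure. 0)"
      using s[OF A] integral_Re[OF i[OF A]] by (simp add: set_lebesgue_integral_def)
  qed (use hi in auto)
  moreover have "AE x in S3_measure. Im (h x) = 0"
  proof (rule density_unique_real)
    fix A assume A: "A \<in> sets S3_measure"
    show "(LINT x:A|S3_measure. Im (h x)) = (LINT x:A|S3_measure. 0)"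
      using s[OF A] integral_Im[OF i[OF A]] by (simp add: set_lebesgue_integral_def)
  qed (use hi in auto)
  ultimately show ?thesis by eventually_elim (simp add: complex_eq_iff)
qed

end

section \<open>Sobolev norms\<close>

text \<open>Two Bessel potentials of the same function have equal inner products with every
  eigenfunction, so they agree almost everywhere by \<open>orth_AE_0\<close>. Hence the choice in
  the definition of the norm may be replaced by any explicit candidate.\<close>

lemma Hs_norm_eq:
  assumes "is_bessel s f g"
  shows "Hs_norm s f = L2_norm g"
proof -
  define g' where "g' = (SOME g. is_bessel s f g)"
  have g': "is_bessel s f g'" unfolding g'_def using someI_ex[of "\<lambda>g. is_bessel s f g"] assms by blast
  have L2: "g \<in> L2_S3" "g' \<in> L2_S3" using assms g' by (auto simp: is_bessel_def)
  have "AE x in S3_measure. g x - g' x = 0"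
  proof (rule orth_AE_0[OF L2_diff[OF L2]])
    fix lam e assume e: "eigenfunction lam e"
    then have c: "continuous_on UNIV (\<lambda>x. cnj (e x))"
      using smooth_S3_continuous[OF smooth_S3_cnj] by (auto simp: eigenfunction_def)
    have "L2_inner (\<lambda>x. g x - g' x) e = L2_inner g e - L2_inner g' e"
      unfolding L2_inner_def left_diff_distrib
      by (rule Bochner_Integration.integral_diff) (intro L2_mult_continuous_integrable L2 c)+
    also have "\<dots> = 0" using assms g' e by (simp add: is_bessel_def)
    finally show "L2_inner (\<lambda>x. g x - g' x) e = 0" .
  qed
  then have "(LINT x|S3_measure. (norm (g x))\<^sup>2) = (LINT x|S3_measure. (norm (g' x))\<^sup>2)"
    using L2 by (intro integral_cong_AE) (auto simp: L2_S3_def)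
  then show ?thesis by (simp add: Hs_norm_def L2_norm_def g'_def)
qed

text \<open>Green's formula with the conjugate of e, which is again an eigenfunction since
  conjugation commutes with the flows and lam is real. All eigenfunctions of the sphere have to be
  covered, as \<open>is_bessel\<close> tests against each of them.\<close>

lemma L2_inner_eigenfunction:
  assumes f: "eigenfunction a f" and e: "eigenfunction lam e" and "a \<noteq> lam"
  shows "L2_inner f e = 0"
proof -
  have s: "smooth_S3 f" "smooth_S3 e" using f e by (auto simp: eigenfunction_def)
  have le: "eigenfunction lam (\<lambda>x. cnj (e x))"
  proof -
    have "X2 A (\<lambda>x. cnj (e x)) x = cnj (X2 A e x)" if A: "cstruct A" for A x
      by (rule X2_eqI[OF smooth_S3_cnj[OF s(2)] A has_vector_derivative_cnj[OF flow_derivative[OF s(2) A]]])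
         (use has_vector_derivative_cnj[OF flow_derivative2[OF s(2) A, of x 0]] in simp)
    then have "laplace_beltrami (\<lambda>x. cnj (e x)) x = cnj (laplace_beltrami e x)" for x
      by (simp add: laplace_beltrami_frame s smooth_S3_cnj cstruct_frame)
    moreover have "- cnj (laplace_beltrami e x) = of_real lam * cnj (e x)" for x
      using e unfolding eigenfunction_def by (metis complex_cnj_complex_of_real complex_cnj_minus complex_cnj_mult)
    ultimately show ?thesis by (simp add: eigenfunction_def smooth_S3_cnj s)
  qed
  have Lf: "laplace_beltrami f x = - of_real a * f x" for x
    using f unfolding eigenfunction_def by (metis minus_equation_iff mult_minus_left)
  have Le: "laplace_beltrami (\<lambda>x. cnj (e x)) x = - of_real lam * cnj (e x)" for x
    using le unfolding eigenfunction_def by (metis minus_equation_iff mult_minus_left)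
  have "- of_real lam * L2_inner f e = - of_real a * L2_inner f e"
    using Green[OF s(1) smooth_S3_cnj[OF s(2)]] unfolding Lf Le L2_inner_def
    by (simp add: mult.assoc mult.left_commute)
  with \<open>a \<noteq> lam\<close> show ?thesis by simp
qed

section \<open>Expansions in space-time modes\<close>

lemma coef_sum: "coef (\<Sum>x\<in>A. f x) y = (\<Sum>x\<in>A. coef (f x) y)"
  by (rule linear_sum[OF bounded_linear.linear[OF bounded_linear_coef]])

text \<open>The exponent \<sigma> counts the derivatives in time and space that the weight controls.
  The threshold 2 covers the linear growth of the sup norm of \<open>e a\<close> and the quadratic
  loss in the two smaller frequencies in the product estimate.\<close>

locale wave = hopf +
  fixes m \<sigma> :: nat
  assumes m_pos: "0 < m" and \<sigma>_ge: "2 \<le> \<sigma>"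
begin

text \<open>
  The index \<open>(k, a)\<close> stands for the mode \<open>cos ((2 k + 1) m \<tau>) e\<^sub>a\<close>: only odd multiples of the basic
  frequency \<open>m\<close> occur. An element of the \<open>\<ell>\<^sup>1\<close> space contains the coefficients multiplied by \<open>wt\<close>.
\<close>

definition lf :: "nat \<times> nat \<Rightarrow> real" where "lf i = real (m * (2 * fst i + 1))"

definition wt :: "nat \<times> nat \<Rightarrow> real" where "wt i = real (2 * fst i + 1) ^ \<sigma> * real (fr (snd i)) ^ \<sigma>"

definition bas :: "real \<Rightarrow> real \<Rightarrow> S3 \<Rightarrow> nat \<times> nat \<Rightarrow> complex"
  where "bas \<omega> t x i = of_real (cos (lf i * (\<omega> * t)) / wt i) * e (snd i) x"

definition ev :: "real \<Rightarrow> (nat \<times> nat) l1 \<Rightarrow> real \<Rightarrow> S3 \<Rightarrow> complex"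
  where "ev \<omega> U t x = lin (bas \<omega> t x) U"

lemma fr_ge_1: "1 \<le> real (fr a)" using fr_pos[of a] by simp

lemma wt_ge: "real (fr (snd i)) ^ \<sigma> \<le> wt i" "0 < wt i" "real (fr (snd i)) ^ 2 \<le> wt i"
proof -
  have "1 * real (fr (snd i)) ^ \<sigma> \<le> wt i" unfolding wt_def by (intro mult_right_mono) auto
  then show *: "real (fr (snd i)) ^ \<sigma> \<le> wt i" by simp
  show "0 < wt i" using fr_pos[of "snd i"] by (simp add: wt_def)
  show "real (fr (snd i)) ^ 2 \<le> wt i"
    using power_increasing[OF \<sigma>_ge fr_ge_1] * order_trans by blast
qed

lemma norm_bas_le: "norm (bas \<omega> t x i) \<le> 4"
proof -
  let ?f = "real (fr (snd i))"
  have "norm (bas \<omega> t x i) = \<bar>cos (lf i * (\<omega> * t))\<bar> / wt i * cmod (e (snd i) x)"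
    using wt_ge(2)[of i] by (simp add: bas_def norm_mult norm_divide)
  also have "\<dots> \<le> 1 / wt i * (4 * ?f)"
    using wt_ge(2)[of i] norm_e_le by (intro mult_mono divide_right_mono) auto
  also have "\<dots> \<le> 1 / wt i * (4 * ?f\<^sup>2)"
    using wt_ge(2)[of i] self_le_power[OF fr_ge_1, of 2 "snd i"] by (intro mult_left_mono) auto
  also have "\<dots> \<le> 4" using wt_ge(2,3)[of i] by (simp add: field_simps)
  finally show ?thesis .
qed

lemma bounded_linear_ev: "bounded_linear (\<lambda>U. ev \<omega> U t x)"
  unfolding ev_def by (rule bounded_linear_lin) (rule norm_bas_le)

lemma norm_ev_le: "norm (ev \<omega> U t x) \<le> 4 * norm U"
  unfolding ev_def by (rule norm_lin_le) (rule norm_bas_le)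

lemma ev_unit: "ev \<omega> (unit i) t x = bas \<omega> t x i"
  unfolding ev_def by (rule lin_unit) (rule norm_bas_le)

lemmas linear_ev = bounded_linear.linear[OF bounded_linear_ev]

lemma ev_diff: "ev \<omega> (U - V) t x = ev \<omega> U t x - ev \<omega> V t x"
  by (rule linear_diff[OF linear_ev])

lemma ev_scaleR: "ev \<omega> (c *\<^sub>R U) t x = of_real c * ev \<omega> U t x"
  by (simp add: linear_scale[OF linear_ev] scaleR_conv_of_real)

lemma ev_time: "ev \<omega> U t x = ev 1 U (\<omega> * t) x"
  by (simp add: ev_def bas_def[abs_def])

lemma continuous_on_e: "continuous_on UNIV (e a)"
  unfolding e_def by (rule smooth_S3_continuous[OF emode_laplace(1)])

lemma continuous_on_bas: "continuous_on UNIV (\<lambda>(t, x). bas \<omega> t x i)"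
proof -
  have "continuous_on UNIV (\<lambda>p :: real \<times> S3. e (snd i) (snd p))"
    by (rule continuous_on_compose2[OF continuous_on_e]) (auto intro: continuous_intros)
  moreover have "continuous_on UNIV (\<lambda>p :: real \<times> S3. complex_of_real (cos (lf i * (\<omega> * fst p)) / wt i))"
    using wt_ge(2)[of i] by (auto intro!: continuous_intros)
  ultimately show ?thesis unfolding bas_def case_prod_unfold by (intro continuous_on_mult)
qed

lemma continuous_on_ev: "continuous_on UNIV (\<lambda>(t, x). ev \<omega> U t x)"
proof -
  have lim: "uniform_limit UNIV (\<lambda>X p. \<Sum>i\<in>X. coef U i *\<^sub>R bas \<omega> (fst p) (snd p) i)
     (\<lambda>p. \<Sum>\<^sub>\<infinity>i. coef U i *\<^sub>R bas \<omega> (fst p) (snd p) i) (finite_subsets_at_top UNIV)"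
  proof (rule Weierstrass_m_test_general[where M = "\<lambda>i. \<bar>coef U i\<bar> * 4"])
    show "norm (coef U i *\<^sub>R bas \<omega> (fst p) (snd p) i) \<le> \<bar>coef U i\<bar> * 4" for i p
      using norm_bas_le by (simp add: mult_left_mono)
    show "(\<lambda>i. \<bar>coef U i\<bar> * 4) summable_on UNIV" by (intro summable_on_cmult_left coef_summable)
  qed
  have "continuous_on UNIV (\<lambda>p. \<Sum>\<^sub>\<infinity>i. coef U i *\<^sub>R bas \<omega> (fst p) (snd p) i)"
  proof (rule uniform_limit_theorem[OF _ lim])
    have "continuous_on UNIV (\<lambda>p. \<Sum>i\<in>X. coef U i *\<^sub>R bas \<omega> (fst p) (snd p) i)" for X
      using continuous_on_bas by (intro continuous_on_sum continuous_on_scaleR continuous_on_const) (auto simp: case_prod_unfold)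
    then show "\<forall>\<^sub>F X in finite_subsets_at_top UNIV. continuous_on UNIV (\<lambda>p. \<Sum>i\<in>X. coef U i *\<^sub>R bas \<omega> (fst p) (snd p) i)"
      by (intro always_eventually) auto
  qed auto
  then show ?thesis unfolding ev_def lin_def case_prod_unfold by simp
qed

lemma continuous_on_ev_time: "continuous_on S (\<lambda>t. ev \<omega> U t x)"
proof -
  have "continuous_on UNIV (\<lambda>t. (\<lambda>(t, x). ev \<omega> U t x) (t, x))"
    by (rule continuous_on_compose2[OF continuous_on_ev]) (auto intro: continuous_intros)
  then show ?thesis by (simp add: continuous_on_subset[of UNIV])
qed

lemma ev_even: "ev \<omega> U (- t) x = ev \<omega> U t x"
proof -
  have "bas \<omega> (- t) x = bas \<omega> t x" by (simp add: bas_def fun_eq_iff)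
  then show ?thesis by (simp add: ev_def)
qed

lemma ev_periodic:
  assumes "\<omega> \<noteq> 0"
  shows "ev \<omega> U (t + 2 * pi / \<omega> / real m) x = ev \<omega> U t x"
proof -
  have "cos (lf i * (\<omega> * (t + 2 * pi / \<omega> / real m))) = cos (lf i * (\<omega> * t))" for i
  proof -
    have "lf i * (\<omega> * (t + 2 * pi / \<omega> / real m)) = lf i * (\<omega> * t) + real (2 * fst i + 1) * (2 * pi)"
      using assms m_pos by (simp add: lf_def field_simps)
    moreover have "cos (y + real n * (2 * pi)) = cos y" for y n
    proof -
      have "real n * (2 * pi) = 2 * real n * pi" by simp
      then show ?thesis by (simp only: cos_add cos_2npi sin_2npi mult_1_right mult_zero_right diff_zero)
    qed
    ultimately show ?thesis by (simp only:)
  qed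
  then have "bas \<omega> (t + 2 * pi / \<omega> / real m) x = bas \<omega> t x" by (simp add: bas_def fun_eq_iff)
  then show ?thesis by (simp add: ev_def)
qed

text \<open>The phase factor and the vanishing imaginary part at zero angles are closed linear
  conditions and hold for each mode; real coefficients thus yield the real profile that the
  definition demands.\<close>

lemma ev_hopf: "hopf_plane_wave \<mu>1 \<mu>2 (ev \<omega> U t)"
  unfolding hopf_plane_wave_def
proof (intro exI ballI allI)
  fix \<eta> \<xi>1 \<xi>2 :: real assume \<eta>: "\<eta> \<in> {0<..<pi/2}"
  define E where "E = exp (\<i> * of_int \<mu>1 * of_real \<xi>1) * exp (\<i> * of_int \<mu>2 * of_real \<xi>2)"
  note bl = bounded_linear_ev[of \<omega> t]
  have b1: "ev \<omega> (unit i) t (hopf \<eta> \<xi>1 \<xi>2) = ev \<omega> (unit i) t (hopf \<eta> 0 0) * E" for i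
    unfolding ev_unit bas_def e_def emode_hopf[OF \<eta>] E_def by simp
  have 1: "ev \<omega> U t (hopf \<eta> \<xi>1 \<xi>2) = ev \<omega> U t (hopf \<eta> 0 0) * E"
    by (rule bounded_linear_l1_eqI[OF bl bounded_linear_compose[OF bounded_linear_mult_left bl] b1])
  have b2: "Im (ev \<omega> (unit i) t (hopf \<eta> 0 0)) = 0" for i
    unfolding ev_unit bas_def e_def emode_hopf[OF \<eta>] by simp
  have "Im (ev \<omega> U t (hopf \<eta> 0 0)) = 0"
    by (rule bounded_linear_l1_eqI[OF bounded_linear_compose[OF bounded_linear_Im bl] bounded_linear_zero b2])
  then have "ev \<omega> U t (hopf \<eta> 0 0) = of_real (Re (ev \<omega> U t (hopf \<eta> 0 0)))"
    by (simp add: complex_eq_iff)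
  with 1 show "ev \<omega> U t (hopf \<eta> \<xi>1 \<xi>2) = of_real (Re (ev \<omega> U t (hopf \<eta> 0 0))) *
      exp (\<i> * of_int \<mu>1 * of_real \<xi>1) * exp (\<i> * of_int \<mu>2 * of_real \<xi>2)"
    by (simp add: E_def mult.assoc)
qed

section \<open>The cubic nonlinearity\<close>

text \<open>Inverse of k \<mapsto> 2 k + 1 applied to |j|; the sign of an odd frequency is dropped
  because the cosine is even.\<close>

definition tidx :: "int \<Rightarrow> nat" where "tidx j = nat ((\<bar>j\<bar> - 1) div 2)"

lemma tidx: "odd j \<Longrightarrow> 2 * int (tidx j) + 1 = \<bar>j\<bar>"
proof -
  assume "odd j"
  then have "odd \<bar>j\<bar>" by simp
  then obtain k where "\<bar>j\<bar> = 2 * k + 1" by (rule oddE)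
  then show ?thesis by (simp add: tidx_def)
qed

abbreviation sgns :: "(int \<times> int) set" where "sgns \<equiv> {1, -1} \<times> {1, -1}"

definition comb :: "nat \<Rightarrow> nat \<Rightarrow> nat \<Rightarrow> int \<times> int \<Rightarrow> int"
  where "comb k k' k'' s = (2 * int k + 1) + fst s * (2 * int k' + 1) + snd s * (2 * int k'' + 1)"

lemma odd_comb: "s \<in> sgns \<Longrightarrow> odd (comb k k' k'' s)"
  by (auto simp: comb_def)

text \<open>The product of mode i, the conjugate of mode j and mode l: 1/4 and the sign pairs come
  from the product of three cosines, \<open>q4\<close> from \<open>e_product\<close>, and the
  quotient of weights from storing weighted coefficients.\<close>

definition cub :: "nat \<times> nat \<Rightarrow> nat \<times> nat \<Rightarrow> nat \<times> nat \<Rightarrow> (nat \<times> nat) l1"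
  where "cub i j l = (\<Sum>s\<in>sgns. \<Sum>d\<le>snd i + snd j + snd l + k1 + k2.
    (q4 (snd i) (snd j) (snd l) d / 4 *
      (wt (tidx (comb (fst i) (fst j) (fst l) s), d) / (wt i * wt j * wt l))) *\<^sub>R
    unit (tidx (comb (fst i) (fst j) (fst l) s), d))"

text \<open>With a the largest index, \<open>q4_eq_0\<close> with the roles of a and d exchanged
  kills all d below a - (b + c + k1 + k2). At most \<open>fr b * fr c\<close> values of d remain,
  each of weight at most (3 fr a)^\<sigma>, and \<open>abs_q4_le\<close> costs another
  \<open>fr b * fr c\<close>. The loss falls on the smaller indices only, where \<sigma> \<ge> 2
  pays for it.\<close>

lemma q4_weighted_sum_le_aux:
  assumes "b \<le> a" "c \<le> a"
  shows "(\<Sum>d\<le>a + b + c + k1 + k2. \<bar>q4 a b c d\<bar> * real (fr d) ^ \<sigma>) \<le>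
    11 * 3 ^ \<sigma> * (real (fr a) ^ \<sigma> * real (fr b) ^ \<sigma> * real (fr c) ^ \<sigma>)"
proof -
  let ?s = "k1 + k2"
  define I where "I = {a - (b + c + ?s)..a + b + c + k1 + k2}"
  define B where "B = 11 * real (fr b) * real (fr c) * (3 * real (fr a)) ^ \<sigma>"
  have "(\<Sum>d\<le>a + b + c + k1 + k2. \<bar>q4 a b c d\<bar> * real (fr d) ^ \<sigma>) = (\<Sum>d\<in>I. \<bar>q4 a b c d\<bar> * real (fr d) ^ \<sigma>)"
  proof (rule sum.mono_neutral_right)
    show "\<forall>d\<in>{..a + b + c + k1 + k2} - I. \<bar>q4 a b c d\<bar> * real (fr d) ^ \<sigma> = 0"
    proof
      fix d assume "d \<in> {..a + b + c + k1 + k2} - I"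
      then have "d + b + c + k1 + k2 < a" by (auto simp: I_def)
      then have "q4 d b c a = 0" by (rule q4_eq_0)
      then have "q4 a b c d = 0" using q4_perm by metis
      then show "\<bar>q4 a b c d\<bar> * real (fr d) ^ \<sigma> = 0" by simp
    qed
  qed (auto simp: I_def)
  also have "\<dots> \<le> (\<Sum>d\<in>I. B)"
  proof (rule sum_mono)
    fix d assume "d \<in> I"
    then have "fr d \<le> 3 * fr a" using assms by (simp add: I_def fr_def)
    then have "real (fr d) \<le> 3 * real (fr a)" by (metis of_nat_le_iff of_nat_mult of_nat_numeral)
    then have "real (fr d) ^ \<sigma> \<le> (3 * real (fr a)) ^ \<sigma>" by (intro power_mono) auto
    then show "\<bar>q4 a b c d\<bar> * real (fr d) ^ \<sigma> \<le> B"
      unfolding B_def by (intro mult_mono abs_q4_le) auto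
  qed
  also have "\<dots> = real (card I) * B" by simp
  also have "\<dots> \<le> (real (fr b) * real (fr c)) * B"
  proof (rule mult_right_mono)
    have "card I \<le> 2 * (b + c + ?s) + 1" by (simp add: I_def)
    also have "\<dots> \<le> fr b * fr c" by (simp add: fr_def algebra_simps)
    finally show "real (card I) \<le> real (fr b) * real (fr c)" by (metis of_nat_le_iff of_nat_mult)
  qed (simp add: B_def)
  also have "\<dots> = 11 * 3 ^ \<sigma> * (real (fr a) ^ \<sigma> * real (fr b) ^ 2 * real (fr c) ^ 2)"
    by (simp add: B_def power_mult_distrib power2_eq_square)
  also have "\<dots> \<le> 11 * 3 ^ \<sigma> * (real (fr a) ^ \<sigma> * real (fr b) ^ \<sigma> * real (fr c) ^ \<sigma>)"
    by (intro mult_left_mono mult_mono power_increasing[OF \<sigma>_ge fr_ge_1] order_refl) auto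
  finally show ?thesis .
qed

lemma q4_weighted_sum_le:
  "(\<Sum>d\<le>a + b + c + k1 + k2. \<bar>q4 a b c d\<bar> * real (fr d) ^ \<sigma>) \<le>
    11 * 3 ^ \<sigma> * (real (fr a) ^ \<sigma> * real (fr b) ^ \<sigma> * real (fr c) ^ \<sigma>)"
proof -
  consider "b \<le> a" "c \<le> a" | "a \<le> b" "c \<le> b" | "a \<le> c" "b \<le> c" by linarith
  then show ?thesis
  proof cases
    case 1
    then show ?thesis by (rule q4_weighted_sum_le_aux)
  next
    case 2
    from q4_weighted_sum_le_aux[OF 2] show ?thesis
      by (simp only: q4_perm(1)[of b a c] add.commute[of b a] mult.commute[of "real (fr b) ^ \<sigma>"])
  next
    case 3
    have "q4 c a b d = q4 a b c d" for d using q4_perm by metis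
    moreover have "c + a + b + k1 + k2 = a + b + c + k1 + k2" by simp
    moreover have "real (fr c) ^ \<sigma> * real (fr a) ^ \<sigma> * real (fr b) ^ \<sigma> =
        real (fr a) ^ \<sigma> * real (fr b) ^ \<sigma> * real (fr c) ^ \<sigma>" by simp
    ultimately show ?thesis using q4_weighted_sum_le_aux[OF 3] by (simp only:)
  qed
qed

text \<open>The four sign pairs cancel the factor 1/4. An outgoing time frequency is at most the
  sum, hence three times the product, of the incoming ones, which costs 3^\<sigma>; the spatial
  estimate costs 3^\<sigma> once more.\<close>

lemma norm_cub_le: "norm (cub i j l) \<le> 11 * 9 ^ \<sigma>"
proof -
  let ?D = "{..snd i + snd j + snd l + k1 + k2}"
  define K where "K k = real (2 * k + 1)" for k
  define R where "R s d = wt (tidx (comb (fst i) (fst j) (fst l) s), d) / (wt i * wt j * wt l)" for s d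
  define F where "F = real (fr (snd i)) ^ \<sigma> * real (fr (snd j)) ^ \<sigma> * real (fr (snd l)) ^ \<sigma>"
  have F: "F > 0" using fr_pos by (simp add: F_def)
  have R: "R s d \<le> 3 ^ \<sigma> * (real (fr d) ^ \<sigma> / F)" "0 \<le> R s d" if "s \<in> sgns" for s d
  proof -
    let ?J = "comb (fst i) (fst j) (fst l) s" and ?KK = "K (fst i) * K (fst j) * K (fst l)"
    have KK: "?KK > 0" by (simp add: K_def)
    have "2 * int (tidx ?J) + 1 = \<bar>?J\<bar>" by (rule tidx[OF odd_comb[OF that]])
    also have "\<dots> \<le> (2 * int (fst i) + 1) + (2 * int (fst j) + 1) + (2 * int (fst l) + 1)"
      using that by (auto simp: comb_def)
    also have "\<dots> \<le> 3 * ((2 * int (fst i) + 1) * (2 * int (fst j) + 1) * (2 * int (fst l) + 1))"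
      by (simp add: algebra_simps)
    finally have "real_of_int (2 * int (tidx ?J) + 1) \<le>
        real_of_int (3 * ((2 * int (fst i) + 1) * (2 * int (fst j) + 1) * (2 * int (fst l) + 1)))"
      by (simp only: of_int_le_iff)
    then have "real (2 * tidx ?J + 1) \<le> 3 * ?KK" by (simp add: K_def add.commute)
    then have p: "real (2 * tidx ?J + 1) ^ \<sigma> \<le> 3 ^ \<sigma> * ?KK ^ \<sigma>"
      unfolding power_mult_distrib[symmetric] by (intro power_mono) auto
    have "R s d = (real (2 * tidx ?J + 1) ^ \<sigma> * real (fr d) ^ \<sigma>) / (?KK ^ \<sigma> * F)"
      by (simp add: R_def wt_def K_def F_def power_mult_distrib mult.assoc mult.left_commute mult.commute)
    also have "\<dots> \<le> (3 ^ \<sigma> * ?KK ^ \<sigma> * real (fr d) ^ \<sigma>) / (?KK ^ \<sigma> * F)"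
      using F KK by (intro divide_right_mono mult_right_mono p) auto
    also have "\<dots> = 3 ^ \<sigma> * (real (fr d) ^ \<sigma> / F)"
    proof -
      have "(3 ^ \<sigma> * q * f) / (q * F) = 3 ^ \<sigma> * (f / F)" if "0 < q" for q f using that by simp
      from this[OF zero_less_power[OF KK]] show ?thesis .
    qed
    finally show "R s d \<le> 3 ^ \<sigma> * (real (fr d) ^ \<sigma> / F)" .
    show "0 \<le> R s d" using wt_ge(2) by (simp add: R_def less_imp_le)
  qed
  have "norm (cub i j l) \<le> (\<Sum>s\<in>sgns. \<Sum>d\<in>?D. \<bar>q4 (snd i) (snd j) (snd l) d\<bar> / 4 * R s d)"
    unfolding cub_def
  proof (intro sum_norm_le)
    fix s d assume s: "s \<in> sgns"
    have "norm ((q4 (snd i) (snd j) (snd l) d / 4 * R s d) *\<^sub>R unit (tidx (comb (fst i) (fst j) (fst l) s), d))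
        \<le> \<bar>q4 (snd i) (snd j) (snd l) d / 4 * R s d\<bar> * 1"
      unfolding norm_scaleR by (intro mult_left_mono norm_unit_le) auto
    then show "norm ((q4 (snd i) (snd j) (snd l) d / 4 *
      (wt (tidx (comb (fst i) (fst j) (fst l) s), d) / (wt i * wt j * wt l))) *\<^sub>R
      unit (tidx (comb (fst i) (fst j) (fst l) s), d)) \<le> \<bar>q4 (snd i) (snd j) (snd l) d\<bar> / 4 * R s d"
      using R(2)[OF s] by (simp add: R_def[symmetric] abs_mult)
  qed
  also have "\<dots> \<le> (\<Sum>s\<in>sgns. \<Sum>d\<in>?D. \<bar>q4 (snd i) (snd j) (snd l) d\<bar> / 4 * (3 ^ \<sigma> * (real (fr d) ^ \<sigma> / F)))"
    by (intro sum_mono mult_left_mono R) auto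
  also have "\<dots> = 3 ^ \<sigma> / F * (\<Sum>d\<in>?D. \<bar>q4 (snd i) (snd j) (snd l) d\<bar> * real (fr d) ^ \<sigma>)"
    by (simp add: sum_distrib_left card_cartesian_product algebra_simps)
  also have "\<dots> \<le> 3 ^ \<sigma> / F * (11 * 3 ^ \<sigma> * F)"
    unfolding F_def by (intro mult_left_mono q4_weighted_sum_le) (simp add: less_imp_le[OF F[unfolded F_def]])
  also have "\<dots> = 11 * 9 ^ \<sigma>" using F by (simp add: power_mult_distrib[symmetric])
  finally show ?thesis .
qed

text \<open>Several sign pairs may lead to the same time frequency, hence the cardinality. The
  formula holds for every d because \<open>q4\<close> vanishes beyond the summation range of
  \<open>cub\<close>.\<close>

lemma coef_cub: "coef (cub i j l) (k, d) =
   real (card {s\<in>sgns. tidx (comb (fst i) (fst j) (fst l) s) = k}) / 4 * q4 (snd i) (snd j) (snd l) d *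
   wt (k, d) / (wt i * wt j * wt l)"
proof -
  let ?D = "{..snd i + snd j + snd l + k1 + k2}" and ?t = "\<lambda>s. tidx (comb (fst i) (fst j) (fst l) s)"
  let ?q = "q4 (snd i) (snd j) (snd l)"
  have "coef (cub i j l) (k, d) = (\<Sum>s\<in>sgns. \<Sum>d'\<in>?D. if d' = d then
      (if ?t s = k then ?q d / 4 * (wt (k, d) / (wt i * wt j * wt l)) else 0) else 0)"
    unfolding cub_def coef_sum coef_scaleR coef_unit by (intro sum.cong refl) auto
  also have "\<dots> = (\<Sum>s\<in>sgns. if ?t s = k then ?q d / 4 * (wt (k, d) / (wt i * wt j * wt l)) else 0)"
    by (intro sum.cong refl) (simp add: sum.delta q4_eq_0)
  also have "\<dots> = real (card {s\<in>sgns. ?t s = k}) * (?q d / 4 * (wt (k, d) / (wt i * wt j * wt l)))"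
    by (subst sum.inter_filter[symmetric]) auto
  finally show ?thesis by (simp add: algebra_simps)
qed

definition N :: "(nat \<times> nat) l1 \<Rightarrow>\<^sub>L (nat \<times> nat) l1 \<Rightarrow>\<^sub>L (nat \<times> nat) l1 \<Rightarrow>\<^sub>L (nat \<times> nat) l1"
  where "N = tri cub"

lemma N_unit: "N (unit i) (unit j) (unit l) = cub i j l"
  unfolding N_def by (rule tri_unit) (rule norm_cub_le)

lemma cos_product:
  "cos x * cos y * cos z = (\<Sum>s\<in>sgns. cos (x + of_int (fst s) * y + of_int (snd s) * z)) / 4" for x y z :: real
proof -
  have "(\<Sum>s\<in>sgns. cos (x + of_int (fst s) * y + of_int (snd s) * z)) =
      cos (x + y + z) + cos (x + y - z) + cos (x - y + z) + cos (x - y - z)"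
    by (simp add: sum.cartesian_product[symmetric])
  also have "\<dots> = 4 * (cos x * cos y * cos z)"
    by (simp add: cos_add cos_diff sin_add sin_diff algebra_simps)
  finally show ?thesis by simp
qed

lemma ev_cub: "ev \<omega> (cub i j l) t x = bas \<omega> t x i * cnj (bas \<omega> t x j) * bas \<omega> t x l"
proof -
  let ?D = "{..snd i + snd j + snd l + k1 + k2}" and ?J = "\<lambda>s. comb (fst i) (fst j) (fst l) s"
  let ?q = "q4 (snd i) (snd j) (snd l)" and ?w = "wt i * wt j * wt l"
  have cs: "cos (lf (tidx (?J s), d) * (\<omega> * t)) = cos (lf i * (\<omega> * t) + of_int (fst s) * (lf j * (\<omega> * t)) + of_int (snd s) * (lf l * (\<omega> * t)))"
    if "s \<in> sgns" for s d
  proof -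
    have "real_of_int (2 * int (tidx (?J s)) + 1) = \<bar>real_of_int (?J s)\<bar>"
      unfolding tidx[OF odd_comb[OF that]] by simp
    then have "real (2 * tidx (?J s) + 1) = \<bar>real_of_int (?J s)\<bar>" by simp
    then have "lf (tidx (?J s), d) = real m * \<bar>real_of_int (?J s)\<bar>"
      unfolding lf_def fst_conv of_nat_mult by (simp only:)
    then have "cos (lf (tidx (?J s), d) * (\<omega> * t)) = cos (real m * real_of_int (?J s) * (\<omega> * t))"
      by (cases "real_of_int (?J s) \<ge> 0") simp_all
    also have "real m * real_of_int (?J s) * (\<omega> * t) =
        lf i * (\<omega> * t) + of_int (fst s) * (lf j * (\<omega> * t)) + of_int (snd s) * (lf l * (\<omega> * t))"
      by (simp add: comb_def lf_def algebra_simps)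
    finally show ?thesis .
  qed
  have "ev \<omega> (cub i j l) t x = (\<Sum>s\<in>sgns. \<Sum>d\<in>?D. (?q d / 4 * (wt (tidx (?J s), d) / ?w)) *\<^sub>R bas \<omega> t x (tidx (?J s), d))"
    unfolding cub_def
    by (simp only: linear_sum[OF bounded_linear.linear[OF bounded_linear_ev]]
        linear_scale[OF bounded_linear.linear[OF bounded_linear_ev]] ev_unit)
  also have "\<dots> = (\<Sum>s\<in>sgns. \<Sum>d\<in>?D. of_real (cos (lf i * (\<omega> * t) + of_int (fst s) * (lf j * (\<omega> * t)) + of_int (snd s) * (lf l * (\<omega> * t)))
      / 4 / ?w) * (of_real (?q d) * e d x))"
  proof (intro sum.cong refl)
    fix s d assume s: "s \<in> sgns"
    show "(?q d / 4 * (wt (tidx (?J s), d) / ?w)) *\<^sub>R bas \<omega> t x (tidx (?J s), d) =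
      of_real (cos (lf i * (\<omega> * t) + of_int (fst s) * (lf j * (\<omega> * t)) + of_int (snd s) * (lf l * (\<omega> * t))) / 4 / ?w) * (of_real (?q d) * e d x)"
      unfolding bas_def cs[OF s] using wt_ge(2)[of "(tidx (?J s), d)"]
      by (simp add: scaleR_conv_of_real mult.assoc mult.left_commute)
  qed
  also have "\<dots> = of_real ((\<Sum>s\<in>sgns. cos (lf i * (\<omega> * t) + of_int (fst s) * (lf j * (\<omega> * t)) + of_int (snd s) * (lf l * (\<omega> * t)))) / 4 / ?w)
      * (\<Sum>d\<in>?D. of_real (?q d) * e d x)"
    by (simp only: sum_divide_distrib of_real_sum sum_product)
  also have "\<dots> = bas \<omega> t x i * cnj (bas \<omega> t x j) * bas \<omega> t x l"
    unfolding cos_product[symmetric] e_product[symmetric] by (simp add: bas_def)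
  finally show ?thesis .
qed

text \<open>The identity for unit vectors is extended in one argument after the other by
  \<open>bounded_linear_l1_eqI\<close>. The conjugated middle factor fits in, as only real linearity
  is required.\<close>

lemma ev_N: "ev \<omega> (N U V Y) t x = ev \<omega> U t x * cnj (ev \<omega> V t x) * ev \<omega> Y t x"
proof -
  note bl = bounded_linear_ev[of \<omega> t x]
  have e3: "ev \<omega> (N (unit i) (unit j) (unit l)) t x = (bas \<omega> t x i * cnj (bas \<omega> t x j)) * ev \<omega> (unit l) t x" for i j l
    by (simp add: N_unit ev_cub ev_unit)
  have 3: "ev \<omega> (N (unit i) (unit j) Y) t x = (bas \<omega> t x i * cnj (bas \<omega> t x j)) * ev \<omega> Y t x" for i j Y
    by (rule bounded_linear_l1_eqI[OF bounded_linear_compose[OF bl blinfun.bounded_linear_right]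
          bounded_linear_compose[OF bounded_linear_mult_right bl] e3])
  have e2: "ev \<omega> (N (unit i) (unit j) Y) t x = (bas \<omega> t x i * ev \<omega> Y t x) * cnj (ev \<omega> (unit j) t x)" for i j
    by (simp add: 3 ev_unit)
  have 2: "ev \<omega> (N (unit i) V Y) t x = (bas \<omega> t x i * ev \<omega> Y t x) * cnj (ev \<omega> V t x)" for i V
    by (rule bounded_linear_l1_eqI[OF bounded_linear_compose[OF bl
            bounded_linear_compose[OF blinfun.bounded_linear_left blinfun.bounded_linear_right]]
          bounded_linear_compose[OF bounded_linear_mult_right bounded_linear_compose[OF bounded_linear_cnj bl]] e2])
  have e1: "ev \<omega> (N (unit i) V Y) t x = (cnj (ev \<omega> V t x) * ev \<omega> Y t x) * ev \<omega> (unit i) t x" for i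
    by (simp add: 2 ev_unit)
  have "ev \<omega> (N U V Y) t x = (cnj (ev \<omega> V t x) * ev \<omega> Y t x) * ev \<omega> U t x"
    by (rule bounded_linear_l1_eqI[OF bounded_linear_compose[OF bl
            bounded_linear_compose[OF blinfun.bounded_linear_left
              bounded_linear_compose[OF blinfun.bounded_linear_left blinfun.bounded_linear_right]]]
          bounded_linear_compose[OF bounded_linear_mult_right bl] e1])
  then show ?thesis by simp
qed

lemma ev_cubic: "of_real ((norm (ev \<omega> U t x))\<^sup>2) * ev \<omega> U t x = ev \<omega> (N U U U) t x"
  unfolding ev_N complex_norm_square ..

end

section \<open>Membership in the Sobolev spaces\<close>

lemma integral_cos_cis:
  assumes "0 < T" "0 < n"
  shows "(LINT t:{0..T}|lborel. of_real (cos (2 * pi * real n * t / T)) * cis (- (2 * pi * of_int l * t / T)))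
    = (if \<bar>l\<bar> = int n then of_real (T / 2) else 0)"
proof -
  define c where "c = 2 * pi / T"
  have I: "(LINT t:{0..T}|lborel. cis (of_int j * c * t)) = (if j = 0 then of_real T else 0)" for j :: int
  proof (cases "j = 0")
    case True
    then show ?thesis using assms by (simp add: set_lebesgue_integral_def scaleR_conv_of_real)
  next
    case False
    define w where "w = \<i> * of_real (of_int j * c)"
    have "w \<noteq> 0" using False assms by (simp add: w_def c_def)
    have cis: "cis (of_int j * c * t) = exp (w * of_real t)" for t
      by (simp add: cis_conv_exp w_def algebra_simps)
    have "(LINT t:{0..T}|lborel. exp (w * of_real t)) = exp (w * of_real T) / w - exp (w * of_real 0) / w"
      unfolding set_lebesgue_integral_def
    proof (rule integral_FTC_Icc)
      show "0 \<le> T" using assms by simp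
      show "((\<lambda>t. exp (w * of_real t) / w) has_vector_derivative exp (w * of_real t)) (at t within {0..T})" for t
        using \<open>w \<noteq> 0\<close> by (auto intro!: has_vector_derivative_real_field derivative_eq_intros)
      show "continuous_on {0..T} (\<lambda>t. exp (w * of_real t))" by (intro continuous_intros)
    qed
    moreover have "exp (w * of_real T) = 1"
    proof -
      have "w * of_real T = of_int j * (of_real (2 * pi) * \<i>)" using assms by (simp add: w_def c_def)
      then show ?thesis by (simp add: exp_eq_1) 
    qed
    ultimately show ?thesis using False by (simp add: cis)
  qed
  have si: "set_integrable lborel {0..T} (\<lambda>t. cis (of_int j * c * t))" for j :: int
    by (rule borel_integrable_atLeastAtMost') (auto intro!: continuous_intros simp: cis_conv_exp)
  have eq: "of_real (cos (2 * pi * real n * t / T)) * cis (- (2 * pi * of_int l * t / T)) =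
      (cis (of_int (int n - l) * c * t) + cis (of_int (- int n - l) * c * t)) * of_real (1 / 2)" for t
  proof -
    have "of_real (cos x) * cis y = (cis (x + y) + cis (- x + y)) * of_real (1 / 2)" for x y
      by (simp add: complex_eq_iff cos_add sin_add cos_diff sin_diff)
    note cp = this[of "2 * pi * real n * t / T" "- (2 * pi * of_int l * t / T)"]
    have a: "2 * pi * real n * t / T + - (2 * pi * of_int l * t / T) = of_int (int n - l) * c * t"
      "- (2 * pi * real n * t / T) + - (2 * pi * of_int l * t / T) = of_int (- int n - l) * c * t"
      using assms by (simp_all add: c_def field_simps)
    show ?thesis using cp unfolding a .
  qed
  have "(LINT t:{0..T}|lborel. of_real (cos (2 * pi * real n * t / T)) * cis (- (2 * pi * of_int l * t / T)))
      = ((if int n - l = 0 then of_real T else 0) + (if - int n - l = 0 then of_real T else 0)) * of_real (1 / 2)"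
    unfolding eq by (subst set_integral_mult_left, subst set_integral_add(2)[OF si si], unfold I, rule refl)
  then show ?thesis using assms by (auto split: if_splits)
qed

lemma has_sum_finite_sum:
  fixes f :: "'a \<Rightarrow> 'b \<Rightarrow> real"
  assumes "finite F" "\<And>l. (f l has_sum v l) A"
  shows "((\<lambda>i. \<Sum>l\<in>F. f l i) has_sum (\<Sum>l\<in>F. v l)) A"
  using assms(1) by (induction F) (auto intro: has_sum_add assms(2))

lemma has_sum_finite_sums_le:
  fixes f :: "'a \<Rightarrow> real"
  assumes "\<And>x. 0 \<le> f x" "\<And>F. finite F \<Longrightarrow> sum f F \<le> B"
  shows "f summable_on UNIV" "infsum f UNIV \<le> B"
proof -
  show s: "f summable_on UNIV"
    by (rule nonneg_bdd_above_summable_on) (use assms in \<open>auto intro!: bdd_aboveI2\<close>)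
  show "infsum f UNIV \<le> B" by (rule infsum_le_finite_sums[OF s]) (use assms in auto)
qed

lemma L2_norm_le:
  assumes f: "continuous_on UNIV f" and B: "\<And>x. norm (f x) \<le> B"
  shows "L2_norm f \<le> B * sqrt (measure S3_measure UNIV)"
proof -
  have B0: "0 \<le> B" using order_trans[OF norm_ge_zero B] .
  have "(LINT x|S3_measure. (norm (f x))\<^sup>2) \<le> (LINT x|S3_measure. B\<^sup>2)"
    using B by (intro integral_mono integrable_continuous_S3) (auto intro!: continuous_intros f power_mono)
  also have "\<dots> = B\<^sup>2 * measure S3_measure UNIV" by simp
  finally have "L2_norm f \<le> sqrt (B\<^sup>2 * measure S3_measure UNIV)" unfolding L2_norm_def by simp
  then show ?thesis using B0 by (simp add: real_sqrt_mult)
qed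

lemma L2_norm_cmult: "L2_norm (\<lambda>x. c * f x) = norm c * L2_norm f"
  by (simp add: L2_norm_def norm_mult power_mult_distrib real_sqrt_mult)

lemma (in hopf) ex_e_nz: "\<exists>x. e a x \<noteq> 0"
proof -
  have "\<not> {0<..<1::real} \<subseteq> {t. poly (P a) t = 0}"
  proof
    assume "{0<..<1::real} \<subseteq> {t. poly (P a) t = 0}"
    from finite_subset[OF this poly_roots_finite[OF P_nz[of a]]] show False
      using infinite_Ioo[of "0::real" 1] by simp
  qed
  then obtain t where t: "0 < t" "t < 1" "poly (P a) t \<noteq> 0" by (auto simp: subset_eq)
  define \<eta> where "\<eta> = arcsin (sqrt t)"
  have "- 1 \<le> sqrt t" "sqrt t \<le> 1" using t by (auto intro: order_trans[of _ 0])
  then have sin: "sin \<eta> = sqrt t" by (simp add: \<eta>_def)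
  have \<eta>: "0 < \<eta>" "\<eta> < pi / 2"
    using t arcsin_less_mono[of 0 "sqrt t"] arcsin_less_mono[of "sqrt t" 1] by (simp_all add: \<eta>_def)
  then have "cos \<eta> > 0" by (intro cos_gt_zero_pi) auto
  then have "emode (P a) (hopf \<eta> 0 0) \<noteq> 0"
    using \<eta> t by (simp add: emode_hopf sin)
  then show ?thesis unfolding e_def by blast
qed

text \<open>A continuous function with norm 0 vanishes almost everywhere; if it were nonzero at a
  point, the part of the ball over the open set where it is nonzero would be open, nonempty and of
  Lebesgue measure 0.\<close>

lemma (in hopf) L2_norm_e_pos: "0 < L2_norm (e a)"
proof (rule ccontr)
  have ce: "continuous_on UNIV (e a)"
    unfolding e_def by (rule smooth_S3_continuous[OF emode_laplace(1)])
  have i: "integrable S3_measure (\<lambda>x. (norm (e a x))\<^sup>2)"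
    by (rule integrable_continuous_S3) (intro continuous_intros ce)
  assume "\<not> 0 < L2_norm (e a)"
  then have "\<not> 0 < (LINT x|S3_measure. (norm (e a x))\<^sup>2)" by (simp add: L2_norm_def)
  moreover have "0 \<le> (LINT x|S3_measure. (norm (e a x))\<^sup>2)" by (rule Bochner_Integration.integral_nonneg) simp
  ultimately have "(LINT x|S3_measure. (norm (e a x))\<^sup>2) = 0" by linarith
  then have "AE x in S3_measure. e a x = 0"
    using integral_nonneg_eq_0_iff_AE[OF i] by simp
  moreover define X where "X = {x. e a x \<noteq> 0}"
  have oX: "open X" unfolding X_def by (rule open_Collect_neq[OF ce continuous_on_const])
  ultimately have "emeasure S3_measure X = 0"
    using AE_iff_measurable[of X S3_measure "\<lambda>x. e a x = 0"] by (simp add: X_def)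
  then have n: "emeasure lborel (radial_proj -` X \<inter> (ball 0 1 - {0})) = 0"
    using emeasure_S3[of X] oX by simp
  have "open ((- {0}) \<inter> radial_proj -` X)"
    using continuous_on_open_vimage[OF open_Compl_0] continuous_on_radial_proj oX by (metis Int_commute)
  then have o: "open (ball 0 1 \<inter> ((- {0}) \<inter> radial_proj -` X))" by (rule open_Int[OF open_ball])
  have eq: "ball 0 1 \<inter> ((- {0}) \<inter> radial_proj -` X) = radial_proj -` X \<inter> (ball 0 1 - {0})" by auto
  obtain x where "e a x \<noteq> 0" using ex_e_nz by blast
  then have "(1/2) *\<^sub>R Rep_S3 x \<in> ball 0 1 \<inter> ((- {0}) \<inter> radial_proj -` X)"
    by (simp add: X_def radial_proj_scale)
  then have "\<not> negligible (ball 0 1 \<inter> ((- {0}) \<inter> radial_proj -` X))"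
    using open_not_negligible[OF o] by blast
  moreover have "ball 0 1 \<inter> ((- {0}) \<inter> radial_proj -` X) \<in> null_sets lborel"
    using n o unfolding eq by (auto simp: null_sets_def)
  ultimately show False
    using negligible_iff_null_sets null_sets_completionI by blast
qed

lemma sets_time_S3: "sets (lborel \<Otimes>\<^sub>M S3_measure) = sets (borel :: (real \<times> S3) measure)"
proof -
  have "sets (lborel \<Otimes>\<^sub>M S3_measure) = sets (borel \<Otimes>\<^sub>M (borel :: S3 measure) :: (real \<times> S3) measure)"
    by (rule sets_pair_measure_cong) simp_all
  then show ?thesis by (simp only: borel_prod)
qed

lemma borel_measurable_time_S3:
  fixes f :: "real \<times> S3 \<Rightarrow> 'b::topological_space"
  shows "continuous_on UNIV f \<Longrightarrow> f \<in> borel_measurable (lborel \<Otimes>\<^sub>M S3_measure)"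
  unfolding measurable_cong_sets[OF sets_time_S3 refl] by (rule borel_measurable_continuous_onI)

lemma emeasure_time_S3: "emeasure (lborel \<Otimes>\<^sub>M S3_measure) ({a..b :: real} \<times> UNIV) < \<infinity>"
  by (subst S3.emeasure_pair_measure_Times)
     (auto simp: ennreal_mult_less_top S3.emeasure_eq_measure emeasure_lborel_Icc_eq)

lemma sum_squares_le_square_sum:
  fixes f :: "'c \<Rightarrow> real"
  assumes "finite F" "\<And>x. 0 \<le> f x"
  shows "(\<Sum>x\<in>F. (f x)\<^sup>2) \<le> (sum f F)\<^sup>2"
proof -
  have "(\<Sum>x\<in>F. (f x)\<^sup>2) \<le> (\<Sum>x\<in>F. f x * sum f F)"
    unfolding power2_eq_square using assms by (intro sum_mono mult_left_mono member_le_sum) auto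
  then show ?thesis by (simp add: sum_distrib_right[symmetric] power2_eq_square)
qed

text \<open>The weight exponent dominates r in time, and s in space with one unit to spare, which
  pays for the growth of the sup norm of \<open>e a\<close>.\<close>

locale sobolev = wave +
  fixes r s :: real
  assumes r: "0 < r" "r \<le> real \<sigma>" and s: "0 < s" "s + 1 \<le> real \<sigma>"
begin

definition lfi :: "nat \<times> nat \<Rightarrow> int" where "lfi i = int (m * (2 * fst i + 1))"

lemma lfi_pos: "0 < lfi i" unfolding lfi_def of_nat_0_less_iff using m_pos by simp

definition tc :: "int \<Rightarrow> nat \<times> nat \<Rightarrow> real" where "tc l i = (if lfi i = \<bar>l\<bar> then 1 / 2 else 0)"

text \<open>The l-th Fourier coefficient in time of \<open>ev\<close> as an explicit series: a
  cosine contributes 1/2 at its frequency and at the opposite one. \<open>tfb\<close> is the Bessel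
  potential of this series, each mode being multiplied by the power s/2 of its eigenvalue
  (fr)^2.\<close>

definition tf :: "int \<Rightarrow> (nat \<times> nat) l1 \<Rightarrow> S3 \<Rightarrow> complex"
  where "tf l U x = lin (\<lambda>i. (tc l i / wt i) *\<^sub>R e (snd i) x) U"

definition tfb :: "int \<Rightarrow> (nat \<times> nat) l1 \<Rightarrow> S3 \<Rightarrow> complex"
  where "tfb l U x = lin (\<lambda>i. (tc l i / wt i * real (fr (snd i)) powr s) *\<^sub>R e (snd i) x) U"

lemma tf_bound: "norm ((tc l i / wt i) *\<^sub>R e (snd i) x) \<le> 4"
proof -
  let ?f = "real (fr (snd i))"
  have "norm ((tc l i / wt i) *\<^sub>R e (snd i) x) = tc l i / wt i * cmod (e (snd i) x)"
    using wt_ge(2)[of i] by (simp add: tc_def)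
  also have "\<dots> \<le> 1 / wt i * (4 * ?f)"
    using wt_ge(2)[of i] norm_e_le by (intro mult_mono divide_right_mono) (auto simp: tc_def)
  also have "\<dots> \<le> 1 / wt i * (4 * ?f\<^sup>2)"
    using wt_ge(2)[of i] self_le_power[OF fr_ge_1, of 2 "snd i"] by (intro mult_left_mono) auto
  also have "\<dots> \<le> 4" using wt_ge(2,3)[of i] by (simp add: field_simps)
  finally show ?thesis .
qed

text \<open>The decay in the time index is kept, since it has to absorb the weight of order r when
  the Fourier coefficients are summed.\<close>

lemma tfb_bound:
  "norm ((tc l i / wt i * real (fr (snd i)) powr s) *\<^sub>R e (snd i) x) \<le> 4 * real (2 * fst i + 1) powr (- real \<sigma>)"
proof -
  let ?f = "real (fr (snd i))" and ?K = "real (2 * fst i + 1)"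
  have f: "?f \<ge> 1" "?f > 0" "?K > 0" using fr_ge_1 fr_pos by auto
  have "norm ((tc l i / wt i * ?f powr s) *\<^sub>R e (snd i) x) = tc l i / wt i * ?f powr s * cmod (e (snd i) x)"
    using wt_ge(2)[of i] by (simp add: tc_def)
  also have "\<dots> \<le> 1 / wt i * ?f powr s * (4 * ?f)"
    using wt_ge(2)[of i] norm_e_le by (intro mult_mono divide_right_mono mult_right_mono) (auto simp: tc_def)
  also have "\<dots> = 4 * (?f powr (s + 1)) / wt i" using f by (simp add: powr_add)
  also have "\<dots> \<le> 4 * (?f powr real \<sigma>) / wt i"
    using wt_ge(2)[of i] s f by (intro divide_right_mono mult_left_mono powr_mono) auto
  also have "\<dots> = 4 * ?K powr (- real \<sigma>)"
    using f by (simp add: wt_def powr_realpow powr_minus field_simps)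
  finally show ?thesis .
qed

lemma tfb_bound': "norm ((tc l i / wt i * real (fr (snd i)) powr s) *\<^sub>R e (snd i) x) \<le> 4"
proof -
  have "real (2 * fst i + 1) powr (- real \<sigma>) \<le> 1" by (simp add: powr_minus powr_realpow field_simps)
  then show ?thesis using tfb_bound[of l i x] by linarith
qed

lemma continuous_on_lin:
  fixes b :: "nat \<times> nat \<Rightarrow> S3 \<Rightarrow> complex"
  assumes b: "\<And>i x. norm (b i x) \<le> B" and c: "\<And>i. continuous_on UNIV (b i)"
  shows "continuous_on UNIV (\<lambda>x. lin (\<lambda>i. b i x) U)"
proof -
  have lim: "uniform_limit UNIV (\<lambda>X x. \<Sum>i\<in>X. coef U i *\<^sub>R b i x) (\<lambda>x. \<Sum>\<^sub>\<infinity>i. coef U i *\<^sub>R b i x) (finite_subsets_at_top UNIV)"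
  proof (rule Weierstrass_m_test_general[where M = "\<lambda>i. \<bar>coef U i\<bar> * B"])
    show "norm (coef U i *\<^sub>R b i x) \<le> \<bar>coef U i\<bar> * B" for i x
      using b by (simp add: mult_left_mono)
    show "(\<lambda>i. \<bar>coef U i\<bar> * B) summable_on UNIV" by (intro summable_on_cmult_left coef_summable)
  qed
  have "continuous_on UNIV (\<lambda>x. \<Sum>\<^sub>\<infinity>i. coef U i *\<^sub>R b i x)"
    by (rule uniform_limit_theorem[OF _ lim]) (auto intro!: always_eventually continuous_on_sum continuous_on_scaleR c)
  then show ?thesis unfolding lin_def .
qed

lemma continuous_on_tf: "continuous_on UNIV (tf l U)"
  unfolding tf_def[abs_def] by (rule continuous_on_lin[OF tf_bound]) (intro continuous_on_scaleR continuous_on_e continuous_on_const)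

lemma continuous_on_tfb: "continuous_on UNIV (tfb l U)"
  unfolding tfb_def[abs_def] by (rule continuous_on_lin[OF tfb_bound']) (intro continuous_on_scaleR continuous_on_e continuous_on_const)

lemma bounded_linear_integral_S3:
  fixes g :: "S3 \<Rightarrow> complex" and f :: "'i l1 \<Rightarrow> S3 \<Rightarrow> complex"
  assumes g: "continuous_on UNIV g" and f: "\<And>U. continuous_on UNIV (f U)"
    and lin: "\<And>x. bounded_linear (\<lambda>U. f U x)" and le: "\<And>U x. norm (f U x) \<le> B * norm U"
  shows "bounded_linear (\<lambda>U. LINT x|S3_measure. f U x * g x)"
proof -
  have i: "integrable S3_measure (\<lambda>x. f U x * g x)" for U
    by (intro integrable_continuous_S3 continuous_on_mult f g)
  obtain G where G: "0 < G" "\<And>x. norm (g x) \<le> G" using continuous_S3_bounded[OF g] by blast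
  show ?thesis
  proof (rule bounded_linear_intro[where K = "B * G * measure S3_measure UNIV"])
    show "(LINT x|S3_measure. f (U + V) x * g x) = (LINT x|S3_measure. f U x * g x) + (LINT x|S3_measure. f V x * g x)" for U V
      using i by (simp add: linear_add[OF bounded_linear.linear[OF lin]] distrib_right)
    show "(LINT x|S3_measure. f (c *\<^sub>R U) x * g x) = c *\<^sub>R (LINT x|S3_measure. f U x * g x)" for c U
      using i by (simp add: linear_scale[OF bounded_linear.linear[OF lin]])
    fix U
    have "norm (LINT x|S3_measure. f U x * g x) \<le> (LINT x|S3_measure. norm (f U x * g x))"
      by (rule integral_norm_bound)
    also have "\<dots> \<le> (LINT x|S3_measure. B * norm U * G)"
    proof (rule integral_mono)
      fix x
      have "0 \<le> B * norm U" using order_trans[OF norm_ge_zero le] .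
      then show "norm (f U x * g x) \<le> B * norm U * G"
        unfolding norm_mult using le[of U x] G by (intro mult_mono) auto
    qed (use i in auto)
    finally show "norm (LINT x|S3_measure. f U x * g x) \<le> norm U * (B * G * measure S3_measure UNIV)"
      by (simp add: algebra_simps)
  qed
qed

text \<open>On a single mode there are two cases: either lam is its eigenvalue and both sides carry
  the same power, or the mode is orthogonal to the test eigenfunction and both sides vanish.\<close>

lemma is_bessel_tf: "is_bessel s (tf l U) (tfb l U)"
  unfolding is_bessel_def
proof (intro conjI allI impI)
  show "tfb l U \<in> L2_S3" by (rule continuous_in_L2[OF continuous_on_tfb])
  fix lam f assume f: "eigenfunction lam f"
  then have cf: "continuous_on UNIV (\<lambda>x. cnj (f x))"
    using smooth_S3_continuous[OF smooth_S3_cnj] by (auto simp: eigenfunction_def)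
  have bl1: "bounded_linear (\<lambda>U. LINT x|S3_measure. tfb l U x * cnj (f x))"
    by (rule bounded_linear_integral_S3[OF cf continuous_on_tfb, where B = 4])
       (simp_all only: tfb_def bounded_linear_lin[OF tfb_bound'] norm_lin_le[OF tfb_bound'])
  have bl2: "bounded_linear (\<lambda>U. LINT x|S3_measure. tf l U x * cnj (f x))"
    by (rule bounded_linear_integral_S3[OF cf continuous_on_tf, where B = 4])
       (simp_all only: tf_def bounded_linear_lin[OF tf_bound] norm_lin_le[OF tf_bound])
  have unit: "(LINT x|S3_measure. tfb l (unit i) x * cnj (f x)) =
      of_real ((lam + 1) powr (s / 2)) * (LINT x|S3_measure. tf l (unit i) x * cnj (f x))" for i
  proof -
    have 1: "tfb l (unit i) x = of_real (real (fr (snd i)) powr s) * tf l (unit i) x" for x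
      unfolding tfb_def tf_def lin_unit[OF tfb_bound'] lin_unit[OF tf_bound] by (simp add: scaleR_conv_of_real)
    show ?thesis
    proof (cases "lam = (real (fr (snd i)))\<^sup>2 - 1")
      case True
      have sq: "y\<^sup>2 powr (s / 2) = y powr s" if "0 < y" for y :: real
      proof -
        have "y\<^sup>2 = y powr real 2" by (rule powr_realpow[OF that, symmetric])
        then show ?thesis by (simp only: powr_powr) simp
      qed
      have "(lam + 1) powr (s / 2) = real (fr (snd i)) powr s"
        using True sq[of "real (fr (snd i))"] fr_pos[of "snd i"] by simp
      then show ?thesis by (simp add: 1 mult.assoc)
    next
      case False
      have "(LINT x|S3_measure. e (snd i) x * cnj (f x)) = 0"
        using L2_inner_eigenfunction[OF eigenfunction_e f] False by (auto simp: L2_inner_def)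
      then have "(LINT x|S3_measure. tf l (unit i) x * cnj (f x)) = 0"
        unfolding tf_def lin_unit[OF tf_bound] by (simp add: scaleR_conv_of_real mult.assoc)
      then show ?thesis by (simp add: 1 mult.assoc)
    qed
  qed
  show "L2_inner (tfb l U) f = of_real ((lam + 1) powr (s / 2)) * L2_inner (tf l U) f"
    unfolding L2_inner_def
    by (rule bounded_linear_l1_eqI[OF bl1 bounded_linear_compose[OF bounded_linear_mult_right bl2] unit])
qed

lemma tf_Hs: "tf l U \<in> Hs s" and Hs_norm_tf: "Hs_norm s (tf l U) = L2_norm (tfb l U)"
  using is_bessel_tf[of l U] continuous_in_L2[OF continuous_on_tf] Hs_norm_eq[OF is_bessel_tf]
  unfolding Hs_def by auto

lemma time_fourier_ev:
  assumes \<omega>: "0 < \<omega>"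
  shows "time_fourier (2 * pi / \<omega>) (ev \<omega> U) l x = tf l U x"
proof -
  define T where "T = 2 * pi / \<omega>"
  have T: "0 < T" using \<omega> by (simp add: T_def)
  have si: "set_integrable lborel {0..T} (\<lambda>t. ev \<omega> U t x * cis (- (2 * pi * of_int l * t / T)))" for U
    using T by (intro borel_integrable_atLeastAtMost')
       (auto intro!: continuous_intros continuous_on_ev_time simp: cis_conv_exp)
  have bl: "bounded_linear (\<lambda>U. time_fourier T (ev \<omega> U) l x)"
  proof (rule bounded_linear_intro[where K = 4])
    show "time_fourier T (ev \<omega> (U + V)) l x = time_fourier T (ev \<omega> U) l x + time_fourier T (ev \<omega> V) l x" for U V
      unfolding time_fourier_def using si T by (simp add: linear_add[OF linear_ev] distrib_right set_integral_add add_divide_distrib)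
    show "time_fourier T (ev \<omega> (c *\<^sub>R U)) l x = c *\<^sub>R time_fourier T (ev \<omega> U) l x" for c U
      unfolding time_fourier_def using T by (simp add: ev_scaleR mult.assoc scaleR_conv_of_real)
    fix U
    have "norm (LINT t:{0..T}|lborel. ev \<omega> U t x * cis (- (2 * pi * of_int l * t / T))) \<le> (LINT t:{0..T}|lborel. norm (ev \<omega> U t x * cis (- (2 * pi * of_int l * t / T))))"
      by (rule set_integral_norm_bound[OF si])
    also have "\<dots> \<le> (LINT t:{0..T}|lborel. 4 * norm U)"
    proof (rule set_integral_mono)
      show "set_integrable lborel {0..T} (\<lambda>t. norm (ev \<omega> U t x * cis (- (2 * pi * of_int l * t / T))))"
        by (rule set_integrable_norm[OF si])
      show "set_integrable lborel {0..T} (\<lambda>t. 4 * norm U)"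
        by (rule borel_integrable_atLeastAtMost') simp
    qed (simp add: norm_mult norm_ev_le)
    also have "\<dots> = T * (4 * norm U)" using T by (simp add: set_lebesgue_integral_def)
    finally show "norm (time_fourier T (ev \<omega> U) l x) \<le> norm U * 4"
      unfolding time_fourier_def using T by (simp add: norm_divide field_simps)
  qed
  have unit: "time_fourier T (ev \<omega> (unit i)) l x = tf l (unit i) x" for i
  proof -
    define n where "n = m * (2 * fst i + 1)"
    have n: "0 < n" using m_pos by (simp add: n_def)
    have "bas \<omega> t x i * cis (- (2 * pi * of_int l * t / T)) =
        (of_real (cos (2 * pi * real n * t / T)) * cis (- (2 * pi * of_int l * t / T))) * (e (snd i) x / of_real (wt i))" for t
    proof -
      have "lf i * (\<omega> * t) = 2 * pi * real n * t / T" using \<omega> by (simp add: T_def lf_def n_def)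
      then show ?thesis by (simp add: bas_def)
    qed
    then have "time_fourier T (ev \<omega> (unit i)) l x =
        (if \<bar>l\<bar> = int n then of_real (T / 2) else 0) * (e (snd i) x / of_real (wt i)) / of_real T"
      unfolding time_fourier_def ev_unit by (simp only: set_integral_mult_left integral_cos_cis[OF T n])
    then show ?thesis
      unfolding tf_def lin_unit[OF tf_bound] using T
      by (auto simp: tc_def lfi_def n_def scaleR_conv_of_real)
  qed
  have blt: "bounded_linear (\<lambda>U. tf l U x)" unfolding tf_def by (rule bounded_linear_lin[OF tf_bound])
  show ?thesis unfolding T_def[symmetric] by (rule bounded_linear_l1_eqI[OF bl blt unit])
qed

definition part :: "int \<Rightarrow> (nat \<times> nat) l1 \<Rightarrow> (nat \<times> nat) l1"
  where "part l = diag (\<lambda>i. if lfi i = \<bar>l\<bar> then 1 else 0)"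

text \<open>A mode belongs to exactly two values of l, its frequency and the negative of it; hence
  the factor 2.\<close>

lemma sum_norm_part_le:
  assumes "finite F"
  shows "(\<Sum>l\<in>F. norm (part l U)) \<le> 2 * norm U"
proof -
  have c: "\<bar>coef (part l U) i\<bar> = (if lfi i = \<bar>l\<bar> then \<bar>coef U i\<bar> else 0)" for l i
    unfolding part_def by (subst coef_diag[where B = 1]) auto
  have hs: "((\<lambda>i. \<Sum>l\<in>F. \<bar>coef (part l U) i\<bar>) has_sum (\<Sum>l\<in>F. norm (part l U))) UNIV"
    unfolding norm_l1_def by (rule has_sum_finite_sum[OF assms]) (rule has_sum_infsum[OF coef_summable])
  then have "(\<Sum>l\<in>F. norm (part l U)) = (\<Sum>\<^sub>\<infinity>i. \<Sum>l\<in>F. \<bar>coef (part l U) i\<bar>)"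
    by (simp add: infsumI)
  also have "\<dots> \<le> (\<Sum>\<^sub>\<infinity>i. 2 * \<bar>coef U i\<bar>)"
  proof (rule infsum_mono)
    show "(\<lambda>i. \<Sum>l\<in>F. \<bar>coef (part l U) i\<bar>) summable_on UNIV" using hs by (rule has_sum_imp_summable)
    show "(\<lambda>i. 2 * \<bar>coef U i\<bar>) summable_on UNIV" by (intro summable_on_cmult_right coef_summable)
    fix i
    have "(\<Sum>l\<in>F. \<bar>coef (part l U) i\<bar>) = (\<Sum>l\<in>F \<inter> {lfi i, - lfi i}. \<bar>coef U i\<bar>)"
      unfolding c using assms lfi_pos[of i] by (intro sum.mono_neutral_cong_right) auto
    also have "\<dots> = real (card (F \<inter> {lfi i, - lfi i})) * \<bar>coef U i\<bar>" by simp
    also have "\<dots> \<le> 2 * \<bar>coef U i\<bar>"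
    proof (rule mult_right_mono)
      have "card (F \<inter> {lfi i, - lfi i}) \<le> card {lfi i, - lfi i}" by (rule card_mono) auto
      also have "\<dots> \<le> 2" by (simp add: card_insert_if)
      finally show "real (card (F \<inter> {lfi i, - lfi i})) \<le> 2" by simp
    qed simp
    finally show "(\<Sum>l\<in>F. \<bar>coef (part l U) i\<bar>) \<le> 2 * \<bar>coef U i\<bar>" .
  qed
  also have "\<dots> = 2 * norm U" by (simp add: norm_l1_def infsum_cmult_right')
  finally show ?thesis .
qed

definition CH :: real where "CH = (1 + 4 * (real m)\<^sup>2) powr (r / 2) * 4 * sqrt (measure S3_measure UNIV)"

text \<open>Only modes with frequency |l| = m K contribute, K = 2 k + 1, and for \<omega> \<le> 2
  the time weight is at most (1 + 4 m^2)^(r/2) K^r. The factor K^(-\<sigma>) of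
  \<open>tfb_bound\<close> absorbs K^r, uniformly in \<omega>.\<close>

lemma Hs_part_le:
  assumes \<omega>: "0 < \<omega>" "\<omega> \<le> 2"
  shows "(1 + (\<omega> * of_int l)\<^sup>2) powr r * (Hs_norm s (tf l U))\<^sup>2 \<le> (CH * norm (part l U))\<^sup>2"
proof -
  have e1: "tfb l U x = tfb l (part l U) x" for x
  proof -
    have bl: "bounded_linear (\<lambda>U. tfb l U x)" unfolding tfb_def by (rule bounded_linear_lin[OF tfb_bound'])
    have blp: "bounded_linear (part l)" unfolding part_def by (rule bounded_linear_diag[where B = 1]) auto
    have "part l (unit i) = (if lfi i = \<bar>l\<bar> then 1 else 0) *\<^sub>R unit i" for i
      unfolding part_def by (rule l1_eqI, subst coef_diag[where B = 1]) (auto simp: coef_unit)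
    then have u: "tfb l (unit i) x = tfb l (part l (unit i)) x" for i
    proof (cases "lfi i = \<bar>l\<bar>")
      case False
      then have "tfb l (unit i) x = 0" unfolding tfb_def lin_unit[OF tfb_bound'] by (simp add: tc_def)
      with False \<open>part l (unit i) = _\<close> show ?thesis
        by (simp add: linear_0[OF bounded_linear.linear[OF bl]])
    qed simp
    show ?thesis by (rule bounded_linear_l1_eqI[OF bl bounded_linear_compose[OF bl blp] u])
  qed
  define w where "w = (1 + (\<omega> * of_int l)\<^sup>2) powr (r / 2)"
  define B where "B = (1 + 4 * (real m)\<^sup>2) powr (r / 2) * 4"
  have w1: "0 < 1 + (\<omega> * of_int l)\<^sup>2" by (intro add_pos_nonneg) auto
  have w: "0 < w" "(1 + (\<omega> * of_int l)\<^sup>2) powr r = w\<^sup>2"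
    using w1 by (auto simp: w_def power2_eq_square powr_add[symmetric])
  have b: "norm ((tc l i / wt i * real (fr (snd i)) powr s) *\<^sub>R e (snd i) x) \<le> B / w" for i x
  proof (cases "lfi i = \<bar>l\<bar>")
    case True
    define K where "K = real (2 * fst i + 1)"
    have K: "1 \<le> K" by (simp add: K_def)
    have "real_of_int \<bar>l\<bar> = real m * K" unfolding True[symmetric] lfi_def K_def by (simp add: algebra_simps)
    then have l2: "(real_of_int l)\<^sup>2 = (real m)\<^sup>2 * K\<^sup>2" by (metis of_int_abs power2_abs power_mult_distrib)
    have "(\<omega> * of_int l)\<^sup>2 \<le> 4 * ((real m)\<^sup>2 * K\<^sup>2)"
    proof -
      have "\<omega>\<^sup>2 \<le> 2\<^sup>2" using \<omega> by (intro power_mono) auto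
      then show ?thesis unfolding power_mult_distrib l2 by (intro mult_right_mono) auto
    qed
    moreover have "1 \<le> K\<^sup>2" using K by simp
    ultimately have "1 + (\<omega> * of_int l)\<^sup>2 \<le> (1 + 4 * (real m)\<^sup>2) * K\<^sup>2" by (simp add: algebra_simps)
    then have "w \<le> ((1 + 4 * (real m)\<^sup>2) * K\<^sup>2) powr (r / 2)"
      unfolding w_def using w1 r by (intro powr_mono2) auto
    also have "\<dots> = (1 + 4 * (real m)\<^sup>2) powr (r / 2) * K powr r"
      using K by (simp add: powr_mult powr_powr powr_realpow[symmetric] del: powr_numeral)
    also have "\<dots> \<le> (1 + 4 * (real m)\<^sup>2) powr (r / 2) * K powr real \<sigma>"
      using K r by (intro mult_left_mono powr_mono) auto
    finally have "w * (4 * K powr (- real \<sigma>)) \<le> B / 4 * K powr real \<sigma> * (4 * K powr (- real \<sigma>))"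
      unfolding B_def by (intro mult_right_mono) auto
    also have "\<dots> = B" using K by (simp add: powr_minus)
    finally have "4 * K powr (- real \<sigma>) \<le> B / w" using w by (simp add: field_simps)
    then show ?thesis using tfb_bound[of l i x] unfolding K_def by linarith
  next
    case False
    then show ?thesis using w by (simp add: tc_def B_def)
  qed
  have "norm (tfb l U x) \<le> B / w * norm (part l U)" for x
    by (subst e1, unfold tfb_def, rule norm_lin_le[OF b])
  then have "L2_norm (tfb l U) \<le> B / w * norm (part l U) * sqrt (measure S3_measure UNIV)"
    by (rule L2_norm_le[OF continuous_on_tfb])
  then have "w * Hs_norm s (tf l U) \<le> w * (B / w * norm (part l U) * sqrt (measure S3_measure UNIV))"
    unfolding Hs_norm_tf using w by (intro mult_left_mono) auto
  also have "\<dots> = CH * norm (part l U)" using w by (simp add: CH_def B_def)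
  finally have "(w * Hs_norm s (tf l U))\<^sup>2 \<le> (CH * norm (part l U))\<^sup>2"
    using w by (intro power_mono mult_nonneg_nonneg) (auto simp: Hs_norm_tf L2_norm_def)
  then show ?thesis unfolding w(2) by (simp add: power_mult_distrib)
qed

lemma CH_nonneg: "0 \<le> CH" by (simp add: CH_def)

lemma ev_periodic_nat:
  assumes "\<omega> \<noteq> 0"
  shows "ev \<omega> U (t + 2 * pi / \<omega>) x = ev \<omega> U t x"
proof -
  have "ev \<omega> U (t + real n * (2 * pi / \<omega> / real m)) x = ev \<omega> U t x" for n
  proof (induction n)
    case (Suc n)
    have "t + real (Suc n) * (2 * pi / \<omega> / real m) = (t + real n * (2 * pi / \<omega> / real m)) + 2 * pi / \<omega> / real m"
      by (simp only: of_nat_Suc distrib_right)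
    then show ?case using Suc ev_periodic[OF assms] by (simp only:)
  qed simp
  from this[of m] show ?thesis using m_pos by simp
qed

lemma HrHs_ev:
  assumes \<omega>: "1 \<le> \<omega>" "\<omega> \<le> 2"
  shows "ev \<omega> U \<in> HrHs (2 * pi / \<omega>) r s"
    and "HrHs_norm (2 * pi / \<omega>) r s (ev \<omega> U) \<le> 2 * CH * sqrt (2 * pi) * norm U"
proof -
  define T where "T = 2 * pi / \<omega>"
  have T: "0 < T" "T \<le> 2 * pi" using \<omega> by (simp_all add: T_def field_simps)
  have tfeq: "time_fourier T (ev \<omega> U) l = tf l U" for l
    by (rule ext) (use time_fourier_ev[of \<omega> U l] \<omega> in \<open>simp add: T_def\<close>)
  have Tl: "2 * pi * of_int l / T = \<omega> * of_int l" for l using \<omega> by (simp add: T_def)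
  define f where "f l = (1 + (2 * pi * of_int l / T)\<^sup>2) powr r * (Hs_norm s (time_fourier T (ev \<omega> U) l))\<^sup>2" for l :: int
  have f0: "0 \<le> f l" for l by (simp add: f_def)
  have fle: "f l \<le> (CH * norm (part l U))\<^sup>2" for l
    unfolding f_def tfeq Tl using Hs_part_le[of \<omega> l U] \<omega> by simp
  have fsum: "sum f F \<le> (2 * CH * norm U)\<^sup>2" if F: "finite F" for F
  proof -
    have "sum f F \<le> (\<Sum>l\<in>F. (CH * norm (part l U))\<^sup>2)" by (rule sum_mono) (rule fle)
    \<comment> \<open>The l2 norm over frequencies is dominated by the l1 norm, which the
      coefficient space provides.\<close>
    also have "\<dots> \<le> (\<Sum>l\<in>F. CH * norm (part l U))\<^sup>2"
      by (rule sum_squares_le_square_sum[OF F]) (simp add: CH_nonneg)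
    also have "\<dots> \<le> (CH * (2 * norm U))\<^sup>2"
      unfolding sum_distrib_left[symmetric]
      by (intro power_mono mult_left_mono sum_norm_part_le F mult_nonneg_nonneg sum_nonneg) (auto simp: CH_nonneg)
    finally show ?thesis by (simp add: mult.commute mult.left_commute)
  qed
  note hs = has_sum_finite_sums_le[of f, OF f0 fsum]
  show "ev \<omega> U \<in> HrHs (2 * pi / \<omega>) r s"
    unfolding HrHs_def T_def[symmetric]
  proof (intro CollectI conjI allI)
    show "periodic T (ev \<omega> U)"
      unfolding periodic_def T_def using ev_periodic_nat \<omega> by simp
    show "(\<lambda>(t, x). ev \<omega> U t x) \<in> borel_measurable (lborel \<Otimes>\<^sub>M S3_measure)"
      by (rule borel_measurable_time_S3[OF continuous_on_ev])
    show "set_integrable (lborel \<Otimes>\<^sub>M S3_measure) ({0..T} \<times> UNIV) (\<lambda>(t, x). (norm (ev \<omega> U t x))\<^sup>2)"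
      unfolding set_integrable_def
    proof (rule integrableI_bounded_set_indicator[where B = "(4 * norm U)\<^sup>2"])
      show "{0..T} \<times> UNIV \<in> sets (lborel \<Otimes>\<^sub>M S3_measure)"
        by (rule pair_measureI) auto
      have "continuous_on UNIV (\<lambda>(t, x). (norm (ev \<omega> U t x))\<^sup>2)"
        using continuous_on_ev[of \<omega> U] unfolding case_prod_unfold by (intro continuous_intros)
      then show "(\<lambda>(t, x). (norm (ev \<omega> U t x))\<^sup>2) \<in> borel_measurable (lborel \<Otimes>\<^sub>M S3_measure)"
        by (rule borel_measurable_time_S3)
      have "(norm (ev \<omega> U t x))\<^sup>2 \<le> (4 * norm U)\<^sup>2" for t x
        by (rule power_mono[OF norm_ev_le norm_ge_zero])
      then show "AE p in lborel \<Otimes>\<^sub>M S3_measure. p \<in> {0..T} \<times> UNIV \<longrightarrow>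
          norm (case p of (t, x) \<Rightarrow> (norm (ev \<omega> U t x))\<^sup>2) \<le> (4 * norm U)\<^sup>2"
        by (intro AE_I2) (simp only: case_prod_unfold real_norm_def abs_power2, blast)
    qed (rule emeasure_time_S3)
    show "time_fourier T (ev \<omega> U) l \<in> Hs s" for l unfolding tfeq by (rule tf_Hs)
    show "(\<lambda>l. (1 + (2 * pi * of_int l / T)\<^sup>2) powr r * (Hs_norm s (time_fourier T (ev \<omega> U) l))\<^sup>2) summable_on UNIV"
      using hs(1) unfolding f_def .
  qed
  have "HrHs_norm T r s (ev \<omega> U) = sqrt (T * infsum f UNIV)" unfolding HrHs_norm_def f_def ..
  also have "\<dots> \<le> sqrt (2 * pi * (2 * CH * norm U)\<^sup>2)"
    using T f0 by (intro real_sqrt_le_mono mult_mono hs(2) infsum_nonneg) auto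
  also have "\<dots> = 2 * CH * sqrt (2 * pi) * norm U"
    using CH_nonneg by (simp add: real_sqrt_mult)
  finally show "HrHs_norm (2 * pi / \<omega>) r s (ev \<omega> U) \<le> 2 * CH * sqrt (2 * pi) * norm U"
    by (simp add: T_def)
qed

text \<open>An exact value is needed, since the size of the linear solution enters from both sides.
  Only the two time frequencies m and - m are present, each with half of the amplitude.\<close>

lemma HrHs_norm_single:
  assumes \<omega>: "0 < \<omega>" and a: "fr a = m"
  shows "HrHs_norm (2 * pi / \<omega>) r s (ev \<omega> (c *\<^sub>R unit (0, a))) =
    \<bar>c\<bar> / wt (0, a) * real m powr s * L2_norm (e a) * sqrt (pi / \<omega> * (1 + (\<omega> * real m)\<^sup>2) powr r)"
proof -
  define T where "T = 2 * pi / \<omega>"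
  define u where "u = \<bar>c\<bar> / wt (0, a) * real m powr s * L2_norm (e a)"
  let ?U = "c *\<^sub>R unit (0, a)"
  have u0: "0 \<le> u" using wt_ge(2)[of "(0, a)"] by (simp add: u_def L2_norm_def)
  have tfeq: "time_fourier T (ev \<omega> ?U) l = tf l ?U" for l
    by (rule ext) (use time_fourier_ev[of \<omega> ?U l] \<omega> in \<open>simp add: T_def\<close>)
  have Tl: "2 * pi * of_int l / T = \<omega> * of_int l" for l using \<omega> by (simp add: T_def)
  have tfb: "tfb l ?U = (\<lambda>x. of_real (c * (tc l (0, a) / wt (0, a) * real m powr s)) * e a x)" for l
  proof
    fix x
    have bl: "bounded_linear (\<lambda>U. tfb l U x)" unfolding tfb_def by (rule bounded_linear_lin[OF tfb_bound'])
    show "tfb l ?U x = of_real (c * (tc l (0, a) / wt (0, a) * real m powr s)) * e a x"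
      unfolding linear_scale[OF bounded_linear.linear[OF bl]]
      unfolding tfb_def lin_unit[OF tfb_bound'] by (simp add: a scaleR_conv_of_real)
  qed
  have Hs: "Hs_norm s (time_fourier T (ev \<omega> ?U) l) = (if \<bar>l\<bar> = int m then u / 2 else 0)" for l
    unfolding tfeq Hs_norm_tf tfb L2_norm_cmult norm_of_real using wt_ge(2)[of "(0, a)"]
    by (auto simp: tc_def lfi_def u_def abs_mult)
  have "(\<Sum>\<^sub>\<infinity>l::int. (1 + (2 * pi * of_int l / T)\<^sup>2) powr r * (Hs_norm s (time_fourier T (ev \<omega> ?U) l))\<^sup>2)
      = (\<Sum>\<^sub>\<infinity>l\<in>{int m, - int m}. (1 + (\<omega> * real m)\<^sup>2) powr r * (u / 2)\<^sup>2)"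
    unfolding Hs Tl by (rule infsum_cong_neutral) auto
  also have "\<dots> = 2 * ((1 + (\<omega> * real m)\<^sup>2) powr r * (u / 2)\<^sup>2)"
    using m_pos by (simp add: card_insert_if)
  finally have "HrHs_norm T r s (ev \<omega> ?U) = sqrt (T * (2 * ((1 + (\<omega> * real m)\<^sup>2) powr r * (u / 2)\<^sup>2)))"
    unfolding HrHs_norm_def by simp
  also have "\<dots> = sqrt (u\<^sup>2 * (pi / \<omega> * (1 + (\<omega> * real m)\<^sup>2) powr r))"
    by (simp add: T_def power2_eq_square)
  also have "\<dots> = u * sqrt (pi / \<omega> * (1 + (\<omega> * real m)\<^sup>2) powr r)"
    by (simp only: real_sqrt_mult real_sqrt_abs abs_of_nonneg[OF u0])
  finally show ?thesis by (simp add: T_def u_def)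
qed

end

section \<open>Weak solutions\<close>

text \<open>Integration by parts twice against a cosine. The boundary terms vanish because a
  function that is zero for |t| > R has derivatives with the same property.\<close>

lemma integral_cos_second_derivative:
  fixes g g1 g2 :: "real \<Rightarrow> complex"
  assumes g1: "\<And>t. (g has_vector_derivative g1 t) (at t)" and g2: "\<And>t. (g1 has_vector_derivative g2 t) (at t)"
    and c2: "continuous_on UNIV g2" and R: "\<And>t. R < \<bar>t\<bar> \<Longrightarrow> g t = 0"
  shows "(LINT t|lborel. of_real (cos (\<nu> * t)) * g2 t) = - of_real (\<nu>\<^sup>2) * (LINT t|lborel. of_real (cos (\<nu> * t)) * g t)"
    and "R < \<bar>t\<bar> \<Longrightarrow> g2 t = 0"
proof -
  have c: "continuous_on UNIV g" "continuous_on UNIV g1"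
    using g1 g2 by (auto intro!: continuous_at_imp_continuous_on has_vector_derivative_continuous)
  have op: "open {t. R < \<bar>t\<bar>}" by (intro open_Collect_less continuous_intros)
  have z1: "g1 t = 0" if "R < \<bar>t\<bar>" for t
  proof (rule vector_derivative_unique_at[OF g1])
    show "(g has_vector_derivative 0) (at t)"
      by (rule has_vector_derivative_transform_within_open[of "\<lambda>_. 0" _ _ "{t. R < \<bar>t\<bar>}"])
         (use op R that in auto)
  qed
  have z2: "g2 t = 0" if "R < \<bar>t\<bar>" for t
  proof (rule vector_derivative_unique_at[OF g2])
    show "(g1 has_vector_derivative 0) (at t)"
      by (rule has_vector_derivative_transform_within_open[of "\<lambda>_. 0" _ _ "{t. R < \<bar>t\<bar>}"])
         (use op z1 that in auto)
  qed
  then show "R < \<bar>t\<bar> \<Longrightarrow> g2 t = 0" .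
  define S where "S = \<bar>R\<bar> + 1"
  have S: "R < \<bar>t\<bar>" if "t \<notin> {-S..S}" for t using that by (auto simp: S_def)
  have ind: "(LINT t|lborel. f t) = (LINT t:{-S..S}|lborel. f t)" if "\<And>t. R < \<bar>t\<bar> \<Longrightarrow> f t = 0" for f :: "real \<Rightarrow> complex"
    unfolding set_lebesgue_integral_def
    by (rule Bochner_Integration.integral_cong) (use that S in \<open>auto simp: indicator_def\<close>)
  have si: "set_integrable lborel {-S..S} f" if "continuous_on UNIV f" for f :: "real \<Rightarrow> complex"
    by (rule borel_integrable_atLeastAtMost'[OF continuous_on_subset[OF that]]) simp
  \<comment> \<open>An antiderivative of cos g'' + \<nu>^2 cos g, so that both integrations by parts
    are one use of the fundamental theorem.\<close>
  define H where "H t = of_real (cos (\<nu> * t)) * g1 t + of_real (\<nu> * sin (\<nu> * t)) * g t" for t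
  define H' where "H' t = of_real (cos (\<nu> * t)) * g2 t + of_real (\<nu>\<^sup>2) * (of_real (cos (\<nu> * t)) * g t)" for t
  have cos': "((\<lambda>t. complex_of_real (cos (\<nu> * t))) has_vector_derivative of_real (- \<nu> * sin (\<nu> * t))) (at t)"
    "((\<lambda>t. complex_of_real (\<nu> * sin (\<nu> * t))) has_vector_derivative of_real (\<nu> * (\<nu> * cos (\<nu> * t)))) (at t)" for t
    by (intro has_vector_derivative_of_real; auto intro!: derivative_eq_intros simp: has_real_derivative_iff_has_vector_derivative[symmetric])+
  have dH: "(H has_vector_derivative H' t) (at t)" for t
    unfolding H_def[abs_def] H'_def
    by (rule has_vector_derivative_eq_rhs[OF has_vector_derivative_add[OF
          has_vector_derivative_mult[OF cos'(1) g2] has_vector_derivative_mult[OF cos'(2) g1]]])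
       (simp add: algebra_simps power2_eq_square)
  have cont: "continuous_on UNIV (\<lambda>t. complex_of_real (cos (\<nu> * t)) * g2 t)"
    "continuous_on UNIV (\<lambda>t. complex_of_real (cos (\<nu> * t)) * g t)"
    by (intro continuous_intros c c2)+
  have "(LINT t:{-S..S}|lborel. H' t) = H S - H (- S)"
    unfolding set_lebesgue_integral_def
  proof (rule integral_FTC_Icc)
    show "- S \<le> S" by (simp add: S_def)
    show "(H has_vector_derivative H' t) (at t within {- S..S})" for t
      by (rule has_vector_derivative_at_within[OF dH])
    show "continuous_on {- S..S} H'"
      unfolding H'_def[abs_def]
      by (rule continuous_on_subset[OF continuous_on_add[OF cont(1) continuous_on_mult_left[OF cont(2)]]]) simp
  qed
  also have "\<dots> = 0" using R[of S] R[of "- S"] z1[of S] z1[of "- S"] by (simp add: H_def S_def)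
  finally have "(LINT t:{-S..S}|lborel. of_real (cos (\<nu> * t)) * g2 t) +
      of_real (\<nu>\<^sup>2) * (LINT t:{-S..S}|lborel. of_real (cos (\<nu> * t)) * g t) = 0"
    unfolding H'_def
    by (subst (asm) set_integral_add(2)) (auto intro!: si cont continuous_on_mult_left simp del: of_real_power)
  then show "(LINT t|lborel. of_real (cos (\<nu> * t)) * g2 t) = - of_real (\<nu>\<^sup>2) * (LINT t|lborel. of_real (cos (\<nu> * t)) * g t)"
    using ind[of "\<lambda>t. of_real (cos (\<nu> * t)) * g2 t"] ind[of "\<lambda>t. of_real (cos (\<nu> * t)) * g t"] R z2
    by (simp add: eq_neg_iff_add_eq_0)
qed

interpretation time_S3: pair_sigma_finite lborel S3_measure ..

lemma integrable_time_S3: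
  fixes G :: "real \<times> S3 \<Rightarrow> complex"
  assumes G: "continuous_on UNIV G" and R: "\<And>t x. R < \<bar>t\<bar> \<Longrightarrow> G (t, x) = 0"
  shows "integrable (lborel \<Otimes>\<^sub>M S3_measure) G"
proof -
  have "compact ({-R..R} \<times> (UNIV :: S3 set))" by (intro compact_Times compact_S3) simp
  then have "bounded (G ` ({-R..R} \<times> UNIV))"
    using compact_continuous_image[OF continuous_on_subset[OF G]] compact_imp_bounded by blast
  then obtain B where B: "\<And>p. p \<in> {-R..R} \<times> UNIV \<Longrightarrow> norm (G p) \<le> B" unfolding bounded_iff by blast
  have "integrable (lborel \<Otimes>\<^sub>M S3_measure) (\<lambda>p. indicator ({-R..R} \<times> UNIV) p *\<^sub>R G p)"
  proof (rule integrableI_bounded_set_indicator[where B = B])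
    show "{-R..R} \<times> UNIV \<in> sets (lborel \<Otimes>\<^sub>M S3_measure)" by (rule pair_measureI) auto
    show "G \<in> borel_measurable (lborel \<Otimes>\<^sub>M S3_measure)" by (rule borel_measurable_time_S3[OF G])
  qed (use B emeasure_time_S3[of "-R" R] in auto)
  moreover have "indicator ({-R..R} \<times> UNIV) p *\<^sub>R G p = G p" for p
    using R[of "fst p" "snd p"] by (cases p) (auto simp: indicator_def)
  ultimately show ?thesis by simp
qed

text \<open>The time derivatives and the Laplacians of the slices in \<open>KG_operator\<close> are
  taken separately. Both are expressed by second partial derivatives of one smooth function of t and
  y, which yields joint continuity and thereby integrability.\<close>

locale test =
  fixes \<psi> :: "real \<Rightarrow> S3 \<Rightarrow> complex"
  assumes test: "test_function \<psi>"
begin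

definition \<Psi> :: "real \<times> (real ^ 4) \<Rightarrow> complex" where "\<Psi> = (\<lambda>(t, y). \<psi> t (radial_proj y))"

definition D :: "real \<times> (real ^ 4) \<Rightarrow> real \<times> (real ^ 4) \<Rightarrow> complex"
  where "D v p = frechet_derivative \<Psi> (at p) v"

definition DD :: "real \<times> (real ^ 4) \<Rightarrow> real \<times> (real ^ 4) \<Rightarrow> complex"
  where "DD v p = frechet_derivative (D v) (at p) v"

abbreviation dom :: "(real \<times> (real ^ 4)) set" where "dom \<equiv> UNIV \<times> (- {0})"

lemma Ck: "Ck_on k dom \<Psi>"
  using test unfolding test_function_def smooth_on_def \<Psi>_def by blast

lemma has_derivative_Psi: "y \<noteq> 0 \<Longrightarrow> (\<Psi> has_derivative (\<lambda>v. D v (t, y))) (at (t, y))"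
  using Ck_on_has_derivative[OF Ck[of "Suc 0"], of "(t, y)"] by (simp add: D_def)

lemma Ck_D: "v \<in> Basis \<Longrightarrow> Ck_on k dom (D v)"
  using Ck[of "Suc k"] by (simp add: D_def[abs_def])

lemma has_derivative_D:
  "v \<in> Basis \<Longrightarrow> y \<noteq> 0 \<Longrightarrow> (D v has_derivative frechet_derivative (D v) (at (t, y))) (at (t, y))"
  using Ck_on_has_derivative[OF Ck_D[of v "Suc 0"], of "(t, y)"] by simp

lemma continuous_on_DD: "v \<in> Basis \<Longrightarrow> continuous_on UNIV (\<lambda>(t, x). DD v (t, Rep_S3 x))"
proof -
  assume v: "v \<in> Basis"
  have "continuous_on dom (DD v)"
    using Ck_D[OF v, of "Suc 0"] v by (simp add: DD_def[abs_def])
  then have "continuous_on UNIV (\<lambda>p. DD v (fst p, Rep_S3 (snd p)))"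
    by (rule continuous_on_compose2)
       (auto intro!: continuous_intros continuous_on_compose2[OF continuous_on_Rep_S3[of UNIV]])
  then show ?thesis by (simp add: case_prod_unfold)
qed

lemma continuous_on_DD_time: "v \<in> Basis \<Longrightarrow> continuous_on UNIV (\<lambda>t. DD v (t, Rep_S3 x))"
proof -
  assume v: "v \<in> Basis"
  have "continuous_on UNIV (\<lambda>t. (\<lambda>(t, x). DD v (t, Rep_S3 x)) (t, x))"
    by (rule continuous_on_compose2[OF continuous_on_DD[OF v]]) (auto intro: continuous_intros)
  then show ?thesis by simp
qed

lemma continuous_on_psi: "continuous_on UNIV (\<lambda>(t, x). \<psi> t x)"
proof -
  have "continuous_on UNIV (\<lambda>p. \<Psi> (fst p, Rep_S3 (snd p)))"
    by (rule continuous_on_compose2[OF Ck_on_continuous[OF Ck]])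
       (auto intro!: continuous_intros continuous_on_compose2[OF continuous_on_Rep_S3[of UNIV]])
  then show ?thesis by (simp add: case_prod_unfold \<Psi>_def)
qed

lemma e0: "(1, 0) \<in> (Basis :: (real \<times> (real ^ 4)) set)" and eb: "b \<in> Basis \<Longrightarrow> (0 :: real, b :: real ^ 4) \<in> Basis"
  by (auto simp: Basis_prod_def)

lemma time_derivative: "((\<lambda>t. \<psi> t x) has_vector_derivative D (1, 0) (t, Rep_S3 x)) (at t)"
proof -
  have 1: "((\<lambda>t. (t, Rep_S3 x)) has_derivative (\<lambda>h. (h, 0))) (at t)" by (auto intro!: derivative_eq_intros)
  note d = has_derivative_Psi[OF Rep_S3_nz, of t x]
  have "((\<lambda>t. \<Psi> (t, Rep_S3 x)) has_derivative (\<lambda>h. D (h, 0) (t, Rep_S3 x))) (at t)"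
    using has_derivative_compose[OF 1 d] .
  moreover have "(\<lambda>h. D (h, 0) (t, Rep_S3 x)) = (\<lambda>h. h *\<^sub>R D (1, 0) (t, Rep_S3 x))"
  proof
    show "D (h, 0) (t, Rep_S3 x) = h *\<^sub>R D (1, 0) (t, Rep_S3 x)" for h
      using linear_scale[OF has_derivative_linear[OF d], of h "(1, 0)"] by simp
  qed
  ultimately show ?thesis by (simp only: has_vector_derivative_def \<Psi>_def case_prod_conv radial_proj_Rep)
qed

lemma time_derivative2: "((\<lambda>t. D (1, 0) (t, Rep_S3 x)) has_vector_derivative DD (1, 0) (t, Rep_S3 x)) (at t)"
proof -
  have 1: "((\<lambda>t. (t, Rep_S3 x)) has_derivative (\<lambda>h. (h, 0))) (at t)" by (auto intro!: derivative_eq_intros)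
  note d = has_derivative_D[OF e0 Rep_S3_nz, of t x]
  have "((\<lambda>t. D (1, 0) (t, Rep_S3 x)) has_derivative (\<lambda>h. frechet_derivative (D (1, 0)) (at (t, Rep_S3 x)) (h, 0))) (at t)"
    using has_derivative_compose[OF 1 d] .
  moreover have "(\<lambda>h. frechet_derivative (D (1, 0)) (at (t, Rep_S3 x)) (h, 0)) = (\<lambda>h. h *\<^sub>R DD (1, 0) (t, Rep_S3 x))"
  proof
    show "frechet_derivative (D (1, 0)) (at (t, Rep_S3 x)) (h, 0) = h *\<^sub>R DD (1, 0) (t, Rep_S3 x)" for h
      using linear_scale[OF has_derivative_linear[OF d], of h "(1, 0)"] by (simp add: DD_def)
  qed
  ultimately show ?thesis by (simp only: has_vector_derivative_def)
qed

lemma smooth_slice: "smooth_S3 (\<psi> t)"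
proof -
  have "Ck_on k (- {0}) (\<lambda>y. \<Psi> (t, y))" for k by (rule Ck_on_slice[OF open_Compl_0 Ck])
  then show ?thesis by (simp add: smooth_S3_def smooth_on_def \<Psi>_def)
qed

lemma laplace_slice: "laplace_beltrami (\<psi> t) x = (\<Sum>b\<in>Basis. DD (0, b) (t, Rep_S3 x))"
proof -
  have sl: "frechet_derivative (\<lambda>y. F (t, y)) (at y) b = F' (0, b)"
    if "(F has_derivative F') (at (t, y))" for F :: "real \<times> (real ^ 4) \<Rightarrow> complex" and F' y b
  proof -
    have 1: "((\<lambda>y. (t, y)) has_derivative (\<lambda>h. (0, h))) (at y)" by (auto intro!: derivative_eq_intros)
    from frechet_derivative_at[OF has_derivative_compose[OF 1 that]] show ?thesis by metis
  qed
  have 1: "frechet_derivative (\<lambda>y. \<psi> t (radial_proj y)) (at y) b = D (0, b) (t, y)" if "y \<noteq> 0" for y b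
    using sl[OF has_derivative_Psi[OF that]] by (simp add: \<Psi>_def)
  have "frechet_derivative (\<lambda>y. frechet_derivative (\<lambda>y. \<psi> t (radial_proj y)) (at y) b) (at (Rep_S3 x)) b
      = DD (0, b) (t, Rep_S3 x)" if b: "b \<in> Basis" for b
  proof -
    have d: "(\<lambda>y. D (0, b) (t, y)) differentiable (at (Rep_S3 x))"
      using Ck_on_slice[OF open_Compl_0 Ck_D[OF eb[OF b], of "Suc 0"], of t] by simp
    have "frechet_derivative (\<lambda>y. D (0, b) (t, y)) (at (Rep_S3 x)) =
        frechet_derivative (\<lambda>y. frechet_derivative (\<lambda>y. \<psi> t (radial_proj y)) (at y) b) (at (Rep_S3 x))"
      by (rule frechet_derivative_transform_within_open[OF d open_Compl_0]) (auto simp: 1)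
    moreover have "frechet_derivative (\<lambda>y. D (0, b) (t, y)) (at (Rep_S3 x)) b = DD (0, b) (t, Rep_S3 x)"
      using sl[OF has_derivative_D[OF eb[OF b] Rep_S3_nz]] by (simp add: DD_def)
    ultimately show ?thesis by (simp only:)
  qed
  then show ?thesis unfolding laplace_beltrami_def euclidean_laplacian_def by simp
qed

lemma KG_eq: "KG_operator \<psi> t x = - DD (1, 0) (t, Rep_S3 x) + laplace_beltrami (\<psi> t) x - \<psi> t x"
  unfolding KG_operator_def
  by (simp add: vector_derivative_at[OF time_derivative] vector_derivative_at[OF time_derivative2])

lemma continuous_on_laplace: "continuous_on UNIV (\<lambda>(t, x). laplace_beltrami (\<psi> t) x)"
  unfolding laplace_slice case_prod_unfold
  using continuous_on_DD[OF eb] by (intro continuous_on_sum) (simp add: case_prod_unfold)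

lemma support:
  obtains R where "\<And>t x. R < \<bar>t\<bar> \<Longrightarrow> \<psi> t x = 0" "\<And>t x. R < \<bar>t\<bar> \<Longrightarrow> DD (1, 0) (t, Rep_S3 x) = 0"
    "\<And>t x. R < \<bar>t\<bar> \<Longrightarrow> laplace_beltrami (\<psi> t) x = 0"
proof -
  obtain R where R: "\<And>t x. R < \<bar>t\<bar> \<Longrightarrow> \<psi> t x = 0" using test unfolding test_function_def by blast
  have "DD (1, 0) (t, Rep_S3 x) = 0" if "R < \<bar>t\<bar>" for t x
    by (rule integral_cos_second_derivative(2)[OF time_derivative time_derivative2 continuous_on_DD_time[OF e0] R that])
  moreover have "laplace_beltrami (\<psi> t) x = 0" if "R < \<bar>t\<bar>" for t x
  proof -
    have "\<psi> t = (\<lambda>x. 0)" using R[OF that] by auto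
    then show ?thesis using laplace_beltrami_cmult[where f = "\<lambda>x. 0" and c = 0, OF smooth_S3_const] by simp
  qed
  ultimately show ?thesis using that R by blast
qed

end

context wave
begin

text \<open>For a single mode two integrations by parts in time give (\<omega> lf)^2, Green's
  formula on the sphere gives - (fr^2 - 1) and the mass term gives - 1. Both sides of the weak
  equation are continuous in the coefficients because the test function has compact support.\<close>

lemma solves_ev:
  assumes coef: "\<And>i. coef Y i = ((\<omega> * lf i)\<^sup>2 - (real (fr (snd i)))\<^sup>2) * coef U i"
    and F: "\<And>t x. F (ev \<omega> U t x) = ev \<omega> Y t x"
  shows "solves F (ev \<omega> U)"
  unfolding solves_def
proof (intro conjI allI impI)
  show "continuous_on UNIV (\<lambda>(t, x). ev \<omega> U t x)" by (rule continuous_on_ev)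
  fix \<psi> assume "test_function \<psi>"
  then interpret test \<psi> by unfold_locales
  obtain R where R: "\<And>t x. R < \<bar>t\<bar> \<Longrightarrow> \<psi> t x = 0" "\<And>t x. R < \<bar>t\<bar> \<Longrightarrow> DD (1, 0) (t, Rep_S3 x) = 0"
    "\<And>t x. R < \<bar>t\<bar> \<Longrightarrow> laplace_beltrami (\<psi> t) x = 0" using support by metis
  let ?M = "lborel \<Otimes>\<^sub>M S3_measure"
  have blG: "bounded_linear (\<lambda>U. LINT p|?M. (case p of (t, x) \<Rightarrow> ev \<omega> U t x) * G p)"
    if G: "continuous_on UNIV G" and z: "\<And>t x. R < \<bar>t\<bar> \<Longrightarrow> G (t, x) = 0" for G
  proof -
    have i: "integrable ?M (\<lambda>p. (case p of (t, x) \<Rightarrow> ev \<omega> U t x) * G p)" for U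
      by (rule integrable_time_S3[where R = R]) (auto intro!: continuous_on_mult continuous_on_ev G simp: z)
    have iG: "integrable ?M G" by (rule integrable_time_S3[OF G z])
    show ?thesis
    proof (rule bounded_linear_intro[where K = "4 * (LINT p|?M. norm (G p))"])
      show "(LINT p|?M. (case p of (t, x) \<Rightarrow> ev \<omega> (V + V') t x) * G p) =
        (LINT p|?M. (case p of (t, x) \<Rightarrow> ev \<omega> V t x) * G p) + (LINT p|?M. (case p of (t, x) \<Rightarrow> ev \<omega> V' t x) * G p)" for V V'
        using i by (simp add: linear_add[OF linear_ev] case_prod_unfold distrib_right)
      show "(LINT p|?M. (case p of (t, x) \<Rightarrow> ev \<omega> (c *\<^sub>R V) t x) * G p) = c *\<^sub>R (LINT p|?M. (case p of (t, x) \<Rightarrow> ev \<omega> V t x) * G p)" for c V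
        by (simp add: ev_scaleR case_prod_unfold mult.assoc scaleR_conv_of_real)
      fix V
      have "norm (LINT p|?M. (case p of (t, x) \<Rightarrow> ev \<omega> V t x) * G p) \<le> (LINT p|?M. norm ((case p of (t, x) \<Rightarrow> ev \<omega> V t x) * G p))"
        by (rule integral_norm_bound)
      also have "\<dots> \<le> (LINT p|?M. 4 * norm V * norm (G p))"
      proof (rule integral_mono)
        show "integrable ?M (\<lambda>p. norm ((case p of (t, x) \<Rightarrow> ev \<omega> V t x) * G p))" by (rule integrable_norm[OF i])
        show "integrable ?M (\<lambda>p. 4 * norm V * norm (G p))" using iG by simp
      qed (simp add: norm_mult case_prod_unfold mult_right_mono norm_ev_le)
      finally show "norm (LINT p|?M. (case p of (t, x) \<Rightarrow> ev \<omega> V t x) * G p) \<le> norm V * (4 * (LINT p|?M. norm (G p)))"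
        by simp
    qed
  qed
  have cKG: "continuous_on UNIV (\<lambda>(t, x). KG_operator \<psi> t x)"
    unfolding KG_eq case_prod_unfold
    using continuous_on_DD[OF e0] continuous_on_laplace continuous_on_psi
    by (intro continuous_on_diff continuous_on_add continuous_on_minus) (simp_all add: case_prod_unfold)
  define A where "A V = (LINT p|?M. (case p of (t, x) \<Rightarrow> ev \<omega> V t x) * (case p of (t, x) \<Rightarrow> KG_operator \<psi> t x))" for V
  define B where "B V = (LINT p|?M. (case p of (t, x) \<Rightarrow> ev \<omega> V t x) * (case p of (t, x) \<Rightarrow> \<psi> t x))" for V
  have A: "bounded_linear A" unfolding A_def[abs_def] by (rule blG[OF cKG]) (simp add: KG_eq R)
  have B: "bounded_linear B" unfolding B_def[abs_def] by (rule blG[OF continuous_on_psi]) (simp add: R)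
  have AB: "A (unit i) = ((\<omega> * lf i)\<^sup>2 - (real (fr (snd i)))\<^sup>2) *\<^sub>R B (unit i)" for i
  proof -
    define c where "c t = complex_of_real (cos ((\<omega> * lf i) * t) / wt i)" for t
    let ?e = "e (snd i)"
    have bas: "bas \<omega> t x i = c t * ?e x" for t x by (simp add: bas_def c_def mult_ac)
    have cc: "continuous_on UNIV c" unfolding c_def using wt_ge(2)[of i] by (intro continuous_intros) auto
    have cce: "continuous_on UNIV (\<lambda>p :: real \<times> S3. c (fst p) * ?e (snd p))"
      by (intro continuous_on_mult continuous_on_compose2[OF cc] continuous_on_compose2[OF continuous_on_e])
         (auto intro: continuous_intros)
    have i: "integrable ?M (\<lambda>(t, x). c t * ?e x * G t x)"
      if "continuous_on UNIV (\<lambda>(t, x). G t x)" "\<And>t x. R < \<bar>t\<bar> \<Longrightarrow> G t x = 0" for G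
      by (rule integrable_time_S3[where R = R])
         (use continuous_on_mult[OF cce that(1)] that(2) in \<open>auto simp: case_prod_unfold\<close>)
    note i1 = i[OF continuous_on_DD[OF e0] R(2)] and i2 = i[OF continuous_on_laplace R(3)] and i3 = i[OF continuous_on_psi R(1)]
    have tt: "(LINT t|lborel. c t * ?e x * DD (1, 0) (t, Rep_S3 x)) = (LINT t|lborel. - of_real ((\<omega> * lf i)\<^sup>2) * (c t * ?e x * \<psi> t x))" for x
    proof -
      have "(LINT t|lborel. c t * ?e x * DD (1, 0) (t, Rep_S3 x)) =
          (?e x / of_real (wt i)) * (LINT t|lborel. of_real (cos ((\<omega> * lf i) * t)) * DD (1, 0) (t, Rep_S3 x))"
        by (simp add: c_def mult_ac flip: integral_mult_right_zero)
      also have "\<dots> = (?e x / of_real (wt i)) * (- of_real ((\<omega> * lf i)\<^sup>2) * (LINT t|lborel. of_real (cos ((\<omega> * lf i) * t)) * \<psi> t x))"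
        by (subst integral_cos_second_derivative(1)[OF time_derivative time_derivative2 continuous_on_DD_time[OF e0] R(1)]) simp_all
      also have "\<dots> = (LINT t|lborel. - of_real ((\<omega> * lf i)\<^sup>2) * (c t * ?e x * \<psi> t x))"
        by (simp add: c_def mult_ac flip: integral_mult_right_zero)
      finally show ?thesis .
    qed
    have 1: "(LINT p|?M. (\<lambda>(t, x). c t * ?e x * DD (1, 0) (t, Rep_S3 x)) p) =
        - of_real ((\<omega> * lf i)\<^sup>2) * (LINT p|?M. (\<lambda>(t, x). c t * ?e x * \<psi> t x) p)"
    proof -
      have "(LINT p|?M. (\<lambda>(t, x). c t * ?e x * DD (1, 0) (t, Rep_S3 x)) p) =
          (LINT x|S3_measure. LINT t|lborel. c t * ?e x * DD (1, 0) (t, Rep_S3 x))"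
        using time_S3.integral_snd[OF i1] by simp
      also have "\<dots> = (LINT x|S3_measure. - of_real ((\<omega> * lf i)\<^sup>2) * (LINT t|lborel. c t * ?e x * \<psi> t x))"
        unfolding tt by simp
      also have "\<dots> = - of_real ((\<omega> * lf i)\<^sup>2) * (LINT p|?M. (\<lambda>(t, x). c t * ?e x * \<psi> t x) p)"
        using time_S3.integral_snd[OF i3] by simp
      finally show ?thesis .
    qed
    have se: "smooth_S3 ?e" and Le: "laplace_beltrami ?e x = - of_real ((real (fr (snd i)))\<^sup>2 - 1) * ?e x" for x
      using eigenfunction_e[of "snd i"] unfolding eigenfunction_def by (auto simp: minus_equation_iff algebra_simps)
    have 2: "(LINT p|?M. (\<lambda>(t, x). c t * ?e x * laplace_beltrami (\<psi> t) x) p) =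
        - of_real ((real (fr (snd i)))\<^sup>2 - 1) * (LINT p|?M. (\<lambda>(t, x). c t * ?e x * \<psi> t x) p)"
    proof -
      have gr: "(LINT x|S3_measure. c t * ?e x * laplace_beltrami (\<psi> t) x) =
          - of_real ((real (fr (snd i)))\<^sup>2 - 1) * (LINT x|S3_measure. c t * ?e x * \<psi> t x)" for t
      proof -
        have "(LINT x|S3_measure. c t * ?e x * laplace_beltrami (\<psi> t) x) = c t * (LINT x|S3_measure. ?e x * laplace_beltrami (\<psi> t) x)"
          by (simp add: mult.assoc)
        also have "\<dots> = c t * (LINT x|S3_measure. - of_real ((real (fr (snd i)))\<^sup>2 - 1) * (?e x * \<psi> t x))"
          unfolding Green[OF se smooth_slice] Le by (simp only: mult.assoc)
        also have "\<dots> = - of_real ((real (fr (snd i)))\<^sup>2 - 1) * (c t * (LINT x|S3_measure. ?e x * \<psi> t x))"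
          by (simp only: integral_mult_right_zero) (rule mult.left_commute)
        also have "c t * (LINT x|S3_measure. ?e x * \<psi> t x) = (LINT x|S3_measure. c t * ?e x * \<psi> t x)"
          by (simp add: mult.assoc)
        finally show ?thesis .
      qed
      have "(LINT p|?M. (\<lambda>(t, x). c t * ?e x * laplace_beltrami (\<psi> t) x) p) =
          (LINT t|lborel. LINT x|S3_measure. c t * ?e x * laplace_beltrami (\<psi> t) x)"
        using time_S3.integral_fst[OF i2] by simp
      also have "\<dots> = - of_real ((real (fr (snd i)))\<^sup>2 - 1) * (LINT p|?M. (\<lambda>(t, x). c t * ?e x * \<psi> t x) p)"
        unfolding gr using time_S3.integral_fst[OF i3] by simp
      finally show ?thesis .
    qed
    have Bu: "B (unit i) = (LINT p|?M. (\<lambda>(t, x). c t * ?e x * \<psi> t x) p)"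
      by (simp add: B_def ev_unit bas case_prod_unfold)
    have lin3: "(LINT p|?M. - f p + g p - h p) = - (LINT p|?M. f p) + (LINT p|?M. g p) - (LINT p|?M. h p)"
      if "integrable ?M f" "integrable ?M g" "integrable ?M h" for f g h :: "real \<times> S3 \<Rightarrow> complex"
      using that by simp
    have "A (unit i) = (LINT p|?M. - ((\<lambda>(t, x). c t * ?e x * DD (1, 0) (t, Rep_S3 x)) p)
        + (\<lambda>(t, x). c t * ?e x * laplace_beltrami (\<psi> t) x) p - (\<lambda>(t, x). c t * ?e x * \<psi> t x) p)"
      unfolding A_def by (simp add: ev_unit bas case_prod_unfold KG_eq algebra_simps)
    also have "\<dots> = - (LINT p|?M. (\<lambda>(t, x). c t * ?e x * DD (1, 0) (t, Rep_S3 x)) p)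
        + (LINT p|?M. (\<lambda>(t, x). c t * ?e x * laplace_beltrami (\<psi> t) x) p) - (LINT p|?M. (\<lambda>(t, x). c t * ?e x * \<psi> t x) p)"
      by (rule lin3[OF i1 i2 i3])
    also have "\<dots> = ((\<omega> * lf i)\<^sup>2 - (real (fr (snd i)))\<^sup>2) *\<^sub>R B (unit i)"
      unfolding 1 2 Bu by (simp add: scaleR_conv_of_real algebra_simps)
    finally show ?thesis .
  qed
  \<comment> \<open>The multiplier relating U and Y is unbounded in the mode, so it is not applied
    as an operator on the space; the two convergent series over the modes are compared term by
    term.\<close>
  have "A U = B Y"
  proof (rule has_sum_unique)
    show "((\<lambda>i. coef U i *\<^sub>R A (unit i)) has_sum A U) UNIV" by (rule bounded_linear_has_sum_unit[OF A])
    show "((\<lambda>i. coef U i *\<^sub>R A (unit i)) has_sum B Y) UNIV"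
      using bounded_linear_has_sum_unit[OF B, of Y] by (simp add: AB coef mult.commute)
  qed
  then show "(LINT (t, x)|(lborel \<Otimes>\<^sub>M S3_measure). ev \<omega> U t x * KG_operator \<psi> t x) =
      (LINT (t, x)|(lborel \<Otimes>\<^sub>M S3_measure). F (ev \<omega> U t x) * \<psi> t x)"
    unfolding A_def B_def F by (simp add: case_prod_unfold)
qed

end

section \<open>The bifurcating branch\<close>

lemma card_sgns:
  "real (card {s \<in> {1, -1 :: int} \<times> {1, -1 :: int}. Q s}) =
    of_bool (Q (1, 1)) + of_bool (Q (1, -1)) + of_bool (Q (-1, 1)) + of_bool (Q (-1, -1))"
proof -
  have "{s \<in> {1, -1 :: int} \<times> {1, -1 :: int}. Q s} = ({1, -1} \<times> {1, -1}) \<inter> {s. Q s}" by auto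
  then have "real (card {s \<in> {1, -1 :: int} \<times> {1, -1 :: int}. Q s}) = (\<Sum>s\<in>{1, -1} \<times> {1, -1}. of_bool (Q s))"
    by (simp only: sum_of_bool_eq finite_cartesian_product finite.intros)
  also have "\<dots> = (\<Sum>a\<in>{1, -1}. \<Sum>b\<in>{1, -1}. of_bool (Q (a, b)))"
    unfolding sum.cartesian_product by (rule sum.cong) auto
  also have "\<dots> = of_bool (Q (1, 1)) + of_bool (Q (1, -1)) + (of_bool (Q (-1, 1)) + of_bool (Q (-1, -1)))"
    by (simp del: sum_of_bool_eq)
  finally show ?thesis by simp
qed

text \<open>For an angle of at most pi / 2 the first multiple reaching pi / 2 does not exceed pi;
  angles in (pi / 2, pi] qualify themselves, and larger ones are reflected at pi. This excludes
  periods shorter than that of the leading mode.\<close>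

lemma ex_cos_multiple_nonpos:
  assumes "0 < \<theta>" "\<theta> < 2 * pi"
  shows "\<exists>k :: nat. cos (real k * \<theta>) \<le> 0"
proof -
  have small: "\<exists>k :: nat. cos (real k * x) \<le> 0" if "0 < x" "x \<le> pi" for x
  proof (cases "x \<le> pi / 2")
    case True
    define k where "k = nat \<lceil>pi / 2 / x\<rceil>"
    have "0 \<le> pi / 2 / x" using that by simp
    then have k: "real k = of_int \<lceil>pi / 2 / x\<rceil>" unfolding k_def by (intro of_nat_nat) linarith
    have "pi / 2 / x \<le> real k" "real k < pi / 2 / x + 1"
      using k ceiling_correct[of "pi / 2 / x"] by linarith+
    then have "pi / 2 \<le> real k * x" "real k * x < pi / 2 + x"
      using that by (simp_all add: field_simps)
    then have "cos (real k * x) \<le> cos (pi / 2)" using True by (intro cos_monotone_0_pi_le) auto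
    then show ?thesis by auto
  next
    case False
    then have "cos x \<le> cos (pi / 2)" using that by (intro cos_monotone_0_pi_le) auto
    then show ?thesis by (intro exI[of _ 1]) simp
  qed
  show ?thesis
  proof (cases "\<theta> \<le> pi")
    case True
    then show ?thesis using small assms by blast
  next
    case False
    then obtain k :: nat where k: "cos (real k * (2 * pi - \<theta>)) \<le> 0" using small[of "2 * pi - \<theta>"] assms by auto
    have "real k * (2 * pi - \<theta>) = 2 * real k * pi - real k * \<theta>" by (simp add: algebra_simps)
    then have "cos (real k * (2 * pi - \<theta>)) = cos (real k * \<theta>)" by (simp only: cos_diff cos_2npi sin_2npi)
    then show ?thesis using k by auto
  qed
qed

definition solution_pair ::
    "int \<Rightarrow> int \<Rightarrow> real \<Rightarrow> real \<Rightarrow> real \<Rightarrow> real \<Rightarrow> nat \<Rightarrow> real \<Rightarrow> (real \<Rightarrow> S3 \<Rightarrow> complex) \<Rightarrow> (real \<Rightarrow> S3 \<Rightarrow> complex) \<Rightarrow> bool"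
  where "solution_pair \<mu>1 \<mu>2 d r s C m \<epsilon> \<phi> v \<longleftrightarrow>
    \<phi> \<in> HrHs (period \<epsilon>) r s \<and> solves_cubic_KG \<phi> \<and>
    \<phi> \<noteq> (\<lambda>t x. 0) \<and> periodic (period \<epsilon>) \<phi> \<and>
    (\<forall>t. hopf_plane_wave \<mu>1 \<mu>2 (\<phi> t)) \<and>
    (\<forall>t x. \<phi> (- t) x = \<phi> t x) \<and>
    v \<in> HrHs (2 * pi) r s \<and> solves_linear_KG v \<and>
    v \<noteq> (\<lambda>t x. 0) \<and> periodic (2 * pi) v \<and>
    (\<forall>t. hopf_plane_wave \<mu>1 \<mu>2 (v t)) \<and>
    \<epsilon> powr (1/2) / C \<le> HrHs_norm (2 * pi) r s v \<and>
    HrHs_norm (2 * pi) r s v \<le> C * \<epsilon> powr (1/2 - d) \<and>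
    minimal_period (period \<epsilon> / real m) \<phi> \<and>
    minimal_period (2 * pi / real m) v"

locale branch = sobolev +
  fixes a0 :: nat
  assumes m_fr: "m = fr a0" and nondeg: "nondegenerate a0"
begin

abbreviation i0 :: "nat \<times> nat" where "i0 \<equiv> (0, a0)"

definition q0 :: real where "q0 = q4 a0 a0 a0 a0"
text \<open>The solution of A^2 (3/4) q0 = m^2: the cube of the cosine has component 3/4 along the
  cosine and the cube of \<open>e a0\<close> has component \<open>q0\<close> along itself, while
  \<omega>^2 - 1 = \<epsilon> multiplies m^2 on the linear side.\<close>

definition A :: real where "A = sqrt (4 * (real m)\<^sup>2 / (3 * q0))"
definition v0 :: "(nat \<times> nat) l1" where "v0 = (A * wt i0) *\<^sub>R unit i0"

text \<open>The resonant modes, those annihilated by the wave operator at \<omega> = 1.\<close>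

definition isV :: "nat \<times> nat \<Rightarrow> bool" where "isV i \<longleftrightarrow> m * (2 * fst i + 1) = fr (snd i)"

lemma A_pos: "0 < A" and A_sq: "A\<^sup>2 = 4 * (real m)\<^sup>2 / (3 * q0)"
  using q4_diag_pos[of a0] m_pos by (simp_all add: A_def q0_def)

lemma q0_pos: "0 < q0" unfolding q0_def by (rule q4_diag_pos)

lemma isV_i0: "isV i0" unfolding isV_def by (simp add: m_fr)

lemma isV_eq: "isV i \<Longrightarrow> isV j \<Longrightarrow> fst i = fst j \<Longrightarrow> i = j"
  by (auto simp: isV_def fr_def prod_eq_iff)

lemma isV_lf: "isV i \<Longrightarrow> lf i = real (fr (snd i))"
  by (simp add: isV_def lf_def)

text \<open>The number of sign pairs that combine the frequencies 2 k + 1, 1, 1 to 2 k' + 1 up to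
  sign. Truncated subtraction is intended: for k = 0 the frequency - 1 folds back to 1, so
  \<open>cnt 0 0 = 3\<close>, whereas \<open>cnt k k = 2\<close> for positive k.\<close>

definition cnt :: "nat \<Rightarrow> nat \<Rightarrow> real"
  where "cnt k k' = of_bool (k' = k + 1) + 2 * of_bool (k' = k) + of_bool (k' = k - 1)"

lemma tidx_eq_iff: "odd j \<Longrightarrow> tidx j = k \<longleftrightarrow> \<bar>j\<bar> = 2 * int k + 1"
  using tidx[of j] by auto

lemma cnt_comb:
  "real (card {s\<in>sgns. tidx (comb k 0 0 s) = k'}) = cnt k k'"
  "real (card {s\<in>sgns. tidx (comb 0 k 0 s) = k'}) = cnt k k'"
  "real (card {s\<in>sgns. tidx (comb 0 0 k s) = k'}) = cnt k k'"
proof -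
  have t: "tidx (2 * int k + 3) = k + 1" "tidx (2 * int k + 1) = k" "tidx (- 1 - 2 * int k) = k"
    "tidx (2 * int k - 1) = k - 1" "tidx (1 - 2 * int k) = k - 1"
    by (cases k; simp add: tidx_eq_iff)+
  have c: "comb k 0 0 (1, 1) = 2 * int k + 3" "comb k 0 0 (1, -1) = 2 * int k + 1"
    "comb k 0 0 (-1, 1) = 2 * int k + 1" "comb k 0 0 (-1, -1) = 2 * int k - 1"
    "comb 0 k 0 (1, 1) = 2 * int k + 3" "comb 0 k 0 (1, -1) = 2 * int k + 1"
    "comb 0 k 0 (-1, 1) = 1 - 2 * int k" "comb 0 k 0 (-1, -1) = - 1 - 2 * int k"
    "comb 0 0 k (1, 1) = 2 * int k + 3" "comb 0 0 k (1, -1) = 1 - 2 * int k"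
    "comb 0 0 k (-1, 1) = 2 * int k + 1" "comb 0 0 k (-1, -1) = - 1 - 2 * int k"
    by (simp_all add: comb_def)
  show "real (card {s\<in>sgns. tidx (comb k 0 0 s) = k'}) = cnt k k'"
    "real (card {s\<in>sgns. tidx (comb 0 k 0 s) = k'}) = cnt k k'"
    "real (card {s\<in>sgns. tidx (comb 0 0 k s) = k'}) = cnt k k'"
    unfolding card_sgns c t cnt_def by (simp_all add: eq_commute)
qed

text \<open>
  The degree of \<open>P\<^sub>d\<close> exceeds that of the rest of the integrand, so two different resonant modes are not
  coupled by the square of the mode \<open>(0, a0)\<close>: the linearized bifurcation equation is diagonal.
\<close>

lemma resonant_decoupling:
  assumes "isV i" "isV j" "i \<noteq> j"
  shows "cnt (fst i) (fst j) * q4 a0 a0 (snd i) (snd j) = 0"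
proof (cases "cnt (fst i) (fst j) = 0")
  case False
  obtain k a k' d where ij: "i = (k, a)" "j = (k', d)" by (cases i, cases j) auto
  have "k \<noteq> k'" using isV_eq[OF assms(1,2)] assms(3) by (auto simp: ij)
  then have "k' = k + 1 \<or> k = k' + 1" using False by (cases k) (auto simp: cnt_def ij split: if_splits)
  then have "q4 a0 a0 a d = 0"
  proof
    assume "k' = k + 1"
    \<comment> \<open>In indices this reads d = a + 2 a0 + k1 + k2 + 1, exactly one above the last
      degree for which \<open>q4\<close> can be nonzero.\<close>
    then have "fr d = fr a + 2 * fr a0" using assms(1,2) unfolding isV_def ij by (simp add: m_fr algebra_simps)
    then show ?thesis by (intro q4_eq_0) (simp add: fr_def)
  next
    assume "k = k' + 1"
    then have "fr a = fr d + 2 * fr a0" using assms(1,2) unfolding isV_def ij by (simp add: m_fr algebra_simps)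
    then have "q4 a0 a0 d a = 0" by (intro q4_eq_0) (simp add: fr_def)
    then show ?thesis using q4_perm(3) by metis
  qed
  then show ?thesis by (simp add: ij)
qed simp

definition DN :: "(nat \<times> nat) l1 \<Rightarrow> (nat \<times> nat) l1"
  where "DN h = N h v0 v0 + N v0 h v0 + N v0 v0 h"

definition \<Gamma> :: "nat \<times> nat \<Rightarrow> real"
  where "\<Gamma> i = 3 / 4 * A\<^sup>2 * cnt (fst i) (fst i) * q4 a0 a0 (snd i) (snd i)"

lemma bounded_linear_DN: "bounded_linear DN"
  unfolding DN_def[abs_def]
  by (intro bounded_linear_add blinfun.bounded_linear_right
      bounded_linear_compose[OF blinfun.bounded_linear_left blinfun.bounded_linear_right]
      bounded_linear_compose[OF blinfun.bounded_linear_left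
        bounded_linear_compose[OF blinfun.bounded_linear_left blinfun.bounded_linear_right]])

text \<open>The three positions of the increment contribute equally, since \<open>q4\<close> is
  symmetric and the sign count of \<open>cnt_comb\<close> does not depend on the position; this
  turns 1/4 into 3/4.\<close>

lemma coef_DN_unit:
  "coef (DN (unit i)) j = 3 / 4 * A\<^sup>2 * cnt (fst i) (fst j) * q4 a0 a0 (snd i) (snd j) * wt j / wt i"
proof -
  obtain k a k' d where ij: "i = (k, a)" "j = (k', d)" by (cases i, cases j) auto
  have q: "q4 a a0 a0 d = q4 a0 a0 a d" "q4 a0 a a0 d = q4 a0 a0 a d" using q4_perm by metis+
  have "DN (unit i) = (A * wt i0)\<^sup>2 *\<^sub>R (cub i i0 i0 + cub i0 i i0 + cub i0 i0 i)"
    by (simp add: DN_def v0_def blinfun.scaleR_left blinfun.scaleR_right N_unit power2_eq_square scaleR_add_right)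
  then have "coef (DN (unit i)) j = (A * wt i0)\<^sup>2 * (3 * (cnt k k' / 4 * q4 a0 a0 a d * wt j / (wt i * wt i0 * wt i0)))"
    by (simp only: ij coef_scaleR coef_add coef_cub cnt_comb q fst_conv snd_conv) (simp add: algebra_simps)
  also have "\<dots> = 3 / 4 * A\<^sup>2 * cnt k k' * q4 a0 a0 a d * wt j / wt i"
    using wt_ge(2)[of i0] by (simp add: power2_eq_square field_simps)
  finally show ?thesis by (simp add: ij)
qed

lemma coef_DN_V:
  assumes h: "\<And>i. \<not> isV i \<Longrightarrow> coef h i = 0" and j: "isV j"
  shows "coef (DN h) j = \<Gamma> j * coef h j"
proof -
  \<comment> \<open>The projection onto the resonant modes: composed with it, the claim becomes an
    identity of bounded operators that can be tested on unit vectors.\<close>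
  define d where "d = diag (\<lambda>i. of_bool (isV i))"
  have d: "bounded_linear d" unfolding d_def by (rule bounded_linear_diag[where B = 1]) simp
  have cd: "coef (d x) i = of_bool (isV i) * coef x i" for x i
    unfolding d_def by (rule coef_diag[where B = 1]) simp
  have du: "d (unit i) = (if isV i then unit i else 0)" for i
    by (rule l1_eqI) (auto simp: cd coef_unit)
  have u: "coef (DN (d (unit i))) j = \<Gamma> j * coef (unit i) j" for i
  proof (cases "isV i")
    case True
    show ?thesis
    proof (cases "i = j")
      case True
      then show ?thesis using j wt_ge(2)[of j] by (simp add: du coef_DN_unit coef_unit \<Gamma>_def)
    next
      case False
      have "coef (DN (unit i)) j = 3 / 4 * A\<^sup>2 * (cnt (fst i) (fst j) * q4 a0 a0 (snd i) (snd j)) * wt j / wt i"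
        by (simp add: coef_DN_unit)
      then show ?thesis using resonant_decoupling[OF True j False] False True by (simp add: du coef_unit)
    qed
  next
    case False
    then show ?thesis using j linear_0[OF bounded_linear.linear[OF bounded_linear_DN]]
      by (auto simp: du coef_unit)
  qed
  have "coef (DN (d h)) j = \<Gamma> j * coef h j"
    by (rule bounded_linear_l1_eqI[OF bounded_linear_compose[OF bounded_linear_coef
            bounded_linear_compose[OF bounded_linear_DN d]]
          bounded_linear_compose[OF bounded_linear_mult_right bounded_linear_coef] u])
  moreover have "d h = h" by (rule l1_eqI) (auto simp: cd h)
  ultimately show ?thesis by simp
qed

text \<open>The resonant equation holds exactly at \<open>v0\<close>: at \<open>i0\<close> by the
  choice of \<open>A\<close>, at the other resonant modes because both sides vanish by decoupling.
  So the error of the approximate solution is purely non-resonant.\<close>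

lemma coef_N_v0:
  assumes "isV j"
  shows "coef (N v0 v0 v0) j = (lf j)\<^sup>2 * coef v0 j"
proof -
  obtain k d where j: "j = (k, d)" by (cases j)
  have "N v0 v0 v0 = (A * wt i0) ^ 3 *\<^sub>R cub i0 i0 i0"
    by (simp add: v0_def blinfun.scaleR_left blinfun.scaleR_right N_unit power3_eq_cube)
  then have c: "coef (N v0 v0 v0) j = (A * wt i0) ^ 3 * (cnt 0 k / 4 * q4 a0 a0 a0 d * wt j / (wt i0 * wt i0 * wt i0))"
    by (simp only: j coef_scaleR coef_cub cnt_comb fst_conv snd_conv)
  show ?thesis
  proof (cases "j = i0")
    case True
    have "coef (N v0 v0 v0) j = (A * wt i0) * (A\<^sup>2 * (3 / 4 * q0))"
      unfolding c using True wt_ge(2)[of i0] by (simp add: j cnt_def q0_def power3_eq_cube power2_eq_square)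
    also have "A\<^sup>2 * (3 / 4 * q0) = (real m)\<^sup>2" using q0_pos by (simp add: A_sq)
    finally show ?thesis using True by (simp add: v0_def coef_unit lf_def)
  next
    case False
    have "cnt 0 k * q4 a0 a0 a0 d = 0"
      using resonant_decoupling[OF isV_i0 assms] False by (auto simp: j)
    then have "coef (N v0 v0 v0) j = 0" unfolding c by auto
    then show ?thesis using False by (simp add: v0_def coef_unit)
  qed
qed

text \<open>At \<open>i0\<close> the entry is m^2 - 3 m^2 = - 2 m^2. At any other resonant mode the
  frequency is K m with odd K \<ge> 3, and nondegeneracy leaves at least a quarter of its
  square.\<close>

lemma abs_linearization_ge:
  assumes "isV i"
  shows "1 / 4 \<le> \<bar>(lf i)\<^sup>2 - \<Gamma> i\<bar>"
proof (cases "fst i = 0")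
  case True
  then have i: "i = i0" using isV_eq[OF assms isV_i0] by simp
  have "\<Gamma> i = 9 / 4 * (A\<^sup>2 * q0)" by (simp add: i \<Gamma>_def cnt_def q0_def)
  also have "\<dots> = 3 * (real m)\<^sup>2" using q0_pos by (simp add: A_sq)
  finally have "(lf i)\<^sup>2 - \<Gamma> i = - 2 * (real m)\<^sup>2" by (simp add: i lf_def)
  moreover have "1 \<le> (real m)\<^sup>2" using m_pos by simp
  ultimately show ?thesis by simp
next
  case False
  define K where "K = 2 * fst i + 1"
  have K: "3 \<le> K" "K * fr a0 = fr (snd i)" using False assms unfolding K_def isV_def by (auto simp: m_fr mult.commute)
  have lf: "lf i = real m * real K" by (simp add: lf_def K_def algebra_simps)
  have "cnt (fst i) (fst i) = 2" using False by (simp add: cnt_def)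
  then have "\<Gamma> i = A\<^sup>2 * 3 / 4 * (2 * q4 a0 a0 (snd i) (snd i))" by (simp add: \<Gamma>_def)
  also have "\<dots> \<le> A\<^sup>2 * 3 / 4 * (3 / 4 * (real K)\<^sup>2 * q0)"
    using nondeg K unfolding nondegenerate_def q0_def by (intro mult_left_mono) auto
  also have "\<dots> = 3 / 4 * (lf i)\<^sup>2" using q0_pos by (simp add: A_sq lf power_mult_distrib)
  finally have "(lf i)\<^sup>2 / 4 \<le> (lf i)\<^sup>2 - \<Gamma> i" by simp
  moreover have "1 \<le> (lf i)\<^sup>2"
  proof -
    have "1 \<le> m * K" using m_pos K by (simp add: Suc_le_eq)
    then have "1 \<le> real (m * K)" by linarith
    then show ?thesis unfolding lf of_nat_mult[symmetric] by (rule one_le_power)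
  qed
  ultimately show ?thesis by linarith
qed

definition G :: "(nat \<times> nat) l1 \<Rightarrow>\<^sub>L (nat \<times> nat) l1"
  where "G = Blinfun (diag (\<lambda>i. if isV i then 1 / ((lf i)\<^sup>2 - \<Gamma> i) else 0))"

lemma coef_G: "coef (G x) i = (if isV i then coef x i / ((lf i)\<^sup>2 - \<Gamma> i) else 0)"
proof -
  have b: "\<bar>if isV i then 1 / ((lf i)\<^sup>2 - \<Gamma> i) else 0\<bar> \<le> 4" for i
    using le_imp_inverse_le[OF abs_linearization_ge[of i]] by (auto simp: inverse_eq_divide)
  show ?thesis
    unfolding G_def bounded_linear_Blinfun_apply[OF bounded_linear_diag[OF b]] coef_diag[OF b] by simp
qed

text \<open>The difference of squares is factored: off resonance the first factor is at least
  \<gamma> / l, and the second is at least \<omega> l \<ge> l / 2, which compensates the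
  denominator.\<close>

lemma small_divisors:
  assumes "0 < \<gamma>" "\<omega> \<in> Omega \<gamma>" "\<not> isV i"
  shows "\<gamma> / 2 \<le> \<bar>(\<omega> * lf i)\<^sup>2 - (real (fr (snd i)))\<^sup>2\<bar>"
proof -
  define l where "l = m * (2 * fst i + 1)"
  define j where "j = fr (snd i)"
  have l: "1 \<le> l" "l \<noteq> j" using m_pos assms(3) by (auto simp: l_def j_def isV_def)
  have o: "1 / 2 \<le> \<omega>" "\<gamma> / real l \<le> \<bar>\<omega> * real l - real j\<bar>"
    using assms(2) l by (auto simp: Omega_def)
  have "\<gamma> / 2 = \<gamma> / real l * (1 / 2 * real l)" using l by simp
  also have "\<dots> \<le> \<bar>\<omega> * real l - real j\<bar> * (\<omega> * real l + real j)"
  proof (rule mult_mono[OF o(2)])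
    have "1 / 2 * real l \<le> \<omega> * real l" using o(1) by (rule mult_right_mono) simp
    then show "1 / 2 * real l \<le> \<omega> * real l + real j" by simp
  qed auto
  also have "\<dots> = \<bar>(\<omega> * real l - real j) * (\<omega> * real l + real j)\<bar>"
    using o(1) by (simp add: abs_mult)
  also have "(\<omega> * real l - real j) * (\<omega> * real l + real j) = (\<omega> * lf i)\<^sup>2 - (real (fr (snd i)))\<^sup>2"
    by (simp add: lf_def l_def j_def power2_eq_square algebra_simps)
  finally show ?thesis .
qed

text \<open>Decoding of the fixed point with bound 2 / \<gamma> on \<open>K\<close>. Off resonance
  it says h = w, the equation solved by division. On a resonant mode h - w has only resonant
  components, so DN h - DN w is the diagonal term that cancels in the linearization; the wave
  operator is there \<epsilon> times the squared frequency, and \<epsilon> divides out.\<close>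

lemma ex_solution:
  assumes "0 < \<gamma>"
  shows "\<exists>\<epsilon>1>0. \<exists>C>0. \<forall>\<epsilon>. 0 < \<epsilon> \<and> \<epsilon> < \<epsilon>1 \<and> freq \<epsilon> \<in> Omega \<gamma> \<longrightarrow>
    (\<exists>h. norm h \<le> C * \<epsilon> \<and> (\<forall>i. ((freq \<epsilon> * lf i)\<^sup>2 - (real (fr (snd i)))\<^sup>2) * coef (v0 + h) i =
       \<epsilon> * coef (N (v0 + h) (v0 + h) (v0 + h)) i))"
proof -
  obtain \<epsilon>1 C where \<epsilon>1: "\<epsilon>1 > 0" and C: "C > 0" and fp: "\<And>\<epsilon> K. 0 < \<epsilon> \<Longrightarrow> \<epsilon> < \<epsilon>1 \<Longrightarrow> norm (K :: (nat \<times> nat) l1 \<Rightarrow>\<^sub>L (nat \<times> nat) l1) \<le> 2 / \<gamma> \<Longrightarrow>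
    \<exists>h. norm h \<le> C * \<epsilon> \<and> h = G (N (\<epsilon> *\<^sub>R K (N (v0 + h) (v0 + h) (v0 + h))) v0 v0 +
        N v0 (\<epsilon> *\<^sub>R K (N (v0 + h) (v0 + h) (v0 + h))) v0 + N v0 v0 (\<epsilon> *\<^sub>R K (N (v0 + h) (v0 + h) (v0 + h))) +
        (N (v0 + h) (v0 + h) (v0 + h) - N v0 v0 v0 - (N h v0 v0 + N v0 h v0 + N v0 v0 h))) +
        \<epsilon> *\<^sub>R K (N (v0 + h) (v0 + h) (v0 + h))"
    using cubic_fixed_point[where \<kappa> = "2 / \<gamma>" and N = N and v = v0 and G = G] assms by auto
  have "\<exists>h. norm h \<le> C * \<epsilon> \<and> (\<forall>i. ((freq \<epsilon> * lf i)\<^sup>2 - (real (fr (snd i)))\<^sup>2) * coef (v0 + h) i =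
       \<epsilon> * coef (N (v0 + h) (v0 + h) (v0 + h)) i)"
    if \<epsilon>: "0 < \<epsilon>" "\<epsilon> < \<epsilon>1" and \<omega>: "freq \<epsilon> \<in> Omega \<gamma>" for \<epsilon>
  proof -
    define dv where "dv i = (freq \<epsilon> * lf i)\<^sup>2 - (real (fr (snd i)))\<^sup>2" for i
    have dv: "\<gamma> / 2 \<le> \<bar>dv i\<bar>" if "\<not> isV i" for i
      unfolding dv_def by (rule small_divisors[OF assms \<omega> that])
    have b: "\<bar>if isV i then 0 else 1 / dv i\<bar> \<le> 2 / \<gamma>" for i
    proof (cases "isV i")
      case False
      have "1 / \<bar>dv i\<bar> \<le> 1 / (\<gamma> / 2)" by (rule divide_left_mono[OF dv[OF False]]) (use assms dv[OF False] in auto)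
      then show ?thesis using False by simp
    qed (use assms in simp)
    define K where "K = Blinfun (diag (\<lambda>i. if isV i then 0 else 1 / dv i))"
    have Kap: "blinfun_apply K = diag (\<lambda>i. if isV i then 0 else 1 / dv i)"
      unfolding K_def by (rule bounded_linear_Blinfun_apply[OF bounded_linear_diag[OF b]])
    have nK: "norm K \<le> 2 / \<gamma>"
    proof (rule norm_blinfun_bound)
      show "norm (blinfun_apply K x) \<le> 2 / \<gamma> * norm x" for x unfolding Kap by (rule norm_diag_le[OF b])
    qed (use assms in simp)
    have cK: "coef (K x) i = (if isV i then 0 else coef x i / dv i)" for x i
      unfolding Kap coef_diag[OF b] by simp
    obtain h where h: "norm h \<le> C * \<epsilon>" and eq: "h = G (N (\<epsilon> *\<^sub>R K (N (v0 + h) (v0 + h) (v0 + h))) v0 v0 +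
        N v0 (\<epsilon> *\<^sub>R K (N (v0 + h) (v0 + h) (v0 + h))) v0 + N v0 v0 (\<epsilon> *\<^sub>R K (N (v0 + h) (v0 + h) (v0 + h))) +
        (N (v0 + h) (v0 + h) (v0 + h) - N v0 v0 v0 - (N h v0 v0 + N v0 h v0 + N v0 v0 h))) +
        \<epsilon> *\<^sub>R K (N (v0 + h) (v0 + h) (v0 + h))"
      using fp[OF \<epsilon> nK] by blast
    define NU where "NU = N (v0 + h) (v0 + h) (v0 + h)"
    define w where "w = \<epsilon> *\<^sub>R K NU"
    have eq': "h = G (DN w + (NU - N v0 v0 v0 - DN h)) + w"
      using eq unfolding DN_def NU_def w_def .
    have cw: "coef w i = (if isV i then 0 else \<epsilon> * coef NU i / dv i)" for i by (simp add: w_def cK)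
    have ch: "coef h i = (if isV i then coef (DN w + (NU - N v0 v0 v0 - DN h)) i / ((lf i)\<^sup>2 - \<Gamma> i) else coef w i)" for i
      by (subst eq') (simp add: coef_G cw)
    have DNd: "DN (h - w) = DN h - DN w"
      by (rule linear_diff[OF bounded_linear.linear[OF bounded_linear_DN]])
    have \<omega>2: "(freq \<epsilon>)\<^sup>2 = 1 + \<epsilon>" using \<epsilon> by (simp add: freq_def)
    have "dv i * coef (v0 + h) i = \<epsilon> * coef NU i" for i
    proof (cases "isV i")
      case True
      have "coef (DN (h - w)) i = \<Gamma> i * coef (h - w) i"
        by (rule coef_DN_V[OF _ True]) (simp add: ch)
      then have d: "coef (DN h) i - coef (DN w) i = \<Gamma> i * coef h i" using True by (simp add: DNd cw)
      have nz: "(lf i)\<^sup>2 - \<Gamma> i \<noteq> 0" using abs_linearization_ge[OF True] by auto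
      have "((lf i)\<^sup>2 - \<Gamma> i) * coef h i = coef (DN w) i + (coef NU i - coef (N v0 v0 v0) i - coef (DN h) i)"
        using nz True ch[of i] by simp
      then have "(lf i)\<^sup>2 * coef (v0 + h) i = coef NU i"
        using d coef_N_v0[OF True] by (simp add: algebra_simps)
      moreover have "dv i = \<epsilon> * (lf i)\<^sup>2"
        using isV_lf[OF True] by (simp add: dv_def power_mult_distrib \<omega>2 algebra_simps)
      ultimately show ?thesis by simp
    next
      case False
      then have "i \<noteq> i0" using isV_i0 by auto
      then have "coef (v0 + h) i = \<epsilon> * coef NU i / dv i" using False by (simp add: ch cw v0_def coef_unit)
      moreover have "dv i \<noteq> 0" using dv[OF False] assms by auto
      ultimately show ?thesis by simp
    qed
    then show ?thesis using h unfolding dv_def NU_def by blast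
  qed
  then show ?thesis using \<epsilon>1 C by blast
qed

lemma ev_v0: "ev \<omega> v0 t x = of_real (A * cos (real m * (\<omega> * t))) * e a0 x"
  using wt_ge(2)[of i0] by (simp add: v0_def ev_scaleR ev_unit bas_def lf_def)

text \<open>A period T' has all its multiples as periods, and for T' below the claimed value some
  multiple brings the leading cosine to a value \<le> 0. At x the leading term then changes by at
  least A |e a0 x|, whereas the perturbation can change by at most 8 norm h.\<close>

lemma minimal_period_ev:
  assumes \<omega>: "0 < \<omega>" and c: "c \<noteq> 0" and x: "8 * norm h < A * cmod (e a0 x)"
  shows "minimal_period (2 * pi / \<omega> / real m) (ev \<omega> (c *\<^sub>R (v0 + h)))"
    and "ev \<omega> (c *\<^sub>R (v0 + h)) \<noteq> (\<lambda>t x. 0)"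
proof -
  let ?U = "c *\<^sub>R (v0 + h)"
  have ev: "ev \<omega> ?U t x = of_real c * (of_real (A * cos (real m * (\<omega> * t))) * e a0 x + ev \<omega> h t x)" for t
    by (simp add: ev_scaleR linear_add[OF linear_ev] ev_v0)
  show "ev \<omega> ?U \<noteq> (\<lambda>t x. 0)"
  proof
    assume "ev \<omega> ?U = (\<lambda>t x. 0)"
    then have "ev \<omega> ?U 0 x = 0" by simp
    then have "of_real A * e a0 x = - ev \<omega> h 0 x" using c by (simp add: ev add_eq_0_iff2)
    then have "A * cmod (e a0 x) = norm (ev \<omega> h 0 x)" using A_pos by (metis norm_minus_cancel norm_mult norm_of_real abs_of_pos)
    also have "\<dots> \<le> 4 * norm h" by (rule norm_ev_le)
    finally show False using x by (smt (verit) norm_ge_zero)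
  qed
  show "minimal_period (2 * pi / \<omega> / real m) (ev \<omega> ?U)"
    unfolding minimal_period_def
  proof (intro conjI allI impI)
    show "0 < 2 * pi / \<omega> / real m" using \<omega> m_pos by simp
    show "periodic (2 * pi / \<omega> / real m) (ev \<omega> ?U)" using ev_periodic \<omega> by (simp add: periodic_def)
    fix T' assume T': "0 < T' \<and> T' < 2 * pi / \<omega> / real m"
    show "\<not> periodic T' (ev \<omega> ?U)"
    proof
      assume per: "periodic T' (ev \<omega> ?U)"
      have kper: "ev \<omega> ?U (real k * T') x = ev \<omega> ?U 0 x" for k
      proof (induction k)
        case (Suc k)
        have "ev \<omega> ?U (real k * T' + T') x = ev \<omega> ?U (real k * T') x" using per unfolding periodic_def by blast
        then show ?case using Suc by (simp add: algebra_simps)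
      qed simp
      define \<theta> where "\<theta> = real m * \<omega> * T'"
      have "0 < \<theta>" "\<theta> < 2 * pi" using T' \<omega> m_pos by (auto simp: \<theta>_def field_simps)
      then obtain k :: nat where k: "cos (real k * \<theta>) \<le> 0" using ex_cos_multiple_nonpos by blast
      have k\<theta>: "real m * (\<omega> * (real k * T')) = real k * \<theta>" by (simp add: \<theta>_def)
      have "of_real (A * cos (real k * \<theta>)) * e a0 x + ev \<omega> h (real k * T') x = of_real A * e a0 x + ev \<omega> h 0 x"
        using kper[of k] c unfolding ev k\<theta> by simp
      then have "of_real (A * (1 - cos (real k * \<theta>))) * e a0 x = ev \<omega> h (real k * T') x - ev \<omega> h 0 x"
        by (simp add: algebra_simps)
      moreover have pos: "0 \<le> A * (1 - cos (real k * \<theta>))" using A_pos k by simp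
      ultimately have "A * (1 - cos (real k * \<theta>)) * cmod (e a0 x) = norm (ev \<omega> h (real k * T') x - ev \<omega> h 0 x)"
        by (metis norm_mult norm_of_real abs_of_nonneg)
      also have "\<dots> \<le> 4 * norm h + 4 * norm h"
        by (intro order_trans[OF norm_triangle_ineq4] add_mono norm_ev_le)
      finally have "A * (1 - cos (real k * \<theta>)) * cmod (e a0 x) \<le> 8 * norm h" by simp
      moreover have "A * 1 * cmod (e a0 x) \<le> A * (1 - cos (real k * \<theta>)) * cmod (e a0 x)"
        using A_pos k by (intro mult_right_mono mult_left_mono) auto
      ultimately show False using x by simp
    qed
  qed
qed

lemma branch_exists:
  assumes "0 < d" "d < 1/2"
  shows "\<exists>C>0. \<forall>\<gamma>>0. \<exists>\<epsilon>0>0. \<exists>\<phi> v K. \<forall>\<epsilon>\<in>admissible \<gamma> \<epsilon>0.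
      solution_pair \<mu>1 \<mu>2 d r s C m \<epsilon> (\<phi> \<epsilon>) (v \<epsilon>) \<and>
      HrHs_norm (period \<epsilon>) r s (\<lambda>t x. \<phi> \<epsilon> t x - v \<epsilon> (freq \<epsilon> * t) x)
        \<le> K * \<epsilon> * HrHs_norm (period \<epsilon>) r s (\<lambda>t x. v \<epsilon> (freq \<epsilon> * t) x)"
    (is "\<exists>C>0. \<forall>\<gamma>>0. ?Q C \<gamma>")
proof -
  define c1 where "c1 = A * real m powr s * L2_norm (e a0)"
  define c2 where "c2 = c1 * sqrt (pi * (1 + (real m)\<^sup>2) powr r)"
  have c1: "0 < c1" using A_pos m_pos L2_norm_e_pos by (simp add: c1_def)
  have "0 < (1 + (real m)\<^sup>2) powr r" by (intro powr_gt_zero[THEN iffD2]) (smt (verit) zero_le_power2)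
  then have c2: "0 < c2" using c1 by (simp add: c2_def)
  \<comment> \<open>One constant for both sides: it dominates c2, and its inverse is below c2. It is
    fixed before \<gamma> is introduced.\<close>
  define C where "C = c2 + 1 / c2"
  have C: "0 < C" using c2 by (simp add: C_def add_pos_pos)
  obtain x0 where x0: "e a0 x0 \<noteq> 0" using ex_e_nz by blast
  have single: "HrHs_norm (2 * pi / \<omega>) r s (ev \<omega> (q *\<^sub>R v0)) =
      \<bar>q\<bar> * c1 * sqrt (pi / \<omega> * (1 + (\<omega> * real m)\<^sup>2) powr r)" if "0 < \<omega>" for q \<omega>
    unfolding v0_def scaleR_scaleR HrHs_norm_single[OF that m_fr[symmetric]]
    using A_pos wt_ge(2)[of i0] by (simp add: c1_def abs_mult)
  have main: "?Q C \<gamma>" if \<gamma>: "0 < \<gamma>" for \<gamma>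
  proof -
    obtain \<epsilon>1 C0 where \<epsilon>1: "\<epsilon>1 > 0" and C0: "C0 > 0" and sol: "\<And>\<epsilon>. 0 < \<epsilon> \<Longrightarrow> \<epsilon> < \<epsilon>1 \<Longrightarrow> freq \<epsilon> \<in> Omega \<gamma> \<Longrightarrow>
      \<exists>h. norm h \<le> C0 * \<epsilon> \<and> (\<forall>i. ((freq \<epsilon> * lf i)\<^sup>2 - (real (fr (snd i)))\<^sup>2) * coef (v0 + h) i =
       \<epsilon> * coef (N (v0 + h) (v0 + h) (v0 + h)) i)" using ex_solution[OF \<gamma>] by blast
    \<comment> \<open>The bound 1 keeps the frequency in [1, 2]; the last entry makes 8 norm h
      smaller than the leading amplitude at x0, as the minimal period requires.\<close>
    define \<epsilon>0 where "\<epsilon>0 = min (min \<epsilon>1 1) (A * cmod (e a0 x0) / (8 * C0))"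
    have \<epsilon>0: "0 < \<epsilon>0" using \<epsilon>1 C0 A_pos x0 by (simp add: \<epsilon>0_def)
    have "\<forall>\<epsilon>\<in>admissible \<gamma> \<epsilon>0. \<exists>h. norm h \<le> C0 * \<epsilon> \<and> (\<forall>i. ((freq \<epsilon> * lf i)\<^sup>2 - (real (fr (snd i)))\<^sup>2) * coef (v0 + h) i =
       \<epsilon> * coef (N (v0 + h) (v0 + h) (v0 + h)) i)"
      using sol by (auto simp: admissible_def \<epsilon>0_def)
    then obtain h where h: "\<And>\<epsilon>. \<epsilon> \<in> admissible \<gamma> \<epsilon>0 \<Longrightarrow> norm (h \<epsilon>) \<le> C0 * \<epsilon>"
      and heq: "\<And>\<epsilon> i. \<epsilon> \<in> admissible \<gamma> \<epsilon>0 \<Longrightarrow> ((freq \<epsilon> * lf i)\<^sup>2 - (real (fr (snd i)))\<^sup>2) * coef (v0 + h \<epsilon>) i =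
       \<epsilon> * coef (N (v0 + h \<epsilon>) (v0 + h \<epsilon>) (v0 + h \<epsilon>)) i" by metis
    define \<phi> where "\<phi> \<epsilon> = ev (freq \<epsilon>) (sqrt \<epsilon> *\<^sub>R (v0 + h \<epsilon>))" for \<epsilon>
    define v where "v \<epsilon> = ev 1 (sqrt \<epsilon> *\<^sub>R v0)" for \<epsilon>
    \<comment> \<open>The quotient of the upper bound for the remainder and the lower bound for the
      single mode, where \<omega> \<le> 2 gives pi / \<omega> \<ge> pi / 2.\<close>
    define K where "K = 2 * CH * sqrt (2 * pi) * C0 / (c1 * sqrt (pi / 2))"
    show ?thesis
    proof (rule exI[of _ \<epsilon>0], rule conjI[OF \<epsilon>0], rule exI[of _ \<phi>], rule exI[of _ v], rule exI[of _ K],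
        unfold solution_pair_def, intro ballI conjI allI)
      fix \<epsilon> assume adm: "\<epsilon> \<in> admissible \<gamma> \<epsilon>0"
      then have \<epsilon>: "0 < \<epsilon>" "\<epsilon> < 1" "C0 * \<epsilon> * 8 < A * cmod (e a0 x0)"
        using C0 by (auto simp: admissible_def \<epsilon>0_def field_simps)
      define \<omega> where "\<omega> = freq \<epsilon>"
      have "1 \<le> \<omega>" unfolding \<omega>_def freq_def using \<epsilon> by simp
      moreover have "\<omega> \<le> 2" unfolding \<omega>_def freq_def using \<epsilon> by (intro real_le_lsqrt) auto
      ultimately have \<omega>: "1 \<le> \<omega>" "\<omega> \<le> 2" "0 < \<omega>" by auto
      have per: "period \<epsilon> = 2 * pi / \<omega>" by (simp add: period_def \<omega>_def)
      have small: "8 * norm (h \<epsilon>) < A * cmod (e a0 x0)" using h[OF adm] \<epsilon>(3) by linarith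
      have small0: "8 * norm (0 :: (nat \<times> nat) l1) < A * cmod (e a0 x0)" using A_pos x0 by simp
      have sq: "sqrt \<epsilon> \<noteq> 0" using \<epsilon> by simp
      have \<phi>: "\<phi> \<epsilon> = ev \<omega> (sqrt \<epsilon> *\<^sub>R (v0 + h \<epsilon>))" by (simp add: \<phi>_def \<omega>_def)
      have v: "v \<epsilon> = ev 1 (sqrt \<epsilon> *\<^sub>R (v0 + 0))" by (simp add: v_def)
      show "\<phi> \<epsilon> \<in> HrHs (period \<epsilon>) r s" unfolding per \<phi> by (rule HrHs_ev(1)[OF \<omega>(1,2)])
      show "v \<epsilon> \<in> HrHs (2 * pi) r s" using HrHs_ev(1)[of 1] by (simp add: v)
      show "solves_cubic_KG (\<phi> \<epsilon>)"
        unfolding \<phi>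
      proof (rule solves_ev[OF _ ev_cubic])
        fix i
        have "coef (N (sqrt \<epsilon> *\<^sub>R (v0 + h \<epsilon>)) (sqrt \<epsilon> *\<^sub>R (v0 + h \<epsilon>)) (sqrt \<epsilon> *\<^sub>R (v0 + h \<epsilon>))) i =
            sqrt \<epsilon> * (\<epsilon> * coef (N (v0 + h \<epsilon>) (v0 + h \<epsilon>) (v0 + h \<epsilon>)) i)"
          using \<epsilon> by (simp add: blinfun.scaleR_left blinfun.scaleR_right mult.assoc[symmetric])
        also have "\<dots> = ((\<omega> * lf i)\<^sup>2 - (real (fr (snd i)))\<^sup>2) * coef (sqrt \<epsilon> *\<^sub>R (v0 + h \<epsilon>)) i"
          unfolding heq[OF adm, symmetric] \<omega>_def by simp
        finally show "coef (N (sqrt \<epsilon> *\<^sub>R (v0 + h \<epsilon>)) (sqrt \<epsilon> *\<^sub>R (v0 + h \<epsilon>)) (sqrt \<epsilon> *\<^sub>R (v0 + h \<epsilon>))) i =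
            ((\<omega> * lf i)\<^sup>2 - (real (fr (snd i)))\<^sup>2) * coef (sqrt \<epsilon> *\<^sub>R (v0 + h \<epsilon>)) i" .
      qed
      show "solves_linear_KG (v \<epsilon>)"
        unfolding v_def
      proof (rule solves_ev[where Y = 0])
        show "coef 0 i = ((1 * lf i)\<^sup>2 - (real (fr (snd i)))\<^sup>2) * coef (sqrt \<epsilon> *\<^sub>R v0) i" for i
          unfolding v0_def lf_def by (cases "i = i0") (simp_all add: coef_unit m_fr)
      qed (simp add: linear_0[OF linear_ev])
      show "\<phi> \<epsilon> \<noteq> (\<lambda>t x. 0)" unfolding \<phi> by (rule minimal_period_ev(2)[OF \<omega>(3) sq small])
      show "v \<epsilon> \<noteq> (\<lambda>t x. 0)" unfolding v by (rule minimal_period_ev(2)[OF zero_less_one sq small0])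
      show "periodic (period \<epsilon>) (\<phi> \<epsilon>)"
        unfolding per \<phi> periodic_def using ev_periodic_nat \<omega>(3) by simp
      show "periodic (2 * pi) (v \<epsilon>)"
        unfolding v periodic_def using ev_periodic_nat[of 1] by simp
      show "hopf_plane_wave \<mu>1 \<mu>2 (\<phi> \<epsilon> t)" "hopf_plane_wave \<mu>1 \<mu>2 (v \<epsilon> t)" for t
        unfolding \<phi> v by (rule ev_hopf)+
      show "\<phi> \<epsilon> (- t) x = \<phi> \<epsilon> t x" for t x unfolding \<phi> by (rule ev_even)
      show "minimal_period (period \<epsilon> / real m) (\<phi> \<epsilon>)"
        unfolding per \<phi> by (rule minimal_period_ev(1)[OF \<omega>(3) sq small])
      show "minimal_period (2 * pi / real m) (v \<epsilon>)"
        unfolding v using minimal_period_ev(1)[OF zero_less_one sq small0] by simp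
      have nv: "HrHs_norm (2 * pi) r s (v \<epsilon>) = sqrt \<epsilon> * c2"
        using single[of 1 "sqrt \<epsilon>"] \<epsilon> by (simp add: v_def c2_def)
      have half: "\<epsilon> powr (1/2) = sqrt \<epsilon>" using \<epsilon> by (simp add: powr_half_sqrt)
      have "1 / C \<le> c2" using c2 C by (simp add: C_def field_simps add_pos_pos)
      then have "sqrt \<epsilon> * (1 / C) \<le> sqrt \<epsilon> * c2" using \<epsilon> by (intro mult_left_mono) auto
      then show "\<epsilon> powr (1/2) / C \<le> HrHs_norm (2 * pi) r s (v \<epsilon>)" unfolding nv half by simp
      have "sqrt \<epsilon> * c2 \<le> \<epsilon> powr (1/2 - d) * C"
      proof (rule mult_mono)
        show "sqrt \<epsilon> \<le> \<epsilon> powr (1/2 - d)"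
          unfolding half[symmetric] using \<epsilon> assms by (intro powr_mono') auto
        show "c2 \<le> C" using c2 by (simp add: C_def)
      qed (use c2 in auto)
      then show "HrHs_norm (2 * pi) r s (v \<epsilon>) \<le> C * \<epsilon> powr (1/2 - d)" unfolding nv by (simp add: mult.commute)
      have v\<omega>: "(\<lambda>t x. v \<epsilon> (freq \<epsilon> * t) x) = ev \<omega> (sqrt \<epsilon> *\<^sub>R v0)"
        unfolding v_def \<omega>_def by (intro ext) (rule ev_time[symmetric])
      have diff: "(\<lambda>t x. \<phi> \<epsilon> t x - v \<epsilon> (freq \<epsilon> * t) x) = ev \<omega> (sqrt \<epsilon> *\<^sub>R h \<epsilon>)"
      proof (intro ext)
        fix t x
        have "v \<epsilon> (freq \<epsilon> * t) x = ev \<omega> (sqrt \<epsilon> *\<^sub>R v0) t x" using v\<omega> by (metis (no_types))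
        then show "\<phi> \<epsilon> t x - v \<epsilon> (freq \<epsilon> * t) x = ev \<omega> (sqrt \<epsilon> *\<^sub>R h \<epsilon>) t x"
          unfolding \<phi> by (simp add: ev_diff[symmetric] scaleR_add_right)
      qed
      have lower: "sqrt \<epsilon> * (c1 * sqrt (pi / 2)) \<le> HrHs_norm (period \<epsilon>) r s (\<lambda>t x. v \<epsilon> (freq \<epsilon> * t) x)"
      proof -
        have "1 \<le> (1 + (\<omega> * real m)\<^sup>2) powr r" using r by (intro ge_one_powr_ge_zero) auto
        then have "pi / 2 * 1 \<le> pi / \<omega> * (1 + (\<omega> * real m)\<^sup>2) powr r"
          using \<omega> by (intro mult_mono divide_left_mono) auto
        then have "\<bar>sqrt \<epsilon>\<bar> * c1 * sqrt (pi / 2) \<le> \<bar>sqrt \<epsilon>\<bar> * c1 * sqrt (pi / \<omega> * (1 + (\<omega> * real m)\<^sup>2) powr r)"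
          using c1 \<epsilon> by (intro mult_left_mono) auto
        then show ?thesis unfolding v\<omega> per single[OF \<omega>(3)] using \<epsilon> by (simp add: mult.assoc)
      qed
      have "HrHs_norm (period \<epsilon>) r s (\<lambda>t x. \<phi> \<epsilon> t x - v \<epsilon> (freq \<epsilon> * t) x) \<le> 2 * CH * sqrt (2 * pi) * norm (sqrt \<epsilon> *\<^sub>R h \<epsilon>)"
        unfolding diff per by (rule HrHs_ev(2)[OF \<omega>(1,2)])
      also have "\<dots> \<le> 2 * CH * sqrt (2 * pi) * (sqrt \<epsilon> * (C0 * \<epsilon>))"
        using h[OF adm] \<epsilon> CH_nonneg by (intro mult_left_mono) auto
      also have "\<dots> = K * \<epsilon> * (sqrt \<epsilon> * (c1 * sqrt (pi / 2)))"
      proof -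
        have "c1 * sqrt (pi / 2) \<noteq> 0" using c1 by simp
        then show ?thesis unfolding K_def by (simp only: times_divide_eq_left nonzero_eq_divide_eq mult_ac) (simp add: mult_ac)
      qed
      also have "\<dots> \<le> K * \<epsilon> * HrHs_norm (period \<epsilon>) r s (\<lambda>t x. v \<epsilon> (freq \<epsilon> * t) x)"
        using c1 C0 \<epsilon> CH_nonneg by (intro mult_left_mono lower) (auto simp: K_def intro!: mult_nonneg_nonneg divide_nonneg_nonneg)
      finally show "HrHs_norm (period \<epsilon>) r s (\<lambda>t x. \<phi> \<epsilon> t x - v \<epsilon> (freq \<epsilon> * t) x)
        \<le> K * \<epsilon> * HrHs_norm (period \<epsilon>) r s (\<lambda>t x. v \<epsilon> (freq \<epsilon> * t) x)" .
    qed
  qed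
  show ?thesis by (intro exI[of _ C] conjI allI impI C main)
qed

end

lemma solution_pair_mono:
  assumes "solution_pair \<mu>1 \<mu>2 d r s C m \<epsilon> \<phi> v" "0 < C" "C \<le> C'"
  shows "solution_pair \<mu>1 \<mu>2 d r s C' m \<epsilon> \<phi> v"
proof -
  have "\<epsilon> powr (1/2) / C' \<le> \<epsilon> powr (1/2) / C" using assms by (intro divide_left_mono) auto
  moreover have "C * \<epsilon> powr (1/2 - d) \<le> C' * \<epsilon> powr (1/2 - d)" using assms by (intro mult_right_mono) auto
  ultimately show ?thesis using assms(1) unfolding solution_pair_def by (auto intro: order_trans)
qed

lemma minimal_period_unique: "minimal_period T u \<Longrightarrow> minimal_period T' u \<Longrightarrow> T = T'"
  unfolding minimal_period_def by (metis linorder_neqE_linordered_idom)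

lemma strict_mono_divide_inject:
  assumes "strict_mono_on S m" "\<And>k. k \<in> S \<Longrightarrow> 0 < m k" "0 < T" "j \<in> S" "k \<in> S" "T / real (m j) = T / real (m k)"
  shows "(j :: nat) = k"
proof -
  have "m j = m k" using assms(2)[of j] assms(2)[of k] assms(3-6) by (simp add: field_simps)
  then show ?thesis using strict_mono_on_imp_inj_on[OF assms(1)] assms(4,5) by (auto dest: inj_onD)
qed

lemma smallo_if_le_linear:
  fixes f g :: "real \<Rightarrow> real"
  assumes le: "\<And>\<epsilon>. \<epsilon> \<in> S \<Longrightarrow> 0 < \<epsilon> \<and> \<bar>f \<epsilon>\<bar> \<le> K * \<epsilon> * \<bar>g \<epsilon>\<bar>"
  shows "f \<in> o[at 0 within S](g)"
proof (rule landau_o.smallI)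
  fix c :: real assume c: "0 < c"
  show "\<forall>\<^sub>F \<epsilon> in at 0 within S. norm (f \<epsilon>) \<le> c * norm (g \<epsilon>)"
    unfolding eventually_at
  proof (intro exI[of _ "c / (\<bar>K\<bar> + 1)"] conjI ballI impI)
    show "0 < c / (\<bar>K\<bar> + 1)" using c by simp
    fix \<epsilon> assume \<epsilon>: "\<epsilon> \<in> S" "\<epsilon> \<noteq> 0 \<and> dist \<epsilon> 0 < c / (\<bar>K\<bar> + 1)"
    have pos: "0 < \<epsilon>" using le[OF \<epsilon>(1)] by simp
    have "K * \<epsilon> \<le> (\<bar>K\<bar> + 1) * \<epsilon>" using pos by (intro mult_right_mono) auto
    also have "\<dots> \<le> c" using \<epsilon>(2) pos by (simp add: dist_real_def field_simps)
    finally have "K * \<epsilon> * \<bar>g \<epsilon>\<bar> \<le> c * \<bar>g \<epsilon>\<bar>" by (intro mult_right_mono) auto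
    then show "norm (f \<epsilon>) \<le> c * norm (g \<epsilon>)" using le[OF \<epsilon>(1)] by simp
  qed
qed

theorem theorem1p4:
  fixes \<gamma>0 d r s :: real and n :: nat and \<mu>1 \<mu>2 :: int
  assumes "0 < \<gamma>0"
    and "\<And>\<gamma>. 0 < \<gamma> \<Longrightarrow> \<gamma> < \<gamma>0 \<Longrightarrow>
           uncountable (Omega \<gamma>) \<and> Omega \<gamma> \<in> null_sets lborel \<and> 1 islimpt Omega \<gamma>"
    and "0 < d" "d < 1/2" "r > 1/2" "s > 3/2"
  shows "\<exists>C>0. \<forall>\<gamma>. 0 < \<gamma> \<and> \<gamma> < \<gamma>0 \<longrightarrow>
    (\<exists>\<epsilon>0>0. \<exists>(m :: nat \<Rightarrow> nat)
        (\<phi> :: real \<Rightarrow> nat \<Rightarrow> real \<Rightarrow> S3 \<Rightarrow> complex) (v :: real \<Rightarrow> nat \<Rightarrow> real \<Rightarrow> S3 \<Rightarrow> complex).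
      strict_mono_on {1..n} m \<and> (\<forall>k\<in>{1..n}. 0 < m k) \<and>
      (\<forall>\<epsilon>\<in>admissible \<gamma> \<epsilon>0.
        inj_on (\<phi> \<epsilon>) {1..n} \<and> inj_on (v \<epsilon>) {1..n} \<and>
        (\<forall>k\<in>{1..n}.
          \<phi> \<epsilon> k \<in> HrHs (period \<epsilon>) r s \<and> solves_cubic_KG (\<phi> \<epsilon> k) \<and>
          \<phi> \<epsilon> k \<noteq> (\<lambda>t x. 0) \<and> periodic (period \<epsilon>) (\<phi> \<epsilon> k) \<and>
          (\<forall>t. hopf_plane_wave \<mu>1 \<mu>2 (\<phi> \<epsilon> k t)) \<and>
          (\<forall>t x. \<phi> \<epsilon> k (- t) x = \<phi> \<epsilon> k t x) \<and>
          v \<epsilon> k \<in> HrHs (2 * pi) r s \<and> solves_linear_KG (v \<epsilon> k) \<and>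
          v \<epsilon> k \<noteq> (\<lambda>t x. 0) \<and> periodic (2 * pi) (v \<epsilon> k) \<and>
          (\<forall>t. hopf_plane_wave \<mu>1 \<mu>2 (v \<epsilon> k t)) \<and>
          \<epsilon> powr (1/2) / C \<le> HrHs_norm (2 * pi) r s (v \<epsilon> k) \<and>
          HrHs_norm (2 * pi) r s (v \<epsilon> k) \<le> C * \<epsilon> powr (1/2 - d) \<and>
          minimal_period (period \<epsilon> / real (m k)) (\<phi> \<epsilon> k) \<and>
          minimal_period (2 * pi / real (m k)) (v \<epsilon> k))) \<and>
      (\<forall>k\<in>{1..n}.
        (\<lambda>\<epsilon>. HrHs_norm (period \<epsilon>) r s (\<lambda>t x. \<phi> \<epsilon> k t x - v \<epsilon> k (freq \<epsilon> * t) x))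
          \<in> o[at 0 within admissible \<gamma> \<epsilon>0](\<lambda>\<epsilon>. HrHs_norm (period \<epsilon>) r s (\<lambda>t x. v \<epsilon> k (freq \<epsilon> * t) x))))"
proof -
  interpret hopf \<mu>1 \<mu>2 .
  define \<sigma> where "\<sigma> = max 2 (nat \<lceil>max r (s + 1)\<rceil>)"
  have \<sigma>: "2 \<le> \<sigma>" "r \<le> real \<sigma>" "s + 1 \<le> real \<sigma>" unfolding \<sigma>_def by linarith+
  have "infinite {a. nondegenerate a}"
    unfolding infinite_nat_iff_unbounded_le using ex_nondegenerate by auto
  then obtain f :: "nat \<Rightarrow> nat" where f: "strict_mono f" "\<And>k. nondegenerate (f k)"
    using infinite_enumerate[of "{a. nondegenerate a}"] by auto
  define m where "m k = fr (f k)" for k :: nat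
  have m: "strict_mono_on {1..n} m"
    using f(1) by (auto simp: strict_mono_on_def strict_mono_def m_def fr_def)
  have m_pos: "0 < m k" for k unfolding m_def by (rule fr_pos)
  have "branch \<mu>1 \<mu>2 (m k) \<sigma> r s (f k)" for k
    by unfold_locales (use assms(5,6) \<sigma> m_pos[of k] f(2)[of k] in \<open>simp_all add: m_def\<close>)
  note branch = branch.branch_exists[OF this assms(3,4)]
  define sol where "sol \<gamma> k C \<epsilon>0 \<phi> v K \<longleftrightarrow> (\<forall>\<epsilon>\<in>admissible \<gamma> \<epsilon>0.
      solution_pair \<mu>1 \<mu>2 d r s C (m k) \<epsilon> (\<phi> \<epsilon>) (v \<epsilon>) \<and>
      HrHs_norm (period \<epsilon>) r s (\<lambda>t x. \<phi> \<epsilon> t x - v \<epsilon> (freq \<epsilon> * t) x)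
        \<le> K * \<epsilon> * HrHs_norm (period \<epsilon>) r s (\<lambda>t x. v \<epsilon> (freq \<epsilon> * t) x))" for \<gamma> k C \<epsilon>0 \<phi> v K
  have "\<forall>k. \<exists>C>0. \<forall>\<gamma>>0. \<exists>\<epsilon>0>0. \<exists>\<phi> v K. sol \<gamma> k C \<epsilon>0 \<phi> v K"
    unfolding sol_def by (intro allI branch)
  then obtain C where C: "\<And>k. 0 < C k"
    and ex: "\<And>\<gamma> k. 0 < \<gamma> \<Longrightarrow> \<exists>\<epsilon>0>0. \<exists>\<phi> v K. sol \<gamma> k (C k) \<epsilon>0 \<phi> v K" by metis
  \<comment> \<open>The sum dominates every \<open>C k\<close>, so all branches share one constant;
    the added 1 keeps it positive when n = 0.\<close>
  define C' where "C' = (\<Sum>k\<in>{1..n}. C k) + 1"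
  have C': "C k \<le> C'" if "k \<in> {1..n}" for k
    using member_le_sum[OF that, of C] C by (simp add: C'_def less_imp_le)
  have "0 < C'" using C by (simp add: C'_def add_nonneg_pos sum_nonneg less_imp_le)
  have "\<exists>\<epsilon>0>0. \<exists>(m :: nat \<Rightarrow> nat) \<phi> v.
      strict_mono_on {1..n} m \<and> (\<forall>k\<in>{1..n}. 0 < m k) \<and>
      (\<forall>\<epsilon>\<in>admissible \<gamma> \<epsilon>0. inj_on (\<phi> \<epsilon>) {1..n} \<and> inj_on (v \<epsilon>) {1..n} \<and>
        (\<forall>k\<in>{1..n}. solution_pair \<mu>1 \<mu>2 d r s C' (m k) \<epsilon> (\<phi> \<epsilon> k) (v \<epsilon> k))) \<and>
      (\<forall>k\<in>{1..n}.
        (\<lambda>\<epsilon>. HrHs_norm (period \<epsilon>) r s (\<lambda>t x. \<phi> \<epsilon> k t x - v \<epsilon> k (freq \<epsilon> * t) x))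
          \<in> o[at 0 within admissible \<gamma> \<epsilon>0](\<lambda>\<epsilon>. HrHs_norm (period \<epsilon>) r s (\<lambda>t x. v \<epsilon> k (freq \<epsilon> * t) x)))"
    if \<gamma>: "0 < \<gamma>" for \<gamma>
  proof -
    obtain E \<Phi> V K where E: "\<And>k. 0 < E k" and sol: "\<And>k. sol \<gamma> k (C k) (E k) (\<Phi> k) (V k) (K k)"
      using ex[OF \<gamma>] by metis
    \<comment> \<open>Inserting 1 keeps the set nonempty when n = 0.\<close>
    define \<epsilon>0 where "\<epsilon>0 = Min (insert 1 (E ` {1..n}))"
    have \<epsilon>0: "0 < \<epsilon>0" using E by (simp add: \<epsilon>0_def)
    have adm: "\<epsilon> \<in> admissible \<gamma> (E k)" if "\<epsilon> \<in> admissible \<gamma> \<epsilon>0" "k \<in> {1..n}" for \<epsilon> k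
    proof -
      have "\<epsilon>0 \<le> E k" unfolding \<epsilon>0_def using that(2) by (intro Min_le) auto
      then show ?thesis using that(1) by (auto simp: admissible_def)
    qed
    have pair: "solution_pair \<mu>1 \<mu>2 d r s C' (m k) \<epsilon> (\<Phi> k \<epsilon>) (V k \<epsilon>)"
      if "\<epsilon> \<in> admissible \<gamma> \<epsilon>0" "k \<in> {1..n}" for \<epsilon> k
      using sol[of k] adm[OF that] C C'[OF that(2)] solution_pair_mono unfolding sol_def by blast
    define \<phi> where "\<phi> \<epsilon> k = \<Phi> k \<epsilon>" for \<epsilon> k
    define v where "v \<epsilon> k = V k \<epsilon>" for \<epsilon> k
    \<comment> \<open>Equal solutions would have equal minimal periods, while the divisors
      \<open>m k\<close> are strictly increasing in k.\<close>
    have inj: "inj_on (\<phi> \<epsilon>) {1..n}" "inj_on (v \<epsilon>) {1..n}" if \<epsilon>: "\<epsilon> \<in> admissible \<gamma> \<epsilon>0" for \<epsilon>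
    proof -
      have pos: "0 < period \<epsilon>" using \<epsilon> by (simp add: period_def freq_def admissible_def)
      show "inj_on (\<phi> \<epsilon>) {1..n}"
      proof (rule inj_onI)
        fix j k assume jk: "j \<in> {1..n}" "k \<in> {1..n}" "\<phi> \<epsilon> j = \<phi> \<epsilon> k"
        then have "period \<epsilon> / real (m j) = period \<epsilon> / real (m k)"
          using pair[OF \<epsilon> jk(1)] pair[OF \<epsilon> jk(2)] unfolding solution_pair_def \<phi>_def
          by (metis minimal_period_unique)
        then show "j = k" by (rule strict_mono_divide_inject[OF m m_pos pos jk(1,2)])
      qed
      show "inj_on (v \<epsilon>) {1..n}"
      proof (rule inj_onI)
        fix j k assume jk: "j \<in> {1..n}" "k \<in> {1..n}" "v \<epsilon> j = v \<epsilon> k"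
        then have "2 * pi / real (m j) = 2 * pi / real (m k)"
          using pair[OF \<epsilon> jk(1)] pair[OF \<epsilon> jk(2)] unfolding solution_pair_def v_def
          by (metis minimal_period_unique)
        then show "j = k" by (rule strict_mono_divide_inject[OF m m_pos _ jk(1,2), rotated]) simp
      qed
    qed
    have small: "(\<lambda>\<epsilon>. HrHs_norm (period \<epsilon>) r s (\<lambda>t x. \<phi> \<epsilon> k t x - v \<epsilon> k (freq \<epsilon> * t) x))
          \<in> o[at 0 within admissible \<gamma> \<epsilon>0](\<lambda>\<epsilon>. HrHs_norm (period \<epsilon>) r s (\<lambda>t x. v \<epsilon> k (freq \<epsilon> * t) x))"
      if k: "k \<in> {1..n}" for k
    proof (rule smallo_if_le_linear[where K = "K k"], rule conjI)
      fix \<epsilon> assume \<epsilon>: "\<epsilon> \<in> admissible \<gamma> \<epsilon>0"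
      then show "0 < \<epsilon>" by (simp add: admissible_def)
      have "0 \<le> period \<epsilon>" using \<epsilon> by (simp add: period_def freq_def admissible_def)
      then have "0 \<le> HrHs_norm (period \<epsilon>) r s u" for u
        unfolding HrHs_norm_def by (intro real_sqrt_ge_zero mult_nonneg_nonneg infsum_nonneg) auto
      then show "\<bar>HrHs_norm (period \<epsilon>) r s (\<lambda>t x. \<phi> \<epsilon> k t x - v \<epsilon> k (freq \<epsilon> * t) x)\<bar>
          \<le> K k * \<epsilon> * \<bar>HrHs_norm (period \<epsilon>) r s (\<lambda>t x. v \<epsilon> k (freq \<epsilon> * t) x)\<bar>"
        using sol[of k] adm[OF \<epsilon> k] by (simp add: sol_def \<phi>_def v_def)
    qed
    show ?thesis
      by (rule exI[of _ \<epsilon>0], rule conjI[OF \<epsilon>0], rule exI[of _ m], rule exI[of _ \<phi>], rule exI[of _ v])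
        (use m m_pos inj small pair in \<open>auto simp: \<phi>_def v_def\<close>)
  qed
  note main = this[unfolded solution_pair_def]
  show ?thesis
    by (rule exI[of _ C'], intro conjI allI impI, rule \<open>0 < C'\<close>, elim conjE, rule main)
qed

end
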